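(* Let $\ell$ be a prime and let $\varepsilon>0$. There is a constant $C(\ell,\varepsilon)$ such that for every pure cubic field $K=\mathbb{Q}(\sqrt[3]{d})$, where $d>1$ is a cube-free integer, one has \[h_\ell(K)\le C(\ell,\varepsilon)\,|\Delta_K|^{1/2-1/(4\ell)+\varepsilon}.\]
   Context: For a number field $K$, $\Delta_K$ denotes its discriminant, $\mathrm{Cl}(K)$ its ideal class group, and $h_\ell(K)$ the cardinality of the $\ell$-torsion subgroup of $\mathrm{Cl}(K)$, i.e. the subgroup of ideal classes whose order divides $\ell$. *)

theory Defs
  imports
    Complex_Main
    "HOL-Library.FuncSet"
    "HOL-Computational_Algebra.Computational_Algebra"
    "HOL-Algebra.Algebra"
    "HOL-Algebra.Algebraic_Closure_Type"
    "Jordan_Normal_Form.Determinant"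
begin

text \<open>
  Number fields are subfields of the complex numbers, given by their carrier sets; every number
  field is isomorphic to one of this kind.
\<close>

abbreviation complex_ring :: "complex ring" where
  "complex_ring \<equiv> ring_of_type_algebra"

definition rat_adjoin :: "complex \<Rightarrow> complex set" where
  "rat_adjoin \<alpha> = generate_field complex_ring {\<alpha>}"

definition ring_of_integers :: "complex set \<Rightarrow> complex set" where
  "ring_of_integers K = {x \<in> K. algebraic_int x}"


text \<open>
  Homomorphisms in \<^const>\<open>Ring.ring_hom\<close> are only determined on the carrier, so they are restricted
  to extensional functions in order that every embedding
  is counted once. The trace is the sum of the conjugates.
\<close>

definition embeddings :: "complex set \<Rightarrow> (complex \<Rightarrow> complex) set" where
  "embeddings K = Ring.ring_hom (complex_ring\<lparr>carrier := K\<rparr>) complex_ring \<inter> extensional K"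

definition field_trace :: "complex set \<Rightarrow> complex \<Rightarrow> complex" where
  "field_trace K x = (\<Sum>\<sigma>\<in>embeddings K. \<sigma> x)"

definition integral_basis :: "complex set \<Rightarrow> nat \<Rightarrow> (nat \<Rightarrow> complex) \<Rightarrow> bool" where
  "integral_basis K n b \<longleftrightarrow>
     bij_betw (\<lambda>c. \<Sum>i<n. of_int (c i) * b i) ({..<n} \<rightarrow>\<^sub>E (UNIV :: int set)) (ring_of_integers K)"

text \<open>
  The determinant below is a rational integer that does not depend on the integral basis.
\<close>

definition discriminant :: "complex set \<Rightarrow> int" where
  "discriminant K = (THE D. \<exists>n b. integral_basis K n b \<and>
     of_int D = det (mat n n (\<lambda>(i, j). field_trace K (b i * b j))))"


definition fractional_ideals :: "complex set \<Rightarrow> complex set set" where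
  "fractional_ideals K = {(\<lambda>x. x / a) ` I | a I.
     a \<in> ring_of_integers K \<and> a \<noteq> 0 \<and>
     ideal I (complex_ring\<lparr>carrier := ring_of_integers K\<rparr>) \<and> I \<noteq> {0}}"

definition principal_fractional_ideals :: "complex set \<Rightarrow> complex set set" where
  "principal_fractional_ideals K = {(\<lambda>y. x * y) ` ring_of_integers K | x. x \<in> K \<and> x \<noteq> 0}"

text \<open>
  \<^const>\<open>ideal_prod\<close> \<open>R I J\<close> is the set of all finite nonempty sums of products of elements of \<open>I\<close>
  and \<open>J\<close>, computed in \<open>R\<close>; it makes sense for fractional ideals too if \<open>R\<close> is an overfield.
\<close>

definition ideal_group :: "complex set \<Rightarrow> complex set monoid" where
  "ideal_group K =
     \<lparr>carrier = fractional_ideals K, monoid.mult = ideal_prod complex_ring, one = ring_of_integers K\<rparr>"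

definition class_group :: "complex set \<Rightarrow> complex set set monoid" where
  "class_group K = ideal_group K Mod principal_fractional_ideals K"

definition torsion_class_number :: "nat \<Rightarrow> complex set \<Rightarrow> nat" where
  "torsion_class_number l K =
     card {x \<in> carrier (class_group K). x [^]\<^bsub>class_group K\<^esub> l = \<one>\<^bsub>class_group K\<^esub>}"


definition cube_free :: "int \<Rightarrow> bool" where
  "cube_free d \<longleftrightarrow> (\<forall>x. x ^ 3 dvd d \<longrightarrow> is_unit x)"

end

theory Submission
  imports
    Defs
    "HOL-Number_Theory.Number_Theory"
    "HOL-Real_Asymp.Real_Asymp"
    "Jordan_Normal_Form.Char_Poly"
begin

hide_const (open) Divisibility.prime

text \<open>
  Write \<open>d = a b\<^sup>2\<close> with \<open>a\<close>, \<open>b\<close> squarefree and coprime, and \<open>N = a b\<close>; then \<open>N\<^sup>2 \<le> 27 \<bar>\<Delta>\<bar>\<close>, so it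
  suffices to bound the torsion by \<open>N\<close> to the power \<open>1 - 1/(2 l) + \<epsilon>\<close>. As in the argument of Ellenberg
  and Venkatesh, small primes with a degree-one prime ideal \<open>P\<^sub>p\<close> produce many distinct classes. Every
  prime \<open>p \<equiv> 2 (mod 3)\<close> not dividing \<open>N\<close> has such a \<open>P\<^sub>p\<close>, because every residue is then a cube.

  Choose for each \<open>l\<close>-torsion class an ideal \<open>I\<close> with \<open>I\<^sup>l =
  (\<gamma>)\<close>. For a prime \<open>p\<close> take an element \<open>v\<close> of \<open>I
  P\<^sub>p\<close> of least size, the real and the complex absolute value being measured in units of the
  \<open>l\<close>-th roots of those of \<open>\<gamma>\<close>. The ideal \<open>v\<^sup>-\<^sup>1 I
  P\<^sub>p\<close> contains \<open>1\<close> and has denominator at most \<open>100 N\<close>, so by the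
  divisor bound there are only \<open>N\<close> to the power \<open>1 + \<epsilon>\<close> possibilities for
  it. Record this ideal together with the logarithms of the two sizes of \<open>v\<close>, rounded down. If
  two pairs (class, \<open>p\<close>) and (possibly another class, \<open>p'\<close>) have the same record,
  then \<open>P\<^sub>p\<^sup>l\<close> and \<open>P\<^sub>p\<^sub>'\<^sup>l\<close> differ by a factor whose
  absolute values are at most \<open>e\<^sup>l\<close>. For \<open>p \<noteq> p'\<close> such a factor would
  give an element \<open>x + y t1 + z t2\<close> whose index form \<open>b y\<^sup>3 - a z\<^sup>3\<close> is
  divisible by \<open>p\<^sup>l\<close> but smaller than \<open>p\<^sup>l\<close>, as long as \<open>p,
  p'\<close> are at most a constant times \<open>N\<close> to the power \<open>1/(2 l)\<close>. The form
  vanishes only for \<open>y = z = 0\<close>, so the factor would be rational, which is impossible. For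
  \<open>p = p'\<close> the two classes agree. So the recording map is injective, and the number of classes
  times the number of primes is at most \<open>N\<close> to the power \<open>1 + \<epsilon>\<close>.

  That there are enough primes \<open>p \<equiv> 2 (mod 3)\<close> follows from Chebyshev's estimate, since summing
  \<open>\<chi>(n) ln n\<close> for the nontrivial character modulo 3 shows that the primes \<open>\<equiv> 1\<close> cannot dominate.
\<close>

subsection \<open>Ideals of orders\<close>

text \<open>The field has one real and one complex place, hence units of infinite order, possibly
  enormous ones. An equality of ideals therefore determines a generator only up to factors whose two
  absolute values are out of control; this is the reason for recording two rounded logarithms next
  to the ideal. They are cheap: a least vector is balanced between the two places up to powers of N,
  so each of them takes only O(log N) values. The range of p' up to N^(1/(2 l)) is forced by q' =
  p'^l. The element under test has both absolute values O(q'), so its index form has size O(q'^3 /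
  N); to be below its divisor q' it needs q'^2 smaller than a constant times N. The integers of the
  field are never described by an explicit basis, which would depend on a and b modulo 9. It
  suffices that three times an integer lies in Z + Z t1 + Z t2, which costs only constants such as
  27 and 54. Likewise an ideal containing n is recovered from the list of prime powers that contain
  it, which is all of unique factorization that the divisor bound requires.\<close>

abbreviation iprod :: "'a::field set \<Rightarrow> 'a set \<Rightarrow> 'a set" (infixl "\<diamondop>" 70)
  where "A \<diamondop> B \<equiv> ideal_prod ring_of_type_algebra A B"

lemma iprod_mult: "x \<in> A \<Longrightarrow> y \<in> B \<Longrightarrow> x * y \<in> A \<diamondop> B"
  using ideal_prod.prod[of x A y B ring_of_type_algebra] by (simp add: ring_of_type_algebra_def)

lemma iprod_add: "x \<in> A \<diamondop> B \<Longrightarrow> y \<in> A \<diamondop> B \<Longrightarrow> x + y \<in> A \<diamondop> B"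
  using ideal_prod.sum[of x ring_of_type_algebra A B y] by (simp add: ring_of_type_algebra_def)

lemma iprod_induct [consumes 1, case_names mult add]:
  assumes "z \<in> A \<diamondop> B"
    and "\<And>x y. x \<in> A \<Longrightarrow> y \<in> B \<Longrightarrow> P (x * y)"
    and "\<And>x y. x \<in> A \<diamondop> B \<Longrightarrow> y \<in> A \<diamondop> B \<Longrightarrow> P x \<Longrightarrow> P y \<Longrightarrow> P (x + y)"
  shows "P z"
  using assms(1)
proof (induction rule: ideal_prod.induct)
  case (prod i j)
  then show ?case using assms(2) by (simp add: ring_of_type_algebra_def)
next
  case (sum s1 s2)
  then show ?case using assms(3) by (simp add: ring_of_type_algebra_def)
qed

lemma iprod_subset:
  assumes "\<And>x y. x \<in> A \<Longrightarrow> y \<in> B \<Longrightarrow> x * y \<in> C"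
    and "\<And>x y. x \<in> C \<Longrightarrow> y \<in> C \<Longrightarrow> x + y \<in> C"
  shows "A \<diamondop> B \<subseteq> C"
proof
  fix z assume "z \<in> A \<diamondop> B"
  then show "z \<in> C" by (induction rule: iprod_induct) (use assms in auto)
qed

lemma iprod_mono: "A \<subseteq> A' \<Longrightarrow> B \<subseteq> B' \<Longrightarrow> A \<diamondop> B \<subseteq> A' \<diamondop> B'"
  by (rule iprod_subset) (auto intro: iprod_mult iprod_add)

lemma iprod_commute: "A \<diamondop> B = B \<diamondop> A"
proof -
  have "A \<diamondop> B \<subseteq> B \<diamondop> A" for A B :: "'a set"
  proof (rule iprod_subset)
    fix x y assume "x \<in> A" "y \<in> B"
    then have "y * x \<in> B \<diamondop> A" by (intro iprod_mult)
    then show "x * y \<in> B \<diamondop> A" by (simp add: mult.commute)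
  qed (rule iprod_add)
  then show ?thesis by blast
qed

lemma iprod_assoc_subset: "(A \<diamondop> B) \<diamondop> C \<subseteq> A \<diamondop> (B \<diamondop> C)"
proof (rule iprod_subset)
  fix x y assume "x \<in> A \<diamondop> B" and y: "y \<in> C"
  from this(1) show "x * y \<in> A \<diamondop> (B \<diamondop> C)"
  proof (induction rule: iprod_induct)
    case (mult u v)
    then show ?case using y by (metis iprod_mult mult.assoc)
  next
    case (add u v)
    then show ?case by (simp add: distrib_right iprod_add)
  qed
qed (rule iprod_add)

lemma iprod_assoc: "(A \<diamondop> B) \<diamondop> C = A \<diamondop> (B \<diamondop> C)"
proof
  show "A \<diamondop> (B \<diamondop> C) \<subseteq> (A \<diamondop> B) \<diamondop> C"
    using iprod_assoc_subset[of C B A] by (simp add: iprod_commute)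
qed (rule iprod_assoc_subset)

lemma iprod_left_commute: "A \<diamondop> (B \<diamondop> C) = B \<diamondop> (A \<diamondop> C)"
  by (metis iprod_assoc iprod_commute)

lemma iprod_scale: "((*) c ` A) \<diamondop> B = (*) c ` (A \<diamondop> B)"
proof
  show "((*) c ` A) \<diamondop> B \<subseteq> (*) c ` (A \<diamondop> B)"
  proof (rule iprod_subset)
    fix x y assume "x \<in> (*) c ` A" "y \<in> B"
    then show "x * y \<in> (*) c ` (A \<diamondop> B)" by (auto simp: mult.assoc intro!: imageI iprod_mult)
  next
    fix x y assume "x \<in> (*) c ` (A \<diamondop> B)" "y \<in> (*) c ` (A \<diamondop> B)"
    then show "x + y \<in> (*) c ` (A \<diamondop> B)"
      by (auto simp: distrib_left[symmetric] intro!: imageI iprod_add)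
  qed
  show "(*) c ` (A \<diamondop> B) \<subseteq> ((*) c ` A) \<diamondop> B"
  proof (rule image_subsetI)
    fix z assume "z \<in> A \<diamondop> B"
    then show "c * z \<in> ((*) c ` A) \<diamondop> B"
      by (induction rule: iprod_induct)
        (auto simp: distrib_left mult.assoc[symmetric] intro!: iprod_mult iprod_add)
  qed
qed

lemma scale_scale: "(*) (c::'a::field) ` ((*) d ` A) = (*) (c * d) ` A"
  by (auto simp: image_image mult.assoc)

lemma scale_one: "(*) (1::'a::field) ` A = A"
  by auto

lemma scale_cancel: "c \<noteq> 0 \<Longrightarrow> (*) (c::'a::field) ` A = (*) c ` B \<Longrightarrow> A = B"
  by (simp add: inj_image_eq_iff inj_on_def)

section \<open>Modules over a subring of a field\<close>

locale subring_set =
  fixes R :: "'a::field set"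
  assumes one_in: "1 \<in> R" and minus_one_in: "- 1 \<in> R"
    and add_in: "\<And>x y. x \<in> R \<Longrightarrow> y \<in> R \<Longrightarrow> x + y \<in> R"
    and mult_in: "\<And>x y. x \<in> R \<Longrightarrow> y \<in> R \<Longrightarrow> x * y \<in> R"
begin

lemma minus_in: "x \<in> R \<Longrightarrow> - x \<in> R"
  using mult_in[OF minus_one_in, of x] by simp

lemma diff_in: "x \<in> R \<Longrightarrow> y \<in> R \<Longrightarrow> x - y \<in> R"
  using add_in[OF _ minus_in, of x y] by simp

lemma zero_in: "0 \<in> R"
  using diff_in[OF one_in one_in] by simp

lemma of_nat_in: "of_nat n \<in> R"
  by (induction n) (auto intro: zero_in one_in add_in)

lemma of_int_in: "of_int n \<in> R"
  by (cases n) (auto intro: of_nat_in minus_in simp del: of_nat_Suc)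

lemma power_in: "x \<in> R \<Longrightarrow> x ^ n \<in> R"
  by (induction n) (auto intro: one_in mult_in)

definition submod :: "'a set \<Rightarrow> bool" where
  "submod A \<longleftrightarrow> 0 \<in> A \<and> (\<forall>x\<in>A. \<forall>y\<in>A. x + y \<in> A) \<and> (\<forall>r\<in>R. \<forall>x\<in>A. r * x \<in> A)"

lemma submod_zero: "submod A \<Longrightarrow> 0 \<in> A"
  and submod_add: "submod A \<Longrightarrow> x \<in> A \<Longrightarrow> y \<in> A \<Longrightarrow> x + y \<in> A"
  and submod_smult: "submod A \<Longrightarrow> r \<in> R \<Longrightarrow> x \<in> A \<Longrightarrow> r * x \<in> A"
  by (auto simp: submod_def)

lemma submod_minus: "submod A \<Longrightarrow> x \<in> A \<Longrightarrow> - x \<in> A"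
  using submod_smult[OF _ minus_one_in, of A x] by simp

lemma submod_diff: "submod A \<Longrightarrow> x \<in> A \<Longrightarrow> y \<in> A \<Longrightarrow> x - y \<in> A"
  using submod_add[OF _ _ submod_minus, of A x y] by simp

lemma submod_sum: "submod A \<Longrightarrow> (\<And>i. i \<in> I \<Longrightarrow> f i \<in> A) \<Longrightarrow> sum f I \<in> A"
  by (induction I rule: infinite_finite_induct) (auto intro: submod_zero submod_add)

lemma submod_of_nat: "submod A \<Longrightarrow> x \<in> A \<Longrightarrow> of_nat n * x \<in> A"
  by (rule submod_smult[OF _ of_nat_in])

lemma submod_R: "submod R"
  by (auto simp: submod_def zero_in add_in mult_in)

lemma submod_scale: "submod A \<Longrightarrow> submod ((*) c ` A)"
  unfolding submod_def
  by (auto simp: image_iff distrib_left[symmetric] mult.left_commute[of _ c])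

lemma submod_iprod:
  assumes "submod A" "submod B"
  shows "submod (A \<diamondop> B)"
  unfolding submod_def
proof (intro conjI ballI)
  show "0 \<in> A \<diamondop> B" using iprod_mult[OF submod_zero submod_zero, OF assms] by simp
next
  fix r x assume r: "r \<in> R" and "x \<in> A \<diamondop> B"
  from this(2) show "r * x \<in> A \<diamondop> B"
  proof (induction rule: iprod_induct)
    case (mult u v)
    then have "(r * u) * v \<in> A \<diamondop> B" using submod_smult[OF assms(1) r] by (intro iprod_mult)
    then show ?case by (simp add: mult.assoc)
  next
    case (add u v)
    then show ?case by (simp add: distrib_left iprod_add)
  qed
qed (rule iprod_add)

lemma R_iprod: "submod A \<Longrightarrow> R \<diamondop> A = A"
proof
  assume A: "submod A"
  show "R \<diamondop> A \<subseteq> A"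
    by (rule iprod_subset) (use A in \<open>auto intro: submod_smult submod_add\<close>)
  show "A \<subseteq> R \<diamondop> A"
    using iprod_mult[OF one_in, of _ A] by auto
qed

lemma iprod_R: "submod A \<Longrightarrow> A \<diamondop> R = A"
  using R_iprod by (simp add: iprod_commute)

lemma iprod_subset_submod:
  assumes "submod C" "\<And>x y. x \<in> A \<Longrightarrow> y \<in> B \<Longrightarrow> x * y \<in> C"
  shows "A \<diamondop> B \<subseteq> C"
  by (rule iprod_subset) (use assms in \<open>auto intro: submod_add\<close>)

definition adjoin :: "'a set \<Rightarrow> 'a \<Rightarrow> 'a set" where
  "adjoin J x = {j + r * x | j r. j \<in> J \<and> r \<in> R}"

lemma submod_adjoin: assumes J: "submod J" shows "submod (adjoin J x)"
  unfolding submod_def adjoin_def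
proof (intro conjI ballI)
  show "0 \<in> {j + r * x |j r. j \<in> J \<and> r \<in> R}" using submod_zero[OF J] zero_in
    by (intro CollectI exI[of _ 0]) simp
next
  fix u v assume "u \<in> {j + r * x |j r. j \<in> J \<and> r \<in> R}" "v \<in> {j + r * x |j r. j \<in> J \<and> r \<in> R}"
  then obtain j r j' r' where *: "u = j + r * x" "v = j' + r' * x" "j \<in> J" "r \<in> R" "j' \<in> J" "r' \<in> R" by blast
  then have "u + v = (j + j') + (r + r') * x" by (simp add: algebra_simps)
  with * show "u + v \<in> {j + r * x |j r. j \<in> J \<and> r \<in> R}" using submod_add[OF J] add_in by blast
next
  fix q u assume "q \<in> R" "u \<in> {j + r * x |j r. j \<in> J \<and> r \<in> R}"
  then obtain j r where *: "u = j + r * x" "j \<in> J" "r \<in> R" by blast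
  then have "q * u = q * j + (q * r) * x" by (simp add: algebra_simps)
  with * show "q * u \<in> {j + r * x |j r. j \<in> J \<and> r \<in> R}"
    using submod_smult[OF J \<open>q \<in> R\<close>] mult_in[OF \<open>q \<in> R\<close>] by blast
qed

lemma adjoin_superset: "J \<subseteq> adjoin J x"
  unfolding adjoin_def using zero_in by force

lemma adjoin_mem: "submod J \<Longrightarrow> x \<in> adjoin J x"
  unfolding adjoin_def using submod_zero one_in by force

lemma adjoin_subset: "submod I \<Longrightarrow> J \<subseteq> I \<Longrightarrow> x \<in> I \<Longrightarrow> adjoin J x \<subseteq> I"
  unfolding adjoin_def by (auto intro!: submod_add submod_smult)

definition ipow :: "'a set \<Rightarrow> nat \<Rightarrow> 'a set" where
  "ipow M e = ((\<diamondop>) M ^^ e) R"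

lemma ipow_0 [simp]: "ipow M 0 = R"
  and ipow_Suc: "ipow M (Suc e) = M \<diamondop> ipow M e"
  by (simp_all add: ipow_def)

lemma submod_ipow: "submod M \<Longrightarrow> submod (ipow M e)"
  by (induction e) (auto simp: ipow_Suc submod_R submod_iprod)

lemma power_in_ipow: "x \<in> M \<Longrightarrow> x ^ e \<in> ipow M e"
  by (induction e) (auto simp: ipow_Suc one_in intro: iprod_mult)

lemma ipow_iprod: "submod A \<Longrightarrow> submod B \<Longrightarrow> ipow (A \<diamondop> B) e = ipow A e \<diamondop> ipow B e"
  by (induction e) (auto simp: ipow_Suc R_iprod submod_R submod_ipow iprod_assoc iprod_left_commute)

lemma ipow_scale: "ipow ((*) c ` A) e = (*) (c ^ e) ` ipow A e"
proof (induction e)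
  case (Suc e)
  then show ?case
    by (simp add: ipow_Suc iprod_scale iprod_commute[of A] scale_scale)
qed (simp add: scale_one)

lemma ipow_R: "ipow R e = R"
  by (induction e) (simp_all add: ipow_Suc R_iprod submod_R)

lemma ipow_mono: "A \<subseteq> B \<Longrightarrow> ipow A e \<subseteq> ipow B e"
  by (induction e) (simp_all add: ipow_Suc iprod_mono)

end

text \<open>These two properties of a ring of integers of rank three carry the whole ideal theory
  below. The first says that \<open>R\<close> modulo \<open>m\<close> has at most
  \<open>m ^ 3\<close> classes, phrased by pairwise incongruent elements so that no quotient ring
  has to be formed. The second says that a multiplier of a nonzero ideal is integral, which is the
  form of integral closedness that inverting a prime ideal requires.\<close>

locale order_ring = subring_set R for R :: "'a::field_char_0 set" +
  assumes index_bound: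
    "\<And>m S. m > 0 \<Longrightarrow> S \<subseteq> R \<Longrightarrow>
      (\<And>x y. x \<in> S \<Longrightarrow> y \<in> S \<Longrightarrow> x \<noteq> y \<Longrightarrow> x - y \<notin> (*) (of_nat m) ` R) \<Longrightarrow> finite S \<and> card S \<le> m ^ 3"
    and integrally_closed:
    "\<And>n J x. submod J \<Longrightarrow> J \<subseteq> R \<Longrightarrow> n > 0 \<Longrightarrow> of_nat n \<in> J \<Longrightarrow> (\<And>y. y \<in> J \<Longrightarrow> x * y \<in> J) \<Longrightarrow> x \<in> R"
begin

definition ideals_of :: "nat \<Rightarrow> 'a set set" where
  "ideals_of n = {J. submod J \<and> J \<subseteq> R \<and> of_nat n \<in> J}"

lemma scale_R_subset: "submod J \<Longrightarrow> of_nat n \<in> J \<Longrightarrow> (*) (of_nat n) ` R \<subseteq> J"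
  using submod_smult by (auto simp: mult.commute)

text \<open>The number of pairwise incongruent elements is bounded, so a largest such set exists; an
  element incongruent to all of its members could be added to it.\<close>

lemma representatives:
  assumes "m > 0"
  obtains S where "S \<subseteq> R" "finite S" "\<And>x. x \<in> R \<Longrightarrow> \<exists>s\<in>S. x - s \<in> (*) (of_nat m) ` R"
proof -
  define Q where "Q S \<longleftrightarrow> S \<subseteq> R \<and> (\<forall>x\<in>S. \<forall>y\<in>S. x \<noteq> y \<longrightarrow> x - y \<notin> (*) (of_nat m) ` R)" for S
  have b: "finite S \<and> card S \<le> m ^ 3" if "Q S" for S
    using index_bound[OF assms, of S] that unfolding Q_def by blast
  have "Q {}" by (simp add: Q_def)
  then obtain S where S: "Q S" "\<And>T. Q T \<Longrightarrow> card T \<le> card S"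
    using ex_has_greatest_nat[of Q "{}" card "Suc (m ^ 3)"] b by (metis less_Suc_eq_le)
  have "\<exists>s\<in>S. x - s \<in> (*) (of_nat m) ` R" if x: "x \<in> R" for x
  proof (rule ccontr)
    assume n: "\<not> ?thesis"
    then have "x \<notin> S" using zero_in by force
    have sy: "y - x \<notin> (*) (of_nat m) ` R" if "y \<in> S" for y
    proof
      assume "y - x \<in> (*) (of_nat m) ` R"
      then have "- (y - x) \<in> (*) (of_nat m) ` R" using submod_minus[OF submod_scale[OF submod_R]] by blast
      then show False using n that by auto
    qed
    have "Q (insert x S)" using S(1) n sy x unfolding Q_def by auto
    then have "card (insert x S) \<le> card S" using S(2) by blast
    then show False using b[OF S(1)] \<open>x \<notin> S\<close> by simp
  qed
  then show ?thesis using that S(1) b unfolding Q_def by blast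
qed

text \<open>An ideal containing \<open>n\<close> is a union of classes modulo \<open>n\<close>,
  hence determined by the representatives that it contains.\<close>

lemma finite_ideals_of: assumes "n > 0" shows "finite (ideals_of n)"
proof -
  obtain S where S: "S \<subseteq> R" "finite S" "\<And>x. x \<in> R \<Longrightarrow> \<exists>s\<in>S. x - s \<in> (*) (of_nat n) ` R"
    using representatives[OF assms] by blast
  have "inj_on (\<lambda>J. J \<inter> S) (ideals_of n)"
  proof (rule inj_onI)
    have *: "J \<subseteq> J'" if J: "J \<in> ideals_of n" "J' \<in> ideals_of n" "J \<inter> S = J' \<inter> S" for J J'
    proof
      fix x assume x: "x \<in> J"
      then obtain s where s: "s \<in> S" "x - s \<in> (*) (of_nat n) ` R" using S(3) J(1) unfolding ideals_of_def by blast
      have "(*) (of_nat n) ` R \<subseteq> J" "(*) (of_nat n) ` R \<subseteq> J'"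
        using J scale_R_subset by (auto simp: ideals_of_def simp del: image_subset_iff)
      then have d: "x - s \<in> J" "x - s \<in> J'" using s(2) by blast+
      have "x - (x - s) \<in> J" using d(1) x J(1) unfolding ideals_of_def by (blast intro: submod_diff)
      then have "s \<in> J'" using J(3) s(1) by auto
      then have "s + (x - s) \<in> J'" using d J(2) by (intro submod_add) (auto simp: ideals_of_def)
      then show "x \<in> J'" by simp
    qed
    fix J J' assume "J \<in> ideals_of n" "J' \<in> ideals_of n" "J \<inter> S = J' \<inter> S"
    then show "J = J'" using *[of J J'] *[of J' J] by auto
  qed
  moreover have "(\<lambda>J. J \<inter> S) ` ideals_of n \<subseteq> Pow S" by auto
  ultimately show ?thesis using S(2) by (meson finite_Pow_iff inj_on_finite)
qed

text \<open>Being nonzero is expressed by containing a positive integer, which makes the residue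
  ring finite.\<close>

definition prime_ideal :: "'a set \<Rightarrow> bool" where
  "prime_ideal M \<longleftrightarrow> submod M \<and> M \<subseteq> R \<and> 1 \<notin> M \<and> (\<exists>n>0. of_nat n \<in> M) \<and>
     (\<forall>x\<in>R. \<forall>y\<in>R. x * y \<in> M \<longrightarrow> x \<in> M \<or> y \<in> M)"

lemma prime_idealD:
  assumes "prime_ideal M"
  shows "submod M" "M \<subseteq> R" "1 \<notin> M" "\<And>x y. x \<in> R \<Longrightarrow> y \<in> R \<Longrightarrow> x * y \<in> M \<Longrightarrow> x \<in> M \<or> y \<in> M"
  using assms unfolding prime_ideal_def by blast+

lemma one_in_ideal: "submod I \<Longrightarrow> 1 \<in> I \<Longrightarrow> R \<subseteq> I"
  using submod_smult[of I _ 1] by force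

text \<open>The residue ring of a prime ideal is a finite domain: among the powers of
  \<open>x\<close> two agree modulo \<open>M\<close>, and cancelling the smaller one exhibits an
  inverse of \<open>x\<close>.\<close>

lemma prime_ideal_maximal:
  assumes M: "prime_ideal M" and x: "x \<in> R" "x \<notin> M"
  obtains r where "r \<in> R" "1 - r * x \<in> M"
proof -
  obtain n where n: "n > 0" "of_nat n \<in> M" using M unfolding prime_ideal_def by blast
  obtain S where S: "S \<subseteq> R" "finite S" "\<And>x. x \<in> R \<Longrightarrow> \<exists>s\<in>S. x - s \<in> (*) (of_nat n) ` R"
    using representatives[OF n(1)] by blast
  have "\<exists>s. s \<in> S \<and> x ^ k - s \<in> (*) (of_nat n) ` R" for k :: nat
    using S(3)[OF power_in[OF x(1), of k]] unfolding Bex_def .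
  then obtain f where f: "\<And>k::nat. f k \<in> S \<and> x ^ k - f k \<in> (*) (of_nat n) ` R" by metis
  have fM: "x ^ k - f k \<in> M" for k :: nat
    using f[of k] scale_R_subset[OF prime_idealD(1)[OF M] n(2)] by (meson subsetD)
  have "\<not> inj f"
  proof
    assume "inj f"
    then have "infinite (range f)" by (simp add: finite_image_iff)
    then show False using f S(2) by (metis finite_subset image_subsetI)
  qed
  then obtain i j where ij: "i < j" "f i = f j"
    unfolding inj_def by (metis linorder_neqE_nat)
  have "(x ^ i - f i) - (x ^ j - f j) \<in> M"
    by (intro submod_diff[OF prime_idealD(1)[OF M]] fM)
  then have "x ^ i - x ^ j \<in> M" using ij by simp
  moreover have "x ^ i - x ^ j = x ^ i * (1 - x ^ (j - i - 1) * x)"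
    using ij(1) by (simp add: algebra_simps flip: power_Suc power_add)
  moreover have "x ^ i \<notin> M" for i
    by (induction i) (use prime_idealD[OF M] x power_in[OF x(1)] in auto)
  ultimately have "1 - x ^ (j - i - 1) * x \<in> M"
    using prime_idealD(4)[OF M, of "x ^ i" "1 - x ^ (j - i - 1) * x"] x
    by (auto intro: power_in diff_in one_in mult_in)
  then show ?thesis using that power_in[OF x(1)] by blast
qed

lemma prime_ideal_subset_eq:
  assumes M: "prime_ideal M" and I: "submod I" "I \<subseteq> R" "M \<subseteq> I" "1 \<notin> I"
  shows "I = M"
proof (rule ccontr)
  assume "I \<noteq> M"
  then obtain x where x: "x \<in> I" "x \<notin> M" using I by blast
  then obtain r where r: "r \<in> R" "1 - r * x \<in> M" using prime_ideal_maximal[OF M, of x] I by blast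
  have "(1 - r * x) + r * x \<in> I" using r x I by (intro submod_add submod_smult) auto
  then show False using I by simp
qed

section \<open>Products of prime ideals\<close>

definition iprod_list :: "'a set list \<Rightarrow> 'a set" where
  "iprod_list Ms = foldr (\<diamondop>) Ms R"

lemma iprod_list_simps: "iprod_list [] = R" "iprod_list (M # Ms) = M \<diamondop> iprod_list Ms"
  by (simp_all add: iprod_list_def)

lemma submod_iprod_list: "(\<And>M. M \<in> set Ms \<Longrightarrow> submod M) \<Longrightarrow> submod (iprod_list Ms)"
  by (induction Ms) (auto simp: iprod_list_simps submod_R submod_iprod)

lemma iprod_list_subset: "(\<And>M. M \<in> set Ms \<Longrightarrow> M \<subseteq> R) \<Longrightarrow> iprod_list Ms \<subseteq> R"
proof (induction Ms)
  case (Cons M Ms)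
  then show ?case unfolding iprod_list_simps
    by (intro iprod_subset_submod[OF submod_R] mult_in) auto
qed (simp add: iprod_list_simps)

lemma iprod_list_append:
  assumes "\<And>M. M \<in> set Ns \<Longrightarrow> submod M"
  shows "iprod_list (Ms @ Ns) = iprod_list Ms \<diamondop> iprod_list Ns"
  by (induction Ms) (use assms in \<open>auto simp: iprod_list_simps iprod_assoc R_iprod submod_iprod_list\<close>)

lemma iprod_list_remove1:
  "M \<in> set Ms \<Longrightarrow> iprod_list Ms = M \<diamondop> iprod_list (remove1 M Ms)"
  by (induction Ms) (auto simp: iprod_list_simps iprod_left_commute)

text \<open>Noetherian induction on the finite number of ideals above \<open>J\<close>: if
  \<open>x * y\<close> is in \<open>J\<close> but neither factor is, then the product of the two
  larger ideals \<open>adjoin J x\<close> and \<open>adjoin J y\<close> is still inside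
  \<open>J\<close>.\<close>

lemma contains_product_of_primes:
  assumes n: "n > 0" and J: "J \<in> ideals_of n"
  shows "\<exists>Ms. (\<forall>M\<in>set Ms. prime_ideal M) \<and> iprod_list Ms \<subseteq> J"
  using J
proof (induction "card {I \<in> ideals_of n. J \<subseteq> I}" arbitrary: J rule: less_induct)
  case less
  note J = less.prems
  have J': "submod J" "J \<subseteq> R" "of_nat n \<in> J" using J by (auto simp: ideals_of_def)
  show ?case
  proof (cases "1 \<in> J \<or> prime_ideal J")
    case True
    then show ?thesis
    proof
      assume "1 \<in> J"
      then show ?thesis using one_in_ideal[OF J'(1)] by (intro exI[of _ "[]"]) (simp add: iprod_list_simps)
    next
      assume "prime_ideal J"
      then show ?thesis by (intro exI[of _ "[J]"]) (simp add: iprod_list_simps iprod_R J')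
    qed
  next
    case False
    then obtain x y where xy: "x \<in> R" "y \<in> R" "x * y \<in> J" "x \<notin> J" "y \<notin> J"
      using J' n unfolding prime_ideal_def by blast
    have *: "\<exists>Ms. (\<forall>M\<in>set Ms. prime_ideal M) \<and> iprod_list Ms \<subseteq> adjoin J z" if z: "z \<in> R" "z \<notin> J" for z
    proof (rule less.hyps)
      show m: "adjoin J z \<in> ideals_of n"
        using submod_adjoin[OF J'(1)] adjoin_superset[of J z] adjoin_subset[OF submod_R J'(2) z(1)] J'(3)
        by (auto simp: ideals_of_def)
      have "{I \<in> ideals_of n. adjoin J z \<subseteq> I} \<subset> {I \<in> ideals_of n. J \<subseteq> I}"
        using adjoin_superset[of J z] adjoin_mem[OF J'(1), of z] z J by blast
      then show "card {I \<in> ideals_of n. adjoin J z \<subseteq> I} < card {I \<in> ideals_of n. J \<subseteq> I}"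
        using finite_ideals_of[OF n] by (intro psubset_card_mono) auto
    qed
    obtain Ms Ns where Ms: "\<forall>M\<in>set Ms. prime_ideal M" "iprod_list Ms \<subseteq> adjoin J x"
      and Ns: "\<forall>M\<in>set Ns. prime_ideal M" "iprod_list Ns \<subseteq> adjoin J y"
      using *[OF xy(1,4)] *[OF xy(2,5)] by blast
    have "adjoin J x \<diamondop> adjoin J y \<subseteq> J"
    proof (rule iprod_subset_submod[OF J'(1)])
      fix u v assume "u \<in> adjoin J x" "v \<in> adjoin J y"
      then obtain j r j' r' where uv: "u = j + r * x" "v = j' + r' * y"
        "j \<in> J" "r \<in> R" "j' \<in> J" "r' \<in> R" unfolding adjoin_def by blast
      then have "u * v = (j' + r' * y) * j + (r * x) * j' + (r * r') * (x * y)" by (simp add: algebra_simps)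
      then show "u * v \<in> J" using uv xy J'
        by (auto intro!: submod_add[OF J'(1)] submod_smult[OF J'(1)] add_in mult_in)
    qed
    moreover have "iprod_list (Ms @ Ns) = iprod_list Ms \<diamondop> iprod_list Ns"
      using Ns(1) prime_idealD(1) by (intro iprod_list_append) blast
    ultimately have "iprod_list (Ms @ Ns) \<subseteq> J" using iprod_mono[OF Ms(2) Ns(2)] by simp
    then show ?thesis using Ms Ns by (intro exI[of _ "Ms @ Ns"]) auto
  qed
qed

text \<open>If the first factor \<open>N\<close> is not inside \<open>M\<close>, an element of
  \<open>N\<close> outside \<open>M\<close> can be cancelled, and the remaining product lies in
  \<open>M\<close>; if it is inside, maximality of primes gives equality.\<close>

lemma prime_ideal_contains_factor:
  assumes M: "prime_ideal M" and Ms: "\<forall>N\<in>set Ms. prime_ideal N" "iprod_list Ms \<subseteq> M"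
  shows "M \<in> set Ms"
  using Ms
proof (induction Ms)
  case Nil
  then show ?case using M one_in by (auto simp: iprod_list_simps prime_ideal_def)
next
  case (Cons N Ms)
  show ?case
  proof (cases "N \<subseteq> M")
    case True
    then show ?thesis using prime_ideal_subset_eq[OF _ prime_idealD(1,2)[OF M] _ prime_idealD(3)[OF M], of N] Cons.prems(1)
      by simp
  next
    case False
    then obtain x where x: "x \<in> N" "x \<notin> M" by blast
    have "iprod_list Ms \<subseteq> R"
      using Cons.prems(1) by (intro iprod_list_subset) (auto dest: prime_idealD(2))
    have "iprod_list Ms \<subseteq> M"
    proof
      fix y assume y: "y \<in> iprod_list Ms"
      then have "x * y \<in> M" using x Cons.prems(2) by (auto simp: iprod_list_simps intro: iprod_mult)
      then show "y \<in> M" using prime_idealD(4)[OF M, of x y] x y prime_idealD(2)[of N] Cons.prems(1) \<open>iprod_list Ms \<subseteq> R\<close>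
        by auto
    qed
    then show ?thesis using Cons.IH Cons.prems(1) by simp
  qed
qed

section \<open>Invertibility of prime ideals\<close>

definition inv_ideal :: "'a set \<Rightarrow> 'a set" where
  "inv_ideal M = {x. \<forall>m\<in>M. x * m \<in> R}"

lemma submod_inv_ideal: "submod (inv_ideal M)"
  unfolding submod_def inv_ideal_def
  by (simp add: zero_in distrib_right add_in mult.assoc mult_in)

text \<open>A shortest product of primes inside \<open>n R\<close> must have \<open>M\<close> as a
  factor. Without that factor it is no longer inside, and an element \<open>y\<close> of it outside
  \<open>n R\<close> gives \<open>y / n\<close> in the inverse but not in \<open>R\<close>. By
  maximality \<open>M\<close> times its inverse is \<open>M\<close> or \<open>R\<close>; in the
  first case every element of the inverse would multiply \<open>M\<close> into itself and so be
  integral.\<close>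

lemma prime_ideal_inverse:
  assumes M: "prime_ideal M"
  shows "M \<diamondop> inv_ideal M = R" and "\<not> inv_ideal M \<subseteq> R"
proof -
  obtain n where n: "n > 0" "of_nat n \<in> M" using M unfolding prime_ideal_def by blast
  have nR: "(*) (of_nat n) ` R \<in> ideals_of n"
    using submod_scale[OF submod_R, of "of_nat n"] one_in mult_in[OF of_nat_in[of n]]
    by (auto simp: ideals_of_def intro!: image_eqI[of _ _ 1])
  define Q where "Q Ms \<longleftrightarrow> (\<forall>M\<in>set Ms. prime_ideal M) \<and> iprod_list Ms \<subseteq> (*) (of_nat n) ` R" for Ms
  obtain Ms where Ms: "Q Ms" "\<And>Ns. Q Ns \<Longrightarrow> length Ms \<le> length Ns"
    using contains_product_of_primes[OF n(1) nR] ex_has_least_nat[of Q _ length] unfolding Q_def by metis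
  have "M \<in> set Ms"
    using Ms(1) scale_R_subset[OF prime_idealD(1)[OF M] n(2)] prime_ideal_contains_factor[OF M] unfolding Q_def by blast
  define Ns where "Ns = remove1 M Ms"
  have "length Ns < length Ms"
    using \<open>M \<in> set Ms\<close> length_pos_if_in_set[of M Ms]
    by (simp add: Ns_def length_remove1 del: length_greater_0_conv)
  then have "\<not> Q Ns" using Ms(2)[of Ns] by (meson not_le)
  moreover have "\<forall>M\<in>set Ns. prime_ideal M" using Ms(1) set_remove1_subset[of M Ms] unfolding Q_def Ns_def by blast
  ultimately obtain y where y: "y \<in> iprod_list Ns" "y \<notin> (*) (of_nat n) ` R" unfolding Q_def by blast
  define x where "x = y / of_nat n"
  have n0: "of_nat n \<noteq> (0 :: 'a)" using n(1) by simp
  have "x \<in> inv_ideal M"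
    unfolding inv_ideal_def
  proof (intro CollectI ballI)
    fix m assume "m \<in> M"
    then have "m * y \<in> M \<diamondop> iprod_list Ns" using y by (intro iprod_mult)
    then have "m * y \<in> (*) (of_nat n) ` R"
      using iprod_list_remove1[OF \<open>M \<in> set Ms\<close>] Ms(1) unfolding Q_def Ns_def by blast
    then show "x * m \<in> R" using n0 by (auto simp: x_def field_simps)
  qed
  moreover have "x \<notin> R"
  proof
    assume "x \<in> R"
    then have "of_nat n * x \<in> (*) (of_nat n) ` R" by blast
    then show False using y n0 by (simp add: x_def)
  qed
  ultimately show 1: "\<not> inv_ideal M \<subseteq> R" by blast
  have I: "submod (M \<diamondop> inv_ideal M)" using prime_idealD(1)[OF M] submod_inv_ideal by (rule submod_iprod)
  have IR: "M \<diamondop> inv_ideal M \<subseteq> R"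
    by (rule iprod_subset_submod[OF submod_R]) (auto simp: inv_ideal_def mult.commute)
  have "1 \<in> inv_ideal M" using prime_idealD(2)[OF M] by (auto simp: inv_ideal_def)
  then have MI: "M \<subseteq> M \<diamondop> inv_ideal M" using iprod_mult[of _ M 1 "inv_ideal M"] by auto
  have "1 \<in> M \<diamondop> inv_ideal M"
  proof (rule ccontr)
    assume "1 \<notin> M \<diamondop> inv_ideal M"
    then have eq: "M \<diamondop> inv_ideal M = M" using prime_ideal_subset_eq[OF M I IR MI] by blast
    have "inv_ideal M \<subseteq> R"
    proof
      fix z assume z: "z \<in> inv_ideal M"
      show "z \<in> R"
      proof (rule integrally_closed[OF prime_idealD(1,2)[OF M] n])
        fix y assume "y \<in> M"
        then have "y * z \<in> M \<diamondop> inv_ideal M" using z by (intro iprod_mult)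
        then show "z * y \<in> M" using eq by (simp add: mult.commute)
      qed
    qed
    then show False using 1 by blast
  qed
  then show "M \<diamondop> inv_ideal M = R" using one_in_ideal[OF I] IR by blast
qed

lemma inv_prime_cancel:
  "prime_ideal M \<Longrightarrow> submod A \<Longrightarrow> inv_ideal M \<diamondop> (M \<diamondop> A) = A"
  "prime_ideal M \<Longrightarrow> submod A \<Longrightarrow> M \<diamondop> (inv_ideal M \<diamondop> A) = A"
proof -
  assume M: "prime_ideal M" and A: "submod A"
  show "M \<diamondop> (inv_ideal M \<diamondop> A) = A"
    using prime_ideal_inverse(1)[OF M] R_iprod[OF A] by (metis iprod_assoc)
  then show "inv_ideal M \<diamondop> (M \<diamondop> A) = A"
    by (metis iprod_left_commute)
qed

text \<open>Among the finitely many proper ideals above \<open>J\<close> that contain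
  \<open>n\<close> there is a maximal one, and it is prime.\<close>

lemma ideal_in_prime_ideal:
  assumes n: "n > 0" and J: "J \<in> ideals_of n" and "1 \<notin> J"
  obtains M where "prime_ideal M" "J \<subseteq> M"
proof -
  define F where "F = {I \<in> ideals_of n. J \<subseteq> I \<and> 1 \<notin> I}"
  have "finite F" "J \<in> F" using finite_ideals_of[OF n] J assms(3) by (auto simp: F_def)
  then obtain M where M: "M \<in> F" "\<And>I. I \<in> F \<Longrightarrow> M \<subseteq> I \<Longrightarrow> M = I"
    using finite_has_maximal[of F] by blast
  have M': "submod M" "M \<subseteq> R" "of_nat n \<in> M" "1 \<notin> M" "J \<subseteq> M" using M(1) by (auto simp: F_def ideals_of_def)
  have "prime_ideal M"
    unfolding prime_ideal_def
  proof (intro conjI ballI impI)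
    fix x y assume xy: "x \<in> R" "y \<in> R" "x * y \<in> M"
    show "x \<in> M \<or> y \<in> M"
    proof (rule disjCI)
      assume "y \<notin> M"
      have "1 \<in> adjoin M y"
      proof (rule ccontr)
        assume "1 \<notin> adjoin M y"
        then have "adjoin M y \<in> F"
          using submod_adjoin[OF M'(1)] adjoin_superset[of M y] adjoin_subset[OF submod_R M'(2) xy(2)] M'
          by (auto simp: F_def ideals_of_def)
        then show False using M(2) adjoin_superset[of M y] adjoin_mem[OF M'(1), of y] \<open>y \<notin> M\<close> by metis
      qed
      then obtain j r where jr: "1 = j + r * y" "j \<in> M" "r \<in> R" unfolding adjoin_def by blast
      have "x * 1 = x * j + r * (x * y)" unfolding jr(1) by (simp add: algebra_simps)
      moreover have "x * j + r * (x * y) \<in> M" using submod_smult[OF M'(1) xy(1) jr(2)] submod_smult[OF M'(1) jr(3) xy(3)] submod_add[OF M'(1)] by blast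
      ultimately show "x \<in> M" by (metis mult.right_neutral)
    qed
  qed (use M' n in auto)
  then show ?thesis using that M' by blast
qed

lemma comaximal_power:
  assumes "submod M" "x \<in> R" "1 - x \<in> M"
  shows "1 - x ^ e \<in> M"
proof (induction e)
  case (Suc e)
  have "1 - x ^ Suc e = (1 - x) + x * (1 - x ^ e)" by (simp add: algebra_simps)
  moreover have "(1 - x) + x * (1 - x ^ e) \<in> M"
    using assms Suc by (intro submod_add submod_smult)
  ultimately show ?case by metis
qed (use assms submod_zero in auto)

text \<open>Stands in for unique factorization. Both ideals lie in a common prime \<open>M\<close>;
  dividing by it shifts the exponents at \<open>M\<close> by one and leaves those at all other
  primes, so the hypothesis survives, while fewer ideals lie above the quotient.\<close>

lemma ideal_determined_by_prime_powers:
  assumes n: "n > 0" and J: "J \<in> ideals_of n" "J' \<in> ideals_of n"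
    and eq: "\<And>M e. prime_ideal M \<Longrightarrow> of_nat n \<in> M \<Longrightarrow> J \<subseteq> ipow M e \<longleftrightarrow> J' \<subseteq> ipow M e"
  shows "J = J'"
  using J eq
proof (induction "card {I \<in> ideals_of n. J \<subseteq> I}" arbitrary: J J' rule: less_induct)
  case less
  note J = less.prems(1,2)
  note eq = less.prems(3)
  have J1: "submod J" "J \<subseteq> R" "of_nat n \<in> J" and J2: "submod J'" "J' \<subseteq> R" "of_nat n \<in> J'"
    using J by (auto simp: ideals_of_def)
  have ip1: "ipow M 1 = M" if "prime_ideal M" for M
    using iprod_R[OF prime_idealD(1)[OF that]] by (simp add: ipow_Suc)
  show ?case
  proof (cases "1 \<in> J")
    case True
    have "1 \<in> J'"
    proof (rule ccontr)
      assume "1 \<notin> J'"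
      then obtain M where M: "prime_ideal M" "J' \<subseteq> M" using ideal_in_prime_ideal[OF n J(2)] by blast
      then show False using eq[of M 1] ip1[OF M(1)] J2(3) True prime_idealD(3)[OF M(1)] by auto
    qed
    then show ?thesis using one_in_ideal[OF J1(1) True] one_in_ideal[OF J2(1)] J1 J2 by blast
  next
    case False
    then obtain M where M: "prime_ideal M" "J \<subseteq> M" using ideal_in_prime_ideal[OF n J(1)] by blast
    then have M2: "J' \<subseteq> M" using eq[of M 1] ip1 J1 by auto
    note sM = prime_idealD(1,2)[OF M(1)]
    define dv where "dv I = inv_ideal M \<diamondop> I" for I
    have dv: "dv I \<in> ideals_of n" "I \<subseteq> dv I" "M \<diamondop> dv I = I" 
      "\<And>M' e. prime_ideal M' \<Longrightarrow> dv I \<subseteq> ipow M' e \<longleftrightarrow> I \<subseteq> ipow M' (if M' = M then Suc e else e)"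
      if I: "I \<in> ideals_of n" "I \<subseteq> M" for I
    proof -
      have I': "submod I" "I \<subseteq> R" "of_nat n \<in> I" using I by (auto simp: ideals_of_def)
      have sd: "submod (dv I)" unfolding dv_def by (intro submod_iprod submod_inv_ideal I')
      show MI: "M \<diamondop> dv I = I" unfolding dv_def by (rule inv_prime_cancel(2)[OF M(1) I'(1)])
      have "1 \<in> inv_ideal M" using sM(2) by (auto simp: inv_ideal_def)
      then show Id: "I \<subseteq> dv I" using iprod_mult[of 1 "inv_ideal M" _ I] by (auto simp: dv_def)
      have "dv I \<subseteq> R" unfolding dv_def
        by (rule iprod_subset_submod[OF submod_R]) (use I in \<open>auto simp: inv_ideal_def\<close>)
      then show "dv I \<in> ideals_of n" using sd Id I' by (auto simp: ideals_of_def)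
      fix M' e assume M': "prime_ideal M'"
      show "dv I \<subseteq> ipow M' e \<longleftrightarrow> I \<subseteq> ipow M' (if M' = M then Suc e else e)"
      proof (cases "M' = M")
        case True
        have "dv I \<subseteq> ipow M e \<longleftrightarrow> I \<subseteq> M \<diamondop> ipow M e"
        proof
          assume "dv I \<subseteq> ipow M e"
          then show "I \<subseteq> M \<diamondop> ipow M e" using iprod_mono[of M M] MI by blast
        next
          assume "I \<subseteq> M \<diamondop> ipow M e"
          then have "dv I \<subseteq> inv_ideal M \<diamondop> (M \<diamondop> ipow M e)" unfolding dv_def by (intro iprod_mono) auto
          then show "dv I \<subseteq> ipow M e" using inv_prime_cancel(1)[OF M(1) submod_ipow[OF sM(1)]] by simp
        qed
        then show ?thesis using True by (simp add: ipow_Suc)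
      next
        case False
        \<comment> \<open>Distinct primes are comaximal, so some \<open>r * x\<close> is in
          \<open>M'\<close> and congruent to 1 modulo \<open>M\<close>. Its \<open>e\<close>-th
          power splits any \<open>y\<close> of \<open>dv I\<close> into a part in \<open>M\<close>
          times \<open>dv I\<close>, which is \<open>I\<close>, and a part in
          \<open>ipow M' e\<close>.\<close>
        obtain x where x: "x \<in> M'" "x \<notin> M"
          using False prime_ideal_subset_eq[OF M' sM(1,2)] prime_idealD(3)[OF M(1)] prime_ideal_subset_eq[OF M(1) prime_idealD(1,2)[OF M']] prime_idealD(3)[OF M']
          by blast
        then obtain r where r: "r \<in> R" "1 - r * x \<in> M"
          using prime_ideal_maximal[OF M(1), of x] prime_idealD(2)[OF M'] by blast
        have rx: "r * x \<in> M'" using r x prime_idealD(1)[OF M'] submod_smult by blast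
        have "dv I \<subseteq> ipow M' e" if "I \<subseteq> ipow M' e"
        proof
          fix y assume y: "y \<in> dv I"
          have a: "1 - (r * x) ^ e \<in> M"
            using r rx prime_idealD(2)[OF M'] by (intro comaximal_power[OF sM(1)]) auto
          have "(1 - (r * x) ^ e) * y \<in> M \<diamondop> dv I" using a y by (rule iprod_mult)
          then have "(1 - (r * x) ^ e) * y \<in> ipow M' e" using MI that by blast
          moreover have "y * (r * x) ^ e \<in> ipow M' e"
            using power_in_ipow[OF rx] y \<open>dv I \<subseteq> R\<close> submod_smult[OF submod_ipow[OF prime_idealD(1)[OF M']]] by blast
          ultimately have "(1 - (r * x) ^ e) * y + y * (r * x) ^ e \<in> ipow M' e"
            using submod_add[OF submod_ipow[OF prime_idealD(1)[OF M']]] by blast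
          then show "y \<in> ipow M' e" by (simp add: algebra_simps)
        qed
        then show ?thesis using False Id by auto
      qed
    qed
    \<comment> \<open>If dividing by \<open>M\<close> changed nothing, each element of the inverse
      of \<open>M\<close> would multiply \<open>J\<close> into itself and be integral.\<close>
    have ne: "J \<noteq> dv J"
    proof
      assume e: "J = dv J"
      have "inv_ideal M \<subseteq> R"
      proof
        fix z assume z: "z \<in> inv_ideal M"
        show "z \<in> R"
          by (rule integrally_closed[OF J1(1,2) n J1(3)]) (use z e iprod_mult[of z "inv_ideal M" _ J] in \<open>auto simp: dv_def\<close>)
      qed
      then show False using prime_ideal_inverse(2)[OF M(1)] by blast
    qed
    have "{I \<in> ideals_of n. dv J \<subseteq> I} \<subset> {I \<in> ideals_of n. J \<subseteq> I}"
      using dv(2)[OF J(1) M(2)] ne J(1) by blast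
    then have "card {I \<in> ideals_of n. dv J \<subseteq> I} < card {I \<in> ideals_of n. J \<subseteq> I}"
      using finite_ideals_of[OF n] by (intro psubset_card_mono) auto
    then have "dv J = dv J'"
      by (rule less.hyps) (use dv[OF J(1) M(2)] dv[OF J(2) M2] eq in auto)
    then show ?thesis using dv(3)[OF J(1) M(2)] dv(3)[OF J(2) M2] by metis
  qed
qed

section \<open>Counting the ideals that contain a given integer\<close>

lemma of_nat_unit_multiple:
  assumes L: "submod L" and px: "of_nat p * x \<in> L" and kx: "of_nat k * x \<in> L" and c: "coprime k p"
  shows "x \<in> L"
proof -
  obtain u v where uv: "u * int k + v * int p = 1"
    using c by (metis bezout_int coprime_iff_gcd_eq_1 coprime_int_iff gcd_eq_1_imp_coprime)
  have "x = of_int (u * int k + v * int p) * x" using uv by simp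
  also have "\<dots> = of_int u * (of_nat k * x) + of_int v * (of_nat p * x)" by (simp add: algebra_simps)
  also have "\<dots> \<in> L" using submod_smult[OF L of_int_in px, of v] submod_smult[OF L of_int_in kx, of u] submod_add[OF L] by blast
  finally show ?thesis .
qed

text \<open>Each strict step has a quotient killed by \<open>p\<close>, so it multiplies the index
  by at least \<open>p\<close>, while the index of \<open>L e\<close> is at most that of
  \<open>m R\<close>, which is at most \<open>m ^ 3\<close>.\<close>

lemma strict_chain_bound:
  assumes p: "prime p" and sub: "\<And>i. i \<le> e \<Longrightarrow> submod (L i)" and "L 0 \<subseteq> R"
    and strict: "\<And>i. i < e \<Longrightarrow> L (Suc i) \<subset> L i"
    and pL: "\<And>i x. i < e \<Longrightarrow> x \<in> L i \<Longrightarrow> of_nat p * x \<in> L (Suc i)"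
    and m: "m > 0" "(*) (of_nat m) ` R \<subseteq> L e"
  shows "p ^ e \<le> m ^ 3"
proof -
  have LR: "L i \<subseteq> R" if "i \<le> e" for i
    using that
  proof (induction i)
    case (Suc i)
    then show ?case using strict[of i] by auto
  qed (use assms in auto)
  have "\<exists>S\<subseteq>R. finite S \<and> card S = p ^ i \<and> (\<forall>x\<in>S. \<forall>y\<in>S. x - y \<in> L i \<longrightarrow> x = y)" if "i \<le> e" for i
    using that
  proof (induction i)
    case 0
    show ?case using one_in by (intro exI[of _ "{1}"]) auto
  next
    case (Suc i)
    then obtain S where S: "S \<subseteq> R" "finite S" "card S = p ^ i" "\<And>x y. x \<in> S \<Longrightarrow> y \<in> S \<Longrightarrow> x - y \<in> L i \<Longrightarrow> x = y"
      by auto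
    have i: "i < e" "i \<le> e" using Suc by auto
    obtain x where x: "x \<in> L i" "x \<notin> L (Suc i)" using strict[OF i(1)] by blast
    have jj: "j = j'" if "of_nat j * x - of_nat j' * x \<in> L (Suc i)" "j < p" "j' < p" for j j'
    proof -
      have False if "of_nat j * x - of_nat j' * x \<in> L (Suc i)" "j' < j" "j < p" for j j'
      proof -
        have "of_nat (j - j') * x \<in> L (Suc i)" using that by (simp add: of_nat_diff algebra_simps)
        moreover have "coprime (j - j') p"
          using that p by (metis coprime_commute diff_is_0_eq dvd_imp_le less_imp_diff_less not_le prime_imp_coprime zero_less_diff)
        ultimately show False
          using of_nat_unit_multiple[OF sub[OF Suc.prems] pL[OF i(1) x(1)]] x(2) by blast
      qed
      moreover have "of_nat j' * x - of_nat j * x \<in> L (Suc i)"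
        using submod_minus[OF sub[OF Suc.prems] that(1)] by simp
      ultimately show "j = j'" using that by (meson linorder_neqE_nat)
    qed
    \<comment> \<open>A system that is incongruent modulo \<open>L i\<close> becomes one modulo
      \<open>L (Suc i)\<close>, \<open>p\<close> times as large, by adding the first
      \<open>p\<close> multiples of an element \<open>x\<close> of the difference.\<close>
    define f where "f = (\<lambda>(s, j). s + of_nat j * x)"
    have key: "u = v" if "u \<in> S \<times> {..<p}" "v \<in> S \<times> {..<p}" "f u - f v \<in> L (Suc i)" for u v
    proof -
      obtain s j s' j' where uv: "u = (s, j)" "v = (s', j')" "s \<in> S" "s' \<in> S" "j < p" "j' < p"
        using \<open>u \<in> _\<close> \<open>v \<in> _\<close> by auto
      have d: "(s - s') + (of_nat j * x - of_nat j' * x) \<in> L (Suc i)"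
        using that(3) by (simp add: f_def uv algebra_simps)
      have "of_nat j * x - of_nat j' * x \<in> L i"
        by (intro submod_diff[OF sub[OF i(2)]] submod_of_nat[OF sub[OF i(2)]] x)
      moreover have "(s - s') + (of_nat j * x - of_nat j' * x) \<in> L i" using d strict[OF i(1)] by blast
      ultimately have "(s - s') + (of_nat j * x - of_nat j' * x) - (of_nat j * x - of_nat j' * x) \<in> L i"
        using submod_diff[OF sub[OF i(2)]] by blast
      then have "s = s'" using S(4)[OF uv(3,4)] by simp
      moreover have "j = j'" using jj[of j j'] d uv \<open>s = s'\<close> by simp
      ultimately show ?thesis using uv by simp
    qed
    have inj: "inj_on f (S \<times> {..<p})"
    proof (rule inj_onI)
      fix u v assume "u \<in> S \<times> {..<p}" "v \<in> S \<times> {..<p}" "f u = f v"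
      then show "u = v" using key[of u v] submod_zero[OF sub[OF Suc.prems]] by simp
    qed
    show ?case
    proof (intro exI[of _ "f ` (S \<times> {..<p})"] conjI)
      show "f ` (S \<times> {..<p}) \<subseteq> R"
        using S(1) x(1) LR[OF i(2)] by (auto simp: f_def intro!: add_in mult_in of_nat_in)
      show "card (f ` (S \<times> {..<p})) = p ^ Suc i"
        using S by (simp add: card_image[OF inj] card_cartesian_product)
      show "\<forall>a\<in>f ` (S \<times> {..<p}). \<forall>b\<in>f ` (S \<times> {..<p}). a - b \<in> L (Suc i) \<longrightarrow> a = b"
        using key by blast
    qed (use S in auto)
  qed
  then obtain S where S: "S \<subseteq> R" "card S = p ^ e" "\<And>x y. x \<in> S \<Longrightarrow> y \<in> S \<Longrightarrow> x - y \<in> L e \<Longrightarrow> x = y"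
    by (metis order_refl)
  have "card S \<le> m ^ 3" using index_bound[OF m(1) S(1)] S(3) m(2) by (meson subsetD)
  then show ?thesis using S(2) by simp
qed

lemma ipow_Suc_psubset:
  assumes M: "prime_ideal M"
  shows "ipow M (Suc e) \<subset> ipow M e"
proof (induction e)
  case 0
  then show ?case using iprod_R[OF prime_idealD(1)[OF M]] prime_idealD(2,3)[OF M] one_in
    by (auto simp: ipow_Suc)
next
  case (Suc e)
  have "M \<diamondop> ipow M (Suc e) \<subseteq> M \<diamondop> ipow M e" using Suc by (intro iprod_mono) auto
  moreover have "M \<diamondop> ipow M (Suc e) \<noteq> M \<diamondop> ipow M e"
    using Suc inv_prime_cancel(1)[OF M submod_ipow[OF prime_idealD(1)[OF M]]] by (metis order_less_irrefl)
  ultimately show ?case by (simp add: ipow_Suc psubset_eq)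
qed

lemma ipow_antimono: "prime_ideal M \<Longrightarrow> i \<le> j \<Longrightarrow> ipow M j \<subseteq> ipow M i"
  by (rule lift_Suc_antimono_le[of "ipow M"]) (use ipow_Suc_psubset in auto)

text \<open>Only the \<open>p\<close>-part \<open>p ^ k\<close> of \<open>n\<close> counts, since
  the cofactor is invertible modulo powers of \<open>M\<close>; then the powers of \<open>M\<close>
  form a strict chain from \<open>R\<close> down to a module containing \<open>p ^ k\<close>. The
  factor 3 is the rank.\<close>

lemma prime_power_exponent_bound:
  assumes M: "prime_ideal M" and p: "prime p" "of_nat p \<in> M" and n: "n > 0" "of_nat n \<in> ipow M e"
  shows "e \<le> 3 * multiplicity p n"
proof -
  define k where "k = multiplicity p n"
  obtain n' where n': "n = p ^ k * n'" "\<not> p dvd n'"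
    using multiplicity_decompose'[of n p] n(1) p(1) not_prime_1 unfolding k_def
    by (metis less_numeral_extra(3) not_prime_unit)
  note sM = prime_idealD(1,2)[OF M]
  note sI = submod_ipow[OF sM(1)]
  have "coprime n' p" using prime_imp_coprime[OF p(1) n'(2)] by (simp add: coprime_commute)
  then obtain u v where uv: "u * int n' + v * int p = 1"
    by (metis bezout_int coprime_iff_gcd_eq_1 coprime_int_iff gcd_eq_1_imp_coprime)
  \<comment> \<open>This Bezout term is in \<open>M\<close> and congruent to 1 modulo the cofactor
    \<open>n'\<close>; its \<open>e\<close>-th power is in \<open>ipow M e\<close> and still
    congruent to 1 modulo \<open>n'\<close>.\<close>
  define x where "x = (of_int v * of_nat p :: 'a)"
  have xM: "x \<in> M" unfolding x_def using p(2) by (intro submod_smult[OF sM(1)] of_int_in)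
  have "1 - x = of_nat n' * of_int u"
  proof -
    have "of_int (u * int n' + v * int p) = (1 :: 'a)" using uv by simp
    then show ?thesis by (simp add: x_def algebra_simps)
  qed
  then have "1 - x \<in> (*) (of_nat n') ` R" using of_int_in by auto
  then have "1 - x ^ e \<in> (*) (of_nat n') ` R"
    using xM sM by (intro comaximal_power[OF submod_scale[OF submod_R]]) auto
  then obtain w where w: "w \<in> R" "1 - x ^ e = of_nat n' * w" by auto
  have "of_nat (p ^ k) = of_nat (p ^ k) * x ^ e + w * of_nat n"
  proof -
    have "of_nat (p ^ k) = of_nat (p ^ k) * (x ^ e + (1 - x ^ e))" by simp
    also have "\<dots> = of_nat (p ^ k) * x ^ e + w * of_nat n"
      unfolding w(2) distrib_left by (simp add: n'(1))
    finally show ?thesis .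
  qed
  also have "\<dots> \<in> ipow M e"
    using power_in_ipow[OF xM] w n by (intro submod_add[OF sI] submod_smult[OF sI] of_nat_in)
  finally have pk: "of_nat (p ^ k) \<in> ipow M e" .
  have "p ^ e \<le> (p ^ k) ^ 3"
  proof (rule strict_chain_bound[OF p(1), of e "ipow M"])
    fix i x assume "x \<in> ipow M i"
    then show "of_nat p * x \<in> ipow M (Suc i)" using p by (auto simp: ipow_Suc intro: iprod_mult)
  qed (use sI ipow_Suc_psubset[OF M] p(1) scale_R_subset[OF sI pk] in \<open>auto simp: prime_gt_0_nat\<close>)
  then have "p ^ e \<le> p ^ (3 * k)" by (simp add: mult.commute flip: power_mult)
  then show ?thesis using power_le_imp_le_exp[of p e "3 * k"] prime_gt_1_nat[OF p(1)] by (simp add: k_def)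
qed

text \<open>Intersecting the primes over \<open>p\<close> one after another gives a strict chain
  with quotients killed by \<open>p\<close> that stays above \<open>p R\<close>; its length is at
  most 3 because \<open>p R\<close> has index at most \<open>p ^ 3\<close>. The enumeration
  \<open>h\<close> may repeat itself or contain other sets when there are fewer than three
  primes.\<close>

lemma prime_ideals_over:
  assumes p: "prime p"
  obtains h :: "nat \<Rightarrow> 'a set" where "{M. prime_ideal M \<and> of_nat p \<in> M} \<subseteq> h ` {..<3}"
proof -
  define F where "F = {M. prime_ideal M \<and> of_nat p \<in> M}"
  have p0: "p > 0" using p by (simp add: prime_gt_0_nat)
  have "finite F" using finite_ideals_of[OF p0]
    by (rule rev_finite_subset) (auto simp: F_def ideals_of_def dest: prime_idealD)
  then obtain h where h: "bij_betw h {0..<card F} F" using ex_bij_betw_nat_finite by blast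
  have hF: "prime_ideal (h i)" "of_nat p \<in> h i" if "i < card F" for i
    using bij_betwE[OF h] that by (auto simp: F_def)
  define L where "L i = {x \<in> R. \<forall>j<i. x \<in> h j}" for i
  have "p ^ card F \<le> p ^ 3"
  proof (rule strict_chain_bound[OF p, of "card F" L])
    fix i assume i: "i \<le> card F"
    show "submod (L i)"
      unfolding submod_def L_def using i hF(1)[THEN prime_idealD(1)]
      by (auto intro: zero_in add_in mult_in submod_zero submod_add submod_smult)
  next
    fix i x assume i: "i < card F" and x: "x \<in> L i"
    have "x \<in> R" using x by (simp add: L_def)
    have "of_nat p * x \<in> h j" if "j < Suc i" for j
      using submod_smult[OF prime_idealD(1)[OF hF(1)[of j]] \<open>x \<in> R\<close> hF(2)[of j]] that i
      by (simp add: mult.commute)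
    then show "of_nat p * x \<in> L (Suc i)" using \<open>x \<in> R\<close> by (simp add: L_def mult_in of_nat_in)
  next
    fix i assume i: "i < card F"
    have "\<exists>x. x \<in> h j \<and> x \<notin> h i" if "j < i" for j
    proof (rule ccontr)
      assume "\<not> ?thesis"
      then have "h j \<subseteq> h i" by blast
      then have "h i = h j"
        using prime_ideal_subset_eq[OF hF(1)[of j] prime_idealD(1,2)[OF hF(1)[OF i]] _ prime_idealD(3)[OF hF(1)[OF i]]] that i
        by simp
      then have "i = j" using inj_onD[OF bij_betw_imp_inj_on[OF h], of i j] that i by simp
      then show False using that by simp
    qed
    \<comment> \<open>The product of these elements lies in all earlier ideals but, the
      \<open>i\<close>-th one being prime, not in that one.\<close>
    then obtain x where x: "\<And>j. j < i \<Longrightarrow> x j \<in> h j \<and> x j \<notin> h i" by metis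
    have xR: "x j \<in> R" if "j < i" for j using x[OF that] prime_idealD(2)[OF hF(1)[of j]] that i by auto
    have "(\<Prod>j<k. x j) \<in> L k \<and> (\<Prod>j<k. x j) \<notin> h i" if "k \<le> i" for k
      using that
    proof (induction k)
      case 0
      then show ?case using prime_idealD(3)[OF hF(1)[OF i]] one_in by (simp add: L_def)
    next
      case (Suc k)
      then have IH: "(\<Prod>j<k. x j) \<in> L k" "(\<Prod>j<k. x j) \<notin> h i" by auto
      have "(\<Prod>j<k. x j) * x k \<in> h j" if "j < Suc k" for j
      proof (cases "j = k")
        case True
        then show ?thesis using x[of k] Suc.prems IH(1) i submod_smult[OF prime_idealD(1)[OF hF(1)[of k]]] by (auto simp: L_def)
      next
        case False
        then have "x k * (\<Prod>j<k. x j) \<in> h j"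
          using that IH(1) i Suc.prems xR[of k] by (intro submod_smult[OF prime_idealD(1)[OF hF(1)]]) (auto simp: L_def)
        then show ?thesis by (simp add: mult.commute)
      qed
      moreover have "(\<Prod>j<k. x j) * x k \<notin> h i"
        using IH x[of k] Suc.prems prime_idealD(4)[OF hF(1)[OF i], of "\<Prod>j<k. x j" "x k"] xR[of k] by (auto simp: L_def)
      ultimately show ?case using IH(1) xR[of k] Suc.prems by (auto simp: L_def intro: mult_in)
    qed
    from this[of i] have "(\<Prod>j<i. x j) \<in> L i" "(\<Prod>j<i. x j) \<notin> L (Suc i)" by (auto simp: L_def)
    moreover have "L (Suc i) \<subseteq> L i" by (auto simp: L_def)
    ultimately show "L (Suc i) \<subset> L i" by blast
  next
    show "(*) (of_nat p) ` R \<subseteq> L (card F)"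
    proof (rule image_subsetI)
      fix x assume x: "x \<in> R"
      have "of_nat p * x \<in> h j" if "j < card F" for j
        using submod_smult[OF prime_idealD(1)[OF hF(1)[OF that]] x hF(2)[OF that]] by (simp add: mult.commute)
      then show "of_nat p * x \<in> L (card F)" using x by (simp add: L_def mult_in of_nat_in)
    qed
  qed (use p0 in \<open>auto simp: L_def\<close>)
  then have "card F \<le> 3" using power_le_imp_le_exp prime_gt_1_nat[OF p] by blast
  then have "{0..<card F} \<subseteq> {..<3}" by auto
  then have "F \<subseteq> h ` {..<3}" using bij_betw_imp_surj_on[OF h] image_mono by metis
  then show ?thesis using that unfolding F_def by blast
qed

lemma prime_factor_in_prime_ideal:
  assumes M: "prime_ideal M" and n: "n > 0" "of_nat n \<in> M"
  obtains p where "p \<in> prime_factors n" "of_nat p \<in> M"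
proof -
  have "n > 0 \<Longrightarrow> of_nat n \<in> M \<Longrightarrow> \<exists>p. p \<in> prime_factors n \<and> of_nat p \<in> M"
  proof (induction n rule: less_induct)
    case (less n)
    have "n \<noteq> 1" using less.prems prime_idealD(3)[OF M] by auto
    then obtain p where p: "prime p" "p dvd n" using prime_factor_nat by blast
    then obtain q where q: "n = p * q" by blast
    consider "of_nat p \<in> M" | "of_nat q \<in> M"
      using prime_idealD(4)[OF M of_nat_in[of p] of_nat_in[of q]] less.prems q by auto
    then show ?case
    proof cases
      case 1
      then show ?thesis using p less.prems by (auto simp: prime_factors_dvd)
    next
      case 2
      have "q > 0" "q < n" using q less.prems prime_gt_1_nat[OF p(1)] by (auto simp: Suc_lessI)
      then obtain p' where "p' \<in> prime_factors q" "of_nat p' \<in> M" using less.IH 2 by blast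
      then show ?thesis using q less.prems by (auto simp: prime_factors_dvd)
    qed
  qed
  then show ?thesis using that n by blast
qed

text \<open>An ideal is encoded by the largest exponents of the prime powers containing it. Over
  each prime \<open>p\<close> dividing \<open>n\<close> there are at most three prime ideals, and
  each exponent ranges over \<open>3 * multiplicity p n + 1\<close> values including 0.\<close>

theorem card_ideals_of:
  assumes n: "n > 0"
  shows "card (ideals_of n) \<le> (\<Prod>p\<in>prime_factors n. (3 * multiplicity p n + 1) ^ 3)"
proof -
  have "\<forall>p :: nat. \<exists>h :: nat \<Rightarrow> 'a set. prime p \<longrightarrow> {M. prime_ideal M \<and> of_nat p \<in> M} \<subseteq> h ` {..<3}"
    using prime_ideals_over by metis
  from choice[OF this] obtain h :: "nat \<Rightarrow> nat \<Rightarrow> 'a set"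
    where h: "\<And>p. prime p \<Longrightarrow> {M. prime_ideal M \<and> of_nat p \<in> M} \<subseteq> h p ` {..<3}" by blast
  define D where "D = prime_factors n \<times> {..<3::nat}"
  \<comment> \<open>Entries \<open>h p i\<close> that are no prime ideals do no harm: the zeroth
    power is \<open>R\<close> for every set, so the maximum is over a nonempty set.\<close>
  define E where "E J = (\<lambda>(p, i)\<in>D. Max {e \<in> {..3 * multiplicity p n}. J \<subseteq> ipow (h p i) e})" for J
  have fin: "finite {e \<in> {..m}. P e}" for m :: nat and P by simp
  have "inj_on E (ideals_of n)"
  proof (rule inj_onI)
    fix J J' assume J: "J \<in> ideals_of n" "J' \<in> ideals_of n" and E: "E J = E J'"
    show "J = J'"
    proof (rule ideal_determined_by_prime_powers[OF n J])
      fix M e assume M: "prime_ideal M" "of_nat n \<in> M"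
      obtain p where p: "p \<in> prime_factors n" "of_nat p \<in> M"
        using prime_factor_in_prime_ideal[OF M(1) n M(2)] by blast
      then have pp: "prime p" by auto
      obtain i where i: "i < 3" "M = h p i" using h[OF pp] M p by blast
      define v where "v = 3 * multiplicity p n"
      have iff: "J \<subseteq> ipow M e \<longleftrightarrow> e \<le> Max {e \<in> {..v}. J \<subseteq> ipow M e}" if J: "J \<in> ideals_of n" for J
      proof
        assume "J \<subseteq> ipow M e"
        then show "e \<le> Max {e \<in> {..v}. J \<subseteq> ipow M e}"
          using prime_power_exponent_bound[OF M(1) pp p(2) n, of e] J
          by (intro Max_ge[OF fin]) (auto simp: ideals_of_def v_def)
      next
        assume e: "e \<le> Max {e \<in> {..v}. J \<subseteq> ipow M e}"
        have "0 \<in> {e \<in> {..v}. J \<subseteq> ipow M e}" using J by (auto simp: ideals_of_def)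
        then have "Max {e \<in> {..v}. J \<subseteq> ipow M e} \<in> {e \<in> {..v}. J \<subseteq> ipow M e}"
          by (intro Max_in[OF fin]) blast
        then show "J \<subseteq> ipow M e" using ipow_antimono[OF M(1) e] by blast
      qed
      have "E J (p, i) = E J' (p, i)" using E by simp
      then have "Max {e \<in> {..v}. J \<subseteq> ipow M e} = Max {e \<in> {..v}. J' \<subseteq> ipow M e}"
        using p(1) i by (simp add: E_def D_def v_def)
      then show "J \<subseteq> ipow M e \<longleftrightarrow> J' \<subseteq> ipow M e" using iff J by simp
    qed
  qed
  moreover have "E ` ideals_of n \<subseteq> (\<Pi>\<^sub>E (p, i)\<in>D. {..3 * multiplicity p n})"
  proof (rule image_subsetI)
    fix J assume J: "J \<in> ideals_of n"
    have "Max {e \<in> {..v}. J \<subseteq> ipow M e} \<le> v" for v M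
    proof -
      have "0 \<in> {e \<in> {..v}. J \<subseteq> ipow M e}" using J by (auto simp: ideals_of_def)
      then have "Max {e \<in> {..v}. J \<subseteq> ipow M e} \<in> {e \<in> {..v}. J \<subseteq> ipow M e}"
        by (intro Max_in[OF fin]) blast
      then show ?thesis by simp
    qed
    then show "E J \<in> (\<Pi>\<^sub>E (p, i)\<in>D. {..3 * multiplicity p n})" by (auto simp: E_def)
  qed
  moreover have D: "finite D" by (simp add: D_def)
  then have "finite (\<Pi>\<^sub>E (p, i)\<in>D. {..3 * multiplicity p n})" by (intro finite_PiE) auto
  ultimately have "card (ideals_of n) \<le> card (\<Pi>\<^sub>E (p, i)\<in>D. {..3 * multiplicity p n})"
    by (rule card_inj_on_le)
  also have "\<dots> = (\<Prod>(p, i)\<in>D. 3 * multiplicity p n + 1)"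
    using D by (simp add: card_PiE case_prod_unfold)
  also have "\<dots> = (\<Prod>p\<in>prime_factors n. (3 * multiplicity p n + 1) ^ 3)"
    unfolding D_def by (subst prod.cartesian_product[symmetric]) simp
  finally show ?thesis .
qed

end

subsection \<open>Algebraic integers\<close>

definition zspan :: "'a::ring_1 set \<Rightarrow> 'a set" where
  "zspan V = range (\<lambda>c. \<Sum>v\<in>V. of_int (c v) * v)"

lemma zspan_zero: "0 \<in> zspan V"
  unfolding zspan_def by (rule range_eqI[of _ _ "\<lambda>_. 0"]) simp

lemma zspan_add: "x \<in> zspan V \<Longrightarrow> y \<in> zspan V \<Longrightarrow> x + y \<in> zspan V"
  unfolding zspan_def
proof (elim rangeE)
  fix c d assume "x = (\<Sum>v\<in>V. of_int (c v) * v)" "y = (\<Sum>v\<in>V. of_int (d v) * v)"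
  then show "x + y \<in> range (\<lambda>c. \<Sum>v\<in>V. of_int (c v) * v)"
    by (intro range_eqI[of _ _ "\<lambda>v. c v + d v"]) (simp add: sum.distrib distrib_right)
qed

lemma zspan_int: "x \<in> zspan V \<Longrightarrow> of_int k * x \<in> zspan V"
  unfolding zspan_def
proof (elim rangeE)
  fix c assume "x = (\<Sum>v\<in>V. of_int (c v) * v)"
  then show "of_int k * x \<in> range (\<lambda>c. \<Sum>v\<in>V. of_int (c v) * v)"
    by (intro range_eqI[of _ _ "\<lambda>v. k * c v"]) (simp add: sum_distrib_left mult.assoc)
qed

lemma zspan_sum: "(\<And>i. i \<in> I \<Longrightarrow> f i \<in> zspan V) \<Longrightarrow> sum f I \<in> zspan V"
  by (induction I rule: infinite_finite_induct) (auto intro: zspan_zero zspan_add)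

lemma zspan_base: "finite V \<Longrightarrow> v \<in> V \<Longrightarrow> v \<in> zspan V"
  unfolding zspan_def
proof (rule range_eqI[of _ _ "\<lambda>w. if w = v then 1 else 0"])
  assume "finite V" "v \<in> V"
  then have "(\<Sum>w\<in>V. of_int (if w = v then 1 else 0) * w) = (\<Sum>w\<in>V. if w = v then w else 0)"
    by (intro sum.cong) auto
  then show "v = (\<Sum>w\<in>V. of_int (if w = v then 1 else 0) * w)"
    using \<open>finite V\<close> \<open>v \<in> V\<close> by simp
qed

lemma zspan_mult:
  fixes z :: "'a::comm_ring_1"
  assumes "\<And>v. v \<in> V \<Longrightarrow> z * v \<in> zspan V" "u \<in> zspan V"
  shows "z * u \<in> zspan V"
proof -
  obtain c where c: "u = (\<Sum>v\<in>V. of_int (c v) * v)" using assms(2) by (auto simp: zspan_def)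
  have "z * u = (\<Sum>v\<in>V. of_int (c v) * (z * v))" by (simp add: c sum_distrib_left mult.left_commute)
  then show ?thesis using assms(1) by (auto intro: zspan_sum zspan_int)
qed

text \<open>Stability of a finitely generated module makes \<open>z\<close> an eigenvalue of an integer matrix.\<close>

lemma algebraic_int_if_stable:
  fixes z :: "'a::field_char_0"
  assumes V: "finite V" "v0 \<in> V" "v0 \<noteq> 0" and st: "\<And>v. v \<in> V \<Longrightarrow> z * v \<in> zspan V"
  shows "algebraic_int z"
proof -
  define n where "n = card V"
  obtain e where e: "bij_betw e {0..<n} V" using V(1) ex_bij_betw_nat_finite unfolding n_def by blast
  have "\<forall>v\<in>V. \<exists>c. z * v = (\<Sum>w\<in>V. of_int (c w) * w)"
    using st by (auto simp: zspan_def)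
  from bchoice[OF this] obtain c where c: "\<And>v. v \<in> V \<Longrightarrow> z * v = (\<Sum>w\<in>V. of_int (c v w) * w)" by blast
  define A where "A = mat n n (\<lambda>(i, j). c (e i) (e j))"
  define B where "B = map_mat (of_int :: int \<Rightarrow> 'a) A"
  have A: "A \<in> carrier_mat n n" and B: "B \<in> carrier_mat n n" by (auto simp: A_def B_def)
  have "B *\<^sub>v vec n e = z \<cdot>\<^sub>v vec n e"
  proof (rule eq_vecI)
    fix i assume "i < dim_vec (z \<cdot>\<^sub>v vec n e)"
    then have i: "i < n" by simp
    then have ei: "e i \<in> V" using bij_betwE[OF e] by simp
    have "(B *\<^sub>v vec n e) $ i = (\<Sum>j\<in>{0..<n}. of_int (c (e i) (e j)) * e j)"
      using i by (simp add: B_def A_def scalar_prod_def)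
    also have "\<dots> = (\<Sum>w\<in>V. of_int (c (e i) w) * w)"
      by (rule sum.reindex_bij_betw[OF e, of "\<lambda>w. of_int (c (e i) w) * w"])
    finally show "(B *\<^sub>v vec n e) $ i = (z \<cdot>\<^sub>v vec n e) $ i" using c[OF ei] i by simp
  qed (use B in auto)
  moreover have "vec n e \<noteq> 0\<^sub>v n"
  proof
    obtain i where i: "i < n" "e i = v0" using e V(2) by (auto simp: bij_betw_def)
    assume "vec n e = 0\<^sub>v n"
    then have "vec n e $ i = 0\<^sub>v n $ i" by simp
    then show False using i V(3) by simp
  qed
  ultimately have "eigenvalue B z"
    using B unfolding eigenvalue_def eigenvector_def by (intro exI[of _ "vec n e"]) auto
  then have "poly (char_poly B) z = 0" using eigenvalue_root_char_poly[OF B] by simp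
  moreover have "char_poly B = map_poly of_int (char_poly A)"
    unfolding B_def by (rule of_int_hom.char_poly_hom[OF A])
  moreover have "lead_coeff (char_poly A) = 1" using degree_monic_char_poly[OF A] by simp
  ultimately show ?thesis unfolding algebraic_int_altdef_ipoly by (intro exI[of _ "char_poly A"]) simp
qed

lemma algebraic_int_power_relation:
  fixes x :: "'a::field_char_0"
  assumes "algebraic_int x"
  obtains n c where "n > 0" "x ^ n = (\<Sum>i<n. of_int (c i) * x ^ i)"
proof -
  obtain p where p: "poly (map_poly of_int p) x = 0" "lead_coeff p = 1"
    using assms unfolding algebraic_int_altdef_ipoly by blast
  define n where "n = degree p"
  have "(\<Sum>i\<le>n. of_int (coeff p i) * x ^ i) = 0"
    using p(1) by (simp add: poly_altdef n_def)
  then have "(\<Sum>i<n. of_int (coeff p i) * x ^ i) + x ^ n = 0"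
    using p(2) by (simp add: n_def flip: lessThan_Suc_atMost)
  then have *: "x ^ n = (\<Sum>i<n. of_int (- coeff p i) * x ^ i)"
    by (simp add: sum_negf add_eq_0_iff2 add_eq_0_iff)
  have "n \<noteq> 0"
  proof
    assume "n = 0"
    then show False using * by simp
  qed
  then show ?thesis using that[OF _ *] by simp
qed

text \<open>Both numbers multiply the span of the finitely many monomials
  \<open>x ^ i * y ^ j\<close>, with exponents below the degrees of the two monic relations, into
  itself.\<close>

lemma algebraic_int_add_mult:
  fixes x y :: "'a::field_char_0"
  assumes "algebraic_int x" "algebraic_int y"
  shows "algebraic_int (x + y)" and "algebraic_int (x * y)"
proof -
  obtain n c where x: "n > 0" "x ^ n = (\<Sum>i<n. of_int (c i) * x ^ i)"
    using algebraic_int_power_relation[OF assms(1)] by blast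
  obtain m d where y: "m > 0" "y ^ m = (\<Sum>i<m. of_int (d i) * y ^ i)"
    using algebraic_int_power_relation[OF assms(2)] by blast
  define V where "V = (\<lambda>(i, j). x ^ i * y ^ j) ` ({..<n} \<times> {..<m})"
  have fin: "finite V" by (simp add: V_def)
  have b: "x ^ i * y ^ j \<in> zspan V" if "i < n" "j < m" for i j
    using that by (intro zspan_base[OF fin]) (auto simp: V_def)
  have X: "x * v \<in> zspan V" if vV: "v \<in> V" for v
  proof -
    obtain i j where v: "v = x ^ i * y ^ j" "i < n" "j < m" using vV by (auto simp: V_def)
    show ?thesis
    proof (cases "Suc i < n")
      case True
      then show ?thesis using b[of "Suc i" j] v by (simp add: mult.assoc)
    next
      case False
      then have "n = Suc i" using v by simp
      then have "x * v = x ^ n * y ^ j" using v by (simp add: mult.assoc)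
      also have "\<dots> = (\<Sum>k<n. of_int (c k) * (x ^ k * y ^ j))" by (simp add: x(2) sum_distrib_right mult.assoc)
      also have "\<dots> \<in> zspan V" using b v by (intro zspan_sum zspan_int) auto
      finally show ?thesis .
    qed
  qed
  have Y: "y * v \<in> zspan V" if vV: "v \<in> V" for v
  proof -
    obtain i j where v: "v = x ^ i * y ^ j" "i < n" "j < m" using vV by (auto simp: V_def)
    show ?thesis
    proof (cases "Suc j < m")
      case True
      then show ?thesis using b[of i "Suc j"] v by (simp add: mult.left_commute)
    next
      case False
      then have "m = Suc j" using v by simp
      then have "y * v = x ^ i * y ^ m" using v by simp
      also have "\<dots> = (\<Sum>k<m. of_int (d k) * (x ^ i * y ^ k))"
        by (simp add: y(2) sum_distrib_left mult.left_commute)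
      also have "\<dots> \<in> zspan V" using b v by (intro zspan_sum zspan_int) auto
      finally show ?thesis .
    qed
  qed
  have 1: "1 \<in> V" unfolding V_def by (rule image_eqI[of _ _ "(0, 0)"]) (use x(1) y(1) in auto)
  show "algebraic_int (x + y)"
  proof (rule algebraic_int_if_stable[OF fin 1])
    show "(x + y) * v \<in> zspan V" if "v \<in> V" for v
      unfolding distrib_right using X[OF that] Y[OF that] by (rule zspan_add)
  qed simp
  show "algebraic_int (x * y)"
  proof (rule algebraic_int_if_stable[OF fin 1])
    show "(x * y) * v \<in> zspan V" if "v \<in> V" for v
      unfolding mult.assoc using X Y[OF that] by (rule zspan_mult)
  qed simp
qed

subsection \<open>The divisor bound\<close>

text \<open>Exponential against polynomial growth; the constant absorbs the finitely many small
  \<open>k\<close>.\<close>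

lemma local_exponent_bound:
  fixes \<delta> :: real
  assumes "\<delta> > 0"
  obtains A where "A \<ge> 1" "\<And>k. real ((3 * k + 1) ^ 3) \<le> A * 2 powr (\<delta> * real k)"
proof -
  have "eventually (\<lambda>k::nat. real ((3 * k + 1) ^ 3) \<le> 2 powr (\<delta> * real k)) at_top"
    using assms by real_asymp
  then obtain k0 where k0: "\<And>k. k \<ge> k0 \<Longrightarrow> real ((3 * k + 1) ^ 3) \<le> 2 powr (\<delta> * real k)"
    by (auto simp: eventually_at_top_linorder)
  define A where "A = real ((3 * k0 + 1) ^ 3)"
  have A1: "A \<ge> 1" unfolding A_def by simp
  have "real ((3 * k + 1) ^ 3) \<le> A * 2 powr (\<delta> * real k)" for k
  proof (cases "k \<ge> k0")
    case True
    have "1 * 2 powr (\<delta> * real k) \<le> A * 2 powr (\<delta> * real k)" using A1 by (intro mult_right_mono) auto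
    then show ?thesis using k0[OF True] by linarith
  next
    case False
    then have "(3 * k + 1) ^ 3 \<le> (3 * k0 + 1) ^ 3" by (intro power_mono) auto
    then have "real ((3 * k + 1) ^ 3) \<le> A * 1" unfolding A_def by (simp only: of_nat_le_iff mult_1_right)
    also have "\<dots> \<le> A * 2 powr (\<delta> * real k)" using A1 assms by (intro mult_left_mono ge_one_powr_ge_zero) auto
    finally show ?thesis .
  qed
  then show ?thesis using that A1 by blast
qed

text \<open>A prime \<open>p\<close> with \<open>p powr \<delta>\<close> at least 64 needs no
  constant, because \<open>3 * k + 1\<close> is at most \<open>4 ^ k\<close>. Only primes below the
  resulting threshold \<open>P\<close> contribute a factor \<open>A\<close>, and there are at most
  \<open>P\<close> of them.\<close>

theorem divisor_type_bound:
  fixes \<delta> :: real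
  assumes \<delta>: "\<delta> > 0"
  obtains C where "C \<ge> 1" "\<And>n. n > 0 \<Longrightarrow> real (\<Prod>p\<in>prime_factors n. (3 * multiplicity p n + 1) ^ 3) \<le> C * real n powr \<delta>"
proof -
  obtain A where A: "A \<ge> 1" "\<And>k. real ((3 * k + 1) ^ 3) \<le> A * 2 powr (\<delta> * real k)"
    using local_exponent_bound[OF \<delta>] by blast
  define P where "P = nat \<lceil>64 powr (1 / \<delta>)\<rceil>"
  have big: "real ((3 * k + 1) ^ 3) \<le> real p powr (\<delta> * real k)" if "p \<ge> P" for p k
  proof -
    have "3 * k + 1 \<le> 4 ^ k" by (induction k) auto
    then have "(3 * k + 1) ^ 3 \<le> (4 ^ k) ^ 3" by (rule power_mono) simp
    then have "real ((3 * k + 1) ^ 3) \<le> real ((4 ^ k) ^ 3)" by (simp only: of_nat_le_iff)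
    also have "(4 ^ k) ^ 3 = (64 ^ k :: nat)" by (subst power_mult[symmetric], subst mult.commute, subst power_mult) simp
    also have "real (64 ^ k) = 64 powr real k" by (simp add: powr_realpow)
    also have "\<dots> = (64 powr (1 / \<delta>)) powr (\<delta> * real k)" using \<delta> by (simp add: powr_powr)
    also have "\<dots> \<le> real p powr (\<delta> * real k)"
    proof (rule powr_mono2)
      have "64 powr (1 / \<delta>) \<le> real P" unfolding P_def by linarith
      also have "\<dots> \<le> real p" using that by simp
      finally show "64 powr (1 / \<delta>) \<le> real p" .
    qed (use \<delta> in auto)
    finally show ?thesis .
  qed
  have "real (\<Prod>p\<in>prime_factors n. (3 * multiplicity p n + 1) ^ 3) \<le> A ^ P * real n powr \<delta>" if n: "n > 0" for n
  proof -
    have pp: "prime p" if "p \<in> prime_factors n" for p using that by auto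
    have "real (\<Prod>p\<in>prime_factors n. (3 * multiplicity p n + 1) ^ 3)
        = (\<Prod>p\<in>prime_factors n. real ((3 * multiplicity p n + 1) ^ 3))" by (simp only: of_nat_prod)
    also have "\<dots> \<le> (\<Prod>p\<in>prime_factors n. (if p < P then A else 1) * real p powr (\<delta> * real (multiplicity p n)))"
    proof (rule prod_mono, rule conjI)
      fix p assume p: "p \<in> prime_factors n"
      show "real ((3 * multiplicity p n + 1) ^ 3) \<le> (if p < P then A else 1) * real p powr (\<delta> * real (multiplicity p n))"
      proof (cases "p < P")
        case True
        have "A * 2 powr (\<delta> * real (multiplicity p n)) \<le> A * real p powr (\<delta> * real (multiplicity p n))"
          using A(1) \<delta> prime_ge_2_nat[OF pp[OF p]] by (intro mult_left_mono powr_mono2) auto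
        then show ?thesis using A(2)[of "multiplicity p n"] True by simp
      next
        case False
        then show ?thesis using big[of p "multiplicity p n"] by simp
      qed
    qed simp
    also have "\<dots> = (\<Prod>p\<in>prime_factors n. if p < P then A else 1) * (\<Prod>p\<in>prime_factors n. real p powr (\<delta> * real (multiplicity p n)))"
      by (rule prod.distrib)
    also have "\<dots> \<le> A ^ P * (\<Prod>p\<in>prime_factors n. real p powr (\<delta> * real (multiplicity p n)))"
    proof -
      have "(\<Prod>p\<in>prime_factors n. if p < P then A else 1) = A ^ card {p \<in> prime_factors n. p < P}"
        by (subst prod.inter_filter[symmetric]) simp_all
      moreover have "card {p \<in> prime_factors n. p < P} \<le> card {..<P}" by (rule card_mono) auto
      ultimately have "(\<Prod>p\<in>prime_factors n. if p < P then A else 1) \<le> A ^ P" using A(1) by (simp add: power_increasing)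
      then show ?thesis by (rule mult_right_mono) (simp add: prod_nonneg)
    qed
    also have "(\<Prod>p\<in>prime_factors n. real p powr (\<delta> * real (multiplicity p n))) = real n powr \<delta>"
    proof -
      have "(\<Prod>p\<in>prime_factors n. real p powr (\<delta> * real (multiplicity p n))) = (\<Prod>p\<in>prime_factors n. (real (p ^ multiplicity p n)) powr \<delta>)"
      proof (rule prod.cong[OF refl])
        fix p assume "p \<in> prime_factors n"
        then have "real p > 0" using pp prime_gt_0_nat by simp
        then show "real p powr (\<delta> * real (multiplicity p n)) = real (p ^ multiplicity p n) powr \<delta>"
          by (simp add: powr_powr mult.commute flip: powr_realpow)
      qed
      also have "\<dots> = (\<Prod>p\<in>prime_factors n. real (p ^ multiplicity p n)) powr \<delta>"
        by (rule prod_powr_distrib[symmetric])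
      also have "(\<Prod>p\<in>prime_factors n. real (p ^ multiplicity p n)) = real n"
        using prime_factorization_nat[OF n] by (simp only: flip: of_nat_prod)
      finally show ?thesis .
    qed
    finally show ?thesis .
  qed
  moreover have "A ^ P \<ge> 1" using A(1) by simp
  ultimately show ?thesis using that by blast
qed

subsection \<open>Primes congruent to 2 modulo 3\<close>

text \<open>The logarithm is the divisor sum of the von Mangoldt function; writing
  \<open>n = d * k\<close> exchanges the summations.\<close>

lemma sum_ln_mangoldt:
  fixes f :: "nat \<Rightarrow> real"
  shows "(\<Sum>n=1..x. f n * ln (real n)) = (\<Sum>d=1..x. mangoldt d * (\<Sum>k=1..x div d. f (d * k)))"
proof -
  have "(\<Sum>n=1..x. f n * ln (real n)) = (\<Sum>n=1..x. \<Sum>d | d dvd n. f n * mangoldt d)"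
  proof (rule sum.cong[OF refl])
    fix n assume "n \<in> {1..x}"
    then have "(\<Sum>d | d dvd n. mangoldt d :: real) = ln (real n)" using mangoldt_sum[of n, where ?'a = real] by simp
    then show "f n * ln (real n) = (\<Sum>d | d dvd n. f n * mangoldt d)" by (simp add: sum_distrib_left flip: sum_distrib_left)
  qed
  also have "\<dots> = (\<Sum>(n, d)\<in>(SIGMA n:{1..x}. {d. d dvd n}). f n * mangoldt d)"
    by (rule sum.Sigma) (auto intro: finite_divisors_nat)
  also have "\<dots> = (\<Sum>(d, k)\<in>(SIGMA d:{1..x}. {1..x div d}). mangoldt d * f (d * k))"
  proof (rule sum.reindex_bij_witness[of _ "\<lambda>(d, k). (d * k, d)" "\<lambda>(n, d). (d, n div d)"], goal_cases)
    case (2 p)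
    obtain n d where p: "p = (n, d)" by (cases p)
    have n: "1 \<le> n" "n \<le> x" "d dvd n" using 2 by (auto simp: p)
    then have "d \<noteq> 0" "d \<le> n" by (auto dest: dvd_imp_le)
    moreover have "n div d \<le> x div d" using n by (simp add: div_le_mono)
    moreover have "n div d \<ge> 1" using n \<open>d \<noteq> 0\<close> \<open>d \<le> n\<close> by (simp add: Suc_le_eq div_greater_zero_iff)
    ultimately show ?case using n by (simp add: p)
  next
    case (4 p)
    obtain d k where p: "p = (d, k)" by (cases p)
    have d: "1 \<le> d" "1 \<le> k" "k \<le> x div d" using 4 by (auto simp: p)
    have "d * k \<le> d * (x div d)" using d by (intro mult_le_mono) auto
    also have "\<dots> \<le> x" by simp
    finally show ?case using d by (simp add: p Suc_le_eq)
  qed auto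
  also have "\<dots> = (\<Sum>d=1..x. \<Sum>k=1..x div d. mangoldt d * f (d * k))"
    by (rule sum.Sigma[symmetric]) auto
  finally show ?thesis by (simp add: sum_distrib_left)
qed

text \<open>All powers of one prime up to \<open>x\<close> contribute together at most
  \<open>ln x\<close>, as their number times \<open>ln p\<close> does not exceed it.
  \<open>R\<close> is the condition that \<open>Q\<close> imposes on the base of a prime
  power.\<close>

lemma sum_mangoldt_le:
  assumes x: "x \<ge> 1" and R: "\<And>p k. prime p \<Longrightarrow> k > 0 \<Longrightarrow> Q (p ^ k) \<Longrightarrow> R p"
  shows "(\<Sum>d | d \<in> {1..x} \<and> Q d. mangoldt d) \<le> real (card {p. prime p \<and> p \<le> x \<and> R p}) * ln (real x)"
proof -
  define S where "S = {d \<in> {1..x}. Q d \<and> primepow d}"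
  define T where "T = {p. prime p \<and> p \<le> x \<and> R p}"
  have finT: "finite T" unfolding T_def by (rule finite_subset[of _ "{..x}"]) auto
  have SE: "\<exists>k. k > 0 \<and> d = aprimedivisor d ^ k \<and> prime (aprimedivisor d) \<and> aprimedivisor d \<in> T" if "d \<in> S" for d
  proof -
    obtain p k where pk: "prime p" "k > 0" "d = p ^ k" using \<open>d \<in> S\<close> by (auto simp: S_def primepow_def)
    then have ap: "aprimedivisor d = p" by (simp add: aprimedivisor_prime_power)
    have "p ^ 1 \<le> p ^ k" using pk prime_ge_1_nat by (intro power_increasing) auto
    then have "p \<le> x" using \<open>d \<in> S\<close> pk by (simp add: S_def)
    moreover have "R p" using R[OF pk(1,2)] \<open>d \<in> S\<close> pk by (simp add: S_def)
    ultimately show ?thesis using pk ap by (auto simp: T_def)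
  qed
  have "(\<Sum>d | d \<in> {1..x} \<and> Q d. mangoldt d) = (\<Sum>d\<in>S. ln (real (aprimedivisor d)))"
    by (intro sum.mono_neutral_cong_right) (auto simp: S_def mangoldt_def)
  also have "\<dots> = (\<Sum>p\<in>T. \<Sum>d\<in>{d \<in> S. aprimedivisor d = p}. ln (real (aprimedivisor d)))"
    by (rule sum.group[symmetric]) (use finT SE in \<open>auto simp: S_def\<close>)
  also have "\<dots> \<le> (\<Sum>p\<in>T. ln (real x))"
  proof (rule sum_mono)
    fix p assume "p \<in> T"
    then have p: "prime p" "p \<le> x" by (auto simp: T_def)
    have lp: "ln (real p) > 0" using prime_gt_1_nat[OF p(1)] by simp
    define K where "K = nat \<lfloor>ln (real x) / ln (real p)\<rfloor>"
    have "{d \<in> S. aprimedivisor d = p} \<subseteq> (\<lambda>k. p ^ k) ` {1..K}"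
    proof
      fix d assume d: "d \<in> {d \<in> S. aprimedivisor d = p}"
      then obtain k where k: "k > 0" "d = p ^ k" using SE[of d] by auto
      have "p ^ k \<le> x" using d k by (auto simp: S_def)
      then have "real (p ^ k) \<le> real x" by (simp only: of_nat_le_iff)
      then have "ln (real p ^ k) \<le> ln (real x)" using prime_gt_0_nat[OF p(1)] x by (subst ln_le_cancel_iff) auto
      then have "real k * ln (real p) \<le> ln (real x)" using prime_gt_0_nat[OF p(1)] by (simp add: ln_realpow)
      then have "real k \<le> ln (real x) / ln (real p)" using lp by (simp add: field_simps)
      then have "k \<le> K" unfolding K_def by linarith
      then show "d \<in> (\<lambda>k. p ^ k) ` {1..K}" using k by auto
    qed
    then have "card {d \<in> S. aprimedivisor d = p} \<le> card ((\<lambda>k. p ^ k) ` {1..K})" by (intro card_mono) auto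
    also have "\<dots> \<le> K" using card_image_le[of "{1..K}" "\<lambda>k. p ^ k"] by simp
    finally have c: "card {d \<in> S. aprimedivisor d = p} \<le> K" .
    have "ln (real x) \<ge> 0" using x by simp
    then have "real K \<le> ln (real x) / ln (real p)" unfolding K_def using lp by simp
    have "(\<Sum>d\<in>{d \<in> S. aprimedivisor d = p}. ln (real (aprimedivisor d))) = real (card {d \<in> S. aprimedivisor d = p}) * ln (real p)"
      by simp
    also have "\<dots> \<le> (ln (real x) / ln (real p)) * ln (real p)"
      using c \<open>real K \<le> _\<close> lp by (intro mult_right_mono) linarith+
    also have "\<dots> = ln (real x)" using lp by simp
    finally show "(\<Sum>d\<in>{d \<in> S. aprimedivisor d = p}. ln (real (aprimedivisor d))) \<le> ln (real x)" .
  qed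
  finally show ?thesis by (simp add: T_def)
qed

definition chi :: "nat \<Rightarrow> real" where
  "chi n = (if n mod 3 = 1 then 1 else if n mod 3 = 2 then - 1 else 0)"

lemma chi_mult: "chi (m * n) = chi m * chi n"
proof -
  have "m mod 3 = 0 \<or> m mod 3 = 1 \<or> m mod 3 = 2" "n mod 3 = 0 \<or> n mod 3 = 1 \<or> n mod 3 = 2" by auto
  moreover have "(m * n) mod 3 = ((m mod 3) * (n mod 3)) mod 3" by (simp add: mod_mult_eq)
  ultimately show ?thesis unfolding chi_def by (elim disjE) simp_all
qed

lemma sum_chi: "(\<Sum>k=1..m. chi k) = (if m mod 3 = 1 then 1 else 0)"
proof (induction m)
  case (Suc m)
  have "m mod 3 = 0 \<or> m mod 3 = 1 \<or> m mod 3 = 2" by auto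
  then show ?case using Suc by (auto simp: chi_def mod_Suc)
qed simp

text \<open>The terms come in groups \<open>ln (3 j + 1) - ln (3 j + 2)\<close>, each negative; only
  an unpaired last term can make the sum positive.\<close>

lemma sum_chi_ln: "(\<Sum>n=1..x. chi n * ln (real n)) \<le> (if x mod 3 = 1 then ln (real x) else 0)"
proof (induction x)
  case (Suc x)
  have e: "(\<Sum>n=1..Suc x. chi n * ln (real n)) = (\<Sum>n=1..x. chi n * ln (real n)) + chi (Suc x) * ln (real (Suc x))" by simp
  have "x mod 3 = 0 \<or> x mod 3 = 1 \<or> x mod 3 = 2" by auto
  then show ?case
  proof (elim disjE)
    assume m: "x mod 3 = 0"
    then have "chi (Suc x) = 1" by (simp add: chi_def mod_Suc)
    then show ?thesis using Suc m unfolding e by (simp add: mod_Suc)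
  next
    assume m: "x mod 3 = 1"
    then have "chi (Suc x) = - 1" by (simp add: chi_def mod_Suc)
    moreover have "(\<Sum>n=1..x. chi n * ln (real n)) \<le> ln (real x)" using Suc m by simp
    moreover have "ln (real x) \<le> ln (real (Suc x))" using m by (cases "x = 0") auto
    ultimately have "chi (Suc x) = - 1" "(\<Sum>n=1..x. chi n * ln (real n)) \<le> ln (real (Suc x))" by linarith+
    then show ?thesis using m unfolding e by (simp add: mod_Suc)
  next
    assume m: "x mod 3 = 2"
    then have "chi (Suc x) = 0" by (simp add: chi_def mod_Suc)
    then show ?thesis using Suc m unfolding e by (simp add: mod_Suc)
  qed
qed simp

definition primes_res :: "nat \<Rightarrow> nat \<Rightarrow> nat set" where
  "primes_res r x = {p. prime p \<and> p \<le> x \<and> p mod 3 = r}"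

lemma finite_primes_res: "finite (primes_res r x)"
  unfolding primes_res_def by (rule finite_subset[of _ "{..x}"]) auto

text \<open>The sum of \<open>w\<close> equals the sum of \<open>chi n * ln n\<close> and is at most
  \<open>ln x\<close>. In it a prime \<open>d\<close> congruent to 1 above \<open>x div 2\<close>
  has \<open>x div d = 1\<close> and enters with full weight \<open>ln d\<close>, at least half of
  \<open>ln x\<close>. Negative terms come only from prime powers congruent to 2 modulo 3, whose
  bases have the same residue. Hence the primes of residue 1 in the upper half are few if those of
  residue 2 are.\<close>

lemma primes_res_step:
  assumes x: "x \<ge> 4"
  shows "card (primes_res 1 x) \<le> card (primes_res 1 (x div 2)) + 2 * (card (primes_res 2 x) + 1)"
proof -
  define w where "w d = mangoldt d * (chi d * (if (x div d) mod 3 = 1 then 1 else 0))" for d :: nat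
  have "(\<Sum>d=1..x. w d) = (\<Sum>n=1..x. chi n * ln (real n))"
    unfolding w_def by (simp only: sum_ln_mangoldt chi_mult sum_distrib_left[symmetric] sum_chi)
  also have "\<dots> \<le> (if x mod 3 = 1 then ln (real x) else 0)" by (rule sum_chi_ln)
  also have "\<dots> \<le> ln (real x)" using x by simp
  finally have total: "(\<Sum>d=1..x. w d) \<le> ln (real x)" .
  define D where "D = {p \<in> primes_res 1 x. p > x div 2}"
  define N where "N = {d \<in> {1..x}. d mod 3 = 2}"
  have DN: "D \<subseteq> {1..x}" "N \<subseteq> {1..x}" "D \<inter> N = {}"
    by (auto simp: D_def N_def primes_res_def prime_ge_1_nat Suc_le_eq prime_gt_0_nat)
  have "(\<Sum>d\<in>D. ln (real d)) - (\<Sum>d\<in>N. mangoldt d) = (\<Sum>d\<in>D \<union> N. if d \<in> D then ln (real d) else - mangoldt d)"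
  proof -
    have "(\<Sum>d\<in>D \<union> N. if d \<in> D then ln (real d) else - mangoldt d)
        = (\<Sum>d\<in>D. if d \<in> D then ln (real d) else - mangoldt d) + (\<Sum>d\<in>N. if d \<in> D then ln (real d) else - mangoldt d)"
      using DN by (intro sum.union_disjoint) (auto intro: finite_subset)
    also have "(\<Sum>d\<in>N. if d \<in> D then ln (real d) else - mangoldt d) = (\<Sum>d\<in>N. - mangoldt d)"
      using DN(3) by (intro sum.cong) auto
    finally show ?thesis by (simp add: sum_negf)
  qed
  also have "\<dots> \<le> (\<Sum>d\<in>D \<union> N. w d)"
  proof (rule sum_mono)
    fix d assume d: "d \<in> D \<union> N"
    show "(if d \<in> D then ln (real d) else - mangoldt d) \<le> w d"
    proof (cases "d \<in> D")
      case True
      then have dd: "prime d" "d \<le> x" "d mod 3 = 1" "x div 2 < d" by (auto simp: D_def primes_res_def)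
      have "x div d = 1"
        by (rule div_nat_eqI) (use dd in auto)
      then show ?thesis using dd True by (simp add: w_def chi_def)
    next
      case False
      then have "chi d = - 1" using d by (auto simp: N_def chi_def)
      then show ?thesis using False mangoldt_nonneg[of d] by (simp add: w_def)
    qed
  qed
  also have "\<dots> \<le> (\<Sum>d=1..x. w d)"
  proof (rule sum_mono2)
    fix d assume d: "d \<in> {1..x} - (D \<union> N)"
    then have "d mod 3 \<noteq> 2" by (auto simp: N_def)
    then have "chi d \<ge> 0" by (simp add: chi_def)
    then show "0 \<le> w d" using mangoldt_nonneg[of d] by (simp add: w_def)
  qed (use DN in auto)
  finally have "(\<Sum>d\<in>D. ln (real d)) \<le> (\<Sum>d\<in>N. mangoldt d) + ln (real x)" using total by linarith
  also have "(\<Sum>d\<in>N. mangoldt d) \<le> real (card (primes_res 2 x)) * ln (real x)"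
  proof -
    have "p mod 3 = 2" if "prime p" "k > 0" "p ^ k mod 3 = 2" for p k :: nat
    proof -
      have "p mod 3 = 0 \<or> p mod 3 = 1 \<or> p mod 3 = 2" by auto
      moreover have "p ^ k mod 3 = (p mod 3) ^ k mod 3" by (simp add: power_mod)
      ultimately show ?thesis using that by (auto simp: zero_power)
    qed
    then have "(\<Sum>d | d \<in> {1..x} \<and> d mod 3 = 2. mangoldt d) \<le> real (card {p. prime p \<and> p \<le> x \<and> p mod 3 = 2}) * ln (real x)"
      using x by (intro sum_mangoldt_le) auto
    then show ?thesis by (simp only: N_def primes_res_def)
  qed
  finally have up: "(\<Sum>d\<in>D. ln (real d)) \<le> (real (card (primes_res 2 x)) + 1) * ln (real x)"
    by (simp add: algebra_simps)
  have lnx: "ln (real x) > 0" using x by simp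
  have "real (card D) * (ln (real x) / 2) = (\<Sum>d\<in>D. ln (real x) / 2)" by simp
  also have "\<dots> \<le> (\<Sum>d\<in>D. ln (real d))"
  proof (rule sum_mono)
    fix d assume "d \<in> D"
    then have "x < 2 * d" by (auto simp: D_def)
    moreover have "d \<ge> 2" using \<open>d \<in> D\<close> prime_ge_2_nat by (auto simp: D_def primes_res_def)
    then have "2 * d \<le> d * d" by simp
    ultimately have "real x \<le> real (d * d)" by (simp only: of_nat_le_iff)
    then have "ln (real x) \<le> ln (real d * real d)" using x \<open>d \<ge> 2\<close> by (subst ln_le_cancel_iff) auto
    also have "\<dots> = 2 * ln (real d)" using \<open>d \<ge> 2\<close> by (simp add: ln_mult)
    finally show "ln (real x) / 2 \<le> ln (real d)" by simp
  qed
  also note up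
  finally have "real (card D) * ln (real x) \<le> (2 * (real (card (primes_res 2 x)) + 1)) * ln (real x)" by (simp add: algebra_simps)
  then have "real (card D) \<le> 2 * (real (card (primes_res 2 x)) + 1)" using lnx by simp
  then have "real (card D) \<le> real (2 * (card (primes_res 2 x) + 1))" by simp
  then have "card D \<le> 2 * (card (primes_res 2 x) + 1)" by (simp only: of_nat_le_iff)
  moreover have "primes_res 1 x = primes_res 1 (x div 2) \<union> D" by (auto simp: primes_res_def D_def)
  then have "card (primes_res 1 x) \<le> card (primes_res 1 (x div 2)) + card D" by (metis card_Un_le)
  ultimately show ?thesis by linarith
qed

lemma primes_res_mono: "x \<le> y \<Longrightarrow> card (primes_res r x) \<le> card (primes_res r y)"
  by (intro card_mono finite_primes_res) (auto simp: primes_res_def)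

text \<open>Halving \<open>x\<close> repeatedly costs a factor that is the number of binary digits;
  below 4 there is no prime congruent to 1 modulo 3.\<close>

lemma primes_res_1_le: "x < 2 ^ k \<Longrightarrow> card (primes_res 1 x) \<le> 2 * k * (card (primes_res 2 x) + 1)"
proof (induction k arbitrary: x)
  case 0
  then have "primes_res 1 x = {}" by (auto simp: primes_res_def dest: prime_gt_0_nat)
  then show ?case by simp
next
  case (Suc k)
  show ?case
  proof (cases "x \<ge> 4")
    case True
    have "card (primes_res 1 x) \<le> card (primes_res 1 (x div 2)) + 2 * (card (primes_res 2 x) + 1)"
      by (rule primes_res_step[OF True])
    also have "card (primes_res 1 (x div 2)) \<le> 2 * k * (card (primes_res 2 (x div 2)) + 1)"
      using Suc.prems by (intro Suc.IH) auto
    also have "\<dots> \<le> 2 * k * (card (primes_res 2 x) + 1)"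
      using primes_res_mono[of "x div 2" x 2] by (intro mult_le_mono) auto
    finally show ?thesis by (simp add: algebra_simps)
  next
    case False
    have "p \<notin> primes_res 1 x" for p
    proof
      assume "p \<in> primes_res 1 x"
      then have "p \<ge> 2" "p \<le> 3" "p mod 3 = 1" using False by (auto simp: primes_res_def prime_ge_2_nat)
      then have "p = 2 \<or> p = 3" by linarith
      then show False using \<open>p mod 3 = 1\<close> by auto
    qed
    then have "primes_res 1 x = {}" by blast
    then show ?thesis by simp
  qed
qed

text \<open>Chebyshev's argument with the central binomial coefficient, whose logarithm is the
  difference of logarithmic sums below: it is at least \<open>n * ln 2\<close> factor by factor, and
  in its von Mangoldt expansion each coefficient is at most 1.\<close>

lemma prime_count_lower:
  assumes n: "n \<ge> 1"
  shows "real n * ln 2 \<le> real (card {p. prime p \<and> p \<le> 2 * n}) * ln (real (2 * n))"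
proof -
  have L: "(\<Sum>m=1..2*n. ln (real m)) - 2 * (\<Sum>m=1..n. ln (real m)) = (\<Sum>d=1..2*n. mangoldt d * (real (2 * n div d) - 2 * real (n div d)))"
  proof -
    have "(\<Sum>m=1..n. ln (real m)) = (\<Sum>d=1..n. mangoldt d * real (n div d))"
      using sum_ln_mangoldt[of "\<lambda>_. 1" n] by simp
    also have "\<dots> = (\<Sum>d=1..2*n. mangoldt d * real (n div d))"
      by (rule sum.mono_neutral_left) auto
    finally have "(\<Sum>m=1..n. ln (real m)) = (\<Sum>d=1..2*n. mangoldt d * real (n div d))" .
    moreover have "(\<Sum>m=1..2*n. ln (real m)) = (\<Sum>d=1..2*n. mangoldt d * real (2 * n div d))"
      using sum_ln_mangoldt[of "\<lambda>_. 1" "2 * n"] by simp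
    ultimately show ?thesis by (simp add: algebra_simps sum_subtractf sum_distrib_left)
  qed
  have "real n * ln 2 = (\<Sum>m=1..n. ln 2)" by simp
  also have "\<dots> \<le> (\<Sum>m=1..n. ln (real (n + m)) - ln (real m))"
  proof (rule sum_mono)
    fix m assume m: "m \<in> {1..n}"
    then have "ln (2 * real m) \<le> ln (real (n + m))" by (subst ln_le_cancel_iff) auto
    then show "ln 2 \<le> ln (real (n + m)) - ln (real m)" using m by (simp add: ln_mult)
  qed
  also have "\<dots> = (\<Sum>m=1..2*n. ln (real m)) - 2 * (\<Sum>m=1..n. ln (real m))"
  proof -
    have "(\<Sum>m=1..2*n. ln (real m)) = (\<Sum>m=1..n. ln (real m)) + (\<Sum>m=n+1..n+n. ln (real m))"
      using sum.ub_add_nat[of 1 n "\<lambda>m. ln (real m)" n] n by (simp add: mult_2)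
    also have "(\<Sum>m=n+1..n+n. ln (real m)) = (\<Sum>m=1..n. ln (real (n + m)))"
      using sum.shift_bounds_cl_nat_ivl[of "\<lambda>m. ln (real m)" 1 n n] by (simp add: add.commute)
    finally show ?thesis by (simp add: sum_subtractf)
  qed
  also have "\<dots> \<le> (\<Sum>d=1..2*n. mangoldt d)"
    unfolding L
  proof (rule sum_mono)
    fix d assume dI: "d \<in> {1..2 * n}"
    have "2 * n div d \<le> 2 * (n div d) + 1"
    proof -
      have "n < d + d * (n div d)" using dividend_less_times_div[of d n] dI by simp
      then have "2 * n < (2 * (n div d) + 2) * d" by (simp add: algebra_simps)
      then have "2 * n div d < 2 * (n div d) + 2" by (rule less_mult_imp_div_less)
      then show ?thesis by simp
    qed
    then have "real (2 * n div d) - 2 * real (n div d) \<le> 1" by linarith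
    then have "mangoldt d * (real (2 * n div d) - 2 * real (n div d)) \<le> mangoldt d * 1"
      by (intro mult_left_mono mangoldt_nonneg)
    then show "mangoldt d * (real (2 * n div d) - 2 * real (n div d)) \<le> (mangoldt d :: real)" by simp
  qed
  also have "\<dots> = (\<Sum>d | d \<in> {1..2*n} \<and> True. mangoldt d)" by (intro sum.cong) auto
  also have "\<dots> \<le> real (card {p. prime p \<and> p \<le> 2 * n \<and> True}) * ln (real (2 * n))"
    using n by (intro sum_mangoldt_le) auto
  finally show ?thesis by simp
qed

text \<open>Primes of residue 1 outnumber those of residue 2 at most by a logarithmic factor, so the
  latter number at least \<open>x\<close> divided by a constant times the squared logarithm, which a
  power \<open>x powr \<delta>\<close> absorbs. The summand 1 keeps the bound true for small
  \<open>x\<close>, where no such prime exists.\<close>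

theorem primes_2_mod_3_lower:
  fixes \<delta> :: real
  assumes \<delta>: "\<delta> > 0"
  obtains c where "c > 0" "\<And>x. x \<ge> 1 \<Longrightarrow> c * real x powr (1 - \<delta>) \<le> real (card (primes_res 2 x)) + 1"
proof -
  have "eventually (\<lambda>x::real. x powr (1 - \<delta>) * (2 * (ln x / ln 2 + 1) + 2) * ln x \<le> x * ln 2 / 4) at_top"
    using \<delta> by real_asymp
  then obtain X0 where X0: "\<And>x. x \<ge> X0 \<Longrightarrow> x powr (1 - \<delta>) * (2 * (ln x / ln 2 + 1) + 2) * ln x \<le> x * ln 2 / 4"
    by (auto simp: eventually_at_top_linorder)
  define B where "B = max 2 X0"
  have main: "real x powr (1 - \<delta>) \<le> real (card (primes_res 2 x)) + 1" if x: "real x \<ge> B" for x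
  proof -
    have x2: "x \<ge> 2" using x by (simp add: B_def)
    have lnx: "ln (real x) > 0" using x2 by simp
    define n where "n = x div 2"
    have n: "n \<ge> 1" "2 * n \<le> x" "real n \<ge> real x / 4" using x2 by (auto simp: n_def) 
    define k where "k = nat \<lfloor>log 2 (real x)\<rfloor> + 1"
    have k: "x < 2 ^ k" "real k \<le> ln (real x) / ln 2 + 1"
    proof -
      have l0: "log 2 (real x) \<ge> 0" using x2 by simp
      have "real x = 2 powr log 2 (real x)" using x2 by simp
      also have "\<dots> < 2 powr real k" unfolding k_def using l0 by (intro powr_less_mono) linarith+
      also have "\<dots> = 2 ^ k" by (simp add: powr_realpow)
      finally have "real x < real (2 ^ k)" by simp
      then show "x < 2 ^ k" by (simp only: of_nat_less_iff)
      show "real k \<le> ln (real x) / ln 2 + 1" unfolding k_def using l0 by (simp add: log_def)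
    qed
    define P where "P = real (card (primes_res 2 x)) + 1"
    define T where "T = 2 * (ln (real x) / ln 2 + 1) + 2"
    have T: "T * ln (real x) > 0" unfolding T_def using lnx by (intro mult_pos_pos add_nonneg_pos) simp_all
    have X0': "real x powr (1 - \<delta>) * T * ln (real x) \<le> real x * ln 2 / 4"
      unfolding T_def using x by (intro X0) (simp add: B_def)
    have "{p. prime p \<and> p \<le> x} \<subseteq> primes_res 1 x \<union> primes_res 2 x \<union> {3}"
    proof
      fix p assume "p \<in> {p. prime p \<and> p \<le> x}"
      then have p: "prime p" "p \<le> x" by auto
      have "p mod 3 = 0 \<or> p mod 3 = 1 \<or> p mod 3 = 2" by auto
      moreover have "p = 3" if "p mod 3 = 0"
        using p(1) that primes_dvd_imp_eq[of 3 p] by (auto simp: mod_eq_0_iff_dvd)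
      ultimately show "p \<in> primes_res 1 x \<union> primes_res 2 x \<union> {3}" using p by (auto simp: primes_res_def)
    qed
    then have "card {p. prime p \<and> p \<le> x} \<le> card (primes_res 1 x \<union> primes_res 2 x \<union> {3})"
      by (rule card_mono[rotated]) (simp add: finite_primes_res)
    also have "\<dots> \<le> card (primes_res 1 x) + card (primes_res 2 x) + 1"
      using card_Un_le[of "primes_res 1 x \<union> primes_res 2 x" "{3}"] card_Un_le[of "primes_res 1 x" "primes_res 2 x"] by simp
    also have "\<dots> \<le> 2 * k * (card (primes_res 2 x) + 1) + card (primes_res 2 x) + 1"
      using primes_res_1_le[OF k(1)] by simp
    finally have "real (card {p. prime p \<and> p \<le> x}) \<le> real (2 * k * (card (primes_res 2 x) + 1) + card (primes_res 2 x) + 1)"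
      by (simp only: of_nat_le_iff)
    also have "\<dots> = (2 * real k + 1) * P" by (simp add: P_def algebra_simps)
    also have "\<dots> \<le> T * P" unfolding T_def using k(2) by (intro mult_right_mono) (auto simp: P_def)
    finally have pc: "real (card {p. prime p \<and> p \<le> x}) \<le> T * P" .
    have "real x * ln 2 / 4 \<le> real n * ln 2" using mult_right_mono[OF n(3), of "ln 2"] by simp
    also have "\<dots> \<le> real (card {p. prime p \<and> p \<le> 2 * n}) * ln (real (2 * n))" by (rule prime_count_lower[OF n(1)])
    also have "\<dots> \<le> real (card {p. prime p \<and> p \<le> x}) * ln (real x)"
    proof (rule mult_mono)
      have "card {p. prime p \<and> p \<le> 2 * n} \<le> card {p. prime p \<and> p \<le> x}"
        by (rule card_mono) (use n(2) in \<open>auto intro: finite_subset[of _ "{..x}"]\<close>)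
      then show "real (card {p. prime p \<and> p \<le> 2 * n}) \<le> real (card {p. prime p \<and> p \<le> x})" by simp
      show "ln (real (2 * n)) \<le> ln (real x)" using n by (subst ln_le_cancel_iff) auto
    qed (use n in auto)
    also have "\<dots> \<le> (T * P) * ln (real x)" using pc lnx by (intro mult_right_mono) auto
    finally have "real x powr (1 - \<delta>) * (T * ln (real x)) \<le> P * (T * ln (real x))"
      using X0' by (simp only: mult_ac)
    then show ?thesis using T unfolding P_def by (simp only: mult_le_cancel_right_pos)
  qed
  \<comment> \<open>Below the threshold \<open>B\<close> the summand 1 alone has to suffice; the
    maximum with 0 covers values of \<open>\<delta>\<close> above 1.\<close>
  define c where "c = min 1 (1 / B powr max 0 (1 - \<delta>))"
  have B2: "B \<ge> 2" by (simp add: B_def)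
  have "c > 0" using B2 by (simp add: c_def)
  moreover have "c * real x powr (1 - \<delta>) \<le> real (card (primes_res 2 x)) + 1" if x: "x \<ge> 1" for x
  proof (cases "real x \<ge> B")
    case True
    have "c * real x powr (1 - \<delta>) \<le> 1 * real x powr (1 - \<delta>)" by (intro mult_right_mono) (auto simp: c_def)
    then show ?thesis using main[OF True] by linarith
  next
    case False
    have "real x powr (1 - \<delta>) \<le> real x powr max 0 (1 - \<delta>)" using x by (intro powr_mono) auto
    also have "\<dots> \<le> B powr max 0 (1 - \<delta>)" using False by (intro powr_mono2) auto
    finally have "c * real x powr (1 - \<delta>) \<le> (1 / B powr max 0 (1 - \<delta>)) * B powr max 0 (1 - \<delta>)"
      by (intro mult_mono) (auto simp: c_def)
    also have "\<dots> = 1" using B2 by simp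
    finally show ?thesis by simp
  qed
  ultimately show ?thesis by (rule that)
qed

subsection \<open>Pure cubic fields\<close>

lemma squarefree_dvd_cube:
  fixes a s :: int
  assumes "squarefree a" "a dvd s ^ 3"
  shows "a dvd s"
proof -
  define g where "g = gcd a s"
  obtain u where u: "a = g * u" by (metis g_def dvd_def gcd_dvd1)
  have "is_unit u"
  proof (rule ccontr)
    assume "\<not> is_unit u"
    moreover have "u \<noteq> 0" using assms(1) u by auto
    ultimately obtain p where p: "p dvd u" "Factorial_Ring.prime p" using prime_divisor_exists by blast
    have "p dvd s ^ 3" using p(1) u assms(2) by (meson dvd_trans dvd_triv_right)
    then have "p dvd s" using p(2) prime_dvd_power by blast
    then have "p dvd g" using p u dvd_mult[of p u g] by (simp add: g_def)
    then have "p ^ 2 dvd a" using p(1) u by (simp add: power2_eq_square mult_dvd_mono)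
    then show False using assms(1) p(2) by (meson not_prime_unit squarefreeD)
  qed
  then have "a dvd g" using u by (metis dvd_refl mult_unit_dvd_iff)
  then show ?thesis unfolding g_def by (meson dvd_trans gcd_dvd2)
qed

text \<open>A square dividing the square part, or a common divisor of the two parts, would give a
  cube dividing \<open>d\<close>. The square part enters with its absolute value, which leaves
  \<open>b ^ 2\<close> unchanged.\<close>

lemma cube_free_decomposition:
  fixes d :: int
  assumes "d > 1" "cube_free d"
  obtains a b :: int where "d = a * b ^ 2" "a > 0" "b > 0" "coprime a b" "squarefree a" "squarefree b" "a * b > 1"
proof -
  define a b where "a = squarefree_part d" and "b = square_part d"
  have d: "d = a * b ^ 2" unfolding a_def b_def by (rule squarefree_decompose)
  have b0: "b \<noteq> 0" using assms(1) d by auto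
  have a0: "a > 0"
  proof (rule ccontr)
    assume "\<not> a > 0"
    then have "a * b ^ 2 \<le> 0" by (intro mult_nonpos_nonneg) auto
    then show False using assms(1) d by simp
  qed
  have sa: "squarefree a" by (simp add: a_def)
  have cf: "is_unit x" if "x ^ 3 dvd d" for x using assms(2) that by (auto simp: cube_free_def)
  have sb: "squarefree b"
  proof (rule squarefreeI)
    fix x assume "x ^ 2 dvd b"
    then have "(x ^ 2) ^ 2 dvd b ^ 2" by (rule dvd_power_same)
    then have "x ^ 3 * x dvd d" unfolding d by (simp add: power2_eq_square power3_eq_cube mult.assoc)
    then show "x dvd 1" using cf[of x] by (meson dvd_mult_left)
  qed
  have co: "coprime a b"
  proof (rule coprimeI)
    fix c assume "c dvd a" "c dvd b"
    then have "c * c ^ 2 dvd d" unfolding d by (intro mult_dvd_mono dvd_power_same)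
    then show "is_unit c" using cf[of c] by (simp add: power2_eq_square power3_eq_cube mult.assoc)
  qed
  have "\<bar>b\<bar> > 0" using b0 by simp
  moreover have "a * \<bar>b\<bar> > 1"
  proof (rule ccontr)
    assume "\<not> ?thesis"
    moreover have "a * 1 \<le> a * \<bar>b\<bar>" "1 * \<bar>b\<bar> \<le> a * \<bar>b\<bar>"
      using a0 b0 by (intro mult_left_mono mult_right_mono; linarith)+
    ultimately have "a = 1" "\<bar>b\<bar> = 1" using a0 b0 by linarith+
    moreover have "b ^ 2 = \<bar>b\<bar> ^ 2" by (rule power2_abs[symmetric])
    ultimately have "d = 1" unfolding d by (simp only: power_one mult_1)
    then show False using assms(1) by simp
  qed
  moreover have "squarefree \<bar>b\<bar>" using sb by (cases "b \<ge> 0") auto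
  ultimately show ?thesis using that[of a "\<bar>b\<bar>"] d a0 co sa by simp
qed

text \<open>The terms with \<open>x ^ 3\<close>, \<open>y ^ 3\<close>, \<open>z ^ 3\<close> have
  \<open>p\<close>-adic valuations 0, 1, 2 modulo 3, as for an Eisenstein polynomial, so
  \<open>p\<close> can be divided out of \<open>x\<close>, then of \<open>y\<close>, then of
  \<open>z\<close>.\<close>

lemma cubic_form_prime_dvd:
  fixes a b x y z p :: int
  assumes p: "Factorial_Ring.prime p" "p dvd a" "\<not> p ^ 2 dvd a" "\<not> p dvd b"
    and eq: "x ^ 3 + a * b ^ 2 * y ^ 3 + a ^ 2 * b * z ^ 3 - 3 * a * b * x * y * z = 0"
  shows "p dvd x \<and> p dvd y \<and> p dvd z"
proof -
  obtain a' where a': "a = p * a'" using p(2) by blast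
  have na: "\<not> p dvd a'" using p(3) a' by (auto simp: power2_eq_square)
  have p0: "p \<noteq> 0" using p(1) by auto
  have "x ^ 3 = p * (- (a' * b ^ 2 * y ^ 3 + p * a' ^ 2 * b * z ^ 3 - 3 * a' * b * x * y * z))"
    using eq by (simp add: a' power2_eq_square algebra_simps)
  then have "p dvd x ^ 3" by (metis dvd_triv_left)
  then have px: "p dvd x" using p(1) prime_dvd_power by blast
  then obtain x' where x': "x = p * x'" by blast
  have "p * (p * (p * x' ^ 3) + a' * b ^ 2 * y ^ 3 + p * a' ^ 2 * b * z ^ 3 - 3 * p * a' * b * x' * y * z) = 0"
    using eq by (simp add: a' x' power2_eq_square power3_eq_cube algebra_simps)
  then have e1: "p * (p * x' ^ 3) + a' * b ^ 2 * y ^ 3 + p * a' ^ 2 * b * z ^ 3 - 3 * p * a' * b * x' * y * z = 0"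
    using p0 by simp
  then have "a' * b ^ 2 * y ^ 3 = p * (- (p * x' ^ 3 + a' ^ 2 * b * z ^ 3 - 3 * a' * b * x' * y * z))"
    by (simp add: algebra_simps)
  then have "p dvd a' * b ^ 2 * y ^ 3" by (metis dvd_triv_left)
  then have py: "p dvd y" using p(1,4) na by (metis prime_dvd_mult_iff prime_dvd_power)
  then obtain y' where y': "y = p * y'" by blast
  have "p * (p * x' ^ 3 + a' * b ^ 2 * (p * (p * y' ^ 3)) + a' ^ 2 * b * z ^ 3 - 3 * p * a' * b * x' * y' * z) = 0"
    using e1 by (simp add: y' power2_eq_square power3_eq_cube algebra_simps)
  then have "p * x' ^ 3 + a' * b ^ 2 * (p * (p * y' ^ 3)) + a' ^ 2 * b * z ^ 3 - 3 * p * a' * b * x' * y' * z = 0"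
    using p0 by simp
  then have "a' ^ 2 * b * z ^ 3 = p * (- (x' ^ 3 + a' * b ^ 2 * (p * y' ^ 3) - 3 * a' * b * x' * y' * z))"
    by (simp add: algebra_simps)
  then have "p dvd a' ^ 2 * b * z ^ 3" by (metis dvd_triv_left)
  then have "p dvd z" using p(1,4) na by (metis prime_dvd_mult_iff prime_dvd_power)
  with px py show ?thesis by simp
qed

locale pure_cubic =
  fixes a b :: int
  assumes a_pos: "a > 0" and b_pos: "b > 0" and coprime_ab: "coprime a b"
    and squarefree_a: "squarefree a" and squarefree_b: "squarefree b" and ab_gt_1: "a * b > 1"
begin

text \<open>The norm of \<open>x + y t1 + z t2\<close>. It is polymorphic because it is used over
  the integers, for divisibility, and over the rationals, for field elements.\<close>

definition normf :: "'a::comm_ring_1 \<Rightarrow> 'a \<Rightarrow> 'a \<Rightarrow> 'a" where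
  "normf x y z = x ^ 3 + of_int (a * b ^ 2) * y ^ 3 + of_int (a ^ 2 * b) * z ^ 3 - 3 * of_int (a * b) * x * y * z"

text \<open>Descent at one prime dividing \<open>a * b\<close>: the coordinates of a zero are
  divisible by every power of it. A prime dividing \<open>b\<close> is handled by exchanging
  \<open>a\<close> with \<open>b\<close> and \<open>y\<close> with \<open>z\<close>.\<close>

lemma normf_int_eq_0:
  fixes x y z :: int
  assumes "normf x y z = 0"
  shows "x = 0 \<and> y = 0 \<and> z = 0"
proof -
  obtain p where p: "p dvd a * b" "Factorial_Ring.prime p"
  proof -
    have "a * b \<noteq> 0" "\<not> is_unit (a * b)" using ab_gt_1 by auto
    from prime_divisor_exists[OF this] show ?thesis using that by blast
  qed
  have np: "\<not> p dvd 1" using p(2) by auto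
  have step: "p dvd x \<and> p dvd y \<and> p dvd z" if "normf x y z = 0" for x y z :: int
  proof -
    from p have "p dvd a \<or> p dvd b" by (simp add: prime_dvd_mult_iff)
    then show ?thesis
    proof
      assume pa: "p dvd a"
      then have "\<not> p dvd b" using coprime_ab np coprime_common_divisor by blast
      moreover have "\<not> p ^ 2 dvd a" using squarefree_a np squarefreeD by blast
      ultimately show ?thesis
        using cubic_form_prime_dvd[OF p(2) pa, of b x y z] that by (simp add: normf_def mult.assoc)
    next
      assume pb: "p dvd b"
      then have "\<not> p dvd a" using coprime_ab np coprime_common_divisor by blast
      moreover have "\<not> p ^ 2 dvd b" using squarefree_b np squarefreeD by blast
      ultimately show ?thesis
        using cubic_form_prime_dvd[OF p(2) pb, of a x z y] that by (simp add: normf_def algebra_simps)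
    qed
  qed
  have "p ^ k dvd x \<and> p ^ k dvd y \<and> p ^ k dvd z" if "normf x y z = 0" for k and x y z :: int
    using that
  proof (induction k arbitrary: x y z)
    case (Suc k)
    then have "p dvd x" "p dvd y" "p dvd z" using step[of x y z] by auto
    then obtain x' y' z' where e: "x = p * x'" "y = p * y'" "z = p * z'" by (elim dvdE)
    have "p ^ 3 * normf x' y' z' = normf x y z" by (simp add: normf_def e power3_eq_cube algebra_simps)
    then have "normf x' y' z' = 0" using Suc.prems p(2) by auto
    then show ?case using Suc.IH[of x' y' z'] by (auto simp: e)
  qed simp
  then have all: "p ^ k dvd x \<and> p ^ k dvd y \<and> p ^ k dvd z" for k using assms by blast
  have "u = 0" if "\<And>k. p ^ k dvd u" for u :: int
  proof (rule ccontr)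
    assume u: "u \<noteq> 0"
    have "p ^ nat \<bar>u\<bar> \<le> \<bar>u\<bar>" using dvd_imp_le_int[OF u that[of "nat \<bar>u\<bar>"]] by linarith
    moreover have "p \<ge> 2" using p(2) by (rule prime_ge_2_int)
    then have "2 ^ nat \<bar>u\<bar> \<le> p ^ nat \<bar>u\<bar>" by (intro power_mono) auto
    moreover have "int (nat \<bar>u\<bar>) < 2 ^ nat \<bar>u\<bar>" by (metis less_exp of_nat_less_numeral_power_cancel_iff)
    ultimately show False by simp
  qed
  then show ?thesis using all by blast
qed

lemma normf_rat_eq_0:
  fixes x y z :: rat
  assumes "normf x y z = 0"
  shows "x = 0 \<and> y = 0 \<and> z = 0"
proof -
  have "\<exists>i m. x = of_int i / of_int m \<and> m > 0" for x :: rat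
    using quotient_of_div[of x] quotient_of_denom_pos[of x] by (metis surj_pair)
  then obtain i m j n k l where e: "x = of_int i / of_int m" "y = of_int j / of_int n" "z = of_int k / of_int l"
    "m > 0" "n > 0" "l > 0"
    by meson
  define D where "D = m * n * l"
  have D: "of_int D * x = of_int (i * n * l)" "of_int D * y = of_int (j * m * l)" "of_int D * z = of_int (k * m * n)"
    using e by (simp_all add: D_def)
  have "normf (of_int D * x) (of_int D * y) (of_int D * z) = of_int D ^ 3 * normf x y z"
    by (simp add: normf_def power3_eq_cube algebra_simps)
  then have "normf (of_int (i * n * l)) (of_int (j * m * l)) (of_int (k * m * n)) = (0 :: rat)"
    using assms D by simp
  then have "of_int (normf (i * n * l) (j * m * l) (k * m * n)) = (0 :: rat)"
    by (simp add: normf_def)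
  then have "normf (i * n * l) (j * m * l) (k * m * n) = 0" by linarith
  then have "i * n * l = 0 \<and> j * m * l = 0 \<and> k * m * n = 0" by (rule normf_int_eq_0)
  then show ?thesis using e by auto
qed

section \<open>Coordinates and the complex embedding of the field\<close>

definition r1 :: real where "r1 = root 3 (real_of_int (a * b ^ 2))"
definition r2 :: real where "r2 = root 3 (real_of_int (a ^ 2 * b))"

lemma r_pos: "r1 > 0" "r2 > 0"
  using a_pos b_pos by (simp_all add: r1_def r2_def)

lemma r_cube: "r1 ^ 3 = of_int (a * b ^ 2)" "r2 ^ 3 = of_int (a ^ 2 * b)"
  using a_pos b_pos by (simp_all add: r1_def r2_def)

lemma r1_sq: "r1 ^ 2 = of_int b * r2"
proof (rule power_eq_imp_eq_base)
  show "(r1 ^ 2) ^ 3 = (of_int b * r2) ^ 3"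
  proof -
    have "(r1 ^ 2) ^ 3 = (r1 ^ 3) ^ 2" by (simp flip: power_mult)
    also have "\<dots> = of_int b ^ 3 * r2 ^ 3" unfolding r_cube by (simp add: power2_eq_square power3_eq_cube)
    finally show ?thesis by (simp add: power_mult_distrib)
  qed
qed (use r_pos b_pos in auto)

lemma r2_sq: "r2 ^ 2 = of_int a * r1"
proof (rule power_eq_imp_eq_base)
  show "(r2 ^ 2) ^ 3 = (of_int a * r1) ^ 3"
  proof -
    have "(r2 ^ 2) ^ 3 = (r2 ^ 3) ^ 2" by (simp flip: power_mult)
    also have "\<dots> = of_int a ^ 3 * r1 ^ 3" unfolding r_cube by (simp add: power2_eq_square power3_eq_cube)
    finally show ?thesis by (simp add: power_mult_distrib)
  qed
qed (use r_pos a_pos in auto)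

lemma r1_r2: "r1 * r2 = of_int (a * b)"
proof (rule power_eq_imp_eq_base)
  show "(r1 * r2) ^ 3 = of_int (a * b) ^ 3"
    unfolding power_mult_distrib r_cube by (simp add: power2_eq_square power3_eq_cube)
qed (use r_pos a_pos b_pos in auto)

lemma r_ge_1: "r1 \<ge> 1" "r2 \<ge> 1"
proof -
  have "1 \<le> a * b ^ 2" "1 \<le> a ^ 2 * b" using a_pos b_pos by (simp_all add: int_one_le_iff_zero_less)
  then have "1 \<le> r1 ^ 3" "1 \<le> r2 ^ 3" unfolding r_cube by linarith+
  then show "r1 \<ge> 1" "r2 \<ge> 1" using r_pos by (smt (verit) power_less_one_iff zero_less_numeral)+
qed

definition omega :: complex where "omega = Complex (- 1 / 2) (sqrt 3 / 2)"

lemma omega_sq: "omega ^ 2 = - 1 - omega"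
  by (simp add: omega_def power2_eq_square complex_eq_iff)

lemma omega_sq': "omega * omega = - 1 - omega"
  using omega_sq by (simp add: power2_eq_square)

lemma omega_cnj: "cnj omega = - 1 - omega"
  by (simp add: omega_def complex_eq_iff)

lemma omega_norm: "norm omega = 1"
  by (simp add: omega_def cmod_def power_divide)

lemma omega_sq_norm: "norm (- 1 - omega) = 1"
  by (simp add: omega_def cmod_def power_divide)

definition t1 :: complex where "t1 = of_real r1"
definition t2 :: complex where "t2 = of_real r2"

lemma t_rels: "t1 * t1 = of_int b * t2" "t2 * t2 = of_int a * t1" "t1 * t2 = of_int a * of_int b"
  using r1_sq r2_sq r1_r2 unfolding t1_def t2_def power2_eq_square
  by (metis of_real_mult of_real_of_int_eq of_int_mult)+

lemma t_rels': "t1 * (t1 * w) = of_int b * (t2 * w)" "t2 * (t2 * w) = of_int a * (t1 * w)"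
  "t1 * (t2 * w) = of_int a * (of_int b * w)" "t2 * t1 = of_int a * of_int b"
  "t2 * (t1 * w) = of_int a * (of_int b * w)"
  using t_rels by (simp_all add: mult.commute[of t2 t1] flip: mult.assoc)

definition el :: "rat \<Rightarrow> rat \<Rightarrow> rat \<Rightarrow> complex" where
  "el x y z = of_rat x + of_rat y * t1 + of_rat z * t2"

text \<open>The conjugate of \<open>el x y z\<close> with \<open>omega * t1\<close> in place of
  \<open>t1\<close>. The square of \<open>omega\<close> is written as \<open>- 1 - omega\<close>,
  which keeps expressions linear in \<open>omega\<close>.\<close>

definition el' :: "rat \<Rightarrow> rat \<Rightarrow> rat \<Rightarrow> complex" where
  "el' x y z = of_rat x + of_rat y * (omega * t1) + of_rat z * ((- 1 - omega) * t2)"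

lemma el_add: "el x y z + el u v w = el (x + u) (y + v) (z + w)"
  and el'_add: "el' x y z + el' u v w = el' (x + u) (y + v) (z + w)"
  by (simp_all add: el_def el'_def of_rat_add algebra_simps)

lemma el_diff: "el x y z - el u v w = el (x - u) (y - v) (z - w)"
  and el'_diff: "el' x y z - el' u v w = el' (x - u) (y - v) (z - w)"
  by (simp_all add: el_def el'_def of_rat_diff algebra_simps)

lemma el_minus: "- el x y z = el (- x) (- y) (- z)"
  by (simp_all add: el_def of_rat_minus algebra_simps)

lemma el_mult: "el x y z * el u v w =
    el (x * u + of_int (a * b) * (y * w + z * v)) (x * v + y * u + of_int a * (z * w)) (x * w + z * u + of_int b * (y * v))"
  by (simp add: el_def of_rat_add of_rat_mult algebra_simps t_rels t_rels')

lemma el'_mult: "el' x y z * el' u v w =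
    el' (x * u + of_int (a * b) * (y * w + z * v)) (x * v + y * u + of_int a * (z * w)) (x * w + z * u + of_int b * (y * v))"
proof -
  have o: "omega * (omega * w) = - w - omega * w" for w
    by (simp only: mult.assoc[symmetric] omega_sq' left_diff_distrib) simp
  have s: "omega * t1 * (omega * t1) = of_int b * ((- 1 - omega) * t2)"
    "(- 1 - omega) * t2 * ((- 1 - omega) * t2) = of_int a * (omega * t1)"
    "omega * t1 * ((- 1 - omega) * t2) = of_int a * of_int b"
    by (simp_all add: algebra_simps t_rels t_rels' omega_sq' o)
  define A B where "A = omega * t1" and "B = (- 1 - omega) * t2"
  have s: "A * A = of_int b * B" "B * B = of_int a * A" "A * B = of_int a * of_int b"
    using s by (simp_all add: A_def B_def)
  have s': "A * (A * w) = of_int b * (B * w)" "B * (B * w) = of_int a * (A * w)"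
    "A * (B * w) = of_int a * (of_int b * w)" "B * A = of_int a * of_int b"
    "B * (A * w) = of_int a * (of_int b * w)" for w
    using s by (simp_all add: mult.commute[of B A] flip: mult.assoc)
  show ?thesis
    unfolding el'_def A_def[symmetric] B_def[symmetric]
    by (simp add: of_rat_add of_rat_mult algebra_simps s s')
qed

text \<open>\<open>el'_norm\<close> identifies the second factor as the product of the two complex
  conjugates; it provides the inverses in the field.\<close>

lemma el_adj: "el x y z * el (x ^ 2 - of_int (a * b) * (y * z)) (of_int a * z ^ 2 - x * y) (of_int b * y ^ 2 - x * z)
    = of_rat (normf x y z)"
  unfolding el_mult by (simp add: el_def normf_def power2_eq_square power3_eq_cube algebra_simps)

lemma el'_norm: "el' x y z * cnj (el' x y z)
    = el (x ^ 2 - of_int (a * b) * (y * z)) (of_int a * z ^ 2 - x * y) (of_int b * y ^ 2 - x * z)"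
proof -
  have cr: "cnj (of_rat r) = of_rat r" for r :: rat
    by (cases r) (simp add: of_rat_rat)
  have o: "omega * (omega * w) = - w - omega * w" for w
    by (simp only: mult.assoc[symmetric] omega_sq' left_diff_distrib) simp
  have c: "cnj t1 = t1" "cnj t2 = t2" by (simp_all add: t1_def t2_def)
  show ?thesis
    unfolding el'_def el_def
    by (simp add: cr c omega_cnj of_rat_add of_rat_mult of_rat_diff power2_eq_square algebra_simps t_rels t_rels' omega_sq' o)
qed

lemma el_0_iff: "el x y z = 0 \<longleftrightarrow> x = 0 \<and> y = 0 \<and> z = 0"
proof
  assume "el x y z = 0"
  then have "of_rat (normf x y z) = (0 :: complex)" using el_adj[of x y z] by simp
  then show "x = 0 \<and> y = 0 \<and> z = 0" using normf_rat_eq_0[of x y z] by simp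
qed (simp add: el_def)

lemma el_eq_iff: "el x y z = el u v w \<longleftrightarrow> x = u \<and> y = v \<and> z = w"
  using el_0_iff[of "x - u" "y - v" "z - w"] unfolding el_diff[symmetric] by simp

definition KK :: "complex set" where "KK = {el x y z | x y z. True}"

lemma KK_E: assumes "w \<in> KK" obtains x y z where "w = el x y z"
  using assms by (auto simp: KK_def)

lemma el_in_KK: "el x y z \<in> KK" by (auto simp: KK_def)

text \<open>\<open>sg\<close> is the complex embedding of the cubic field on \<open>KK\<close>; outside \<open>KK\<close> its value is junk.\<close>

definition sg :: "complex \<Rightarrow> complex" where
  "sg w = (THE u. \<exists>x y z. w = el x y z \<and> u = el' x y z)"

lemma sg_el [simp]: "sg (el x y z) = el' x y z"
  unfolding sg_def by (rule the_equality) (auto simp: el_eq_iff)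

lemma of_rat_el: "of_rat r = el r 0 0"
  by (simp add: el_def)

lemma of_int_el: "of_int n = el (of_int n) 0 0" and of_nat_el: "of_nat m = el (of_nat m) 0 0"
  by (simp_all add: el_def)

lemma of_rat_in_KK: "of_rat r \<in> KK" and of_int_in_KK: "of_int n \<in> KK" and of_nat_in_KK: "of_nat m \<in> KK"
  unfolding of_rat_el of_int_el of_nat_el by (rule el_in_KK)+

lemma KK_add: "u \<in> KK \<Longrightarrow> v \<in> KK \<Longrightarrow> u + v \<in> KK"
  and KK_mult: "u \<in> KK \<Longrightarrow> v \<in> KK \<Longrightarrow> u * v \<in> KK"
  by (auto elim!: KK_E simp: el_add el_diff el_mult intro: el_in_KK)

lemma KK_minus: "u \<in> KK \<Longrightarrow> - u \<in> KK"
  by (auto elim!: KK_E simp: el_minus intro: el_in_KK)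

lemma KK_inverse: assumes "u \<in> KK" shows "inverse u \<in> KK"
proof (cases "u = 0")
  case True
  then show ?thesis using assms by simp
next
  case False
  obtain x y z where u: "u = el x y z" using assms by (rule KK_E)
  define v where "v = el (x ^ 2 - of_int (a * b) * (y * z)) (of_int a * z ^ 2 - x * y) (of_int b * y ^ 2 - x * z)"
  have uv: "u * v = of_rat (normf x y z)" unfolding u v_def by (rule el_adj)
  have "normf x y z \<noteq> 0" using False u normf_rat_eq_0 el_0_iff by blast
  then have "inverse u = v * of_rat (inverse (normf x y z))"
  proof (intro inverse_unique)
    have "u * (v * of_rat (inverse (normf x y z))) = of_rat (normf x y z * inverse (normf x y z))"
      by (simp only: mult.assoc[symmetric] uv of_rat_mult)
    then show "u * (v * of_rat (inverse (normf x y z))) = 1" using \<open>normf x y z \<noteq> 0\<close> by simp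
  qed
  then show ?thesis unfolding v_def by (auto intro: KK_mult el_in_KK of_rat_in_KK)
qed

lemma KK_divide: "u \<in> KK \<Longrightarrow> v \<in> KK \<Longrightarrow> u / v \<in> KK"
  unfolding divide_inverse by (intro KK_mult KK_inverse)

lemma KK_power: "u \<in> KK \<Longrightarrow> u ^ n \<in> KK"
  by (induction n) (auto intro: KK_mult of_nat_in_KK[of 1, simplified])

lemma sg_add: "u \<in> KK \<Longrightarrow> v \<in> KK \<Longrightarrow> sg (u + v) = sg u + sg v"
  and sg_mult: "u \<in> KK \<Longrightarrow> v \<in> KK \<Longrightarrow> sg (u * v) = sg u * sg v"
  by (auto elim!: KK_E simp: el_add el_diff el_mult el'_add el'_diff el'_mult)

lemma sg_of_rat: "sg (of_rat r) = of_rat r"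
  unfolding of_rat_el sg_el by (simp add: el_def el'_def)

lemma sg_of_int: "sg (of_int n) = of_int n"
  using sg_of_rat[of "of_int n"] by simp

lemma sg_of_nat: "sg (of_nat n) = of_nat n"
  using sg_of_int[of "int n"] by simp

lemma sg_0 [simp]: "sg 0 = 0" and sg_1 [simp]: "sg 1 = 1"
  using sg_of_int[of 0] sg_of_int[of 1] by simp_all

lemma sg_power: "u \<in> KK \<Longrightarrow> sg (u ^ n) = sg u ^ n"
  by (induction n) (auto simp: sg_mult KK_power)

lemma sg_eq_0_iff: assumes "u \<in> KK" shows "sg u = 0 \<longleftrightarrow> u = 0"
proof
  assume "sg u = 0"
  show "u = 0"
  proof (rule ccontr)
    assume "u \<noteq> 0"
    then have "sg (u * inverse u) = sg 1" by simp
    then have "sg u * sg (inverse u) = 1" using assms by (simp add: sg_mult KK_inverse del: right_inverse)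
    then show False using \<open>sg u = 0\<close> by simp
  qed
qed simp

lemma sg_divide:
  assumes "u \<in> KK" "v \<in> KK"
  shows "sg (u / v) = sg u / sg v"
proof (cases "v = 0")
  case False
  then have "sg u = sg (u / v * v)" by simp
  also have "\<dots> = sg (u / v) * sg v" using assms by (intro sg_mult KK_divide)
  finally show ?thesis using False assms by (simp add: sg_eq_0_iff)
qed simp

text \<open>One real and one complex place, the latter counted together with its conjugate.\<close>

lemma norm_sg: "norm (el x y z) * norm (sg (el x y z)) ^ 2 = \<bar>of_rat (normf x y z)\<bar>"
proof -
  have "norm (el x y z) * norm (sg (el x y z)) ^ 2 = norm (el x y z * (el' x y z * cnj (el' x y z)))"
    by (simp add: norm_mult power2_eq_square)
  also have "\<dots> = norm (of_rat (normf x y z) :: complex)"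
    unfolding el'_norm el_adj ..
  also have "\<dots> = \<bar>of_rat (normf x y z)\<bar>"
    by (cases "normf x y z") (simp add: of_rat_rat norm_divide)
  finally show ?thesis .
qed

end

text \<open>The equation arises from the integrality of the norm of
  \<open>r / 3 + s t1 / (3 a b) + t t2 / (3 a b)\<close> by clearing denominators. As
  \<open>a\<close> is squarefree and coprime to \<open>b\<close>, it divides \<open>s ^ 3\<close>
  and hence \<open>s\<close>; after a division by \<open>a\<close> the same argument applies to
  \<open>t\<close>.\<close>

lemma cubic_form_dvd:
  fixes a b r s t n :: int
  assumes a: "a > 0" "squarefree a" "coprime a b"
    and eq: "b * s ^ 3 + a * t ^ 3 + a ^ 2 * b ^ 2 * r ^ 3 - 3 * a * b * r * s * t = a ^ 2 * b ^ 2 * n"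
  shows "a dvd s \<and> a dvd t"
proof -
  have "b * s ^ 3 = a * (a * b ^ 2 * n - t ^ 3 - a * b ^ 2 * r ^ 3 + 3 * b * r * s * t)"
    using eq by (simp add: power2_eq_square algebra_simps)
  then have "a dvd b * s ^ 3" by (metis dvd_triv_left)
  then have "a dvd s ^ 3" using a(3) by (metis coprime_dvd_mult_right_iff)
  then have s: "a dvd s" using squarefree_dvd_cube a(2) by blast
  then obtain s' where s': "s = a * s'" by blast
  have "a * (b * a ^ 2 * s' ^ 3 + t ^ 3 + a * b ^ 2 * r ^ 3 - 3 * a * b * r * s' * t) = a * (a * b ^ 2 * n)"
    using eq by (simp add: s' power2_eq_square power3_eq_cube algebra_simps)
  then have "b * a ^ 2 * s' ^ 3 + t ^ 3 + a * b ^ 2 * r ^ 3 - 3 * a * b * r * s' * t = a * b ^ 2 * n"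
    using a(1) by simp
  then have "t ^ 3 = a * (b ^ 2 * n - b * a * s' ^ 3 - b ^ 2 * r ^ 3 + 3 * b * r * s' * t)"
    by (simp add: power2_eq_square algebra_simps)
  then have "a dvd t ^ 3" by (metis dvd_triv_left)
  then have "a dvd t" using squarefree_dvd_cube a(2) by blast
  with s show ?thesis ..
qed

lemma int_subgroup_cyclic:
  fixes S :: "int set"
  assumes m: "m \<in> S" "m > 0" and diff: "\<And>x y. x \<in> S \<Longrightarrow> y \<in> S \<Longrightarrow> x - y \<in> S"
  obtains g where "g > 0" "S = range (\<lambda>k. k * g)"
proof -
  have 0: "0 \<in> S" using diff[OF m(1) m(1)] by simp
  have neg: "- x \<in> S" if "x \<in> S" for x using diff[OF 0 that] by simp
  have add: "x + y \<in> S" if "x \<in> S" "y \<in> S" for x y using diff[OF that(1) neg[OF that(2)]] by simp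
  have mult: "k * x \<in> S" if "x \<in> S" for k x
  proof -
    have "int n * x \<in> S" for n by (induction n) (use 0 add that in \<open>auto simp: distrib_right\<close>)
    then show ?thesis using neg by (cases k rule: int_cases2) force+
  qed
  define n where "n = (LEAST n. n > 0 \<and> int n \<in> S)"
  have ex: "nat m > 0 \<and> int (nat m) \<in> S" using m by simp
  have n: "n > 0" "int n \<in> S" using LeastI[of "\<lambda>n. n > 0 \<and> int n \<in> S", OF ex] by (auto simp: n_def)
  have least: "n \<le> k" if "k > 0" "int k \<in> S" for k unfolding n_def using that by (intro Least_le) auto
  have "x \<in> range (\<lambda>k. k * int n)" if x: "x \<in> S" for x
  proof -
    have "x - (x div int n) * int n \<in> S" using x mult[OF n(2)] diff by blast
    then have "x mod int n \<in> S" by (simp add: minus_div_mult_eq_mod)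
    moreover have "0 \<le> x mod int n" "x mod int n < int n" using n by auto
    ultimately have "x mod int n = 0" using least[of "nat (x mod int n)"] by force
    then show ?thesis by (metis div_mod_decomp_int add.right_neutral rangeI)
  qed
  then have "S = range (\<lambda>k. k * int n)" using mult[OF n(2)] by auto
  then show ?thesis using that[of "int n"] n by simp
qed

text \<open>Hermite normal form: \<open>g\<close>, \<open>e\<close>, \<open>c\<close> generate the
  last coordinates, the second coordinates where the last vanishes, and the first coordinates where
  both others vanish.\<close>

lemma int3_subgroup_triangular:
  fixes L :: "(int \<times> int \<times> int) set"
  assumes diff: "\<And>x y z x' y' z'. (x, y, z) \<in> L \<Longrightarrow> (x', y', z') \<in> L \<Longrightarrow> (x - x', y - y', z - z') \<in> L"
    and m: "m > 0" "(m, 0, 0) \<in> L" "(0, m, 0) \<in> L" "(0, 0, m) \<in> L"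
  obtains c e g u v w where "c > 0" "e > 0" "g > 0"
    "\<And>x y z. (x, y, z) \<in> L \<longleftrightarrow> (\<exists>i j k. x = i * c + j * u + k * v \<and> y = j * e + k * w \<and> z = k * g)"
proof -
  have 0: "(0, 0, 0) \<in> L" using diff[OF m(2) m(2)] by simp
  have neg: "(- x, - y, - z) \<in> L" if "(x, y, z) \<in> L" for x y z using diff[OF 0 that] by simp
  have add: "(x + x', y + y', z + z') \<in> L" if "(x, y, z) \<in> L" "(x', y', z') \<in> L" for x y z x' y' z'
    using diff[OF that(1) neg[OF that(2)]] by simp
  have mult: "(k * x, k * y, k * z) \<in> L" if "(x, y, z) \<in> L" for k x y z
  proof -
    have n: "(int n * x, int n * y, int n * z) \<in> L" for n
    proof (induction n)
      case (Suc n)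
      show ?case using add[OF that Suc] by (simp add: distrib_right)
    qed (use 0 in simp)
    show ?thesis
    proof (cases "k \<ge> 0")
      case True
      then show ?thesis using n[of "nat k"] by simp
    next
      case False
      then show ?thesis using neg[OF n[of "nat (- k)"]] by simp
    qed
  qed
  obtain g where g: "g > 0" "{z. \<exists>x y. (x, y, z) \<in> L} = range (\<lambda>k. k * g)"
    by (rule int_subgroup_cyclic[of m "{z. \<exists>x y. (x, y, z) \<in> L}"]) (use m diff in blast)+
  obtain e where e: "e > 0" "{y. \<exists>x. (x, y, 0) \<in> L} = range (\<lambda>k. k * e)"
  proof (rule int_subgroup_cyclic[of m "{y. \<exists>x. (x, y, 0) \<in> L}"])
    show "x - y \<in> {y. \<exists>x. (x, y, 0) \<in> L}" if "x \<in> {y. \<exists>x. (x, y, 0) \<in> L}" "y \<in> {y. \<exists>x. (x, y, 0) \<in> L}" for x y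
      using that diff by force
  qed (use m in auto)
  obtain c where c: "c > 0" "{x. (x, 0, 0) \<in> L} = range (\<lambda>k. k * c)"
  proof (rule int_subgroup_cyclic[of m "{x. (x, 0, 0) \<in> L}"])
    show "x - y \<in> {x. (x, 0, 0) \<in> L}" if "x \<in> {x. (x, 0, 0) \<in> L}" "y \<in> {x. (x, 0, 0) \<in> L}" for x y
      using that diff by force
  qed (use m in auto)
  have "g \<in> {z. \<exists>x y. (x, y, z) \<in> L}" unfolding g(2) by (rule range_eqI[of _ _ 1]) simp
  then obtain v w where vw: "(v, w, g) \<in> L" by blast
  have "e \<in> {y. \<exists>x. (x, y, 0) \<in> L}" unfolding e(2) by (rule range_eqI[of _ _ 1]) simp
  then obtain u where u: "(u, e, 0) \<in> L" by blast
  have "c \<in> {x. (x, 0, 0) \<in> L}" unfolding c(2) by (rule range_eqI[of _ _ 1]) simp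
  then have cL: "(c, 0, 0) \<in> L" by simp
  have "(x, y, z) \<in> L \<longleftrightarrow> (\<exists>i j k. x = i * c + j * u + k * v \<and> y = j * e + k * w \<and> z = k * g)" for x y z
  proof
    assume L: "(x, y, z) \<in> L"
    then have "z \<in> range (\<lambda>k. k * g)" unfolding g(2)[symmetric] by blast
    then obtain k where k: "z = k * g" by blast
    have L1: "(x - k * v, y - k * w, 0) \<in> L" using diff[OF L mult[OF vw, of k]] k by simp
    then have "y - k * w \<in> range (\<lambda>k. k * e)" unfolding e(2)[symmetric] by blast
    then obtain j where j: "y - k * w = j * e" by blast
    have "(x - k * v - j * u, 0, 0) \<in> L" using diff[OF L1 mult[OF u, of j]] j by simp
    then have "x - k * v - j * u \<in> range (\<lambda>k. k * c)" unfolding c(2)[symmetric] by blast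
    then obtain i where "x - k * v - j * u = i * c" by blast
    then show "\<exists>i j k. x = i * c + j * u + k * v \<and> y = j * e + k * w \<and> z = k * g"
      using j k by (intro exI[of _ i] exI[of _ j] exI[of _ k]) linarith
  next
    assume "\<exists>i j k. x = i * c + j * u + k * v \<and> y = j * e + k * w \<and> z = k * g"
    then obtain i j k where "x = i * c + j * u + k * v" "y = j * e + k * w" "z = k * g" by blast
    then show "(x, y, z) \<in> L" using add[OF add[OF mult[OF cL, of i] mult[OF u, of j]] mult[OF vw, of k]] by simp
  qed
  then show ?thesis using that c(1) e(1) g(1) by blast
qed

context pure_cubic
begin

abbreviation OK :: "complex set" where "OK \<equiv> ring_of_integers KK"

text \<open>An order of finite index in \<open>OK\<close>: by \<open>three_OK\<close> it contains
  \<open>3 * OK\<close>. The explicit computations take place here.\<close>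

definition OZ :: "complex set" where
  "OZ = {el (of_int i) (of_int j) (of_int k) | i j k. True}"

lemma OK_I: "w \<in> KK \<Longrightarrow> algebraic_int w \<Longrightarrow> w \<in> OK"
  and OK_KK: "w \<in> OK \<Longrightarrow> w \<in> KK"
  and OK_alg: "w \<in> OK \<Longrightarrow> algebraic_int w"
  by (auto simp: ring_of_integers_def)

lemma OK_add: "u \<in> OK \<Longrightarrow> v \<in> OK \<Longrightarrow> u + v \<in> OK"
  and OK_mult: "u \<in> OK \<Longrightarrow> v \<in> OK \<Longrightarrow> u * v \<in> OK"
  by (auto simp: ring_of_integers_def KK_add KK_mult algebraic_int_add_mult)

lemma OK_of_int: "of_int n \<in> OK"
  by (intro OK_I of_int_in_KK int_imp_algebraic_int) simp

sublocale OS: subring_set OK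
  by standard (use OK_of_int[of 1] OK_of_int[of "- 1"] OK_add OK_mult in auto)

lemma t_in_OK: "t1 \<in> OK" "t2 \<in> OK"
proof -
  have "t1 = el 0 1 0" "t2 = el 0 0 1" by (simp_all add: el_def)
  then have "t1 \<in> KK" "t2 \<in> KK" by (simp_all add: el_in_KK)
  moreover have "algebraic_int t1" "algebraic_int t2"
    unfolding t1_def t2_def r1_def r2_def
    by (intro algebraic_int_of_real algebraic_int_nth_root_real int_imp_algebraic_int Ints_of_int)+
  ultimately show "t1 \<in> OK" "t2 \<in> OK" by (auto intro: OK_I)
qed

lemma OZ_subset_OK: "OZ \<subseteq> OK"
proof
  fix w assume "w \<in> OZ"
  then obtain i j k where "w = of_int i + of_int j * t1 + of_int k * t2" by (auto simp: OZ_def el_def)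
  then show "w \<in> OK" by (auto intro!: OK_add OK_mult OK_of_int t_in_OK)
qed

text \<open>On \<open>KK\<close> the map \<open>sg\<close> is a ring homomorphism fixing the
  integers, so it sends a root of an integer polynomial to a root.\<close>

lemma algebraic_int_sg:
  assumes "w \<in> KK" "algebraic_int w"
  shows "algebraic_int (sg w)"
proof -
  obtain p where p: "poly (map_poly of_int p) w = 0" "lead_coeff p = 1"
    using assms(2) unfolding algebraic_int_altdef_ipoly by blast
  have "poly (map_poly of_int q) w \<in> KK \<and> sg (poly (map_poly of_int q) w) = poly (map_poly of_int q) (sg w)" for q :: "int poly"
    by (induction q)
      (use assms(1) of_int_in_KK[of 0] in \<open>auto simp: map_poly_pCons sg_add sg_mult sg_of_int KK_mult of_int_in_KK intro: KK_add\<close>)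
  then have "poly (map_poly of_int p) (sg w) = 0" using p(1) by (metis sg_0)
  then show ?thesis using p(2) unfolding algebraic_int_altdef_ipoly by blast
qed

lemma algebraic_int_of_rat: "algebraic_int (of_rat r :: complex) \<Longrightarrow> r \<in> \<int>"
  using rational_algebraic_int_is_int[of "of_rat r :: complex"] by (auto elim!: Ints_cases) 
    (metis Ints_of_int of_rat_eq_iff of_rat_of_int_eq)

lemma trace_int: assumes "el x y z \<in> OK" shows "3 * x \<in> \<int>"
proof -
  let ?w = "el x y z"
  have cr: "cnj (of_rat r) = of_rat r" for r :: rat by (cases r) (simp add: of_rat_rat)
  have c: "cnj t1 = t1" "cnj t2 = t2" by (simp_all add: t1_def t2_def)
  have "algebraic_int (?w + sg ?w + cnj (sg ?w))"
    using algebraic_int_sg[OF el_in_KK OK_alg, OF assms] OK_alg[OF assms]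
    by (intro algebraic_int_add_mult algebraic_int_cnj)
  also have "?w + sg ?w + cnj (sg ?w) = of_rat (3 * x)"
    unfolding sg_el by (simp add: el_def el'_def cr c omega_cnj of_rat_mult algebra_simps)
  finally show ?thesis by (rule algebraic_int_of_rat)
qed

lemma norm_int: assumes "el x y z \<in> OK" shows "normf x y z \<in> \<int>"
proof -
  let ?w = "el x y z"
  have "algebraic_int (?w * (sg ?w * cnj (sg ?w)))"
    using algebraic_int_sg[OF el_in_KK OK_alg, OF assms] OK_alg[OF assms]
    by (intro algebraic_int_add_mult algebraic_int_cnj)
  also have "?w * (sg ?w * cnj (sg ?w)) = of_rat (normf x y z)"
    by (simp only: sg_el el'_norm el_adj)
  finally show ?thesis by (rule algebraic_int_of_rat)
qed

lemma t_el: "t1 = el 0 1 0" "t2 = el 0 0 1"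
  by (simp_all add: el_def)

text \<open>The traces of \<open>w\<close>, \<open>w t1\<close> and \<open>w t2\<close> leave
  denominators 3, \<open>3 a b\<close> and \<open>3 a b\<close>; integrality of the norm removes
  \<open>a\<close> and \<open>b\<close> from the last two by two symmetric applications of
  \<open>cubic_form_dvd\<close>.\<close>

lemma OK_coords:
  assumes w: "el x y z \<in> OK"
  shows "3 * x \<in> \<int> \<and> 3 * y \<in> \<int> \<and> 3 * z \<in> \<int>"
proof -
  have "el x y z * t1 \<in> OK" "el x y z * t2 \<in> OK" using w t_in_OK by (auto intro: OK_mult)
  then have "3 * (of_int (a * b) * z) \<in> \<int>" "3 * (of_int (a * b) * y) \<in> \<int>"
    using trace_int unfolding t_el el_mult by force+
  then obtain r s t where rst: "3 * x = of_int r" "3 * of_int (a * b) * y = of_int s" "3 * of_int (a * b) * z = of_int t"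
    using trace_int[OF w] by (auto elim!: Ints_cases simp: mult.assoc)
  obtain n where n: "normf x y z = of_int n" using norm_int[OF w] by (auto elim: Ints_cases)
  have ab0: "(of_int a :: rat) \<noteq> 0" "(of_int b :: rat) \<noteq> 0" using a_pos b_pos by auto
  have xyz: "x = of_int r / 3" "y = of_int s / (3 * of_int a * of_int b)" "z = of_int t / (3 * of_int a * of_int b)"
    using rst ab0 by (simp_all add: field_simps)
  have "27 * of_int a ^ 2 * of_int b ^ 2 * normf x y z = of_int (b * s ^ 3 + a * t ^ 3 + a ^ 2 * b ^ 2 * r ^ 3 - 3 * a * b * r * s * t)"
    using ab0 unfolding normf_def xyz by (simp add: divide_simps) (simp add: power2_eq_square power3_eq_cube algebra_simps)
  then have "(of_int (b * s ^ 3 + a * t ^ 3 + a ^ 2 * b ^ 2 * r ^ 3 - 3 * a * b * r * s * t) :: rat) = of_int (a ^ 2 * b ^ 2 * (27 * n))"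
    unfolding n by simp
  then have eq: "b * s ^ 3 + a * t ^ 3 + a ^ 2 * b ^ 2 * r ^ 3 - 3 * a * b * r * s * t = a ^ 2 * b ^ 2 * (27 * n)"
    by (simp only: of_int_eq_iff)
  have "a dvd s \<and> a dvd t" by (rule cubic_form_dvd[OF a_pos squarefree_a coprime_ab eq])
  moreover have "b dvd t \<and> b dvd s"
    by (rule cubic_form_dvd[OF b_pos squarefree_b _ , of a _ _ r "27 * n"])
      (use eq coprime_ab in \<open>simp_all add: coprime_commute algebra_simps\<close>)
  ultimately have "a * b dvd s" "a * b dvd t" using coprime_ab divides_mult by blast+
  then obtain s' t' where "s = a * b * s'" "t = a * b * t'" by (elim dvdE)
  then have "3 * y = of_int s'" "3 * z = of_int t'" using ab0 unfolding xyz by simp_all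
  then show ?thesis using trace_int[OF w] by simp
qed

text \<open>Tripled coordinates turn \<open>A\<close> into a subgroup of the integer triples that
  contains all multiples of \<open>3 * m\<close>, to which the triangular form applies. It serves
  for \<open>OK\<close> itself and for its ideals.\<close>

lemma triangular_basis:
  assumes diff: "\<And>u v. u \<in> A \<Longrightarrow> v \<in> A \<Longrightarrow> u - v \<in> A"
    and sub: "A \<subseteq> OK" and m: "m > 0" and mA: "\<And>w. w \<in> OZ \<Longrightarrow> of_int m * w \<in> A"
  obtains c e g u v w :: int where "c > 0" "e > 0" "g > 0"
    "A = {of_int i * el (of_int c / 3) 0 0 + of_int j * el (of_int u / 3) (of_int e / 3) 0
          + of_int k * el (of_int v / 3) (of_int w / 3) (of_int g / 3) | i j k. True}"
proof -
  define f where "f = (\<lambda>(x, y, z). el (of_int x / 3) (of_int y / 3) (of_int z / 3))"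
  define L where "L = {p. f p \<in> A}"
  have f_diff: "f (x, y, z) - f (x', y', z') = f (x - x', y - y', z - z')" for x y z x' y' z'
    by (simp add: f_def el_diff diff_divide_distrib)
  have m': "(3 * m, 0, 0) \<in> L" "(0, 3 * m, 0) \<in> L" "(0, 0, 3 * m) \<in> L"
  proof -
    have "el 1 0 0 \<in> OZ" "el 0 1 0 \<in> OZ" "el 0 0 1 \<in> OZ"
      unfolding OZ_def by (force intro: exI[of _ 0] exI[of _ 1])+
    from mA[OF this(1)] mA[OF this(2)] mA[OF this(3)] show "(3 * m, 0, 0) \<in> L" "(0, 3 * m, 0) \<in> L" "(0, 0, 3 * m) \<in> L"
      by (auto simp: L_def f_def of_int_el el_mult)
  qed
  obtain c e g u v w where B: "c > 0" "e > 0" "g > 0"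
    "\<And>x y z. (x, y, z) \<in> L \<longleftrightarrow> (\<exists>i j k. x = i * c + j * u + k * v \<and> y = j * e + k * w \<and> z = k * g)"
  proof (rule int3_subgroup_triangular[of L "3 * m"])
    fix x y z x' y' z' assume "(x, y, z) \<in> L" "(x', y', z') \<in> L"
    then show "(x - x', y - y', z - z') \<in> L" using diff by (simp add: L_def flip: f_diff)
  qed (use m m' in auto)
  have comb: "of_int i * el (of_int c / 3) 0 0 + of_int j * el (of_int u / 3) (of_int e / 3) 0
          + of_int k * el (of_int v / 3) (of_int w / 3) (of_int g / 3) = f (i * c + j * u + k * v, j * e + k * w, k * g)" for i j k
    by (simp add: f_def of_int_el el_mult el_add add_divide_distrib)
  have "w' \<in> A \<longleftrightarrow> (\<exists>i j k. w' = f (i * c + j * u + k * v, j * e + k * w, k * g))" for w'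
  proof
    assume w': "w' \<in> A"
    then have "w' \<in> OK" "w' \<in> KK" using sub OK_KK by auto
    then obtain x y z where xyz: "w' = el x y z" by (auto elim: KK_E)
    then obtain i j k where "3 * x = of_int i" "3 * y = of_int j" "3 * z = of_int k"
      using OK_coords[of x y z] \<open>w' \<in> OK\<close> by (auto elim!: Ints_cases)
    then have xe: "x = of_int i / 3" "y = of_int j / 3" "z = of_int k / 3" by (simp_all add: field_simps)
    have eq: "w' = f (i, j, k)" unfolding xyz f_def xe by simp
    then have "(i, j, k) \<in> L" using w' by (simp add: L_def)
    then obtain i' j' k' where "i = i' * c + j' * u + k' * v" "j = j' * e + k' * w" "k = k' * g"
      unfolding B(4) by blast
    then show "\<exists>i j k. w' = f (i * c + j * u + k * v, j * e + k * w, k * g)" using eq by blast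
  next
    assume "\<exists>i j k. w' = f (i * c + j * u + k * v, j * e + k * w, k * g)"
    then obtain i j k where "w' = f (i * c + j * u + k * v, j * e + k * w, k * g)" by blast
    moreover have "(i * c + j * u + k * v, j * e + k * w, k * g) \<in> L" using B(4) by blast
    ultimately show "w' \<in> A" by (simp add: L_def)
  qed
  then have "A = {of_int i * el (of_int c / 3) 0 0 + of_int j * el (of_int u / 3) (of_int e / 3) 0
          + of_int k * el (of_int v / 3) (of_int w / 3) (of_int g / 3) | i j k. True}"
    unfolding comb by blast
  then show ?thesis using that B(1-3) by blast
qed

text \<open>Coordinates in a basis modulo \<open>m\<close> separate incongruent elements, which
  gives the index bound. A multiplier of a nonzero ideal preserves a finitely generated module and
  is therefore integral.\<close>

sublocale ID: order_ring OK
proof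
  fix m :: nat and S :: "complex set"
  assume m: "m > 0" and S: "S \<subseteq> OK" and inc: "\<And>x y. x \<in> S \<Longrightarrow> y \<in> S \<Longrightarrow> x \<noteq> y \<Longrightarrow> x - y \<notin> (*) (of_nat m) ` OK"
  obtain b0 b1 b2 where B: "OK = {of_int i * b0 + of_int j * b1 + of_int k * b2 | i j k. True}"
    by (rule triangular_basis[of OK 1]) (use OZ_subset_OK in \<open>auto intro: OS.diff_in\<close>)
  have "\<forall>w\<in>OK. \<exists>p. w = of_int (fst p) * b0 + of_int (fst (snd p)) * b1 + of_int (snd (snd p)) * b2"
    unfolding B by auto
  from bchoice[OF this] obtain p where p: "\<And>w. w \<in> OK \<Longrightarrow> w = of_int (fst (p w)) * b0 + of_int (fst (snd (p w))) * b1 + of_int (snd (snd (p w))) * b2"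
    by blast
  define h where "h w = (fst (p w) mod int m, fst (snd (p w)) mod int m, snd (snd (p w)) mod int m)" for w
  have "inj_on h S"
  proof (rule inj_onI, rule ccontr)
    fix x y assume xy: "x \<in> S" "y \<in> S" "h x = h y" "x \<noteq> y"
    have "int m dvd fst (p x) - fst (p y)" "int m dvd fst (snd (p x)) - fst (snd (p y))" "int m dvd snd (snd (p x)) - snd (snd (p y))"
      using xy(3) by (simp_all add: h_def mod_eq_dvd_iff)
    then obtain i j k where ijk: "fst (p x) - fst (p y) = int m * i" "fst (snd (p x)) - fst (snd (p y)) = int m * j"
      "snd (snd (p x)) - snd (snd (p y)) = int m * k" by (elim dvdE)
    have "x - y = of_int (fst (p x) - fst (p y)) * b0 + of_int (fst (snd (p x)) - fst (snd (p y))) * b1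
        + of_int (snd (snd (p x)) - snd (snd (p y))) * b2"
      using p[of x] p[of y] xy S by (simp add: subset_iff algebra_simps)
    also have "\<dots> = of_nat m * (of_int i * b0 + of_int j * b1 + of_int k * b2)"
      unfolding ijk by (simp add: algebra_simps)
    finally have "x - y \<in> (*) (of_nat m) ` OK" unfolding B by blast
    then show False using inc xy by blast
  qed
  moreover have "h ` S \<subseteq> {0..<int m} \<times> {0..<int m} \<times> {0..<int m}" using m by (auto simp: h_def)
  moreover have "card ({0..<int m} \<times> {0..<int m} \<times> {0..<int m}) = m ^ 3"
    by (simp add: card_cartesian_product power3_eq_cube)
  ultimately show "finite S \<and> card S \<le> m ^ 3"
    by (metis card_inj_on_le finite_SigmaI finite_atLeastLessThan_int inj_on_finite)
next
  fix n :: nat and J x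
  assume J: "OS.submod J" "J \<subseteq> OK" "n > 0" "of_nat n \<in> J" and st: "\<And>y. y \<in> J \<Longrightarrow> x * y \<in> J"
  have n0: "(of_nat n :: complex) \<noteq> 0" using J(3) by simp
  have "x * of_nat n \<in> KK" using st[OF J(4)] J(2) OK_KK by blast
  then have "x * of_nat n / of_nat n \<in> KK" by (intro KK_divide of_nat_in_KK)
  then have "x \<in> KK" using n0 by simp
  have mA: "of_int (int n) * w \<in> J" if "w \<in> OZ" for w
    using OS.submod_smult[OF J(1) _ J(4), of w] that OZ_subset_OK by (auto simp: mult.commute)
  obtain b0 b1 b2 where B: "J = {of_int i * b0 + of_int j * b1 + of_int k * b2 | i j k. True}"
    by (rule triangular_basis[OF _ J(2), of "int n"]) (use J mA in \<open>auto intro: OS.submod_diff\<close>)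
  define V where "V = {b0, b1, b2}"
  have fin: "finite V" by (simp add: V_def)
  have JV: "J \<subseteq> zspan V"
    unfolding B using zspan_base[OF fin] by (auto simp: V_def intro!: zspan_add zspan_int)
  have VJ: "V \<subseteq> J"
  proof -
    have "of_int 1 * b0 + of_int 0 * b1 + of_int 0 * b2 \<in> J" "of_int 0 * b0 + of_int 1 * b1 + of_int 0 * b2 \<in> J"
      "of_int 0 * b0 + of_int 0 * b1 + of_int 1 * b2 \<in> J" unfolding B by blast+
    then show ?thesis by (simp add: V_def)
  qed
  have "\<exists>v\<in>V. v \<noteq> 0"
  proof (rule ccontr)
    assume "\<not> ?thesis"
    then have "b0 = 0" "b1 = 0" "b2 = 0" by (auto simp: V_def)
    then show False using J(4) n0 unfolding B by auto
  qed
  then obtain v where v: "v \<in> V" "v \<noteq> 0" by blast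
  have "algebraic_int x"
    by (rule algebraic_int_if_stable[OF fin v]) (use VJ JV st in blast)
  then show "x \<in> OK" using \<open>x \<in> KK\<close> by (rule OK_I[rotated])
qed

end

subsection \<open>The discriminant\<close>

lemma complex_ring_simps:
  "carrier complex_ring = UNIV" "x \<otimes>\<^bsub>complex_ring\<^esub> y = x * y" "x \<oplus>\<^bsub>complex_ring\<^esub> y = x + y"
  "\<one>\<^bsub>complex_ring\<^esub> = 1" "\<zero>\<^bsub>complex_ring\<^esub> = 0"
  by (simp_all add: ring_of_type_algebra_def)

lemma complex_ring_field: "Ring.field complex_ring"
  by (rule field_from_type_algebra)

lemma complex_ring_a_inv: "\<ominus>\<^bsub>complex_ring\<^esub> x = - x"
proof -
  interpret Ring.field complex_ring by (rule complex_ring_field)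
  show ?thesis by (rule minus_equality) (simp_all add: complex_ring_simps)
qed

lemma complex_ring_m_inv: "x \<noteq> 0 \<Longrightarrow> inv\<^bsub>complex_ring\<^esub> x = inverse x"
proof -
  interpret Ring.field complex_ring by (rule complex_ring_field)
  show "x \<noteq> 0 \<Longrightarrow> inv\<^bsub>complex_ring\<^esub> x = inverse x"
    by (rule comm_inv_char) (simp_all add: complex_ring_simps)
qed

lemma det_mat_3:
  fixes f :: "nat \<times> nat \<Rightarrow> 'a::comm_ring_1"
  shows "det (mat 3 3 f) = f (0, 0) * (f (1, 1) * f (2, 2) - f (1, 2) * f (2, 1))
    - f (0, 1) * (f (1, 0) * f (2, 2) - f (1, 2) * f (2, 0))
    + f (0, 2) * (f (1, 0) * f (2, 1) - f (1, 1) * f (2, 0))"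
proof -
  have d2: "det (mat 2 2 h) = h (0, 0) * h (1, 1) - h (0, 1) * h (1, 0)" for h :: "nat \<times> nat \<Rightarrow> 'a"
  proof -
    have "det (mat 2 2 h) = (\<Sum>j<2. mat 2 2 h $$ (0, j) * cofactor (mat 2 2 h) 0 j)"
      by (rule laplace_expansion_row) auto
    also have "\<dots> = h (0, 0) * det (mat_delete (mat 2 2 h) 0 0) - h (0, 1) * det (mat_delete (mat 2 2 h) 0 1)"
      by (simp add: numeral_2_eq_2 cofactor_def)
    also have "det (mat_delete (mat 2 2 h) 0 0) = h (1, 1)"
      by (subst det_single) (auto simp: mat_delete_def)
    also have "det (mat_delete (mat 2 2 h) 0 1) = h (1, 0)"
      by (subst det_single) (auto simp: mat_delete_def)
    finally show ?thesis .
  qed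
  have "det (mat 3 3 f) = (\<Sum>j<3. mat 3 3 f $$ (0, j) * cofactor (mat 3 3 f) 0 j)"
    by (rule laplace_expansion_row) auto
  also have "\<dots> = f (0, 0) * det (mat_delete (mat 3 3 f) 0 0) - f (0, 1) * det (mat_delete (mat 3 3 f) 0 1)
     + f (0, 2) * det (mat_delete (mat 3 3 f) 0 2)"
    by (simp add: numeral_3_eq_3 cofactor_def) (simp add: numeral_2_eq_2)
  also have "mat_delete (mat 3 3 f) 0 0 = mat 2 2 (\<lambda>(i, j). f (i + 1, j + 1))"
    by (rule eq_matI) (auto simp: mat_delete_def)
  also have "mat_delete (mat 3 3 f) 0 1 = mat 2 2 (\<lambda>(i, j). f (i + 1, if j = 0 then 0 else 2))"
    by (rule eq_matI) (auto simp: mat_delete_def less_2_cases_iff, simp_all add: numeral_2_eq_2)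
  also have "mat_delete (mat 3 3 f) 0 2 = mat 2 2 (\<lambda>(i, j). f (i + 1, j))"
    by (rule eq_matI) (auto simp: mat_delete_def)
  finally show ?thesis unfolding d2 by (simp flip: numeral_2_eq_2)
qed

context pure_cubic
begin

lemma rat_adjoin_eq: "rat_adjoin t1 = KK"
proof
  show "rat_adjoin t1 \<subseteq> KK"
  proof
    fix w assume "w \<in> rat_adjoin t1"
    then show "w \<in> KK"
      unfolding rat_adjoin_def
      by (induction rule: generate_field.induct)
        (auto simp: complex_ring_simps complex_ring_a_inv complex_ring_m_inv t_el el_in_KK of_nat_in_KK[of 1, simplified]
          intro: KK_minus KK_inverse KK_add KK_mult)
  qed
  let ?G = "generate_field complex_ring {t1}"
  have 1: "1 \<in> ?G" using generate_field.one[of complex_ring] by (simp add: complex_ring_simps)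
  have add: "x + y \<in> ?G" and mult: "x * y \<in> ?G" if "x \<in> ?G" "y \<in> ?G" for x y
    using generate_field.eng_add[OF that] generate_field.eng_mult[OF that] by (simp_all add: complex_ring_simps)
  have neg: "- x \<in> ?G" if "x \<in> ?G" for x
    using generate_field.a_inv[OF that] by (simp add: complex_ring_a_inv)
  have 0: "0 \<in> ?G" using add[OF 1 neg[OF 1]] by simp
  have inv: "inverse x \<in> ?G" if "x \<in> ?G" for x
    using generate_field.m_inv[OF that] complex_ring_m_inv[of x] 0 by (cases "x = 0") (simp_all add: complex_ring_simps)
  have nat: "of_nat n \<in> ?G" for n by (induction n) (auto intro: 0 1 add)
  have int: "of_int n \<in> ?G" for n using nat neg by (cases n rule: int_cases2) auto
  have rat: "of_rat r \<in> ?G" for r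
    by (cases r) (auto simp: of_rat_rat divide_inverse intro: mult inv int)
  have t: "t1 \<in> ?G" by (rule generate_field.incl) simp
  have "t2 = t1 * t1 * inverse (of_int b)" using t_rels(1) b_pos by (simp add: field_simps)
  then have t2: "t2 \<in> ?G" using mult[OF mult[OF t t] inv[OF int]] by simp
  show "KK \<subseteq> rat_adjoin t1"
    unfolding rat_adjoin_def KK_def by (auto simp: el_def intro!: add mult rat t t2)
qed

section \<open>Embeddings and traces\<close>

lemma ring_hom_KK:
  assumes "h \<in> Ring.ring_hom (complex_ring\<lparr>carrier := KK\<rparr>) complex_ring"
  shows "\<And>x y. x \<in> KK \<Longrightarrow> y \<in> KK \<Longrightarrow> h (x + y) = h x + h y"
    "\<And>x y. x \<in> KK \<Longrightarrow> y \<in> KK \<Longrightarrow> h (x * y) = h x * h y" "h 1 = 1"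
  using assms by (auto simp: Ring.ring_hom_def complex_ring_simps)

lemma cube_roots_of_unity:
  fixes q :: complex
  assumes "q ^ 3 = 1"
  shows "q = 1 \<or> q = omega \<or> q = - 1 - omega"
proof -
  have "(q - 1) * ((q - omega) * (q - (- 1 - omega))) = q ^ 3 - 1 + (omega * omega + omega + 1) * (1 - q)"
    by (simp add: power3_eq_cube algebra_simps)
  then have "(q - 1) * ((q - omega) * (q - (- 1 - omega))) = 0" using assms omega_sq' by simp
  then show ?thesis by auto
qed

lemma omega_distinct: "omega \<noteq> 1" "omega \<noteq> - 1 - omega" "- 1 - omega \<noteq> 1"
  by (auto simp: omega_def complex_eq_iff)

lemma t1_nonzero: "t1 \<noteq> 0" using r_pos by (simp add: t1_def)

lemma cnj_el': "cnj (el' x y z) = of_rat x + of_rat y * ((- 1 - omega) * t1) + of_rat z * (omega * t2)"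
proof -
  have cr: "cnj (of_rat r) = of_rat r" for r :: rat by (cases r) (simp add: of_rat_rat)
  have c: "cnj t1 = t1" "cnj t2 = t2" by (simp_all add: t1_def t2_def)
  show ?thesis by (simp add: el'_def cr c omega_cnj)
qed

text \<open>An embedding fixes the rationals and multiplies \<open>t1\<close> by some
  \<open>q\<close>; the relations among \<open>t1\<close> and \<open>t2\<close> then force the
  factor \<open>q * q\<close> on \<open>t2\<close> and \<open>q ^ 3 = 1\<close>.\<close>

lemma embedding_KK:
  assumes h: "h \<in> Ring.ring_hom (complex_ring\<lparr>carrier := KK\<rparr>) complex_ring"
  shows "(\<forall>w\<in>KK. h w = w) \<or> (\<forall>w\<in>KK. h w = sg w) \<or> (\<forall>w\<in>KK. h w = cnj (sg w))"
proof -
  note H = ring_hom_KK[OF h]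
  have K1: "1 \<in> KK" and K0: "0 \<in> KK" using of_nat_in_KK[of 1] of_nat_in_KK[of 0] by simp_all
  have h0: "h 0 = 0" using H(1)[OF K0 K0] by simp
  have hneg: "h (- x) = - h x" if "x \<in> KK" for x
    using H(1)[OF that KK_minus[OF that]] h0 by (simp add: eq_neg_iff_add_eq_0 add.commute)
  have hn: "h (of_nat n) = of_nat n" for n
    by (induction n) (use H(1)[OF K1 of_nat_in_KK] H(3) h0 in auto)
  have hi: "h (of_int n) = of_int n" for n
    using hn hneg[OF of_nat_in_KK] by (cases n rule: int_cases2) auto
  have hr: "h (of_rat r) = of_rat r" for r
  proof -
    obtain m n where r: "r = Rat.Fract m n" "n > 0" by (cases r) auto
    have e: "of_rat r * of_int n = (of_int m :: complex)" using r by (simp add: of_rat_rat)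
    have "h (of_rat r) * of_int n = h (of_rat r * of_int n)"
      using H(2)[OF of_rat_in_KK of_int_in_KK, of r n] hi[of n] by simp
    also have "\<dots> = of_rat r * of_int n" unfolding e by (rule hi)
    finally show ?thesis using r by simp
  qed
  have tK: "t1 \<in> KK" "t2 \<in> KK" by (simp_all add: t_el el_in_KK)
  define q where "q = h t1 / t1"
  have ht1: "h t1 = q * t1" using t1_nonzero by (simp add: q_def)
  have "of_int b * h t2 = h (of_int b * t2)" using H(2)[OF of_int_in_KK tK(2)] hi by simp
  also have "\<dots> = h t1 * h t1" using H(2)[OF tK(1) tK(1)] t_rels(1) by simp
  also have "\<dots> = of_int b * (q * q * t2)" using t_rels(1) ht1 by (simp add: algebra_simps)
  finally have ht2: "h t2 = q * q * t2" using b_pos by simp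
  have "h t1 * h t2 = h (t1 * t2)" using H(2)[OF tK] by simp
  also have "\<dots> = t1 * t2" unfolding t_rels(3) using hi[of "a * b"] by simp
  finally have "(q * q * q) * (t1 * t2) = 1 * (t1 * t2)" unfolding ht1 ht2 by (simp add: algebra_simps)
  moreover have "t1 * t2 \<noteq> 0" using t_rels(3) a_pos b_pos by simp
  ultimately have "q ^ 3 = 1" by (simp add: power3_eq_cube)
  then have q: "q = 1 \<or> q = omega \<or> q = - 1 - omega" by (rule cube_roots_of_unity)
  have hel: "h (el x y z) = of_rat x + of_rat y * (q * t1) + of_rat z * (q * q * t2)" for x y z
    unfolding el_def using H(1,2) hr ht1 ht2 tK of_rat_in_KK by (simp add: KK_mult KK_add)
  have s: "(- 1 - omega) * (- 1 - omega) = omega" using omega_sq' by (simp add: algebra_simps)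
  from q show ?thesis
  proof (elim disjE)
    assume q: "q = 1"
    have "h w = w" if "w \<in> KK" for w using that by (rule KK_E) (simp only: hel q, simp add: el_def)
    then show ?thesis by blast
  next
    assume q: "q = omega"
    have "h w = sg w" if "w \<in> KK" for w using that by (rule KK_E) (simp only: hel q sg_el, simp add: el'_def omega_sq')
    then show ?thesis by blast
  next
    assume q: "q = - 1 - omega"
    have "h w = cnj (sg w)" if "w \<in> KK" for w using that by (rule KK_E) (simp only: hel q sg_el cnj_el' s)
    then show ?thesis by blast
  qed
qed

lemma embeddings_KK:
  "embeddings KK = {restrict (\<lambda>w. w) KK, restrict sg KK, restrict (\<lambda>w. cnj (sg w)) KK}" (is "_ = ?E")
proof
  show "embeddings KK \<subseteq> ?E"
  proof
    fix h assume "h \<in> embeddings KK"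
    then have h: "h \<in> Ring.ring_hom (complex_ring\<lparr>carrier := KK\<rparr>) complex_ring" "h \<in> extensional KK"
      by (auto simp: embeddings_def)
    have "h = restrict f KK" if "\<forall>w\<in>KK. h w = f w" for f
      using that h(2) by (intro extensionalityI[of h KK]) auto
    from this[of "\<lambda>w. w"] this[of sg] this[of "\<lambda>w. cnj (sg w)"] show "h \<in> ?E"
      using embedding_KK[OF h(1)] by auto
  qed
  have K1: "1 \<in> KK" using of_nat_in_KK[of 1] by simp
  show "?E \<subseteq> embeddings KK"
    unfolding embeddings_def
    by (auto intro!: ring_hom_memI simp: complex_ring_simps KK_add KK_mult K1 sg_add sg_mult)
qed

lemma field_trace_el: "field_trace KK (el x y z) = of_rat (3 * x)"
proof -
  have tK: "t1 \<in> KK" by (simp add: t_el el_in_KK)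
  have "sg t1 = sg (el 0 1 0)" by (simp only: t_el(1))
  then have st: "sg t1 = omega * t1" by (simp add: el'_def)
  have ct: "cnj (omega * t1) = (- 1 - omega) * t1" by (simp add: omega_cnj t1_def)
  \<comment> \<open>\<open>embeddings KK\<close> is a set, so the trace has three terms only if
    these are pairwise distinct; they differ at \<open>t1\<close>.\<close>
  have d: "restrict (\<lambda>w. w) KK \<noteq> restrict sg KK" "restrict (\<lambda>w. w) KK \<noteq> restrict (\<lambda>w. cnj (sg w)) KK"
    "restrict sg KK \<noteq> restrict (\<lambda>w. cnj (sg w)) KK"
    using t1_nonzero omega_distinct tK by (auto dest!: fun_cong[of _ _ t1] simp: st ct simp del: complex_cnj_mult)
  have "field_trace KK (el x y z) = el x y z + (sg (el x y z) + cnj (sg (el x y z)))"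
    unfolding field_trace_def embeddings_KK using d by (simp add: el_in_KK)
  also have "\<dots> = of_rat (3 * x)"
    unfolding sg_el cnj_el' by (simp add: el_def el'_def of_rat_mult algebra_simps)
  finally show ?thesis .
qed

lemma field_trace_add: "u \<in> KK \<Longrightarrow> v \<in> KK \<Longrightarrow> field_trace KK (u + v) = field_trace KK u + field_trace KK v"
  by (auto elim!: KK_E simp: el_add field_trace_el of_rat_add distrib_left)

lemma field_trace_int: "u \<in> KK \<Longrightarrow> field_trace KK (of_int n * u) = of_int n * field_trace KK u"
  by (auto elim!: KK_E simp: of_int_el el_mult field_trace_el of_rat_mult)

lemma field_trace_0: "field_trace KK 0 = 0"
  using field_trace_el[of 0 0 0] by (simp add: el_def)

lemma KK_sum: "(\<And>i. i \<in> I \<Longrightarrow> f i \<in> KK) \<Longrightarrow> sum f I \<in> KK"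
  by (induction I rule: infinite_finite_induct) (auto intro: KK_add of_nat_in_KK[of 0, simplified])

lemma field_trace_sum: "(\<And>i. i \<in> I \<Longrightarrow> f i \<in> KK) \<Longrightarrow> field_trace KK (sum f I) = (\<Sum>i\<in>I. field_trace KK (f i))"
proof (induction I rule: infinite_finite_induct)
  case (insert i I)
  have "sum f I \<in> KK" using insert.prems by (intro KK_sum) simp
  then show ?case using insert by (simp add: field_trace_add)
qed (simp_all add: field_trace_0)

definition gram :: "nat \<Rightarrow> (nat \<Rightarrow> complex) \<Rightarrow> complex mat" where
  "gram n \<beta> = mat n n (\<lambda>(i, j). field_trace KK (\<beta> i * \<beta> j))"

lemma field_trace_double_sum:
  fixes \<beta> :: "nat \<Rightarrow> complex" and p q :: "nat \<Rightarrow> int"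
  assumes "\<And>j. j < 3 \<Longrightarrow> \<beta> j \<in> KK"
  shows "field_trace KK (\<Sum>j<3. \<Sum>l<3. of_int (p j) * (of_int (q l) * (\<beta> j * \<beta> l)))
    = (\<Sum>j<3. \<Sum>l<3. of_int (p j) * (of_int (q l) * field_trace KK (\<beta> j * \<beta> l)))"
proof -
  have X: "of_int (p j) * (of_int (q l) * (\<beta> j * \<beta> l)) \<in> KK" if "j < 3" "l < 3" for j l
    using assms that by (intro KK_mult of_int_in_KK)
  have "field_trace KK (\<Sum>j<3. \<Sum>l<3. of_int (p j) * (of_int (q l) * (\<beta> j * \<beta> l)))
      = (\<Sum>j<3. field_trace KK (\<Sum>l<3. of_int (p j) * (of_int (q l) * (\<beta> j * \<beta> l))))"
    by (rule field_trace_sum, rule KK_sum, rule X) auto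
  also have "\<dots> = (\<Sum>j<3. \<Sum>l<3. field_trace KK (of_int (p j) * (of_int (q l) * (\<beta> j * \<beta> l))))"
    by (rule sum.cong, rule refl, rule field_trace_sum, rule X) auto
  also have "\<dots> = (\<Sum>j<3. \<Sum>l<3. of_int (p j) * (of_int (q l) * field_trace KK (\<beta> j * \<beta> l)))"
  proof (rule sum.cong[OF refl], rule sum.cong[OF refl])
    fix j l :: nat assume "j \<in> {..<3}" "l \<in> {..<3}"
    then have "\<beta> j * \<beta> l \<in> KK" using assms by (intro KK_mult) auto
    then show "field_trace KK (of_int (p j) * (of_int (q l) * (\<beta> j * \<beta> l))) = of_int (p j) * (of_int (q l) * field_trace KK (\<beta> j * \<beta> l))"
      by (simp only: field_trace_int KK_mult of_int_in_KK)
  qed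
  finally show ?thesis .
qed

lemma gram_change:
  assumes bK: "\<And>j. j < 3 \<Longrightarrow> \<beta> j \<in> KK" and U: "\<And>i. i < 3 \<Longrightarrow> \<beta>' i = (\<Sum>j<3. of_int (U i j) * \<beta> j)"
  shows "gram 3 \<beta>' = map_mat of_int (mat 3 3 (\<lambda>(i, j). U i j)) * gram 3 \<beta> * transpose_mat (map_mat of_int (mat 3 3 (\<lambda>(i, j). U i j)))"
proof (rule eq_matI)
  define C where "C = map_mat (of_int :: int \<Rightarrow> complex) (mat 3 3 (\<lambda>(i, j). U i j))"
  have C: "C \<in> carrier_mat 3 3" "\<And>i j. i < 3 \<Longrightarrow> j < 3 \<Longrightarrow> C $$ (i, j) = of_int (U i j)" by (auto simp: C_def)
  have G: "gram 3 \<beta> \<in> carrier_mat 3 3" by (simp add: gram_def)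
  fix i k assume "i < dim_row (map_mat (of_int :: int \<Rightarrow> complex) (mat 3 3 (\<lambda>(i, j). U i j)) * gram 3 \<beta> * transpose_mat (map_mat of_int (mat 3 3 (\<lambda>(i, j). U i j))))"
    "k < dim_col (map_mat (of_int :: int \<Rightarrow> complex) (mat 3 3 (\<lambda>(i, j). U i j)) * gram 3 \<beta> * transpose_mat (map_mat of_int (mat 3 3 (\<lambda>(i, j). U i j))))"
  then have ik: "i < 3" "k < 3" by auto
  have "\<beta>' i * \<beta>' k = (\<Sum>j<3. \<Sum>l<3. of_int (U i j) * (of_int (U k l) * (\<beta> j * \<beta> l)))"
    unfolding U[OF ik(1)] U[OF ik(2)] sum_product by (intro sum.cong refl) (simp add: mult_ac)
  then have "field_trace KK (\<beta>' i * \<beta>' k) = (\<Sum>j<3. \<Sum>l<3. of_int (U i j) * (of_int (U k l) * field_trace KK (\<beta> j * \<beta> l)))"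
    using field_trace_double_sum[where p = "U i" and q = "U k", OF bK] by (simp only:)
  moreover have "(C * gram 3 \<beta> * transpose_mat C) $$ (i, k)
      = (\<Sum>j\<in>{0..<3}. C $$ (i, j) * (\<Sum>l\<in>{0..<3}. gram 3 \<beta> $$ (j, l) * C $$ (k, l)))"
    using ik C(1) G by (simp add: scalar_prod_def)
  ultimately have "field_trace KK (\<beta>' i * \<beta>' k) = (C * gram 3 \<beta> * transpose_mat C) $$ (i, k)"
    using ik by (simp add: C(2) gram_def lessThan_atLeast0 sum_distrib_left mult_ac)
  then show "gram 3 \<beta>' $$ (i, k) = (map_mat of_int (mat 3 3 (\<lambda>(i, j). U i j)) * gram 3 \<beta> * transpose_mat (map_mat of_int (mat 3 3 (\<lambda>(i, j). U i j)))) $$ (i, k)"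
    using ik by (simp only: gram_def[of 3 "\<beta>'"] C_def) simp
qed (auto simp: gram_def)

text \<open>\<open>discriminant\<close> is a definite description over all ranks and all bases, so
  the rank has to be shown unique together with the determinant. The two matrices of base change are
  inverse to each other and integral, so their determinants are 1 or -1.\<close>

lemma integral_basis_unique:
  assumes "integral_basis KK 3 \<beta>" "integral_basis KK n \<beta>'"
  shows "n = 3 \<and> det (gram n \<beta>') = det (gram 3 \<beta>)"
proof -
  have im: "(\<lambda>c. \<Sum>i<m. of_int (c i) * f i) ` ({..<m} \<rightarrow>\<^sub>E (UNIV :: int set)) = OK" if "integral_basis KK m f" for m f
    using that unfolding integral_basis_def by (rule bij_betw_imp_surj_on)
  have coord: "\<exists>c. w = (\<Sum>i<m. of_int (c i) * f i)" if f: "integral_basis KK m f" "w \<in> OK" for m f w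
  proof -
    have "w \<in> (\<lambda>c. \<Sum>i<m. of_int (c i) * f i) ` ({..<m} \<rightarrow>\<^sub>E (UNIV :: int set))" unfolding im[OF f(1)] by (rule f(2))
    then show ?thesis by (elim imageE) (rule exI)
  qed
  have in_OK: "f i \<in> OK" if f: "integral_basis KK m f" "i < m" for m f i
  proof -
    have "(\<Sum>j<m. of_int ((\<lambda>j\<in>{..<m}. if j = i then 1 else 0) j) * f j) \<in> OK"
      unfolding im[OF f(1), symmetric] by (rule image_eqI[OF refl], rule PiE_I) simp_all
    also have "(\<Sum>j<m. of_int ((\<lambda>j\<in>{..<m}. if j = i then 1 else 0) j) * f j) = (\<Sum>j<m. if j = i then f j else 0)"
      by (intro sum.cong) auto
    also have "\<dots> = f i" using f(2) by simp
    finally show ?thesis .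
  qed
  have uniq: "c i = d i" if f: "integral_basis KK m f" and eq: "(\<Sum>i<m. of_int (c i) * f i) = (\<Sum>i<m. of_int (d i) * f i)" and i: "i < m" for m f c d i
  proof -
    have inj: "inj_on (\<lambda>c. \<Sum>i<m. of_int (c i) * f i) ({..<m} \<rightarrow>\<^sub>E (UNIV :: int set))"
      using f by (simp add: integral_basis_def bij_betw_def)
    have eq': "(\<Sum>i<m. of_int (restrict c {..<m} i) * f i) = (\<Sum>i<m. of_int (restrict d {..<m} i) * f i)"
      using eq by simp
    have "restrict c {..<m} = restrict d {..<m}" using inj_onD[OF inj, of "restrict c {..<m}" "restrict d {..<m}"] eq' by simp
    then show ?thesis using i by (metis lessThan_iff restrict_apply')
  qed
  have "\<exists>c. i < n \<longrightarrow> \<beta>' i = (\<Sum>j<3. of_int (c j) * \<beta> j)" for i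
    using coord[OF assms(1) in_OK[OF assms(2), of i]] by (cases "i < n") auto
  then have "\<forall>i. \<exists>c. i < n \<longrightarrow> \<beta>' i = (\<Sum>j<3. of_int (c j) * \<beta> j)" ..
  from choice[OF this] obtain U where U: "\<forall>i. i < n \<longrightarrow> \<beta>' i = (\<Sum>j<3. of_int (U i j) * \<beta> j)" ..
  have "\<exists>c. i < 3 \<longrightarrow> \<beta> i = (\<Sum>j<n. of_int (c j) * \<beta>' j)" for i
    using coord[OF assms(2) in_OK[OF assms(1), of i]] by (cases "i < 3") auto
  then have "\<forall>i. \<exists>c. i < 3 \<longrightarrow> \<beta> i = (\<Sum>j<n. of_int (c j) * \<beta>' j)" ..
  from choice[OF this] obtain V where V: "\<forall>i. i < 3 \<longrightarrow> \<beta> i = (\<Sum>j<n. of_int (V i j) * \<beta>' j)" ..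
  note U = U[rule_format] and V = V[rule_format]
  have UV: "(\<Sum>j<3. U i j * V j k) = (if i = k then 1 else 0)" if "i < n" "k < n" for i k
  proof (rule uniq[OF assms(2) _ that(2), of "\<lambda>k. \<Sum>j<3. U i j * V j k" "\<lambda>k. if i = k then 1 else 0"])
    have "\<beta>' i = (\<Sum>j<3. of_int (U i j) * (\<Sum>k<n. of_int (V j k) * \<beta>' k))"
      unfolding U[OF that(1)] by (intro sum.cong refl arg_cong2[where f = "(*)"] V) simp
    also have "\<dots> = (\<Sum>j<3. \<Sum>k<n. of_int (U i j) * (of_int (V j k) * \<beta>' k))" by (simp add: sum_distrib_left)
    also have "\<dots> = (\<Sum>k<n. of_int (\<Sum>j<3. U i j * V j k) * \<beta>' k)"
      by (subst sum.swap) (simp add: sum_distrib_right mult.assoc)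
    also have "\<beta>' i = (\<Sum>k<n. if i = k then \<beta>' k else 0)" using that(1) by simp
    also have "\<dots> = (\<Sum>k<n. of_int (if i = k then 1 else 0) * \<beta>' k)" by (intro sum.cong) auto
    finally show "(\<Sum>k<n. of_int (\<Sum>j<3. U i j * V j k) * \<beta>' k) = (\<Sum>k<n. of_int (if i = k then 1 else 0) * \<beta>' k)" ..
  qed
  have VU: "(\<Sum>j<n. V i j * U j k) = (if i = k then 1 else 0)" if "i < 3" "k < 3" for i k
  proof (rule uniq[OF assms(1) _ that(2), of "\<lambda>k. \<Sum>j<n. V i j * U j k" "\<lambda>k. if i = k then 1 else 0"])
    have "\<beta> i = (\<Sum>j<n. of_int (V i j) * (\<Sum>k<3. of_int (U j k) * \<beta> k))"
      unfolding V[OF that(1)] by (intro sum.cong refl arg_cong2[where f = "(*)"] U) simp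
    also have "\<dots> = (\<Sum>j<n. \<Sum>k<3. of_int (V i j) * (of_int (U j k) * \<beta> k))" by (simp add: sum_distrib_left)
    also have "\<dots> = (\<Sum>k<3. of_int (\<Sum>j<n. V i j * U j k) * \<beta> k)"
      by (subst sum.swap) (simp add: sum_distrib_right mult.assoc)
    also have "\<beta> i = (\<Sum>k<3. if i = k then \<beta> k else 0)" using that(1) by simp
    also have "\<dots> = (\<Sum>k<3. of_int (if i = k then 1 else 0) * \<beta> k)" by (intro sum.cong) auto
    finally show "(\<Sum>k<3. of_int (\<Sum>j<n. V i j * U j k) * \<beta> k) = (\<Sum>k<3. of_int (if i = k then 1 else 0) * \<beta> k)" ..
  qed
  text \<open>Comparing the traces of \<open>U V\<close> and \<open>V U\<close> gives the equality of ranks.\<close>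
  have "int n = (\<Sum>i<n. \<Sum>j<3. U i j * V j i)" using UV by simp
  also have "\<dots> = (\<Sum>j<3. \<Sum>i<n. V j i * U i j)" by (subst sum.swap) (simp add: mult.commute)
  also have "\<dots> = int 3" using VU by simp
  finally have n: "n = 3" by linarith
  define A B where "A = mat 3 3 (\<lambda>(i, j). U i j)" and "B = mat 3 3 (\<lambda>(i, j). V i j)"
  have AB: "A \<in> carrier_mat 3 3" "B \<in> carrier_mat 3 3" by (auto simp: A_def B_def)
  have "A * B = 1\<^sub>m 3"
    using UV by (intro eq_matI) (auto simp: A_def B_def n scalar_prod_def simp flip: lessThan_atLeast0)
  then have "det A * det B = 1" using det_mult[OF AB] by simp
  then have "det A = 1 \<or> det A = - 1" using zmult_eq_1_iff[of "det A" "det B"] by blast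
  then have dA: "det A * det A = 1" by auto
  define C where "C = map_mat (of_int :: int \<Rightarrow> complex) A"
  have C: "C \<in> carrier_mat 3 3" using AB by (simp add: C_def)
  have "det C = of_int (det A)" unfolding C_def by (rule of_int_hom.hom_det)
  then have dC: "det C * det C = 1" using dA by (metis of_int_1 of_int_mult)
  have G: "gram 3 \<beta> \<in> carrier_mat 3 3" by (simp add: gram_def)
  have bK: "\<beta> j \<in> KK" if "j < 3" for j using in_OK[OF assms(1) that] by (rule OK_KK)
  have "gram 3 \<beta>' = C * gram 3 \<beta> * transpose_mat C"
    unfolding C_def A_def using U n bK by (intro gram_change) auto
  then have "det (gram 3 \<beta>') = det C * det (gram 3 \<beta>) * det C"
    using C G by (simp add: det_mult[of _ 3] det_transpose)
  also have "\<dots> = det (gram 3 \<beta>)" using dC by (simp add: mult.commute mult.left_commute)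
  finally show ?thesis using n by simp
qed

text \<open>In a triangular basis with diagonal \<open>c / 3\<close>, \<open>e / 3\<close>,
  \<open>g / 3\<close> the Gram determinant is \<open>- 27 (a b)^2\<close>, the discriminant of
  \<open>1, t1, t2\<close>, times the square of \<open>c e g / 27\<close>. Positivity of the
  integers \<open>c\<close>, \<open>e\<close>, \<open>g\<close> is enough, so their values need not
  be found.\<close>

theorem discriminant_bound: "of_int (a * b) ^ 2 \<le> 27 * \<bar>real_of_int (discriminant KK)\<bar>"
proof -
  obtain c e g u v w where cp: "c > 0" "e > 0" "g > 0" and
    B: "OK = {of_int i * el (of_int c / 3) 0 0 + of_int j * el (of_int u / 3) (of_int e / 3) 0
          + of_int k * el (of_int v / 3) (of_int w / 3) (of_int g / 3) | i j k. True}"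
    by (rule triangular_basis[of OK 1]) (use OZ_subset_OK in \<open>auto intro: OS.diff_in\<close>)
  define B0 B1 B2 where "B0 = el (of_int c / 3) 0 0" and "B1 = el (of_int u / 3) (of_int e / 3) 0"
    and "B2 = el (of_int v / 3) (of_int w / 3) (of_int g / 3)"
  define f where "f i = (if i = 0 then B0 else if i = 1 then B1 else B2)" for i :: nat
  have comb: "of_int i * B0 + of_int j * B1 + of_int k * B2 =
      el (of_int (i * c + j * u + k * v) / 3) (of_int (j * e + k * w) / 3) (of_int (k * g) / 3)" for i j k
    by (simp add: B0_def B1_def B2_def of_int_el el_mult el_add add_divide_distrib)
  have sum: "(\<Sum>i<3. of_int (h i) * f i) = of_int (h 0) * B0 + of_int (h 1) * B1 + of_int (h 2) * B2" for h :: "nat \<Rightarrow> int"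
    by (simp add: f_def numeral_3_eq_3) (simp add: numeral_2_eq_2)
  have basis: "integral_basis KK 3 f"
    unfolding integral_basis_def
  proof (rule bij_betw_imageI)
    show "inj_on (\<lambda>c. \<Sum>i<3. of_int (c i) * f i) ({..<3} \<rightarrow>\<^sub>E (UNIV :: int set))"
    proof (rule inj_onI)
      fix h h' :: "nat \<Rightarrow> int" assume h: "h \<in> {..<3} \<rightarrow>\<^sub>E UNIV" "h' \<in> {..<3} \<rightarrow>\<^sub>E UNIV"
        and "(\<Sum>i<3. of_int (h i) * f i) = (\<Sum>i<3. of_int (h' i) * f i)"
      then have "h 2 * g = h' 2 * g" "h 1 * e + h 2 * w = h' 1 * e + h' 2 * w"
        "h 0 * c + h 1 * u + h 2 * v = h' 0 * c + h' 1 * u + h' 2 * v"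
        unfolding sum comb el_eq_iff by (simp_all del: of_int_mult of_int_add)
      then have "h 2 = h' 2" "h 1 = h' 1" "h 0 = h' 0" using cp by auto
      moreover have "i = 0 \<or> i = 1 \<or> i = 2" if "i \<in> {..<3}" for i :: nat using that by auto
      ultimately show "h = h'" using h by (intro PiE_ext[OF h]) metis
    qed
    show "(\<lambda>c. \<Sum>i<3. of_int (c i) * f i) ` ({..<3} \<rightarrow>\<^sub>E (UNIV :: int set)) = OK"
    proof
      show "(\<lambda>c. \<Sum>i<3. of_int (c i) * f i) ` ({..<3} \<rightarrow>\<^sub>E (UNIV :: int set)) \<subseteq> OK"
        unfolding sum B B0_def B1_def B2_def by blast
      show "OK \<subseteq> (\<lambda>c. \<Sum>i<3. of_int (c i) * f i) ` ({..<3} \<rightarrow>\<^sub>E (UNIV :: int set))"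
      proof
        fix x assume "x \<in> OK"
        then obtain i j k where x: "x = of_int i * B0 + of_int j * B1 + of_int k * B2"
          unfolding B B0_def B1_def B2_def by blast
        define h :: "nat \<Rightarrow> int" where "h = (\<lambda>n\<in>{..<3}. if n = 0 then i else if n = 1 then j else k)"
        have "x = (\<Sum>n<3. of_int (h n) * f n)" unfolding sum x by (simp add: h_def)
        moreover have "h \<in> {..<3} \<rightarrow>\<^sub>E UNIV" by (simp add: h_def)
        ultimately show "x \<in> (\<lambda>c. \<Sum>i<3. of_int (c i) * f i) ` ({..<3} \<rightarrow>\<^sub>E (UNIV :: int set))" by blast
      qed
    qed
  qed
  define q :: rat where "q = of_int (a * b * c * e * g)"
  have det: "det (gram 3 f) = of_rat (- (q ^ 2 / 27))"
  proof -
    have T: "field_trace KK (B0 * B0) = of_rat (of_int (c * c) / 3)" "field_trace KK (B0 * B1) = of_rat (of_int (c * u) / 3)"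
      "field_trace KK (B0 * B2) = of_rat (of_int (c * v) / 3)" "field_trace KK (B1 * B1) = of_rat (of_int (u * u) / 3)"
      "field_trace KK (B1 * B2) = of_rat (of_int (u * v + a * b * e * g) / 3)"
      "field_trace KK (B2 * B2) = of_rat (of_int (v * v + 2 * a * b * w * g) / 3)"
      unfolding B0_def B1_def B2_def el_mult field_trace_el by (simp_all add: field_simps)
    have s: "B1 * B0 = B0 * B1" "B2 * B0 = B0 * B2" "B2 * B1 = B1 * B2" by simp_all
    have "det (gram 3 f) = of_rat (of_int (c * c) / 3 * (of_int (u * u) / 3 * (of_int (v * v + 2 * a * b * w * g) / 3)
          - of_int (u * v + a * b * e * g) / 3 * (of_int (u * v + a * b * e * g) / 3))
        - of_int (c * u) / 3 * (of_int (c * u) / 3 * (of_int (v * v + 2 * a * b * w * g) / 3) - of_int (u * v + a * b * e * g) / 3 * (of_int (c * v) / 3))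
        + of_int (c * v) / 3 * (of_int (c * u) / 3 * (of_int (u * v + a * b * e * g) / 3) - of_int (u * u) / 3 * (of_int (c * v) / 3)))"
      unfolding gram_def det_mat_3 of_rat_add of_rat_diff of_rat_mult T[symmetric]
      by (simp add: f_def s)
    also have "of_int (c * c) / 3 * (of_int (u * u) / 3 * (of_int (v * v + 2 * a * b * w * g) / 3)
          - of_int (u * v + a * b * e * g) / 3 * (of_int (u * v + a * b * e * g) / 3))
        - of_int (c * u) / 3 * (of_int (c * u) / 3 * (of_int (v * v + 2 * a * b * w * g) / 3) - of_int (u * v + a * b * e * g) / 3 * (of_int (c * v) / 3))
        + of_int (c * v) / 3 * (of_int (c * u) / 3 * (of_int (u * v + a * b * e * g) / 3) - of_int (u * u) / 3 * (of_int (c * v) / 3)) = - (q ^ 2 / 27)"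
      unfolding q_def by (simp add: power2_eq_square) (simp add: field_simps)
    finally show ?thesis .
  qed
  have fOK: "f i \<in> OK" for i
  proof -
    have "of_int 1 * B0 + of_int 0 * B1 + of_int 0 * B2 \<in> OK" "of_int 0 * B0 + of_int 1 * B1 + of_int 0 * B2 \<in> OK"
      "of_int 0 * B0 + of_int 0 * B1 + of_int 1 * B2 \<in> OK" unfolding B B0_def B1_def B2_def by blast+
    then show ?thesis by (simp add: f_def)
  qed
  have tr: "\<exists>n. field_trace KK x = of_int n" if xO: "x \<in> OK" for x
  proof -
    obtain r s t where x: "x = el r s t" using OK_KK[OF xO] by (rule KK_E)
    then have "3 * r \<in> \<int>" using trace_int xO by simp
    then obtain n where "3 * r = of_int n" by (rule Ints_cases)
    then show ?thesis unfolding x field_trace_el by (intro exI[of _ n]) simp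
  qed
  then have "\<forall>p. \<exists>n. field_trace KK (f (fst p) * f (snd p)) = of_int n" using OK_mult[OF fOK fOK] by simp
  from choice[OF this] obtain T where T: "\<And>p. field_trace KK (f (fst p) * f (snd p)) = of_int (T p)" by blast
  define D where "D = det (mat 3 3 T)"
  have "gram 3 f = map_mat of_int (mat 3 3 T)"
    by (rule eq_matI) (use T[of "(_, _)"] in \<open>auto simp: gram_def\<close>)
  then have D: "of_int D = det (gram 3 f)" by (simp add: D_def of_int_hom.hom_det)
  have "discriminant KK = D"
    unfolding discriminant_def gram_def[symmetric]
  proof (rule the_equality)
    show "\<exists>n \<beta>. integral_basis KK n \<beta> \<and> of_int D = det (gram n \<beta>)"
      by (rule exI[of _ 3], rule exI[of _ f]) (simp add: basis D)
    fix D' assume "\<exists>n \<beta>. integral_basis KK n \<beta> \<and> of_int D' = det (gram n \<beta>)"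
    then obtain n \<beta> where "integral_basis KK n \<beta>" "of_int D' = det (gram n \<beta>)" by blast
    then have "of_int D' = (of_int D :: complex)" using integral_basis_unique[OF basis] D by metis
    then show "D' = D" by simp
  qed
  moreover have "27 * D = - ((a * b * c * e * g) ^ 2)"
  proof -
    have "of_rat (of_int (27 * D)) = (of_rat (- (q ^ 2)) :: complex)"
      using D det by (simp add: of_rat_mult of_rat_divide of_rat_minus)
    then have "of_int (27 * D) = - (q ^ 2)" by (simp only: of_rat_eq_iff)
    also have "- (q ^ 2) = of_int (- ((a * b * c * e * g) ^ 2))" by (simp add: q_def)
    finally show ?thesis by (simp only: of_int_eq_iff)
  qed
  moreover have "(a * b) ^ 2 \<le> (a * b * c * e * g) ^ 2"
  proof (rule power_mono)
    have "1 \<le> c * e * g" using cp by (simp add: int_one_le_iff_zero_less)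
    then have "a * b * 1 \<le> a * b * (c * e * g)" using ab_gt_1 by (intro mult_left_mono) auto
    then show "a * b \<le> a * b * c * e * g" by (simp add: mult.assoc)
  qed (use ab_gt_1 in simp)
  ultimately have "(a * b) ^ 2 \<le> 27 * \<bar>discriminant KK\<bar>" by linarith
  then have "real_of_int ((a * b) ^ 2) \<le> real_of_int (27 * \<bar>discriminant KK\<bar>)" by (simp only: of_int_le_iff)
  then show ?thesis by simp
qed

end

subsection \<open>Reduction of fractional ideals\<close>

context subring_set
begin

text \<open>Lagrange's theorem for the quotient of \<open>A\<close> by \<open>B\<close>: translation
  by \<open>w\<close> permutes a maximal system of incongruent elements modulo \<open>B\<close>, and
  summing over the system leaves \<open>n * w\<close>.\<close>

lemma exponent_of_quotient:
  assumes A: "submod A" and B: "submod B"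
    and bound: "\<And>S. S \<subseteq> A \<Longrightarrow> (\<And>x y. x \<in> S \<Longrightarrow> y \<in> S \<Longrightarrow> x - y \<in> B \<Longrightarrow> x = y) \<Longrightarrow> finite S \<and> card S \<le> M"
  obtains n where "n > 0" "n \<le> M" "\<And>w. w \<in> A \<Longrightarrow> of_nat n * w \<in> B"
proof -
  define Z where "Z S \<longleftrightarrow> S \<subseteq> A \<and> (\<forall>x\<in>S. \<forall>y\<in>S. x - y \<in> B \<longrightarrow> x = y)" for S
  have b: "finite S \<and> card S \<le> M" if "Z S" for S
    using bound[of S] that unfolding Z_def by simp
  have "Z {0}" using submod_zero[OF A] by (simp add: Z_def)
  moreover have "\<forall>S. Z S \<longrightarrow> card S < Suc M" using b by (simp add: less_Suc_eq_le)
  ultimately have "\<exists>S. Z S \<and> (\<forall>T. Z T \<longrightarrow> card T \<le> card S)" by (rule ex_has_greatest_nat)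
  then obtain S where S: "Z S" "\<forall>T. Z T \<longrightarrow> card T \<le> card S" by (elim exE conjE)
  have fin: "finite S" using b S(1) by simp
  have cov: "\<exists>s\<in>S. x - s \<in> B" if x: "x \<in> A" for x
  proof (rule ccontr)
    assume n: "\<not> ?thesis"
    then have "x \<notin> S" using submod_zero[OF B] by auto
    have "y - x \<notin> B" if "y \<in> S" for y
    proof
      assume "y - x \<in> B"
      then have "- (y - x) \<in> B" by (rule submod_minus[OF B])
      then show False using n that by simp
    qed
    then have "Z (insert x S)" using S(1) n x unfolding Z_def by auto
    then have "card (insert x S) \<le> card S" using S(2) by simp
    then show False using fin \<open>x \<notin> S\<close> by simp
  qed
  have inc: "s = t" if "s \<in> S" "t \<in> S" "s - t \<in> B" for s t using S(1) that unfolding Z_def by simp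
  have SA: "s \<in> A" if "s \<in> S" for s using S(1) that unfolding Z_def by auto
  have "of_nat (card S) * w \<in> B" if w: "w \<in> A" for w
  proof -
    have "\<forall>s\<in>S. \<exists>t. t \<in> S \<and> s + w - t \<in> B"
    proof
      fix s assume "s \<in> S"
      from cov[OF submod_add[OF A SA[OF this] w]] show "\<exists>t. t \<in> S \<and> s + w - t \<in> B" by (simp add: Bex_def)
    qed
    from bchoice[OF this] obtain f where f: "\<forall>s\<in>S. f s \<in> S \<and> s + w - f s \<in> B" ..
    have "inj_on f S"
    proof (rule inj_onI)
      fix s t assume st: "s \<in> S" "t \<in> S" "f s = f t"
      then have "s + w - f s \<in> B" "t + w - f t \<in> B" using bspec[OF f st(1)] bspec[OF f st(2)] by blast+
      then have "(s + w - f s) - (t + w - f t) \<in> B" by (rule submod_diff[OF B])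
      then have "s - t \<in> B" using st(3) by simp
      then show "s = t" using inc st by simp
    qed
    then have "f ` S = S" using fin f by (intro endo_inj_surj) auto
    have "(\<Sum>s\<in>S. s + w - f s) \<in> B" using f by (intro submod_sum[OF B]) auto
    also have "(\<Sum>s\<in>S. s + w - f s) = (\<Sum>s\<in>S. s) + of_nat (card S) * w - (\<Sum>s\<in>S. f s)"
      by (simp add: sum_subtractf sum.distrib)
    also have "(\<Sum>s\<in>S. f s) = (\<Sum>s\<in>S. s)"
      using sum.reindex[OF \<open>inj_on f S\<close>, of "\<lambda>s. s"] \<open>f ` S = S\<close> by simp
    finally show ?thesis by simp
  qed
  moreover have "card S > 0" using cov[OF submod_zero[OF A]] fin by (auto simp: card_gt_0_iff)
  ultimately show ?thesis using that[of "card S"] b[OF S(1)] by simp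
qed

end

lemma frac_floor_close:
  fixes x y :: real and K :: nat
  assumes "K > 0" "\<lfloor>of_nat K * frac x\<rfloor> = \<lfloor>of_nat K * frac y\<rfloor>"
  shows "\<bar>frac x - frac y\<bar> < 1 / of_nat K"
proof -
  have "\<bar>of_nat K * frac x - of_nat K * frac y\<bar> < 1" using assms(2) by linarith
  then have "of_nat K * \<bar>frac x - frac y\<bar> < 1"
    by (simp add: abs_mult flip: right_diff_distrib)
  then show ?thesis using assms(1) by (simp add: field_simps)
qed

context pure_cubic
begin

section \<open>Minimal vectors of fractional ideals\<close>

lemma norm_t: "norm t1 = r1" "norm t2 = r2"
  using r_pos by (simp_all add: t1_def t2_def)

lemma norm_of_rat: "norm (of_rat r :: complex) = \<bar>of_rat r\<bar>"
  by (cases r) (simp add: of_rat_rat norm_divide)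

lemma norm_el_le: "norm (el x y z) \<le> \<bar>of_rat x\<bar> + \<bar>of_rat y\<bar> * r1 + \<bar>of_rat z\<bar> * r2"
  unfolding el_def by (intro order_trans[OF norm_triangle_ineq] add_mono) (simp_all add: norm_mult norm_t norm_of_rat)

lemma norm_el'_le: "norm (el' x y z) \<le> \<bar>of_rat x\<bar> + \<bar>of_rat y\<bar> * r1 + \<bar>of_rat z\<bar> * r2"
  unfolding el'_def
  by (intro order_trans[OF norm_triangle_ineq] add_mono)
    (simp_all add: norm_mult norm_t norm_of_rat omega_norm omega_sq_norm)

text \<open>Each coordinate is recovered by averaging the three conjugates against cube roots of
  unity, which have absolute value 1.\<close>

lemma coords_bound:
  assumes "norm (el x y z) \<le> B" "norm (el' x y z) \<le> B"
  shows "\<bar>of_rat x\<bar> \<le> B" "\<bar>of_rat y\<bar> * r1 \<le> B" "\<bar>of_rat z\<bar> * r2 \<le> B"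
proof -
  let ?w = "el x y z" and ?s = "el' x y z"
  have o: "omega * (omega * w) = - w - omega * w" for w
    by (simp only: mult.assoc[symmetric] omega_sq' left_diff_distrib) simp
  define xx yy zz where "xx = (of_rat x :: complex)" and "yy = of_rat y * t1" and "zz = of_rat z * t2"
  have E: "?w = xx + yy + zz" by (simp add: el_def xx_def yy_def zz_def)
  have S: "?s = xx + omega * yy + (- 1 - omega) * zz" by (simp add: el'_def xx_def yy_def zz_def mult.left_commute)
  have C: "cnj ?s = xx + (- 1 - omega) * yy + omega * zz" by (simp add: cnj_el' xx_def yy_def zz_def mult.left_commute)
  have e1: "of_rat (3 * x) = ?w + (1 * ?s + 1 * cnj ?s)"
    unfolding C unfolding E S by (simp add: xx_def of_rat_mult algebra_simps)
  have e2: "of_rat (3 * y) * t1 = ?w + ((- 1 - omega) * ?s + omega * cnj ?s)"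
    unfolding C unfolding E S of_rat_mult mult.assoc yy_def[symmetric] by (simp add: algebra_simps omega_sq' o)
  have e3: "of_rat (3 * z) * t2 = ?w + (omega * ?s + (- 1 - omega) * cnj ?s)"
    unfolding C unfolding E S of_rat_mult mult.assoc zz_def[symmetric] by (simp add: algebra_simps omega_sq' o)
  have nb: "norm (?w + (p * ?s + q * cnj ?s)) \<le> 3 * B" if "norm p = 1" "norm q = 1" for p q
  proof -
    have "norm (?w + (p * ?s + q * cnj ?s)) \<le> norm ?w + (norm (p * ?s) + norm (q * cnj ?s))"
      by (meson add_mono_thms_linordered_semiring(2) norm_triangle_ineq order_trans)
    also have "\<dots> \<le> B + (B + B)" using assms that by (intro add_mono) (simp_all add: norm_mult)
    finally show ?thesis by simp
  qed
  have "norm (of_rat (3 * x) :: complex) \<le> 3 * B" unfolding e1 by (rule nb) simp_all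
  moreover have "norm (of_rat (3 * y) * t1) \<le> 3 * B" unfolding e2 by (rule nb) (simp_all add: omega_norm omega_sq_norm)
  moreover have "norm (of_rat (3 * z) * t2) \<le> 3 * B" unfolding e3 by (rule nb) (simp_all add: omega_norm omega_sq_norm)
  ultimately show "\<bar>of_rat x\<bar> \<le> B" "\<bar>of_rat y\<bar> * r1 \<le> B" "\<bar>of_rat z\<bar> * r2 \<le> B"
    by (simp_all add: norm_mult norm_of_rat norm_t of_rat_mult abs_mult)
qed

definition frac_ideal :: "complex set \<Rightarrow> bool" where
  "frac_ideal A \<longleftrightarrow> OS.submod A \<and> A \<subseteq> KK \<and> (\<exists>g>0. \<forall>w\<in>A. of_nat g * w \<in> OK) \<and> (\<exists>w\<in>A. w \<noteq> 0)"

lemma three_OK: "w \<in> OK \<Longrightarrow> 3 * w \<in> OZ"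
proof -
  assume w: "w \<in> OK"
  obtain x y z where e: "w = el x y z" using OK_KK[OF w] by (rule KK_E)
  then obtain i j k where "3 * x = of_int i" "3 * y = of_int j" "3 * z = of_int k"
    using OK_coords[of x y z] w by (auto elim!: Ints_cases)
  then have "3 * w = el (of_int i) (of_int j) (of_int k)"
    unfolding e using el_mult[of 3 0 0 x y z] by (simp add: el_def)
  then show ?thesis unfolding OZ_def by blast
qed

text \<open>Bounded absolute values bound the rational coordinates, which have the common
  denominator \<open>3 * g\<close>.\<close>

lemma finite_bounded:
  assumes "frac_ideal A"
  shows "finite {w \<in> A. norm w \<le> B \<and> norm (sg w) \<le> B}"
proof -
  obtain g where g: "g > 0" "\<forall>w\<in>A. of_nat g * w \<in> OK" using assms unfolding frac_ideal_def by blast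
  define M where "M = \<lceil>3 * real g * B\<rceil>"
  define h where "h = (\<lambda>(i, j, k). el (of_int i / of_nat (3 * g)) (of_int j / of_nat (3 * g)) (of_int k / of_nat (3 * g)))"
  have "{w \<in> A. norm w \<le> B \<and> norm (sg w) \<le> B} \<subseteq> h ` ({- M..M} \<times> {- M..M} \<times> {- M..M})"
  proof
    fix w assume "w \<in> {w \<in> A. norm w \<le> B \<and> norm (sg w) \<le> B}"
    then have w: "w \<in> A" "norm w \<le> B" "norm (sg w) \<le> B" by auto
    have "w \<in> KK" using w assms unfolding frac_ideal_def by blast
    then obtain x y z where e: "w = el x y z" by (rule KK_E)
    have "3 * (of_nat g * w) \<in> OZ" using g w by (intro three_OK) auto
    then obtain i j k where "3 * (of_nat g * w) = el (of_int i) (of_int j) (of_int k)" unfolding OZ_def by blast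
    moreover have "3 * (of_nat g * w) = el (of_nat (3 * g) * x) (of_nat (3 * g) * y) (of_nat (3 * g) * z)"
      unfolding e el_def by (simp add: of_rat_mult algebra_simps)
    ultimately have ijk: "of_nat (3 * g) * x = of_int i" "of_nat (3 * g) * y = of_int j" "of_nat (3 * g) * z = of_int k"
      by (simp_all add: el_eq_iff)
    then have xyz: "x = of_int i / of_nat (3 * g)" "y = of_int j / of_nat (3 * g)" "z = of_int k / of_nat (3 * g)"
      using g(1) by (simp_all add: field_simps)
    have cb: "\<bar>of_rat x\<bar> \<le> B" "\<bar>of_rat y\<bar> * r1 \<le> B" "\<bar>of_rat z\<bar> * r2 \<le> B"
      using w e coords_bound[of x y z B] by simp_all
    have m: "\<bar>u\<bar> \<le> B" if "\<bar>u\<bar> * r \<le> B" "r \<ge> 1" for u r :: real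
      using that mult_left_mono[of 1 r "\<bar>u\<bar>"] by simp
    have "\<bar>real_of_int n\<bar> \<le> 3 * real g * B" if "\<bar>of_rat u\<bar> \<le> B" "of_nat (3 * g) * u = of_int n" for u n
    proof -
      have "real_of_int n = of_rat (of_nat (3 * g) * u)" using that(2) by simp
      also have "\<dots> = 3 * real g * of_rat u" by (simp add: of_rat_mult)
      finally show ?thesis using that(1) g(1) by (simp add: abs_mult)
    qed
    note le = this
    have *: "n \<in> {- M..M}" if "\<bar>of_rat u\<bar> \<le> B" "of_nat (3 * g) * u = of_int n" for u n
    proof -
      have "\<bar>real_of_int n\<bar> \<le> of_int M" using le[OF that] unfolding M_def by linarith
      then show ?thesis by (simp add: abs_le_iff)
    qed
    have "i \<in> {- M..M}" "j \<in> {- M..M}" "k \<in> {- M..M}"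
      using *[OF cb(1) ijk(1)] *[OF m[OF cb(2) r_ge_1(1)] ijk(2)] *[OF m[OF cb(3) r_ge_1(2)] ijk(3)] by simp_all
    then show "w \<in> h ` ({- M..M} \<times> {- M..M} \<times> {- M..M})"
      by (intro image_eqI[of _ _ "(i, j, k)"]) (simp_all add: h_def e xyz)
  qed
  then show ?thesis by (rule finite_subset) simp
qed

definition wnorm :: "real \<Rightarrow> real \<Rightarrow> complex \<Rightarrow> real" where
  "wnorm x y w = max (norm w / x) (norm (sg w) / y)"

text \<open>A minimum of \<open>A\<close> in the sense of reduction theory, for the box norm with
  weights \<open>x\<close> and \<open>y\<close>; the weights normalize the size of the ideal at each
  place.\<close>

definition minvec :: "complex set \<Rightarrow> real \<Rightarrow> real \<Rightarrow> complex \<Rightarrow> bool" where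
  "minvec A x y v \<longleftrightarrow> v \<in> A \<and> v \<noteq> 0 \<and> (\<forall>w\<in>A. w \<noteq> 0 \<longrightarrow> wnorm x y v \<le> wnorm x y w)"

lemma minvec_exists:
  assumes A: "frac_ideal A" and xy: "x > 0" "y > 0"
  obtains v where "minvec A x y v"
proof -
  obtain w0 where w0: "w0 \<in> A" "w0 \<noteq> 0" using A unfolding frac_ideal_def by blast
  define B where "B = wnorm x y w0 * max x y"
  define F where "F = {w \<in> A. w \<noteq> 0 \<and> wnorm x y w \<le> wnorm x y w0}"
  have "F \<subseteq> {w \<in> A. norm w \<le> B \<and> norm (sg w) \<le> B}"
  proof
    fix w assume w: "w \<in> F"
    have w0': "wnorm x y w0 \<ge> 0" using xy by (simp add: wnorm_def le_max_iff_disj)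
    have "norm w / x \<le> wnorm x y w0" "norm (sg w) / y \<le> wnorm x y w0" using w by (auto simp: F_def wnorm_def)
    then have "norm w \<le> wnorm x y w0 * x" "norm (sg w) \<le> wnorm x y w0 * y" using xy by (simp_all add: field_simps)
    moreover have "wnorm x y w0 * x \<le> B" "wnorm x y w0 * y \<le> B"
      unfolding B_def using w0' by (intro mult_left_mono; simp)+
    ultimately show "w \<in> {w \<in> A. norm w \<le> B \<and> norm (sg w) \<le> B}" using w by (auto simp: F_def)
  qed
  then have "finite F" using finite_bounded[OF A] by (rule finite_subset)
  moreover have "F \<noteq> {}" using w0 by (auto simp: F_def)
  ultimately have am: "arg_min_on (wnorm x y) F \<in> F" "\<not> (\<exists>w\<in>F. wnorm x y w < wnorm x y (arg_min_on (wnorm x y) F))"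
    by (rule arg_min_if_finite)+
  define v where "v = arg_min_on (wnorm x y) F"
  have v: "v \<in> F" "\<And>w. w \<in> F \<Longrightarrow> wnorm x y v \<le> wnorm x y w"
    using am by (auto simp: v_def not_less)
  have "wnorm x y v \<le> wnorm x y w" if "w \<in> A" "w \<noteq> 0" for w
  proof (cases "w \<in> F")
    case False
    then have "wnorm x y w0 < wnorm x y w" using that by (auto simp: F_def)
    then show ?thesis using v(1) by (simp add: F_def)
  qed (use v in auto)
  then have "minvec A x y v" using v(1) unfolding minvec_def F_def by blast
  then show ?thesis by (rule that)
qed

lemma minvec_mult:
  assumes A: "OS.submod A" "A \<subseteq> KK" and v: "minvec A x y v" and xy: "x > 0" "y > 0"
    and w: "w \<in> KK" "w \<noteq> 0" "v * w \<in> A"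
  shows "norm w \<ge> 1 \<or> norm (sg w) \<ge> 1"
    and "norm v / x \<le> wnorm x y (v * w)" "norm (sg v) / y \<le> wnorm x y (v * w)"
    "norm (v * w) = norm v * norm w" "norm (sg (v * w)) = norm (sg v) * norm (sg w)"
proof -
  have v': "v \<in> A" "v \<in> KK" "v \<noteq> 0" using v A by (auto simp: minvec_def)
  show n: "norm (v * w) = norm v * norm w" "norm (sg (v * w)) = norm (sg v) * norm (sg w)"
    using v' w by (simp_all add: norm_mult sg_mult)
  have le: "wnorm x y v \<le> wnorm x y (v * w)" using v w v'(3) unfolding minvec_def by simp
  then show "norm v / x \<le> wnorm x y (v * w)" "norm (sg v) / y \<le> wnorm x y (v * w)" by (auto simp: wnorm_def)
  show "norm w \<ge> 1 \<or> norm (sg w) \<ge> 1"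
  proof (rule ccontr)
    assume "\<not> ?thesis"
    then have "norm w < 1" "norm (sg w) < 1" by auto
    moreover have "norm v > 0" "norm (sg v) > 0" using v' by (simp_all add: sg_eq_0_iff)
    ultimately have "norm (v * w) < norm v" "norm (sg (v * w)) < norm (sg v)" unfolding n by simp_all
    then have "norm (v * w) / x < norm v / x" "norm (sg (v * w)) / y < norm (sg v) / y"
      using xy by (simp_all add: divide_strict_right_mono)
    then have "wnorm x y (v * w) < wnorm x y v" by (auto simp: wnorm_def)
    then show False using le by simp
  qed
qed

text \<open>By minimality, \<open>A / v\<close> has no nonzero element with both absolute values below 1. A box of the
  fundamental domain of \<open>\<int> + \<int> t1 + \<int> t2\<close> with sides \<open>1/4, 1/(4 r1), 1/(4 r2)\<close> in the three coordinates
  therefore meets at most one class of \<open>A / v\<close>.\<close>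

lemma minvec_index:
  assumes A: "frac_ideal A" and v: "minvec A x y v" and xy: "x > 0" "y > 0"
  obtains n where "n > 0" "real n \<le> 100 * of_int (a * b)" "\<And>w. w \<in> A \<Longrightarrow> of_nat n * w \<in> (*) v ` OK"
proof -
  have A': "OS.submod A" "A \<subseteq> KK" using A by (auto simp: frac_ideal_def)
  have v': "v \<in> A" "v \<in> KK" "v \<noteq> 0" using v A' by (auto simp: minvec_def)
  \<comment> \<open>Cells of width at most \<open>1 / (4 r1)\<close> and \<open>1 / (4 r2)\<close>,
    with 4 cells in the rational coordinate, keep the total below 3/4. Rounding up costs at most a
    factor 5/4 since \<open>r1\<close> and \<open>r2\<close> are at least 1, so there are at most
    \<open>4 * 5 r1 * 5 r2 = 100 a b\<close> cells.\<close>
  define K1 K2 where "K1 = nat \<lceil>4 * r1\<rceil>" and "K2 = nat \<lceil>4 * r2\<rceil>"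
  have K: "K1 > 0" "K2 > 0" "real K1 \<ge> 4 * r1" "real K2 \<ge> 4 * r2" "real K1 \<le> 5 * r1" "real K2 \<le> 5 * r2"
    using r_ge_1 unfolding K1_def K2_def by linarith+
  have vOK: "(*) v ` OK \<subseteq> A" using OS.submod_smult[OF A'(1) _ v'(1)] by (auto simp: mult.commute)
  have "\<forall>w\<in>A. \<exists>p. w = v * el (fst p) (fst (snd p)) (snd (snd p))"
  proof
    fix w assume "w \<in> A"
    then have "w / v \<in> KK" using A' v' by (intro KK_divide) auto
    then obtain r s t where "w / v = el r s t" by (rule KK_E)
    then show "\<exists>p. w = v * el (fst p) (fst (snd p)) (snd (snd p))"
      using v'(3) by (intro exI[of _ "(r, s, t)"]) (simp add: field_simps)
  qed
  from bchoice[OF this] obtain p where p: "\<forall>w\<in>A. w = v * el (fst (p w)) (fst (snd (p w))) (snd (snd (p w)))" ..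
  define c1 c2 c3 where "c1 w = (of_rat (fst (p w)) :: real)" and "c2 w = (of_rat (fst (snd (p w))) :: real)"
    and "c3 w = (of_rat (snd (snd (p w))) :: real)" for w
  define key where "key w = (\<lfloor>real 4 * frac (c1 w)\<rfloor>, \<lfloor>real K1 * frac (c2 w)\<rfloor>, \<lfloor>real K2 * frac (c3 w)\<rfloor>)" for w
  define M where "M = 4 * (K1 * K2)"
  have same: "w - w' \<in> (*) v ` OK" if w: "w \<in> A" "w' \<in> A" "key w = key w'" for w w'
  proof -
    obtain r s t where wp: "p w = (r, s, t)" by (cases "p w") auto
    obtain r' s' t' where wp': "p w' = (r', s', t')" by (cases "p w'") auto
    have d: "\<bar>frac (of_rat r) - frac (of_rat r')\<bar> < 1 / real 4" "\<bar>frac (of_rat s) - frac (of_rat s')\<bar> < 1 / real K1"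
      "\<bar>frac (of_rat t) - frac (of_rat t')\<bar> < 1 / real K2"
      using w(3) K by (intro frac_floor_close; simp add: key_def c1_def c2_def c3_def wp wp')+
    \<comment> \<open>The difference of the coordinates is split into integer parts, collected in
      \<open>o'\<close>, and differences of fractional parts, collected in \<open>u\<close>;
      \<open>v * u\<close> lies in \<open>A\<close>, and minimality forces
      \<open>u = 0\<close>.\<close>
    define u where "u = el (r - r' - of_int (\<lfloor>r\<rfloor> - \<lfloor>r'\<rfloor>)) (s - s' - of_int (\<lfloor>s\<rfloor> - \<lfloor>s'\<rfloor>)) (t - t' - of_int (\<lfloor>t\<rfloor> - \<lfloor>t'\<rfloor>))"
    define o' where "o' = el (of_int (\<lfloor>r\<rfloor> - \<lfloor>r'\<rfloor>)) (of_int (\<lfloor>s\<rfloor> - \<lfloor>s'\<rfloor>)) (of_int (\<lfloor>t\<rfloor> - \<lfloor>t'\<rfloor>))"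
    have oO: "o' \<in> OK" unfolding o'_def using OZ_subset_OK by (auto simp: OZ_def simp del: of_int_diff)
    have fl: "\<lfloor>of_rat q :: real\<rfloor> = \<lfloor>q\<rfloor>" for q :: rat
    proof (rule floor_unique)
      have "of_rat (of_int \<lfloor>q\<rfloor>) \<le> (of_rat q :: real)" unfolding of_rat_less_eq by (rule of_int_floor_le)
      then show "of_int \<lfloor>q\<rfloor> \<le> (of_rat q :: real)" by simp
      have "of_rat q < (of_rat (of_int \<lfloor>q\<rfloor> + 1) :: real)" unfolding of_rat_less by linarith
      then show "(of_rat q :: real) < of_int \<lfloor>q\<rfloor> + 1" by (simp add: of_rat_add)
    qed
    have fr: "of_rat (q - q' - of_int (\<lfloor>q\<rfloor> - \<lfloor>q'\<rfloor>)) = frac (of_rat q) - frac (of_rat q' :: real)" for q q' :: rat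
      by (simp add: frac_def fl of_rat_diff)
    have ww: "w - w' = v * (u + o')"
    proof -
      have "w = v * el r s t" "w' = v * el r' s' t'" using bspec[OF p w(1)] bspec[OF p w(2)] by (simp_all only: wp wp' fst_conv snd_conv)
      moreover have "u + o' = el r s t - el r' s' t'" unfolding u_def o'_def el_add el_diff by simp
      ultimately show ?thesis by (simp add: right_diff_distrib)
    qed
    have "v * u = (w - w') - v * o'" unfolding ww by (simp add: algebra_simps)
    also have "\<dots> \<in> A" using vOK oO w by (intro OS.submod_diff[OF A'(1)]) auto
    finally have vu: "v * u \<in> A" .
    have "\<bar>frac (of_rat s) - frac (of_rat s')\<bar> * r1 < 1 / 4" "\<bar>frac (of_rat t) - frac (of_rat t')\<bar> * r2 < 1 / 4"
    proof -
      have "\<bar>frac (of_rat s) - frac (of_rat s')\<bar> * r1 < 1 / real K1 * r1" using d(2) r_pos by (intro mult_strict_right_mono)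
      also have "\<dots> \<le> 1 / 4" using K by (simp add: field_simps)
      finally show "\<bar>frac (of_rat s) - frac (of_rat s')\<bar> * r1 < 1 / 4" .
      have "\<bar>frac (of_rat t) - frac (of_rat t')\<bar> * r2 < 1 / real K2 * r2" using d(3) r_pos by (intro mult_strict_right_mono)
      also have "\<dots> \<le> 1 / 4" using K by (simp add: field_simps)
      finally show "\<bar>frac (of_rat t) - frac (of_rat t')\<bar> * r2 < 1 / 4" .
    qed
    then have b: "\<bar>frac (of_rat r) - frac (of_rat r')\<bar> + \<bar>frac (of_rat s) - frac (of_rat s')\<bar> * r1
        + \<bar>frac (of_rat t) - frac (of_rat t')\<bar> * r2 < 1" using d(1) by simp
    have "norm u < 1" "norm (sg u) < 1"
      unfolding u_def sg_el by (rule le_less_trans[OF norm_el_le], simp only: fr b) (rule le_less_trans[OF norm_el'_le], simp only: fr b)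
    moreover have "u \<in> KK" unfolding u_def by (rule el_in_KK)
    ultimately have "u = 0" using minvec_mult(1)[OF A' v xy _ _ vu] by (meson not_le)
    then show ?thesis using ww oO by (simp add: imageI)
  qed
  obtain n where n: "n > 0" "n \<le> M" "\<And>w. w \<in> A \<Longrightarrow> of_nat n * w \<in> (*) v ` OK"
  proof (rule OS.exponent_of_quotient[OF A'(1) OS.submod_scale[OF OS.submod_R], of v M])
    fix S assume S: "S \<subseteq> A" "\<And>x y. x \<in> S \<Longrightarrow> y \<in> S \<Longrightarrow> x - y \<in> (*) v ` OK \<Longrightarrow> x = y"
    have "inj_on key S" 
    proof (rule inj_onI)
      fix x y assume xy: "x \<in> S" "y \<in> S" "key x = key y"
      then have "x - y \<in> (*) v ` OK" using S(1) by (intro same) auto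
      then show "x = y" using S(2) xy by simp
    qed
    have fb: "\<lfloor>real K * frac q\<rfloor> \<in> {0..<int K}" if "K > 0" for K and q :: real
    proof -
      have "0 \<le> frac q" "frac q < 1" by (simp_all add: frac_lt_1)
      then have "0 \<le> real K * frac q" "real K * frac q < real K * 1" using that by (simp_all add: mult_strict_left_mono)
      then show ?thesis by (simp add: floor_less_iff)
    qed
    have ran: "key ` S \<subseteq> {0..<int 4} \<times> {0..<int K1} \<times> {0..<int K2}"
      using fb[of 4] fb[OF K(1)] fb[OF K(2)] unfolding key_def by (intro image_subsetI SigmaI) simp_all
    have "card ({0..<int 4} \<times> {0..<int K1} \<times> {0..<int K2}) = M" by (simp add: card_cartesian_product M_def)
    then show "finite S \<and> card S \<le> M"
      using card_inj_on_le[OF \<open>inj_on key S\<close> ran] inj_on_finite[OF \<open>inj_on key S\<close> ran] by simp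
  qed (rule that)
  have "real K1 * real K2 \<le> (5 * r1) * (5 * r2)" using K r_pos by (intro mult_mono) auto
  also have "\<dots> = 25 * of_int (a * b)" using r1_r2 by simp
  finally have "real M \<le> 100 * of_int (a * b)" by (simp add: M_def)
  moreover have "real n \<le> real M" using n(2) by simp
  ultimately show ?thesis using that[OF n(1) _ n(3)] by linarith
qed

section \<open>Balance of the two absolute values of a minimal vector\<close>

lemma r_le: "r1 \<le> of_int (a * b)" "r2 \<le> of_int (a * b)"
proof -
  have "r1 * 1 \<le> r1 * r2" "1 * r2 \<le> r1 * r2" using r_ge_1 r_pos by (intro mult_left_mono mult_right_mono; simp)+
  then show "r1 \<le> of_int (a * b)" "r2 \<le> of_int (a * b)" unfolding r1_r2 by simp_all
qed

lemma small_real_place: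
  obtains w where "w \<in> OZ" "w \<noteq> 0" "norm w < 1" "norm (sg w) \<le> 2 * of_int (a * b)"
proof -
  define m where "m = \<lfloor>r1\<rfloor>"
  define w where "w = el (of_int (- m)) (of_int 1) (of_int 0)"
  have "w \<in> OZ" unfolding w_def OZ_def by blast
  moreover have "w \<noteq> 0" unfolding w_def el_0_iff by simp
  moreover have "norm w < 1"
  proof -
    have "w = of_real (r1 - of_int m)" by (simp add: w_def el_def t1_def of_rat_minus)
    then have "norm w = \<bar>r1 - of_int m\<bar>" by (simp only: norm_of_real)
    then show ?thesis unfolding m_def by linarith
  qed
  moreover have "norm (sg w) \<le> 2 * of_int (a * b)"
  proof -
    have "norm (sg w) \<le> \<bar>of_int m\<bar> + r1" using norm_el'_le[of "of_int (- m)" "of_int 1" "of_int 0"]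
      by (simp add: w_def flip: of_int_abs)
    moreover have "m \<ge> 0" using r_pos by (simp add: m_def)
    then have "\<bar>real_of_int m\<bar> \<le> r1" unfolding m_def by simp
    ultimately show ?thesis using r_le by linarith
  qed
  ultimately show ?thesis by (rule that)
qed

text \<open>Dirichlet's pigeonhole principle: \<open>(Q + 1)^2\<close> pairs against
  \<open>Q^2\<close> subintervals.\<close>

lemma simultaneous_approximation:
  fixes Q :: nat
  assumes Q: "Q > 0"
  obtains x y z :: int where "(x, y, z) \<noteq> (0, 0, 0)" "\<bar>y\<bar> \<le> int Q" "\<bar>z\<bar> \<le> int Q"
    "\<bar>of_int x + of_int y * r1 + of_int z * r2\<bar> \<le> 1 / real Q ^ 2"
proof -
  define g where "g p = of_int (fst p) * r1 + of_int (snd p) * r2" for p :: "int \<times> int"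
  define f where "f p = \<lfloor>real (Q ^ 2) * frac (g p)\<rfloor>" for p
  define D where "D = {0..int Q} \<times> {0..int Q}"
  have Q2: "Q ^ 2 > 0" using Q by simp
  have "f ` D \<subseteq> {0..<int (Q ^ 2)}"
  proof (rule image_subsetI)
    fix p
    have "0 \<le> frac (g p)" "frac (g p) < 1" by (simp_all add: frac_lt_1)
    then have "0 \<le> real (Q ^ 2) * frac (g p)" "real (Q ^ 2) * frac (g p) < real (Q ^ 2) * 1"
      using Q2 by (intro mult_nonneg_nonneg mult_strict_left_mono; simp)+
    then show "f p \<in> {0..<int (Q ^ 2)}" unfolding f_def by (simp add: floor_less_iff)
  qed
  then have "card (f ` D) \<le> card {0..<int (Q ^ 2)}" by (rule card_mono[rotated]) simp
  also have "\<dots> = Q ^ 2" by (simp del: of_nat_power)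
  also have "\<dots> < (Q + 1) * (Q + 1)" by (simp add: power2_eq_square)
  also have "\<dots> = card D"
  proof -
    have "card {0..int Q} = Q + 1" by (simp add: nat_add_distrib)
    then show ?thesis unfolding D_def card_cartesian_product by (simp only:)
  qed
  finally have "\<not> inj_on f D" by (rule pigeonhole)
  then obtain p p' where p: "p \<in> D" "p' \<in> D" "f p = f p'" "p \<noteq> p'" unfolding inj_on_def by blast
  have c: "\<bar>frac (g p) - frac (g p')\<bar> < 1 / real (Q ^ 2)"
    using p(3) Q2 by (intro frac_floor_close) (simp_all add: f_def)
  define x y z where "x = \<lfloor>g p'\<rfloor> - \<lfloor>g p\<rfloor>" and "y = fst p - fst p'" and "z = snd p - snd p'"
  have "(y, z) \<noteq> (0, 0)" using p(4) by (auto simp: y_def z_def prod_eq_iff)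
  then have "(x, y, z) \<noteq> (0, 0, 0)" by simp
  moreover have "\<bar>y\<bar> \<le> int Q" "\<bar>z\<bar> \<le> int Q" using p(1,2) by (auto simp: D_def y_def z_def)
  moreover have "of_int x + of_int y * r1 + of_int z * r2 = frac (g p) - frac (g p')"
    by (simp add: x_def y_def z_def frac_def g_def algebra_simps)
  then have "\<bar>of_int x + of_int y * r1 + of_int z * r2\<bar> \<le> 1 / real Q ^ 2" using c by simp
  ultimately show ?thesis by (rule that)
qed

text \<open>An element \<open>u\<close> that is tiny at the real place is found by approximation;
  \<open>w\<close> is the product of its two complex conjugates. At the complex place
  \<open>w\<close> has size \<open>norm u * norm (sg u)\<close>, at most \<open>5 * N / Q\<close>,
  so \<open>Q = 6 * N\<close> suffices. At the real place its size is at most the square of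
  \<open>5 * Q * N\<close>, that is \<open>900 * N ^ 4\<close>.\<close>

lemma small_complex_place:
  obtains w where "w \<in> OZ" "w \<noteq> 0" "norm (sg w) < 1" "norm w \<le> 900 * of_int (a * b) ^ 4"
proof -
  define N where "N = (of_int (a * b) :: real)"
  define Q where "Q = nat (6 * (a * b))"
  have Q: "Q > 0" "real Q = 6 * N" using ab_gt_1 by (simp_all add: Q_def N_def)
  have N1: "N \<ge> 1" using ab_gt_1 unfolding N_def by linarith
  obtain x y z where xyz: "(x, y, z) \<noteq> (0, 0, 0)" "\<bar>y\<bar> \<le> int Q" "\<bar>z\<bar> \<le> int Q"
    "\<bar>of_int x + of_int y * r1 + of_int z * r2\<bar> \<le> 1 / real Q ^ 2"
    by (rule simultaneous_approximation[OF Q(1)])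
  define u where "u = el (of_int x) (of_int y) (of_int z)"
  define w where "w = el (of_int (x ^ 2 - a * b * (y * z))) (of_int (a * z ^ 2 - x * y)) (of_int (b * y ^ 2 - x * z))"
  have uK: "u \<in> KK" and wK: "w \<in> KK" by (simp_all add: u_def w_def el_in_KK)
  have u0: "u \<noteq> 0" using xyz(1) unfolding u_def el_0_iff by simp
  have w_eq: "w = sg u * cnj (sg u)"
    unfolding u_def sg_el el'_norm w_def by simp
  have uw: "u * w = of_rat (normf (of_int x) (of_int y) (of_int z))"
    using el_adj[of "of_int x" "of_int y" "of_int z"] by (simp add: u_def w_def)
  have nu: "norm u \<le> 1 / real Q ^ 2"
  proof -
    have "u = of_real (of_int x + of_int y * r1 + of_int z * r2)" by (simp add: u_def el_def t1_def t2_def)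
    then have "norm u = \<bar>of_int x + of_int y * r1 + of_int z * r2\<bar>" by (simp only: norm_of_real)
    then show ?thesis using xyz(4) by simp
  qed
  have su0: "norm (sg u) > 0" using u0 uK by (simp add: sg_eq_0_iff)
  have nsu: "norm (sg u) \<le> 5 * real Q * N"
  proof -
    have y: "\<bar>of_int y\<bar> * r1 \<le> real Q * N" "\<bar>of_int z\<bar> * r2 \<le> real Q * N"
    proof -
      have "\<bar>real_of_int y\<bar> \<le> real Q" "\<bar>real_of_int z\<bar> \<le> real Q" using xyz(2,3) by linarith+
      then show "\<bar>of_int y\<bar> * r1 \<le> real Q * N" "\<bar>of_int z\<bar> * r2 \<le> real Q * N"
        using r_le r_pos N1 unfolding N_def by (intro mult_mono; simp)+
    qed
    have "1 / real Q ^ 2 \<le> 1" using Q(1) by (simp add: Suc_le_eq)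
    then have "\<bar>of_int x + of_int y * r1 + of_int z * r2\<bar> \<le> 1" using xyz(4) by linarith
    moreover have "\<bar>of_int y * r1\<bar> \<le> real Q * N" "\<bar>of_int z * r2\<bar> \<le> real Q * N" using y r_pos by (simp_all add: abs_mult)
    ultimately have x: "\<bar>real_of_int x\<bar> \<le> 1 + 2 * (real Q * N)" by linarith
    have "norm (sg u) \<le> \<bar>of_int x\<bar> + \<bar>of_int y\<bar> * r1 + \<bar>of_int z\<bar> * r2"
      using norm_el'_le[of "of_int x" "of_int y" "of_int z"] by (simp add: u_def)
    moreover have "1 * 1 \<le> real Q * N" using Q(1) N1 by (intro mult_mono) auto
    ultimately show ?thesis using x y by linarith
  qed
  have "norm (sg u) * norm (sg w) = norm (sg (u * w))" using uK wK by (simp add: sg_mult norm_mult)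
  also have "\<dots> = norm (u * w)" unfolding uw sg_of_rat ..
  also have "\<dots> = norm (sg u) * (norm u * norm (sg u))" unfolding norm_mult w_eq by simp
  finally have sw: "norm (sg w) = norm u * norm (sg u)" using su0 by simp
  also have "\<dots> \<le> (1 / real Q ^ 2) * (5 * real Q * N)" using nu nsu by (intro mult_mono) auto
  also have "\<dots> = 5 * N / real Q" using Q(1) by (simp add: power2_eq_square)
  also have "\<dots> < 1" using Q N1 by simp
  finally have "norm (sg w) < 1" .
  moreover have "w \<in> OZ" unfolding w_def OZ_def by blast
  moreover have "w \<noteq> 0" unfolding w_eq using su0 by simp
  moreover have "norm w \<le> 900 * of_int (a * b) ^ 4"
  proof -
    have "norm w = norm (sg u) ^ 2" unfolding w_eq norm_mult by (simp add: power2_eq_square)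
    also have "\<dots> \<le> (5 * real Q * N) ^ 2" using nsu by (intro power_mono) auto
    also have "\<dots> = 900 * N ^ 4" unfolding Q(2) by (simp add: power2_eq_square power4_eq_xxxx)
    finally show ?thesis unfolding N_def .
  qed
  ultimately show ?thesis using that by simp
qed

text \<open>If one weighted absolute value of \<open>v\<close> were much larger than the other,
  multiplication by an integer of the field that shrinks this place would give a shorter
  vector.\<close>

lemma minvec_balanced:
  assumes A: "frac_ideal A" and v: "minvec A x y v" and xy: "x > 0" "y > 0"
  shows "norm v / x \<le> 2 * of_int (a * b) * (norm (sg v) / y)"
    and "norm (sg v) / y \<le> 900 * of_int (a * b) ^ 4 * (norm v / x)"
proof -
  have A': "OS.submod A" "A \<subseteq> KK" using A by (auto simp: frac_ideal_def)
  have v': "v \<in> A" "v \<in> KK" "v \<noteq> 0" using v A' by (auto simp: minvec_def)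
  have pos: "norm v / x > 0" "norm (sg v) / y > 0" using v' xy by (simp_all add: sg_eq_0_iff)
  have vw: "v * w \<in> A" if "w \<in> OZ" for w
    using OS.submod_smult[OF A'(1) _ v'(1), of w] that OZ_subset_OK by (auto simp: mult.commute)
  have K: "w \<in> KK" if "w \<in> OZ" for w using that OZ_subset_OK OK_KK by auto
  have mult: "norm (v * w) / x = (norm v / x) * norm w" "norm (sg (v * w)) / y = (norm (sg v) / y) * norm (sg w)"
    if "w \<in> OZ" for w using that K v' by (simp_all add: norm_mult sg_mult)
  obtain w where w: "w \<in> OZ" "w \<noteq> 0" "norm w < 1" "norm (sg w) \<le> 2 * of_int (a * b)" by (rule small_real_place)
  have "norm v / x \<le> wnorm x y (v * w)" using minvec_mult(2)[OF A' v xy K[OF w(1)] w(2) vw[OF w(1)]] .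
  moreover have "norm v / x * norm w < norm v / x * 1" using w(3) pos by (intro mult_strict_left_mono) auto
  ultimately have "norm v / x \<le> (norm (sg v) / y) * norm (sg w)"
    unfolding wnorm_def mult[OF w(1)] by linarith
  also have "\<dots> \<le> (norm (sg v) / y) * (2 * of_int (a * b))" using w(4) pos by (intro mult_left_mono) auto
  finally show "norm v / x \<le> 2 * of_int (a * b) * (norm (sg v) / y)" by (simp add: mult.commute)
  obtain w where w: "w \<in> OZ" "w \<noteq> 0" "norm (sg w) < 1" "norm w \<le> 900 * of_int (a * b) ^ 4" by (rule small_complex_place)
  have "norm (sg v) / y \<le> wnorm x y (v * w)" using minvec_mult(3)[OF A' v xy K[OF w(1)] w(2) vw[OF w(1)]] .
  moreover have "norm (sg v) / y * norm (sg w) < norm (sg v) / y * 1" using w(3) pos by (intro mult_strict_left_mono) auto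
  ultimately have "norm (sg v) / y \<le> (norm v / x) * norm w"
    unfolding wnorm_def mult[OF w(1)] by linarith
  also have "\<dots> \<le> (norm v / x) * (900 * of_int (a * b) ^ 4)" using w(4) pos by (intro mult_left_mono) auto
  finally show "norm (sg v) / y \<le> 900 * of_int (a * b) ^ 4 * (norm v / x)" by (simp add: mult.commute)
qed

section \<open>Degree-one primes and their complementary ideals\<close>

abbreviation eli :: "int \<Rightarrow> int \<Rightarrow> int \<Rightarrow> complex" where
  "eli i j k \<equiv> el (of_int i) (of_int j) (of_int k)"

lemma eli_mult: "eli i j k * eli i' j' k' =
    eli (i * i' + a * b * (j * k' + k * j')) (i * j' + j * i' + a * (k * k')) (i * k' + k * i' + b * (j * j'))"
  unfolding el_mult by simp

lemma eli_add: "eli i j k + eli i' j' k' = eli (i + i') (j + j') (k + k')"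
  unfolding el_add by simp

lemma eli_eq_iff: "eli i j k = eli i' j' k' \<longleftrightarrow> i = i' \<and> j = j' \<and> k = k'"
  unfolding el_eq_iff by simp

lemma eli_in_OZ: "eli i j k \<in> OZ"
  unfolding OZ_def by blast

lemma OZ_E: assumes "w \<in> OZ" obtains i j k where "w = eli i j k"
  using assms unfolding OZ_def by (elim CollectE exE conjE) (rule that)

lemma of_int_eli: "of_int n = eli n 0 0"
  by (simp add: el_def)

text \<open>For a modulus coprime to \<open>3 a b\<close>, the pair \<open>(c1, c2)\<close> lists the images of \<open>(t1, t2)\<close> under a ring
  homomorphism onto the integers modulo \<open>m ^ L\<close>. The ideal \<open>PP\<close> is the kernel of its reduction modulo \<open>m\<close>;
  \<open>QQ (m ^ e)\<close> is the complementary ideal, generated modulo \<open>m ^ e\<close> by the element \<open>a b + c2 t1 + c1 t2\<close>,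
  on which \<open>\<int> + \<int> t1 + \<int> t2\<close> acts through that homomorphism.\<close>

definition split_data :: "nat \<Rightarrow> int \<Rightarrow> int \<Rightarrow> int \<Rightarrow> bool" where
  "split_data L m c1 c2 \<longleftrightarrow> m > 0 \<and> coprime m (3 * a * b) \<and>
     m ^ L dvd a * b - c1 * c2 \<and> m ^ L dvd a * c1 - c2 ^ 2 \<and> m ^ L dvd b * c2 - c1 ^ 2"

definition PP :: "int \<Rightarrow> int \<Rightarrow> int \<Rightarrow> complex set" where
  "PP m c1 c2 = {eli i j k | i j k. m dvd i + j * c1 + k * c2}"

definition QQ :: "int \<Rightarrow> int \<Rightarrow> int \<Rightarrow> complex set" where
  "QQ q c1 c2 = {eli i j k | i j k. \<exists>n. q dvd i - n * (a * b) \<and> q dvd j - n * c2 \<and> q dvd k - n * c1}"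

lemma PP_E: assumes "w \<in> PP m c1 c2" obtains i j k where "w = eli i j k" "m dvd i + j * c1 + k * c2"
  using assms unfolding PP_def by (elim CollectE exE conjE) (rule that)

lemma PP_I: "m dvd i + j * c1 + k * c2 \<Longrightarrow> eli i j k \<in> PP m c1 c2"
  unfolding PP_def by blast

lemma QQ_E:
  assumes "w \<in> QQ q c1 c2"
  obtains n x y z where "w = eli (n * (a * b) + q * x) (n * c2 + q * y) (n * c1 + q * z)"
proof -
  obtain i j k n where w: "w = eli i j k" and d: "q dvd i - n * (a * b)" "q dvd j - n * c2" "q dvd k - n * c1"
    using assms unfolding QQ_def by (elim CollectE exE conjE)
  obtain x y z where "i - n * (a * b) = q * x" "j - n * c2 = q * y" "k - n * c1 = q * z" using d by (elim dvdE)
  then have "i = n * (a * b) + q * x" "j = n * c2 + q * y" "k = n * c1 + q * z" by linarith+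
  then show ?thesis using that w by simp
qed

lemma QQ_I: "eli (n * (a * b) + q * x) (n * c2 + q * y) (n * c1 + q * z) \<in> QQ q c1 c2"
proof -
  have "q dvd n * (a * b) + q * x - n * (a * b)" "q dvd n * c2 + q * y - n * c2" "q dvd n * c1 + q * z - n * c1" by simp_all
  then show ?thesis unfolding QQ_def by blast
qed

text \<open>The generator of \<open>QQ\<close> is an eigenvector modulo \<open>m\<close>:
  multiplication by \<open>i + j t1 + k t2\<close> scales it by \<open>i + j c1 + k c2\<close>, and
  this value vanishes modulo \<open>m\<close> on \<open>PP\<close>.\<close>

lemma PP_mult_QQ:
  assumes "split_data L m c1 c2" "L > 0" "u \<in> PP m c1 c2" "w \<in> QQ m c1 c2"
  shows "\<exists>v\<in>OZ. u * w = of_int m * v"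
proof -
  have "m dvd m ^ L" using assms(2) by simp
  then have d: "m dvd a * b - c1 * c2" "m dvd a * c1 - c2 ^ 2" "m dvd b * c2 - c1 ^ 2"
    using assms(1) unfolding split_data_def by (meson dvd_trans)+
  obtain g1 g2 g3 where g: "a * b - c1 * c2 = m * g1" "a * c1 - c2 ^ 2 = m * g2" "b * c2 - c1 ^ 2 = m * g3"
    using d by (elim dvdE)
  obtain i j k where u: "u = eli i j k" "m dvd i + j * c1 + k * c2" using assms(3) by (rule PP_E)
  obtain h where h: "i + j * c1 + k * c2 = m * h" using u(2) by (elim dvdE)
  obtain n x y z where w: "w = eli (n * (a * b) + m * x) (n * c2 + m * y) (n * c1 + m * z)" using assms(4) by (rule QQ_E)
  have "i * (n * (a * b) + m * x) + a * b * (j * (n * c1 + m * z) + k * (n * c2 + m * y))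
      = n * (a * b) * (i + j * c1 + k * c2) + m * (i * x + a * b * (j * z + k * y))"
    by (simp add: algebra_simps)
  also have "\<dots> = m * (n * (a * b) * h + (i * x + a * b * (j * z + k * y)))" unfolding h by (simp add: algebra_simps)
  finally have e1: "i * (n * (a * b) + m * x) + a * b * (j * (n * c1 + m * z) + k * (n * c2 + m * y))
      = m * (n * (a * b) * h + (i * x + a * b * (j * z + k * y)))" .
  have "i * (n * c2 + m * y) + j * (n * (a * b) + m * x) + a * (k * (n * c1 + m * z))
      = n * c2 * (i + j * c1 + k * c2) + n * ((a * b - c1 * c2) * j + (a * c1 - c2 ^ 2) * k) + m * (i * y + j * x + a * (k * z))"
    by (simp add: algebra_simps power2_eq_square)
  also have "\<dots> = m * (n * c2 * h + n * (g1 * j + g2 * k) + (i * y + j * x + a * (k * z)))"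
    unfolding h g by (simp add: algebra_simps)
  finally have e2: "i * (n * c2 + m * y) + j * (n * (a * b) + m * x) + a * (k * (n * c1 + m * z))
      = m * (n * c2 * h + n * (g1 * j + g2 * k) + (i * y + j * x + a * (k * z)))" .
  have "i * (n * c1 + m * z) + k * (n * (a * b) + m * x) + b * (j * (n * c2 + m * y))
      = n * c1 * (i + j * c1 + k * c2) + n * ((a * b - c1 * c2) * k + (b * c2 - c1 ^ 2) * j) + m * (i * z + k * x + b * (j * y))"
    by (simp add: algebra_simps power2_eq_square)
  also have "\<dots> = m * (n * c1 * h + n * (g1 * k + g3 * j) + (i * z + k * x + b * (j * y)))"
    unfolding h g by (simp add: algebra_simps)
  finally have e3: "i * (n * c1 + m * z) + k * (n * (a * b) + m * x) + b * (j * (n * c2 + m * y))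
      = m * (n * c1 * h + n * (g1 * k + g3 * j) + (i * z + k * x + b * (j * y)))" .
  have "u * w = of_int m * eli (n * (a * b) * h + (i * x + a * b * (j * z + k * y)))
      (n * c2 * h + n * (g1 * j + g2 * k) + (i * y + j * x + a * (k * z)))
      (n * c1 * h + n * (g1 * k + g3 * j) + (i * z + k * x + b * (j * y)))"
    unfolding u w eli_mult e1 e2 e3 of_int_eli[of m] by (simp add: eli_mult)
  then show ?thesis using eli_in_OZ by (intro bexI)
qed

lemma QQ_mult_QQ:
  assumes sd: "split_data L m c1 c2" and e: "Suc e \<le> L" and uw: "u \<in> QQ m c1 c2" "w \<in> QQ (m ^ e) c1 c2"
  shows "u * w \<in> QQ (m ^ Suc e) c1 c2"
proof -
  define q where "q = m ^ e"
  have "m * q dvd m ^ L" using e unfolding q_def power_Suc[symmetric] by (rule le_imp_power_dvd)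
  then have d: "m * q dvd a * b - c1 * c2" "m * q dvd a * c1 - c2 ^ 2" "m * q dvd b * c2 - c1 ^ 2"
    using sd unfolding split_data_def by (meson dvd_trans)+
  obtain g1 g2 g3 where g: "a * b - c1 * c2 = m * q * g1" "a * c1 - c2 ^ 2 = m * q * g2" "b * c2 - c1 ^ 2 = m * q * g3"
    using d by (elim dvdE)
  obtain n x y z where u: "u = eli (n * (a * b) + m * x) (n * c2 + m * y) (n * c1 + m * z)" using uw(1) by (rule QQ_E)
  obtain n' x' y' z' where w: "w = eli (n' * (a * b) + q * x') (n' * c2 + q * y') (n' * c1 + q * z')"
    using uw(2) unfolding q_def by (rule QQ_E)
  define i j k where "i = n' * (a * b) + q * x'" and "j = n' * c2 + q * y'" and "k = n' * c1 + q * z'"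
  \<comment> \<open>Write the factors as \<open>n E + m u'\<close> and \<open>n' E + q w'\<close>
    with \<open>E\<close> the generator; modulo \<open>m * q\<close> their product is
    \<open>l E\<close>, because \<open>E\<close> is an eigenvector.\<close>
  define l where "l = n * (i + j * c1 + k * c2) + m * n' * (x + y * c1 + z * c2)"
  have "(n * (a * b) + m * x) * i + a * b * ((n * c2 + m * y) * k + (n * c1 + m * z) * j)
      = l * (a * b) + m * q * (x * x' + a * b * (y * z' + z * y'))"
    unfolding l_def i_def j_def k_def by (simp add: algebra_simps)
  note e1 = this
  have "(n * (a * b) + m * x) * j + (n * c2 + m * y) * i + a * ((n * c1 + m * z) * k)
      = l * c2 + n * ((a * b - c1 * c2) * j + (a * c1 - c2 ^ 2) * k) + m * n' * ((a * b - c1 * c2) * y + (a * c1 - c2 ^ 2) * z)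
        + m * q * (x * y' + y * x' + a * (z * z'))"
    unfolding l_def i_def j_def k_def by (simp add: algebra_simps power2_eq_square)
  also have "\<dots> = l * c2 + m * q * (n * (g1 * j + g2 * k) + m * n' * (g1 * y + g2 * z) + (x * y' + y * x' + a * (z * z')))"
    unfolding g by (simp add: algebra_simps)
  finally have e2: "(n * (a * b) + m * x) * j + (n * c2 + m * y) * i + a * ((n * c1 + m * z) * k)
      = l * c2 + m * q * (n * (g1 * j + g2 * k) + m * n' * (g1 * y + g2 * z) + (x * y' + y * x' + a * (z * z')))" .
  have "(n * (a * b) + m * x) * k + (n * c1 + m * z) * i + b * ((n * c2 + m * y) * j)
      = l * c1 + n * ((a * b - c1 * c2) * k + (b * c2 - c1 ^ 2) * j) + m * n' * ((a * b - c1 * c2) * z + (b * c2 - c1 ^ 2) * y)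
        + m * q * (x * z' + z * x' + b * (y * y'))"
    unfolding l_def i_def j_def k_def by (simp add: algebra_simps power2_eq_square)
  also have "\<dots> = l * c1 + m * q * (n * (g1 * k + g3 * j) + m * n' * (g1 * z + g3 * y) + (x * z' + z * x' + b * (y * y')))"
    unfolding g by (simp add: algebra_simps)
  finally have e3: "(n * (a * b) + m * x) * k + (n * c1 + m * z) * i + b * ((n * c2 + m * y) * j)
      = l * c1 + m * q * (n * (g1 * k + g3 * j) + m * n' * (g1 * z + g3 * y) + (x * z' + z * x' + b * (y * y')))" .
  show ?thesis
    unfolding u w i_def[symmetric] j_def[symmetric] k_def[symmetric] eli_mult e1 e2 e3 power_Suc q_def[symmetric] by (rule QQ_I)
qed

text \<open>Modulo \<open>q\<close> the pair \<open>(j, k)\<close> is a multiple of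
  \<open>(c2, c1)\<close>, where the form vanishes: \<open>b c2^3 - a c1^3\<close> is a combination
  of \<open>b c2 - c1^2\<close> and \<open>a c1 - c2^2\<close>.\<close>

lemma QQ_index_form:
  assumes "q dvd a * c1 - c2 ^ 2" "q dvd b * c2 - c1 ^ 2" "eli i j k \<in> QQ q c1 c2"
  shows "q dvd b * j ^ 3 - a * k ^ 3"
proof -
  obtain n x y z where "eli i j k = eli (n * (a * b) + q * x) (n * c2 + q * y) (n * c1 + q * z)"
    using assms(3) by (rule QQ_E)
  then have jk: "j = n * c2 + q * y" "k = n * c1 + q * z" unfolding eli_eq_iff by simp_all
  obtain g2 g3 where g: "a * c1 - c2 ^ 2 = q * g2" "b * c2 - c1 ^ 2 = q * g3" using assms(1,2) by (elim dvdE)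
  have "b * j ^ 3 - a * k ^ 3 = n ^ 3 * ((b * c2 - c1 ^ 2) * c2 ^ 2 - c1 ^ 2 * (a * c1 - c2 ^ 2))
      + q * (b * (3 * n ^ 2 * c2 ^ 2 * y + 3 * n * c2 * q * y ^ 2 + q ^ 2 * y ^ 3)
           - a * (3 * n ^ 2 * c1 ^ 2 * z + 3 * n * c1 * q * z ^ 2 + q ^ 2 * z ^ 3))"
    unfolding jk by (simp add: algebra_simps power2_eq_square power3_eq_cube)
  also have "\<dots> = q * (n ^ 3 * (g3 * c2 ^ 2 - c1 ^ 2 * g2)
       + (b * (3 * n ^ 2 * c2 ^ 2 * y + 3 * n * c2 * q * y ^ 2 + q ^ 2 * y ^ 3)
           - a * (3 * n ^ 2 * c1 ^ 2 * z + 3 * n * c1 * q * z ^ 2 + q ^ 2 * z ^ 3)))"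
    unfolding g by (simp add: algebra_simps)
  finally show ?thesis by simp
qed

end

text \<open>For \<open>PP\<close> and \<open>QQ\<close>, which need not be modules over the full
  ring of integers.\<close>

lemma (in subring_set) submod_iprod_right:
  assumes B: "submod B" and Sx: "Sx \<noteq> {}"
  shows "submod (Sx \<diamondop> B)"
  unfolding submod_def
proof (intro conjI ballI)
  obtain x where "x \<in> Sx" using Sx by blast
  then have "x * 0 \<in> Sx \<diamondop> B" using submod_zero[OF B] by (rule iprod_mult)
  then show "0 \<in> Sx \<diamondop> B" by simp
next
  fix r z assume r: "r \<in> R" and "z \<in> Sx \<diamondop> B"
  from this(2) show "r * z \<in> Sx \<diamondop> B"
  proof (induction rule: iprod_induct)
    case (mult u v)
    then have "u * (r * v) \<in> Sx \<diamondop> B" using submod_smult[OF B r] by (intro iprod_mult)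
    then show ?case by (simp add: mult.left_commute)
  next
    case (add u v)
    then show ?case unfolding distrib_left by (intro iprod_add)
  qed
qed (rule iprod_add)

context pure_cubic
begin

definition PO :: "int \<Rightarrow> int \<Rightarrow> int \<Rightarrow> complex set" where
  "PO m c1 c2 = PP m c1 c2 \<diamondop> OK"

definition QO :: "int \<Rightarrow> int \<Rightarrow> int \<Rightarrow> complex set" where
  "QO m c1 c2 = QQ m c1 c2 \<diamondop> OK"

lemma m_in_PP: "of_int m \<in> PP m c1 c2"
  unfolding of_int_eli by (rule PP_I) simp

lemma m_in_QQ: "of_int m \<in> QQ m c1 c2"
  using QQ_I[of 0 m 1 c2 0 c1 0] by (simp add: el_def)

lemma PP_subset: "PP m c1 c2 \<subseteq> OZ"
proof
  fix w assume "w \<in> PP m c1 c2"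
  then obtain i j k where "w = eli i j k" by (rule PP_E)
  then show "w \<in> OZ" using eli_in_OZ by simp
qed

lemma QQ_subset: "QQ m c1 c2 \<subseteq> OZ"
proof
  fix w assume "w \<in> QQ m c1 c2"
  then show "w \<in> OZ" by (rule QQ_E) (simp only: eli_in_OZ)
qed

lemma submod_PO: "OS.submod (PO m c1 c2)" and submod_QO: "OS.submod (QO m c1 c2)"
  unfolding PO_def QO_def using m_in_PP m_in_QQ by (intro OS.submod_iprod_right[OF OS.submod_R]; blast)+

lemma PO_subset: "PO m c1 c2 \<subseteq> OK" and QO_subset: "QO m c1 c2 \<subseteq> OK"
  unfolding PO_def QO_def using PP_subset[of m c1 c2] QQ_subset[of m c1 c2] OZ_subset_OK
  by (intro OS.iprod_subset_submod[OF OS.submod_R] OK_mult; blast)+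

lemma m_in_PO: "of_int m \<in> PO m c1 c2"
  using iprod_mult[OF m_in_PP OS.one_in] by (simp add: PO_def)

text \<open>One inclusion is the eigenvector property. For the other, the two ideals are comaximal:
  an element \<open>E\<close> of \<open>QQ\<close> with \<open>1 - E\<close> in \<open>PP\<close>
  gives \<open>m = m * E + (1 - E) * m\<close>.\<close>

lemma PO_QO:
  assumes sd: "split_data L m c1 c2" and L: "L > 0"
  shows "PO m c1 c2 \<diamondop> QO m c1 c2 = (*) (of_int m) ` OK"
proof -
  have e: "PO m c1 c2 \<diamondop> QO m c1 c2 = (PP m c1 c2 \<diamondop> QQ m c1 c2) \<diamondop> OK"
    unfolding PO_def QO_def using OS.R_iprod[OF OS.submod_R] by (metis iprod_assoc iprod_left_commute)
  have mOK: "OS.submod ((*) (of_int m) ` OK)" by (rule OS.submod_scale[OF OS.submod_R])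
  have "PP m c1 c2 \<diamondop> QQ m c1 c2 \<subseteq> (*) (of_int m) ` OK"
  proof (rule OS.iprod_subset_submod[OF mOK])
    fix u w assume "u \<in> PP m c1 c2" "w \<in> QQ m c1 c2"
    then obtain v where "v \<in> OZ" "u * w = of_int m * v" using PP_mult_QQ[OF sd L] by blast
    then show "u * w \<in> (*) (of_int m) ` OK" using OZ_subset_OK by (simp add: image_iff) blast
  qed
  then have "(PP m c1 c2 \<diamondop> QQ m c1 c2) \<diamondop> OK \<subseteq> ((*) (of_int m) ` OK) \<diamondop> OK" by (rule iprod_mono) simp
  also have "\<dots> = (*) (of_int m) ` OK" by (rule OS.iprod_R[OF mOK])
  finally have le: "PO m c1 c2 \<diamondop> QO m c1 c2 \<subseteq> (*) (of_int m) ` OK" unfolding e .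
  have "m dvd m ^ L" using L by simp
  then have "m dvd a * b - c1 * c2" using sd unfolding split_data_def by (meson dvd_trans)
  then obtain g where g: "a * b - c1 * c2 = m * g" by (elim dvdE)
  \<comment> \<open>The homomorphism sends the generator of \<open>QQ\<close> to
    \<open>a b + 2 c1 c2\<close>, which is \<open>3 a b\<close> modulo \<open>m\<close>. The inverse
    \<open>v\<close> of this value normalizes the generator to value 1; this is the reason for
    demanding coprimality with \<open>3 a b\<close>.\<close>
  obtain u v where uv: "u * m + v * (3 * a * b) = 1"
    using sd unfolding split_data_def by (metis bezout_int coprime_imp_gcd_eq_1)
  define E where "E = eli (v * (a * b)) (v * c2) (v * c1)"
  have EQ: "E \<in> QQ m c1 c2" using QQ_I[of v m 0 c2 0 c1 0] by (simp add: E_def)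
  have "1 - E = eli (1 - v * (a * b)) (- (v * c2)) (- (v * c1))"
    using el_diff[of 1 0 0 "of_int (v * (a * b))" "of_int (v * c2)" "of_int (v * c1)"] by (simp add: E_def of_int_eli[of 1, simplified])
  moreover have "(1 - v * (a * b)) + (- (v * c2)) * c1 + (- (v * c1)) * c2 = m * (u + 2 * v * g)"
  proof -
    have "(1 - v * (a * b)) + (- (v * c2)) * c1 + (- (v * c1)) * c2 = 1 - v * (3 * a * b) + 2 * v * (a * b - c1 * c2)"
      by (simp add: algebra_simps)
    also have "\<dots> = m * (u + 2 * v * g)" unfolding g using uv by (simp add: algebra_simps)
    finally show ?thesis .
  qed
  ultimately have EP: "1 - E \<in> PP m c1 c2" by (simp only: PP_I dvd_triv_left)
  have "of_int m * E + (1 - E) * of_int m \<in> PP m c1 c2 \<diamondop> QQ m c1 c2"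
    by (intro iprod_add iprod_mult m_in_PP m_in_QQ EQ EP)
  then have m: "of_int m \<in> PP m c1 c2 \<diamondop> QQ m c1 c2" by (simp add: algebra_simps)
  have "(*) (of_int m) ` OK \<subseteq> PO m c1 c2 \<diamondop> QO m c1 c2"
    unfolding e by (intro image_subsetI iprod_mult m)
  with le show ?thesis by (rule subset_antisym)
qed

lemma QQ_add: assumes "u \<in> QQ q c1 c2" "w \<in> QQ q c1 c2" shows "u + w \<in> QQ q c1 c2"
proof -
  obtain n x y z where u: "u = eli (n * (a * b) + q * x) (n * c2 + q * y) (n * c1 + q * z)" using assms(1) by (rule QQ_E)
  obtain n' x' y' z' where w: "w = eli (n' * (a * b) + q * x') (n' * c2 + q * y') (n' * c1 + q * z')" using assms(2) by (rule QQ_E)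
  have "u + w = eli ((n + n') * (a * b) + q * (x + x')) ((n + n') * c2 + q * (y + y')) ((n + n') * c1 + q * (z + z'))"
    unfolding u w eli_add by (simp add: algebra_simps)
  then show ?thesis by (simp only: QQ_I)
qed

text \<open>Since \<open>QO\<close> is \<open>QQ\<close> times \<open>OK\<close>, and
  \<open>OK\<close> is absorbed by the remaining power, the factor 3 that moves an integer into
  \<open>OZ\<close> is paid once and not for each of the \<open>e\<close> factors.\<close>

lemma ipow_QO:
  assumes sd: "split_data L m c1 c2"
  shows "e \<le> L \<Longrightarrow> z \<in> OS.ipow (QO m c1 c2) e \<Longrightarrow> 3 * z \<in> QQ (m ^ e) c1 c2"
proof (induction e arbitrary: z)
  case 0
  then have "3 * z \<in> OZ" by (simp add: three_OK)
  then obtain i j k where "3 * z = eli i j k" by (rule OZ_E)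
  then show ?case using QQ_I[of 0 1 i c2 j c1 k] by simp
next
  case (Suc e)
  have "OS.ipow (QO m c1 c2) (Suc e) = QQ m c1 c2 \<diamondop> (OK \<diamondop> OS.ipow (QO m c1 c2) e)"
    unfolding OS.ipow_Suc by (simp add: QO_def iprod_assoc)
  also have "\<dots> = QQ m c1 c2 \<diamondop> OS.ipow (QO m c1 c2) e"
    by (simp only: OS.R_iprod[OF OS.submod_ipow[OF submod_QO]])
  finally have "z \<in> QQ m c1 c2 \<diamondop> OS.ipow (QO m c1 c2) e" using Suc.prems(2) by simp
  then show ?case
  proof (induction rule: iprod_induct)
    case (mult q w)
    have "3 * w \<in> QQ (m ^ e) c1 c2" using Suc.IH[OF _ mult(2)] Suc.prems(1) by simp
    then have "q * (3 * w) \<in> QQ (m ^ Suc e) c1 c2" by (rule QQ_mult_QQ[OF sd Suc.prems(1) mult(1)])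
    then show ?case by (simp only: mult.left_commute)
  next
    case (add x y)
    then show ?case using QQ_add by (simp only: distrib_left)
  qed
qed

lemma PO_three:
  assumes sd: "split_data L m c1 c2" and L: "L > 0" and z: "z \<in> PO m c1 c2"
  shows "3 * z \<in> PP m c1 c2"
  using z unfolding PO_def
proof (induction rule: iprod_induct)
  case (mult p w)
  have "m dvd m ^ L" using L by simp
  then have d: "m dvd a * b - c1 * c2" "m dvd a * c1 - c2 ^ 2" "m dvd b * c2 - c1 ^ 2"
    using sd unfolding split_data_def by (meson dvd_trans)+
  obtain i j k where p: "p = eli i j k" "m dvd i + j * c1 + k * c2" using mult(1) by (rule PP_E)
  obtain i' j' k' where w: "3 * w = eli i' j' k'" using three_OK[OF mult(2)] by (rule OZ_E)
  have "(i * i' + a * b * (j * k' + k * j')) + (i * j' + j * i' + a * (k * k')) * c1 + (i * k' + k * i' + b * (j * j')) * c2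
      = (i + j * c1 + k * c2) * (i' + j' * c1 + k' * c2) + (a * b - c1 * c2) * (j * k' + k * j')
        + (a * c1 - c2 ^ 2) * (k * k') + (b * c2 - c1 ^ 2) * (j * j')"
    by (simp add: algebra_simps power2_eq_square)
  also have "m dvd \<dots>" 
    by (rule dvd_add[OF dvd_add[OF dvd_add[OF dvd_mult2[OF p(2)] dvd_mult2[OF d(1)]] dvd_mult2[OF d(2)]] dvd_mult2[OF d(3)]])
  finally have "p * (3 * w) \<in> PP m c1 c2" unfolding p(1) w eli_mult by (rule PP_I)
  then show ?case by (simp only: mult.left_commute)
next
  case (add x y)
  obtain i j k where x: "3 * x = eli i j k" "m dvd i + j * c1 + k * c2" using add.IH(1) by (rule PP_E)
  obtain i' j' k' where y: "3 * y = eli i' j' k'" "m dvd i' + j' * c1 + k' * c2" using add.IH(2) by (rule PP_E)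
  have "m dvd (i + j * c1 + k * c2) + (i' + j' * c1 + k' * c2)" by (rule dvd_add[OF x(2) y(2)])
  then have "m dvd (i + i') + (j + j') * c1 + (k + k') * c2" by (simp add: algebra_simps)
  then show ?case unfolding distrib_left x(1) y(1) eli_add by (rule PP_I)
qed

section \<open>Separation of powers of degree-one primes\<close>

lemma ipow_subset: assumes "OS.submod A" "A \<subseteq> OK" shows "OS.ipow A e \<subseteq> OK" "e > 0 \<Longrightarrow> OS.ipow A e \<subseteq> A"
proof -
  show *: "OS.ipow A e \<subseteq> OK" for e
  proof (induction e)
    case (Suc e)
    then show ?case unfolding OS.ipow_Suc
      using assms(2) by (intro OS.iprod_subset_submod[OF OS.submod_R] OK_mult) auto
  qed simp
  assume "e > 0"
  then obtain e' where e: "e = Suc e'" by (cases e) auto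
  have "A \<diamondop> OS.ipow A e' \<subseteq> A \<diamondop> OK" by (rule iprod_mono) (use * in auto)
  then show "OS.ipow A e \<subseteq> A" unfolding e OS.ipow_Suc OS.iprod_R[OF assms(1)] .
qed

lemma ipow_PO_QO:
  assumes "split_data L m c1 c2" "L > 0"
  shows "OS.ipow (PO m c1 c2) e \<diamondop> OS.ipow (QO m c1 c2) e = (*) (of_int m ^ e) ` OK"
  using OS.ipow_iprod[OF submod_PO submod_QO, of m c1 c2 m c1 c2 e]
  unfolding PO_QO[OF assms] OS.ipow_scale OS.ipow_R by (rule sym)

text \<open>The norm form \<open>b y\<^sup>3 - a z\<^sup>3\<close> is the index form of the pure cubic field: an element of the
  complementary ideal has index divisible by \<open>q\<close>, whereas a balanced generator has small index.\<close>

lemma index_form_small: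
  assumes B: "norm (eli i j k) \<le> B" "norm (sg (eli i j k)) \<le> B"
  shows "of_int (a * b) * \<bar>of_int (b * j ^ 3 - a * k ^ 3)\<bar> \<le> 2 * B ^ 3"
proof -
  have c: "\<bar>of_int j\<bar> * r1 \<le> B" "\<bar>of_int k\<bar> * r2 \<le> B"
    using coords_bound[OF B(1), unfolded sg_el[symmetric], OF B(2)] by simp_all
  have "(\<bar>of_int j\<bar> * r1) ^ 3 \<le> B ^ 3" "(\<bar>of_int k\<bar> * r2) ^ 3 \<le> B ^ 3"
    using c r_pos by (intro power_mono; simp)+
  then have "\<bar>of_int j\<bar> ^ 3 * of_int (a * b ^ 2) \<le> B ^ 3" "\<bar>of_int k\<bar> ^ 3 * of_int (a ^ 2 * b) \<le> B ^ 3"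
    unfolding power_mult_distrib r_cube .
  moreover have "of_int (a * b) * \<bar>of_int (b * j ^ 3 - a * k ^ 3)\<bar>
      \<le> of_int (a * b) * (of_int b * \<bar>of_int j\<bar> ^ 3 + of_int a * \<bar>of_int k\<bar> ^ 3 :: real)"
  proof (rule mult_left_mono)
    have "\<bar>of_int (b * j ^ 3 - a * k ^ 3) :: real\<bar> \<le> \<bar>of_int (b * j ^ 3)\<bar> + \<bar>of_int (a * k ^ 3)\<bar>"
      unfolding of_int_diff by (rule abs_triangle_ineq4)
    then show "\<bar>of_int (b * j ^ 3 - a * k ^ 3)\<bar> \<le> (of_int b * \<bar>of_int j\<bar> ^ 3 + of_int a * \<bar>of_int k\<bar> ^ 3 :: real)"
      using a_pos b_pos by (simp add: abs_mult power_abs)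
  qed (use a_pos b_pos in simp)
  ultimately show ?thesis by (simp add: algebra_simps power2_eq_square)
qed

text \<open>The number \<open>\<alpha> * q'\<close> with \<open>q' = p' ^ l\<close> lies in the
  product of the \<open>l\<close>-th powers of \<open>PO\<close> at \<open>p\<close> and of
  \<open>QO\<close> at \<open>p'\<close>. Membership at \<open>p'\<close> makes the index form of
  three times this number divisible by \<open>q'\<close>, whereas the bounds on
  \<open>\<alpha>\<close> make it smaller than \<open>q'\<close>; so the number is rational. Being
  rational and in the prime over \<open>p\<close> it is divisible by \<open>p\<close>, and this is
  one factor \<open>p\<close> too many in the norm equation with the complement.\<close>

lemma separation:
  assumes l: "l > 0" and p: "Factorial_Ring.prime p" "Factorial_Ring.prime p'" "p \<noteq> p'"
    and sd: "split_data l p c1 c2" and sd': "split_data l p' d1 d2"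
    and \<alpha>: "\<alpha> \<in> KK" "\<alpha> \<noteq> 0" "norm \<alpha> \<le> E" "norm (sg \<alpha>) \<le> E"
    and eq: "(*) \<alpha> ` OS.ipow (PO p' d1 d2) l = OS.ipow (PO p c1 c2) l"
    and small: "54 * E ^ 3 * of_int p' ^ (2 * l) < of_int (a * b)"
  shows False
proof -
  define Sx Sx' Sy Sy' where "Sx = OS.ipow (PO p c1 c2) l" and "Sx' = OS.ipow (PO p' d1 d2) l"
    and "Sy = OS.ipow (QO p c1 c2) l" and "Sy' = OS.ipow (QO p' d1 d2) l"
  have sub: "OS.submod Sx" "OS.submod Sx'" "OS.submod Sy" "OS.submod Sy'"
    unfolding Sx_def Sx'_def Sy_def Sy'_def by (intro OS.submod_ipow submod_PO submod_QO)+
  have le: "Sx \<subseteq> OK" "Sx' \<subseteq> OK" "Sy \<subseteq> OK" "Sy' \<subseteq> OK" "Sx \<subseteq> PO p c1 c2"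
    unfolding Sx_def Sx'_def Sy_def Sy'_def using ipow_subset[OF submod_PO PO_subset] ipow_subset[OF submod_QO QO_subset] l by auto
  have left: "A \<diamondop> B \<subseteq> B" "B \<diamondop> A \<subseteq> B" if "A \<subseteq> OK" "OS.submod B" for A B
  proof -
    show "A \<diamondop> B \<subseteq> B" using iprod_mono[OF that(1) subset_refl, of B] OS.R_iprod[OF that(2)] by simp
    then show "B \<diamondop> A \<subseteq> B" by (simp add: iprod_commute)
  qed
  define q q' where "q = p ^ l" and "q' = p' ^ l"
  have q0: "q > 0" "q' > 0" using p by (simp_all add: q_def q'_def prime_gt_0_int)
  have Sxy: "Sx \<diamondop> Sy = (*) (of_int q) ` OK" "Sx' \<diamondop> Sy' = (*) (of_int q') ` OK"
    unfolding Sx_def Sy_def Sx'_def Sy'_def q_def q'_def of_int_power using sd sd' l by (intro ipow_PO_QO; simp)+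
  have "of_int q' \<in> Sx' \<diamondop> Sy'" unfolding Sxy using imageI[OF OS.one_in, of "(*) (of_int q')"] by simp
  then have "\<alpha> * of_int q' \<in> (*) \<alpha> ` (Sx' \<diamondop> Sy')" by (rule imageI)
  also have "\<dots> = Sx \<diamondop> Sy'" unfolding iprod_scale[symmetric] using eq by (simp only: Sx_def Sx'_def)
  finally have \<alpha>q: "\<alpha> * of_int q' \<in> Sx \<diamondop> Sy'" .
  then have \<alpha>Y: "\<alpha> * of_int q' \<in> Sy'" and \<alpha>X: "\<alpha> * of_int q' \<in> Sx"
    using left(1)[OF le(1) sub(4)] left(2)[OF le(4) sub(1)] by blast+
  have \<beta>: "3 * (\<alpha> * of_int q') \<in> QQ q' d1 d2"
    using ipow_QO[OF sd' order_refl \<alpha>Y[unfolded Sy'_def]] by (simp add: q'_def)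
  then have "3 * (\<alpha> * of_int q') \<in> OZ" using QQ_subset by blast
  then obtain i j k where ijk: "3 * (\<alpha> * of_int q') = eli i j k" by (rule OZ_E)
  have dv: "q' dvd b * j ^ 3 - a * k ^ 3"
    using \<beta> sd' unfolding ijk split_data_def q'_def[symmetric] by (intro QQ_index_form) auto
  have zero: "b * j ^ 3 - a * k ^ 3 = 0"
  proof (rule ccontr)
    assume nz: "b * j ^ 3 - a * k ^ 3 \<noteq> 0"
    have n: "norm (eli i j k) \<le> 3 * of_int q' * E"
    proof -
      have "norm (eli i j k) = 3 * of_int q' * norm \<alpha>" unfolding ijk[symmetric] norm_mult using q0 by simp
      also have "\<dots> \<le> 3 * of_int q' * E" using \<alpha>(3) q0 by (intro mult_left_mono) auto
      finally show ?thesis .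
    qed
    have s: "norm (sg (eli i j k)) \<le> 3 * of_int q' * E"
    proof -
      have "sg (3 * (\<alpha> * of_int q')) = 3 * (sg \<alpha> * of_int q')"
        using \<alpha>(1) sg_of_int[of 3] of_int_in_KK[of 3] by (simp add: sg_mult KK_mult of_int_in_KK sg_of_int)
      then have "norm (sg (eli i j k)) = 3 * of_int q' * norm (sg \<alpha>)" unfolding ijk[symmetric] using q0 by (simp add: norm_mult)
      also have "\<dots> \<le> 3 * of_int q' * E" using \<alpha>(4) q0 by (intro mult_left_mono) auto
      finally show ?thesis .
    qed
    have "q' \<le> \<bar>b * j ^ 3 - a * k ^ 3\<bar>" using dvd_imp_le_int[OF nz dv] by simp
    then have "real_of_int q' \<le> \<bar>of_int (b * j ^ 3 - a * k ^ 3)\<bar>" by linarith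
    then have "of_int (a * b) * real_of_int q' \<le> of_int (a * b) * \<bar>of_int (b * j ^ 3 - a * k ^ 3)\<bar>"
      using a_pos b_pos by (intro mult_left_mono) auto
    also have "\<dots> \<le> 2 * (3 * of_int q' * E) ^ 3" by (rule index_form_small[OF n s])
    also have "\<dots> = (54 * E ^ 3 * of_int p' ^ (2 * l)) * of_int q'"
      by (simp add: q'_def power_mult_distrib power3_eq_cube power_mult power2_eq_square mult.commute[of 2 l])
    finally have "of_int (a * b) \<le> 54 * E ^ 3 * of_int p' ^ (2 * l)" using q0 by simp
    then show False using small by linarith
  qed
  \<comment> \<open>Up to the factor \<open>a b\<close> the index form is the norm form on a plane,
    so it inherits the absence of nontrivial zeros.\<close>
  have "normf 0 j (- k) = a * b * (b * j ^ 3 - a * k ^ 3)" by (simp add: normf_def algebra_simps power2_eq_square)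
  then have "normf 0 j (- k) = 0" using zero by simp
  then have "j = 0" "k = 0" using normf_int_eq_0[of 0 j "- k"] by simp_all
  then have i: "3 * (\<alpha> * of_int q') = of_int i" using ijk by (simp add: el_def)
  have "3 * (\<alpha> * of_int q') \<in> PP p c1 c2" using PO_three[OF sd l] \<alpha>X le(5) by blast
  then obtain x y z where "of_int i = eli x y z" "p dvd x + y * c1 + z * c2" unfolding i by (rule PP_E)
  then have pi: "p dvd i" unfolding of_int_eli eli_eq_iff by simp
  have "of_int q \<in> Sx \<diamondop> Sy" unfolding Sxy using imageI[OF OS.one_in, of "(*) (of_int q)"] by simp
  also have "Sx \<diamondop> Sy = (*) \<alpha> ` (Sx' \<diamondop> Sy)" unfolding iprod_scale[symmetric] using eq by (simp only: Sx_def Sx'_def)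
  finally obtain y where y: "y \<in> Sx' \<diamondop> Sy" "of_int q = \<alpha> * y" by (elim imageE)
  then have "y \<in> Sy" using left(1)[OF le(2) sub(3)] by blast
  then have "3 * y \<in> QQ q c1 c2" using ipow_QO[OF sd order_refl, of y] by (simp add: Sy_def q_def)
  then obtain n x' y' z' where w: "3 * y = eli (n * (a * b) + q * x') (n * c2 + q * y') (n * c1 + q * z')" by (rule QQ_E)
  have "of_int i * (3 * y) = (9 * of_int q') * (\<alpha> * y)" unfolding i[symmetric] by simp
  also have "\<dots> = of_int (9 * q * q')" unfolding y(2)[symmetric] by simp
  finally have "eli (i * (n * (a * b) + q * x')) (i * (n * c2 + q * y')) (i * (n * c1 + q * z')) = eli (9 * q * q') 0 0"
    unfolding w of_int_eli eli_mult by simp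
  then have iw: "i * (n * (a * b) + q * x') = 9 * q * q'" "i * (n * c2 + q * y') = 0" unfolding eli_eq_iff by simp_all
  have "i \<noteq> 0" using iw(1) q0 by auto
  \<comment> \<open>The coordinate at \<open>t1\<close> of the rational number
    \<open>i * (3 * y)\<close> vanishes; as \<open>c2\<close> is a unit modulo \<open>p\<close>,
    this forces \<open>q\<close> to divide \<open>n\<close> and hence the rational coordinate of
    \<open>3 * y\<close>. Together with \<open>p dvd i\<close> it follows that \<open>p * q\<close>
    divides \<open>9 * q * q'\<close>.\<close>
  then have "n * c2 = q * (- y')" using iw(2) by simp
  then have "q dvd n * c2" by (metis dvd_triv_left)
  moreover have "coprime q c2"
  proof -
    have "\<not> p dvd c2"
    proof
      assume "p dvd c2"
      moreover have "p dvd p ^ l" using l by simp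
      then have "p dvd a * b - c1 * c2" using sd unfolding split_data_def by (meson dvd_trans)
      ultimately have "p dvd (a * b - c1 * c2) + c1 * c2" by (intro dvd_add dvd_mult)
      then have "p dvd 3 * a * b" by (simp add: mult.assoc)
      moreover have "coprime p (3 * a * b)" using sd by (simp add: split_data_def)
      ultimately have "is_unit p" by (meson coprime_common_divisor dvd_refl)
      then show False using p(1) not_prime_unit by blast
    qed
    then have "coprime p c2" using p(1) by (simp add: prime_imp_coprime)
    then show ?thesis unfolding q_def by simp
  qed
  ultimately have "q dvd n" by (metis coprime_dvd_mult_left_iff)
  then have "q dvd n * (a * b) + q * x'" by simp
  with pi have "p * q dvd i * (n * (a * b) + q * x')" by (rule mult_dvd_mono)
  then have "q * p dvd q * (9 * q')" unfolding iw(1) by (simp add: mult_ac)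
  then have "p dvd 9 * q'" using q0 by simp
  then have "p dvd 3 * 3 \<or> p dvd q'" using p(1) by (simp add: prime_dvd_mult_iff)
  moreover have "\<not> p dvd q'"
  proof
    assume "p dvd q'"
    then have "p dvd p'" unfolding q'_def using p(1) prime_dvd_power by blast
    then show False using p primes_dvd_imp_eq by blast
  qed
  ultimately have "p dvd 3" using p(1) prime_dvd_mult_iff by blast
  then have "p dvd 3 * a * b" by (simp add: mult.assoc)
  moreover have "coprime p (3 * a * b)" using sd by (simp add: split_data_def)
  ultimately have "is_unit p" by (meson coprime_common_divisor dvd_refl)
  then show False using p(1) not_prime_unit by blast
qed

subsection \<open>The class group\<close>

text \<open>As \<open>m\<close> is 2 modulo 3, the group of units modulo \<open>m ^ L\<close> has
  order prime to 3, so a power of \<open>A = a b^2\<close> is a cube root of it. This is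
  \<open>c1\<close>, and \<open>c2 = c1^2 / b\<close> is dictated by
  \<open>t1^2 = b t2\<close>.\<close>

lemma split_data_exists:
  assumes m: "Factorial_Ring.prime m" "m mod 3 = 2" "\<not> int m dvd a * b" and L: "L > 0"
  obtains c1 c2 where "split_data L (int m) c1 c2"
proof -
  have pm: "Factorial_Ring.prime (int m)" using m(1) by simp
  have m3n: "\<not> m dvd 3"
  proof
    assume "m dvd 3"
    then have "m = 3" using m(1) primes_dvd_imp_eq[of m 3] by simp
    then show False using m(2) by simp
  qed
  then have m3: "\<not> int m dvd 3" using int_dvd_int_iff[of m 3] by simp
  have n3ab: "\<not> int m dvd 3 * a * b" using pm m3 m(3) by (simp add: prime_dvd_mult_iff mult.assoc)
  then have cop: "coprime (int m) (3 * a * b)" using pm by (intro prime_imp_coprime)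
  define q where "q = m ^ L"
  define A where "A = nat (a * b ^ 2)"
  have A: "int A = a * b ^ 2" using a_pos by (simp add: A_def)
  have "\<not> int m dvd int A" unfolding A power2_eq_square using pm m(3) by (simp only: prime_dvd_mult_iff) simp
  then have "\<not> m dvd A" by simp
  then have "coprime A m" using prime_imp_coprime[OF m(1), of A] by (simp add: coprime_commute)
  then have cAq: "coprime A q" by (simp add: q_def)
  define T where "T = totient q"
  have "T = m ^ (L - 1) * (m - 1)" unfolding T_def q_def using m(1) L by (intro totient_prime_power)
  moreover have "coprime m 3" using m3n by (rule prime_imp_coprime[OF m(1)])
  moreover have "coprime (m - 1) 3"
  proof -
    have "\<not> 3 dvd m - 1" using m(2) by presburger
    then have "coprime 3 (m - 1)" by (intro prime_imp_coprime) simp_all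
    then show ?thesis by (simp add: coprime_commute)
  qed
  ultimately have "coprime T 3" by simp
  then have "coprime 3 T" by (simp only: coprime_commute)
  from cong_solve_coprime_nat[OF this] obtain k where k: "[3 * k = 1] (mod T)" unfolding One_nat_def[symmetric] ..
  have "[A ^ (3 * k) = A] (mod q)"
  proof (cases "3 * k \<ge> 1")
    case True
    then have i: "int (3 * k) - int 1 = int (3 * k - 1)" by (simp only: of_nat_diff)
    have "[int (3 * k) = int 1] (mod int T)" using k by (simp only: cong_int_iff)
    then have "int T dvd int (3 * k - 1)" by (simp only: cong_iff_dvd_diff i)
    then have "T dvd 3 * k - 1" by (simp only: int_dvd_int_iff)
    then obtain h where "3 * k - 1 = T * h" by (elim dvdE)
    then have "3 * k = T * h + 1" using True by linarith
    then have "A ^ (3 * k) = A ^ (T * h + 1)" by (rule arg_cong)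
    also have "\<dots> = (A ^ T) ^ h * A" by (simp only: power_add power_mult power_one_right)
    finally have "A ^ (3 * k) = (A ^ T) ^ h * A" .
    moreover have "[(A ^ T) ^ h * A = 1 ^ h * A] (mod q)"
      unfolding T_def by (intro cong_mult cong_pow cong_refl euler_theorem cAq)
    ultimately show ?thesis by simp
  next
    case False
    \<comment> \<open>The inverse of 3 can be represented by \<open>k = 0\<close> only when the
      group of units is trivial.\<close>
    then have k0: "k = 0" by simp
    then have "[0 = 1] (mod T)" using k by simp
    then have "T = 1" by (rule cong_0_1_nat[THEN iffD1])
    then have "[A ^ 1 = 1] (mod q)" using euler_theorem[OF cAq] unfolding T_def[symmetric] by (simp only:)
    from cong_sym[OF this] show ?thesis by (simp add: k0)
  qed
  then have "[int (A ^ (3 * k)) = int A] (mod int q)" by (simp only: cong_int_iff)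
  then have "int q dvd int A - int (A ^ (3 * k))" by (simp add: cong_iff_dvd_diff dvd_diff_commute)
  then obtain h2 where h2: "int A - int (A ^ (3 * k)) = int q * h2" by (elim dvdE)
  define c1 where "c1 = int (A ^ k)"
  have c1: "a * b ^ 2 - c1 ^ 3 = int q * h2" using h2 by (simp add: A c1_def power_mult mult.commute[of 3 k])
  have "coprime b (int q)"
  proof -
    have "\<not> int m dvd b" using m(3) dvd_mult[of "int m" b a] by blast
    then have "coprime (int m) b" using pm by (intro prime_imp_coprime)
    then show ?thesis by (simp add: q_def coprime_commute)
  qed
  from cong_solve_coprime_int[OF this] obtain b' where "[b * b' = 1] (mod int q)" ..
  then have "int q dvd b * b' - 1" by (simp add: cong_iff_dvd_diff)
  then obtain h1 where h1: "b * b' - 1 = int q * h1" by (elim dvdE)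
  define c2 where "c2 = b' * c1 ^ 2"
  have "b * c2 - c1 ^ 2 = (b * b' - 1) * c1 ^ 2" by (simp add: c2_def algebra_simps)
  then have d1: "int q dvd b * c2 - c1 ^ 2" unfolding h1 by simp
  have "a * b - c1 * c2 = b' * (a * b ^ 2 - c1 ^ 3) - a * b * (b * b' - 1)"
    by (simp add: c2_def algebra_simps power2_eq_square power3_eq_cube)
  also have "\<dots> = int q * (b' * h2 - a * b * h1)" unfolding h1 c1 by (simp add: algebra_simps)
  finally have d2: "int q dvd a * b - c1 * c2" by simp
  have "a * c1 - c2 ^ 2 = b' ^ 2 * c1 * (a * b ^ 2 - c1 ^ 3) - a * c1 * (1 + b * b') * (b * b' - 1)"
    by (simp add: c2_def algebra_simps power2_eq_square power3_eq_cube)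
  also have "\<dots> = int q * (b' ^ 2 * c1 * h2 - a * c1 * (1 + b * b') * h1)" unfolding h1 c1 by (simp add: algebra_simps)
  finally have d3: "int q dvd a * c1 - c2 ^ 2" by simp
  have "split_data L (int m) c1 c2"
    unfolding split_data_def using d1 d2 d3 cop prime_gt_0_nat[OF m(1)] by (simp add: q_def)
  then show ?thesis by (rule that)
qed

text \<open>The norm of \<open>3 * w\<close> is a nonzero integer and a multiple of \<open>w\<close>
  within \<open>OK\<close>.\<close>

lemma integer_multiple:
  assumes w: "w \<in> OK" "w \<noteq> 0"
  obtains g where "g > 0" "of_nat g \<in> (*) w ` OK"
proof -
  obtain i j k where e: "3 * w = eli i j k" using three_OK[OF w(1)] by (rule OZ_E)
  define u where "u = eli (i ^ 2 - a * b * (j * k)) (a * k ^ 2 - i * j) (b * j ^ 2 - i * k)"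
  have "eli i j k * u = of_rat (normf (of_int i) (of_int j) (of_int k))"
    using el_adj[of "of_int i" "of_int j" "of_int k"] by (simp add: u_def)
  also have "normf (of_int i) (of_int j) (of_int k) = of_int (normf i j k)" by (simp add: normf_def)
  finally have eu: "w * (3 * u) = of_int (normf i j k)" unfolding e[symmetric] by (simp add: mult_ac)
  have "normf i j k \<noteq> 0"
  proof
    assume "normf i j k = 0"
    then have "i = 0 \<and> j = 0 \<and> k = 0" by (rule normf_int_eq_0)
    then have "3 * w = 0" unfolding e by (simp add: el_def)
    then show False using w(2) by simp
  qed
  have "u \<in> OK" using eli_in_OZ OZ_subset_OK unfolding u_def by blast
  then have u3: "3 * u \<in> OK" using OK_mult[OF OK_of_int[of 3]] by simp
  define g where "g = nat \<bar>normf i j k\<bar>"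
  have "of_int \<bar>normf i j k\<bar> \<in> (*) w ` OK"
  proof (cases "normf i j k \<ge> 0")
    case True
    then show ?thesis using u3 eu[symmetric] by (intro image_eqI[of _ _ "3 * u"]) simp_all
  next
    case False
    then show ?thesis using OS.minus_in[OF u3] eu[symmetric] by (intro image_eqI[of _ _ "- (3 * u)"]) simp_all
  qed
  then have "of_nat g \<in> (*) w ` OK" by (simp add: g_def)
  moreover have "g > 0" using \<open>normf i j k \<noteq> 0\<close> by (simp add: g_def)
  ultimately show ?thesis using that by blast
qed

text \<open>Three times \<open>w\<close> has integer coordinates and hence a nonzero integer norm;
  27 is the norm of 3.\<close>

lemma OK_norm_ge:
  assumes "w \<in> OK" "w \<noteq> 0"
  shows "1 \<le> 27 * (norm w * norm (sg w) ^ 2)"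
proof -
  obtain i j k where e: "3 * w = eli i j k" using three_OK[OF assms(1)] by (rule OZ_E)
  have "normf i j k \<noteq> 0"
  proof
    assume "normf i j k = 0"
    then have "i = 0 \<and> j = 0 \<and> k = 0" by (rule normf_int_eq_0)
    then have "3 * w = 0" unfolding e by (simp add: el_def)
    then show False using assms(2) by simp
  qed
  then have "1 \<le> \<bar>real_of_int (normf i j k)\<bar>" by linarith
  also have "real_of_int (normf i j k) = of_rat (normf (of_int i) (of_int j) (of_int k))"
  proof -
    have "normf (of_int i) (of_int j) (of_int k) = (of_int (normf i j k) :: rat)" by (simp add: normf_def)
    then show ?thesis by simp
  qed
  also have "\<bar>of_rat (normf (of_int i) (of_int j) (of_int k))\<bar> = norm (3 * w) * norm (sg (3 * w)) ^ 2"
    unfolding e by (rule norm_sg[symmetric])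
  also have "sg (3 * w) = 3 * sg w" using sg_mult[OF of_int_in_KK[of 3] OK_KK[OF assms(1)]] sg_of_int[of 3] by simp
  also have "norm (3 * w) * norm (3 * sg w) ^ 2 = 27 * (norm w * norm (sg w) ^ 2)"
    by (simp add: norm_mult power_mult_distrib)
  finally show ?thesis .
qed

section \<open>Ideal classes as orbits under scaling\<close>

definition cls :: "complex set \<Rightarrow> complex set set" where
  "cls I = {(*) x ` I | x. x \<in> KK \<and> x \<noteq> 0}"

lemma clsI: "x \<in> KK \<Longrightarrow> x \<noteq> 0 \<Longrightarrow> (*) x ` I \<in> cls I"
  unfolding cls_def by (rule CollectI, rule exI[of _ x]) simp

lemma clsE:
  assumes "Z \<in> cls I"
  obtains x where "Z = (*) x ` I" "x \<in> KK" "x \<noteq> 0"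
  using assms unfolding cls_def by (elim CollectE exE conjE) (rule that)

lemma one_in_KK: "1 \<in> KK"
  using of_nat_in_KK[of 1] by simp

lemma cls_self: "I \<in> cls I"
  using clsI[OF one_in_KK, of I] by simp

lemma cls_eqI:
  assumes "x \<in> KK" "x \<noteq> 0"
  shows "cls ((*) x ` I) = cls I"
proof
  show "cls ((*) x ` I) \<subseteq> cls I"
  proof
    fix Z assume "Z \<in> cls ((*) x ` I)"
    then obtain y where y: "Z = (*) y ` ((*) x ` I)" "y \<in> KK" "y \<noteq> 0" by (rule clsE)
    have "(*) (y * x) ` I \<in> cls I" using assms y by (intro clsI KK_mult) simp_all
    then show "Z \<in> cls I" unfolding y(1) scale_scale .
  qed
  show "cls I \<subseteq> cls ((*) x ` I)"
  proof
    fix Z assume "Z \<in> cls I"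
    then obtain y where y: "Z = (*) y ` I" "y \<in> KK" "y \<noteq> 0" by (rule clsE)
    have "(*) (y / x) ` ((*) x ` I) \<in> cls ((*) x ` I)" using assms y by (intro clsI KK_divide) simp_all
    moreover have "y / x * x = y" using assms by simp
    ultimately show "Z \<in> cls ((*) x ` I)" unfolding y(1) scale_scale by (simp only:)
  qed
qed

lemma principal_eq: "principal_fractional_ideals KK = cls OK"
  by (simp add: principal_fractional_ideals_def cls_def)

lemma coset_eq_cls:
  assumes "OS.submod I"
  shows "principal_fractional_ideals KK #>\<^bsub>ideal_group KK\<^esub> I = cls I"
proof -
  have "((*) x ` OK) \<diamondop> I = (*) x ` I" for x unfolding iprod_scale OS.R_iprod[OF assms] ..
  note e = this
  have "(\<Union>h\<in>cls OK. {h \<diamondop> I}) = cls I"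
  proof
    show "(\<Union>h\<in>cls OK. {h \<diamondop> I}) \<subseteq> cls I"
    proof
      fix Z assume "Z \<in> (\<Union>h\<in>cls OK. {h \<diamondop> I})"
      then obtain h where h: "h \<in> cls OK" "Z = h \<diamondop> I" by (elim UN_E singletonE)
      from h(1) obtain x where x: "h = (*) x ` OK" "x \<in> KK" "x \<noteq> 0" by (rule clsE)
      show "Z \<in> cls I" unfolding h(2) x(1) e using x(2,3) by (rule clsI)
    qed
    show "cls I \<subseteq> (\<Union>h\<in>cls OK. {h \<diamondop> I})"
    proof
      fix Z assume "Z \<in> cls I"
      then obtain x where x: "Z = (*) x ` I" "x \<in> KK" "x \<noteq> 0" by (rule clsE)
      show "Z \<in> (\<Union>h\<in>cls OK. {h \<diamondop> I})"
        unfolding x(1) e[of x, symmetric] by (rule UN_I[OF clsI[OF x(2,3)]]) simp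
    qed
  qed
  then show ?thesis unfolding principal_eq r_coset_def ideal_group_def by simp
qed

text \<open>The denominator \<open>d\<close> is an algebraic integer; a positive rational integer
  that is a multiple of it serves as common denominator.\<close>

lemma fractional_ideal_frac_ideal:
  assumes "I \<in> fractional_ideals KK"
  shows "frac_ideal I"
proof -
  obtain d J where I: "I = (\<lambda>x. x / d) ` J" and d: "d \<in> OK" "d \<noteq> 0"
    and J: "ideal J (complex_ring\<lparr>carrier := OK\<rparr>)" and J0: "J \<noteq> {0}"
    using assms unfolding fractional_ideals_def by (elim CollectE exE conjE) (rule that)
  interpret J: ideal J "complex_ring\<lparr>carrier := OK\<rparr>" by (rule J)
  have JO: "J \<subseteq> OK" using J.a_subset by simp
  have z: "0 \<in> J" using additive_subgroup.zero_closed[OF J.additive_subgroup_axioms] by (simp add: complex_ring_simps)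
  have sJ: "OS.submod J"
    unfolding OS.submod_def
  proof (intro conjI ballI z)
    fix x y assume "x \<in> J" "y \<in> J"
    then show "x + y \<in> J" using additive_subgroup.a_closed[OF J.additive_subgroup_axioms, of x y] by (simp add: complex_ring_simps)
  next
    fix r x assume "r \<in> OK" "x \<in> J"
    then show "r * x \<in> J" using J.I_l_closed[of x r] by (simp add: complex_ring_simps)
  qed
  have Is: "I = (*) (1 / d) ` J" unfolding I by (intro image_cong) simp_all
  have "OS.submod I" unfolding Is by (rule OS.submod_scale[OF sJ])
  moreover have "I \<subseteq> KK" unfolding I using JO d OK_KK by (auto intro!: KK_divide)
  moreover have "\<exists>g>0. \<forall>w\<in>I. of_nat g * w \<in> OK"
  proof -
    obtain g where g: "g > 0" "of_nat g \<in> (*) d ` OK" by (rule integer_multiple[OF d])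
    obtain e where e: "of_nat g = d * e" "e \<in> OK" using g(2) by (elim imageE)
    have "of_nat g * w \<in> OK" if wI: "w \<in> I" for w
    proof -
      obtain x where x: "w = x / d" "x \<in> J" using wI unfolding I by (elim imageE)
      have "of_nat g * w = e * x" unfolding e(1) x(1) using d(2) by simp
      then show ?thesis using OK_mult[OF e(2), of x] JO x(2) by auto
    qed
    then show ?thesis using g(1) by (intro exI[of _ g] conjI ballI)
  qed
  moreover have "\<exists>w\<in>I. w \<noteq> 0"
  proof -
    obtain x where x: "x \<in> J" "x \<noteq> 0" using J0 z by blast
    have "x / d \<in> I" unfolding I using x(1) by (rule imageI)
    then show ?thesis using d(2) x(2) by (intro bexI[of _ "x / d"]) simp_all
  qed
  ultimately show ?thesis unfolding frac_ideal_def by (intro conjI)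
qed

lemma cls_mult:
  "cls A <#>\<^bsub>ideal_group KK\<^esub> cls B = cls (A \<diamondop> B)"
proof
  have m: "((*) x ` A) \<diamondop> ((*) y ` B) = (*) (x * y) ` (A \<diamondop> B)" for x y
    unfolding iprod_scale iprod_commute[of A] scale_scale ..
  have e: "cls A <#>\<^bsub>ideal_group KK\<^esub> cls B = (\<Union>h\<in>cls A. \<Union>k\<in>cls B. {h \<diamondop> k})"
    by (simp add: set_mult_def ideal_group_def)
  show "cls A <#>\<^bsub>ideal_group KK\<^esub> cls B \<subseteq> cls (A \<diamondop> B)"
  proof
    fix Z assume "Z \<in> cls A <#>\<^bsub>ideal_group KK\<^esub> cls B"
    then have "Z \<in> (\<Union>h\<in>cls A. \<Union>k\<in>cls B. {h \<diamondop> k})" unfolding e .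
    then obtain h k where hk: "h \<in> cls A" "k \<in> cls B" "Z = h \<diamondop> k" by (elim UN_E singletonE)
    from hk(1) obtain x where x: "h = (*) x ` A" "x \<in> KK" "x \<noteq> 0" by (rule clsE)
    from hk(2) obtain y where y: "k = (*) y ` B" "y \<in> KK" "y \<noteq> 0" by (rule clsE)
    show "Z \<in> cls (A \<diamondop> B)" unfolding hk(3) x(1) y(1) m using x y by (intro clsI KK_mult) simp_all
  qed
  show "cls (A \<diamondop> B) \<subseteq> cls A <#>\<^bsub>ideal_group KK\<^esub> cls B"
  proof
    fix Z assume "Z \<in> cls (A \<diamondop> B)"
    then obtain x where x: "Z = (*) x ` (A \<diamondop> B)" "x \<in> KK" "x \<noteq> 0" by (rule clsE)
    have "Z = ((*) x ` A) \<diamondop> B" unfolding x(1) iprod_scale ..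
    moreover have "((*) x ` A) \<diamondop> B \<in> (\<Union>h\<in>cls A. \<Union>k\<in>cls B. {h \<diamondop> k})"
      by (rule UN_I[OF clsI[OF x(2,3)]], rule UN_I[OF cls_self]) simp
    ultimately show "Z \<in> cls A <#>\<^bsub>ideal_group KK\<^esub> cls B" unfolding e by (simp only:)
  qed
qed

lemma cls_pow:
  assumes "OS.submod I"
  shows "cls I [^]\<^bsub>class_group KK\<^esub> n = cls (OS.ipow I n)"
proof (induction n)
  case 0
  show ?case by (simp add: nat_pow_def class_group_def FactGroup_def principal_eq)
next
  case (Suc n)
  have "cls I [^]\<^bsub>class_group KK\<^esub> Suc n = (cls I [^]\<^bsub>class_group KK\<^esub> n) <#>\<^bsub>ideal_group KK\<^esub> cls I"
    by (simp add: nat_pow_def class_group_def FactGroup_def)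
  also have "\<dots> = cls (OS.ipow I n \<diamondop> I)" unfolding Suc by (rule cls_mult)
  finally show ?case by (simp add: OS.ipow_Suc iprod_commute)
qed

lemma torsion_class:
  assumes t: "t \<in> carrier (class_group KK)" "t [^]\<^bsub>class_group KK\<^esub> l = \<one>\<^bsub>class_group KK\<^esub>"
  obtains I \<gamma> where "frac_ideal I" "t = cls I" "\<gamma> \<in> KK" "\<gamma> \<noteq> 0" "OS.ipow I l = (*) \<gamma> ` OK"
proof -
  obtain I where I: "I \<in> fractional_ideals KK" "t = principal_fractional_ideals KK #>\<^bsub>ideal_group KK\<^esub> I"
  proof -
    have "t \<in> (\<Union>I\<in>carrier (ideal_group KK). {principal_fractional_ideals KK #>\<^bsub>ideal_group KK\<^esub> I})"
      using t(1) unfolding class_group_def FactGroup_def RCOSETS_def by simp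
    then obtain I where "I \<in> carrier (ideal_group KK)" "t = principal_fractional_ideals KK #>\<^bsub>ideal_group KK\<^esub> I"
      by (elim UN_E singletonE)
    moreover have "carrier (ideal_group KK) = fractional_ideals KK" by (simp add: ideal_group_def)
    ultimately show ?thesis using that by simp
  qed
  have f: "frac_ideal I" by (rule fractional_ideal_frac_ideal[OF I(1)])
  then have s: "OS.submod I" by (simp add: frac_ideal_def)
  have tI: "t = cls I" unfolding I(2) by (rule coset_eq_cls[OF s])
  have "cls (OS.ipow I l) = cls OK"
    using t(2) unfolding tI cls_pow[OF s] by (simp add: class_group_def FactGroup_def principal_eq)
  then have "OS.ipow I l \<in> cls OK" using cls_self[of "OS.ipow I l"] by simp
  then obtain \<gamma> where "OS.ipow I l = (*) \<gamma> ` OK" "\<gamma> \<in> KK" "\<gamma> \<noteq> 0" by (rule clsE)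
  with f tI show ?thesis by (intro that)
qed

section \<open>Reduced ideals and the size of minimal vectors\<close>

lemma frac_ideal_iprod_PO:
  assumes I: "frac_ideal I" and m: "m > 0"
  shows "frac_ideal (I \<diamondop> PO m c1 c2)"
proof -
  have I': "OS.submod I" "I \<subseteq> KK" using I by (auto simp: frac_ideal_def)
  obtain g where g: "g > 0" "\<forall>w\<in>I. of_nat g * w \<in> OK" using I unfolding frac_ideal_def by blast
  obtain u where u: "u \<in> I" "u \<noteq> 0" using I unfolding frac_ideal_def by blast
  have sub: "I \<diamondop> PO m c1 c2 \<subseteq> I"
    using iprod_mono[OF subset_refl PO_subset, of I m c1 c2] OS.iprod_R[OF I'(1)] by simp
  have "u * of_int m \<in> I \<diamondop> PO m c1 c2" by (rule iprod_mult[OF u(1) m_in_PO])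
  moreover have "u * of_int m \<noteq> 0" using u m by simp
  ultimately have ex: "\<exists>w\<in>I \<diamondop> PO m c1 c2. w \<noteq> 0" by (rule bexI[rotated])
  have "\<forall>w\<in>I \<diamondop> PO m c1 c2. of_nat g * w \<in> OK" using bspec[OF g(2) subsetD[OF sub]] by (rule ballI)
  then have "\<exists>g>0. \<forall>w\<in>I \<diamondop> PO m c1 c2. of_nat g * w \<in> OK" using g(1) by (intro exI[of _ g] conjI)
  then show ?thesis
    unfolding frac_ideal_def using OS.submod_iprod[OF I'(1) submod_PO] subset_trans[OF sub I'(2)] ex by (intro conjI)
qed

definition reduced_ideals :: "complex set set" where
  "reduced_ideals = {B. OS.submod B \<and> 1 \<in> B \<and> (\<exists>n>0. real n \<le> 100 * of_int (a * b) \<and> (\<forall>w\<in>B. of_nat n * w \<in> OK))}"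

text \<open>Multiplication by its denominator \<open>n\<close> turns a reduced ideal, which contains
  1, into an integral ideal containing \<open>n\<close>. The summation over all \<open>n\<close> is
  the source of the exponent 1 in the final bound.\<close>

lemma card_reduced_ideals:
  "finite reduced_ideals \<and> card reduced_ideals \<le> (\<Sum>n=1..nat (100 * (a * b)). card (ID.ideals_of n))"
proof -
  define M where "M = nat (100 * (a * b))"
  have sub: "reduced_ideals \<subseteq> (\<Union>n\<in>{1..M}. (\<lambda>J. (*) (1 / of_nat n) ` J) ` ID.ideals_of n)"
  proof
    fix B assume "B \<in> reduced_ideals"
    then obtain n where B: "OS.submod B" "1 \<in> B" and n: "n > 0" "real n \<le> 100 * of_int (a * b)" "\<forall>w\<in>B. of_nat n * w \<in> OK"
      unfolding reduced_ideals_def by (elim CollectE exE conjE) (rule that)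
    have "real_of_int (int n) \<le> real_of_int (100 * (a * b))" using n(2) by simp
    then have "int n \<le> 100 * (a * b)" by (simp only: of_int_le_iff)
    then have nM: "n \<in> {1..M}" using n(1) by (simp add: M_def)
    define J where "J = (*) (of_nat n) ` B"
    have "of_nat n \<in> J" unfolding J_def using B(2) by (intro image_eqI[of _ _ 1]) simp_all
    moreover have "J \<subseteq> OK" unfolding J_def using n(3) by (intro image_subsetI) simp
    ultimately have "J \<in> ID.ideals_of n" unfolding ID.ideals_of_def J_def using OS.submod_scale[OF B(1)] by simp
    moreover have "B = (*) (1 / of_nat n) ` J" unfolding J_def scale_scale using n(1) by simp
    ultimately show "B \<in> (\<Union>n\<in>{1..M}. (\<lambda>J. (*) (1 / of_nat n) ` J) ` ID.ideals_of n)"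
      by (intro UN_I[OF nM] image_eqI[of _ _ J])
  qed
  have fin: "finite (\<Union>n\<in>{1..M}. (\<lambda>J. (*) (1 / of_nat n :: complex) ` J) ` ID.ideals_of n)"
    by (intro finite_UN_I finite_imageI ID.finite_ideals_of) auto
  have "card reduced_ideals \<le> card (\<Union>n\<in>{1..M}. (\<lambda>J. (*) (1 / of_nat n :: complex) ` J) ` ID.ideals_of n)"
    by (rule card_mono[OF fin sub])
  also have "\<dots> \<le> (\<Sum>n\<in>{1..M}. card ((\<lambda>J. (*) (1 / of_nat n :: complex) ` J) ` ID.ideals_of n))"
    by (rule card_UN_le) simp
  also have "\<dots> \<le> (\<Sum>n\<in>{1..M}. card (ID.ideals_of n))"
    by (intro sum_mono card_image_le ID.finite_ideals_of) auto
  finally show ?thesis using finite_subset[OF sub fin] by (simp add: M_def)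
qed

lemma ipow_class_PO:
  assumes I: "OS.submod I" and \<gamma>: "OS.ipow I l = (*) \<gamma> ` OK"
  shows "OS.ipow (I \<diamondop> PO m c1 c2) l = (*) \<gamma> ` OS.ipow (PO m c1 c2) l"
  unfolding OS.ipow_iprod[OF I submod_PO] \<gamma> iprod_scale OS.R_iprod[OF OS.submod_ipow[OF submod_PO]] ..

lemma minvec_reduced_ideal:
  assumes A: "frac_ideal A" and v: "minvec A x y v" and xy: "x > 0" "y > 0"
  shows "(*) (1 / v) ` A \<in> reduced_ideals"
proof -
  have A': "OS.submod A" "A \<subseteq> KK" using A by (auto simp: frac_ideal_def)
  have v': "v \<in> A" "v \<noteq> 0" using v by (auto simp: minvec_def)
  obtain n where n: "n > 0" "real n \<le> 100 * of_int (a * b)" "\<And>w. w \<in> A \<Longrightarrow> of_nat n * w \<in> (*) v ` OK"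
    using minvec_index[OF A v xy] by metis
  have "of_nat n * w \<in> OK" if wI: "w \<in> (*) (1 / v) ` A" for w
  proof -
    obtain u where u: "w = 1 / v * u" "u \<in> A" using wI by (elim imageE)
    obtain z where z: "of_nat n * u = v * z" "z \<in> OK" using n(3)[OF u(2)] by (elim imageE)
    have "of_nat n * w = (of_nat n * u) / v" unfolding u(1) by simp
    also have "\<dots> = z" unfolding z(1) using v'(2) by simp
    finally show ?thesis using z(2) by simp
  qed
  then have "\<exists>n>0. real n \<le> 100 * of_int (a * b) \<and> (\<forall>w\<in>(*) (1 / v) ` A. of_nat n * w \<in> OK)"
    using n(1,2) by (intro exI[of _ n] conjI ballI)
  moreover have "1 \<in> (*) (1 / v) ` A" using v' by (intro image_eqI[of _ _ v]) simp_all
  ultimately show ?thesis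
    unfolding reduced_ideals_def using OS.submod_scale[OF A'(1)] by (intro CollectI conjI)
qed

text \<open>The logarithm of \<open>(10 * N) ^ 11\<close>, the bound of
  \<open>balanced_log_bound\<close> for the two weighted sizes and their inverses.\<close>

definition logbound :: int where
  "logbound = \<lceil>11 * ln (10 * real_of_int (a * b))\<rceil>"

text \<open>The quantity bounded is the \<open>l\<close>-th root of the norm of
  \<open>\<rho> = v ^ l / \<gamma>\<close>. Since \<open>v ^ l\<close> lies in the
  \<open>l\<close>-th power of the ideal, \<open>\<rho>\<close> is integral, which bounds its norm
  below. Since \<open>n\<close> times the ideal consists of multiples of \<open>v\<close>, some
  integral multiple of \<open>\<rho>\<close> is the \<open>l\<close>-th power of
  \<open>n * m\<close>, which bounds the norm above.\<close>

lemma minvec_norm_bounds: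
  assumes l: "l > 0" and I: "frac_ideal I" and \<gamma>: "\<gamma> \<in> KK" "\<gamma> \<noteq> 0" "OS.ipow I l = (*) \<gamma> ` OK"
    and m: "m > 0" "of_int m \<le> real_of_int (a * b)"
    and v: "minvec (I \<diamondop> PO m c1 c2) (root l (norm \<gamma>)) (root l (norm (sg \<gamma>))) v"
  shows "1 / 27 \<le> (norm v / root l (norm \<gamma>)) * (norm (sg v) / root l (norm (sg \<gamma>))) ^ 2"
    and "(norm v / root l (norm \<gamma>)) * (norm (sg v) / root l (norm (sg \<gamma>))) ^ 2 \<le> 27 * (100 * of_int (a * b) ^ 2) ^ 3"
proof -
  define N where "N = real_of_int (a * b)"
  define A where "A = I \<diamondop> PO m c1 c2"
  define x y where "x = root l (norm \<gamma>)" and "y = root l (norm (sg \<gamma>))"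
  have xy: "x > 0" "y > 0" "x ^ l = norm \<gamma>" "y ^ l = norm (sg \<gamma>)"
    using \<gamma> l by (simp_all add: x_def y_def sg_eq_0_iff)
  have I': "OS.submod I" "I \<subseteq> KK" using I by (auto simp: frac_ideal_def)
  have fA: "frac_ideal A" unfolding A_def using I m(1) by (rule frac_ideal_iprod_PO)
  then have A': "OS.submod A" "A \<subseteq> KK" by (auto simp: frac_ideal_def)
  have v0: "minvec A x y v" using v by (simp add: A_def x_def y_def)
  then have v': "v \<in> A" "v \<in> KK" "v \<noteq> 0" using A' by (auto simp: minvec_def)
  have ipA: "OS.ipow A l = (*) \<gamma> ` OS.ipow (PO m c1 c2) l" unfolding A_def by (rule ipow_class_PO[OF I'(1) \<gamma>(3)])
  define p where "p = (norm v / x) * (norm (sg v) / y) ^ 2"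
  have p0: "p > 0" unfolding p_def using v' xy by (simp add: sg_eq_0_iff)
  define \<rho> where "\<rho> = v ^ l / \<gamma>"
  have \<rho>K: "\<rho> \<in> KK" "\<rho> \<noteq> 0" unfolding \<rho>_def using v' \<gamma> by (simp_all add: KK_divide KK_power)
  have pl: "p ^ l = norm \<rho> * norm (sg \<rho>) ^ 2"
  proof -
    have "norm \<rho> = (norm v / x) ^ l" unfolding \<rho>_def power_divide xy(3) by (simp add: norm_divide norm_power)
    moreover have "sg \<rho> = sg v ^ l / sg \<gamma>" unfolding \<rho>_def using v'(2) \<gamma>(1) by (simp only: sg_divide KK_power sg_power)
    then have "norm (sg \<rho>) = (norm (sg v) / y) ^ l" unfolding power_divide xy(4) by (simp add: norm_divide norm_power)
    ultimately show ?thesis unfolding p_def power_mult_distrib by (simp only: power_mult[symmetric] mult.commute[of 2])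
  qed
  have "v ^ l \<in> OS.ipow A l" using v'(1) by (rule OS.power_in_ipow)
  then obtain z where z: "v ^ l = \<gamma> * z" "z \<in> OS.ipow (PO m c1 c2) l" unfolding ipA by (elim imageE)
  then have "\<rho> = z" unfolding \<rho>_def using \<gamma>(2) by simp
  then have \<rho>O: "\<rho> \<in> OK" using z(2) ipow_subset(1)[OF submod_PO PO_subset] by blast
  have lo: "1 / 27 \<le> p ^ l" using OK_norm_ge[OF \<rho>O \<rho>K(2)] unfolding pl by simp
  show "1 / 27 \<le> (norm v / root l (norm \<gamma>)) * (norm (sg v) / root l (norm (sg \<gamma>))) ^ 2"
    unfolding x_def[symmetric] y_def[symmetric] p_def[symmetric]
  proof (rule ccontr)
    assume "\<not> 1 / 27 \<le> p"
    then have "p < 1 / 27" by simp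
    moreover have "p ^ l \<le> p ^ 1" using \<open>p < 1 / 27\<close> p0 l by (intro power_decreasing) auto
    ultimately show False using lo by simp
  qed
  obtain n where n: "n > 0" "real n \<le> 100 * of_int (a * b)" "\<And>w. w \<in> A \<Longrightarrow> of_nat n * w \<in> (*) v ` OK"
    using minvec_index[OF fA v0 xy(1,2)] by metis
  define d where "d = of_nat n * (of_int m :: complex)"
  have d0: "d \<noteq> 0" "norm d = real n * of_int m" unfolding d_def using n(1) m(1) by (simp_all add: norm_mult)
  have dK: "d \<in> KK" "sg d = d" unfolding d_def by (simp_all add: KK_mult of_nat_in_KK of_int_in_KK sg_mult sg_of_nat sg_of_int)
  have "\<gamma> * of_int m ^ l \<in> OS.ipow A l"
    unfolding ipA by (rule imageI) (rule OS.power_in_ipow[OF m_in_PO])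
  then have "of_nat n ^ l * (\<gamma> * of_int m ^ l) \<in> (*) (of_nat n ^ l) ` OS.ipow A l" by (rule imageI)
  also have "\<dots> = OS.ipow ((*) (of_nat n) ` A) l" by (rule OS.ipow_scale[symmetric])
  also have "\<dots> \<subseteq> OS.ipow ((*) v ` OK) l" using n(3) by (intro OS.ipow_mono image_subsetI)
  also have "\<dots> = (*) (v ^ l) ` OK" unfolding OS.ipow_scale OS.ipow_R ..
  finally obtain u where u: "of_nat n ^ l * (\<gamma> * of_int m ^ l) = v ^ l * u" "u \<in> OK" by (elim imageE)
  have ur: "u * \<rho> = d ^ l"
  proof -
    have "u * \<rho> = (v ^ l * u) / \<gamma>" by (simp add: \<rho>_def)
    also have "\<dots> = d ^ l" unfolding u(1)[symmetric] d_def power_mult_distrib using \<gamma>(2) by simp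
    finally show ?thesis .
  qed
  then have u0: "u \<noteq> 0" using d0 by auto
  have "1 \<le> 27 * (norm u * norm (sg u) ^ 2)" by (rule OK_norm_ge[OF u(2) u0])
  then have "p ^ l * 1 \<le> p ^ l * (27 * (norm u * norm (sg u) ^ 2))" using p0 by (intro mult_left_mono) auto
  also have "\<dots> = 27 * (norm (u * \<rho>) * norm (sg (u * \<rho>)) ^ 2)"
    unfolding pl using OK_KK[OF u(2)] \<rho>K(1) by (simp add: sg_mult norm_mult power_mult_distrib)
  also have "\<dots> = 27 * ((real n * of_int m) ^ 3) ^ l"
    unfolding ur using dK by (simp only: sg_power norm_power d0(2)) (simp add: power2_eq_square power3_eq_cube power_mult_distrib)
  \<comment> \<open>Weakened to \<open>27 ^ l\<close> so that the \<open>l\<close>-th root can be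
    taken.\<close>
  also have "\<dots> \<le> 27 ^ l * ((real n * of_int m) ^ 3) ^ l"
    using power_increasing[of 1 l "27::real"] l m(1) by (intro mult_right_mono) auto
  also have "\<dots> = (27 * (real n * of_int m) ^ 3) ^ l" by (simp only: power_mult_distrib)
  finally have "p ^ l \<le> (27 * (real n * of_int m) ^ 3) ^ l" by simp
  then have "p \<le> 27 * (real n * of_int m) ^ 3"
    by (rule power_mono_iff[THEN iffD1, rotated -1]) (use p0 l m(1) in auto)
  also have "\<dots> \<le> 27 * (100 * N ^ 2) ^ 3"
  proof -
    have "real n * of_int m \<le> (100 * N) * N" using n(2) m unfolding N_def by (intro mult_mono) auto
    then have "real n * of_int m \<le> 100 * N ^ 2" by (simp add: power2_eq_square)
    then show ?thesis using m(1) by (intro mult_left_mono power_mono) auto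
  qed
  finally show "(norm v / root l (norm \<gamma>)) * (norm (sg v) / root l (norm (sg \<gamma>))) ^ 2 \<le> 27 * (100 * of_int (a * b) ^ 2) ^ 3"
    unfolding x_def[symmetric] y_def[symmetric] p_def[symmetric] by (simp add: N_def)
qed

text \<open>Bounds on both ratios of \<open>p\<close> and \<open>q\<close> and on
  \<open>p * q ^ 2\<close> bound each of the two numbers; the largest quantity that occurs is
  \<open>48600000000 * N ^ 11\<close>, which is below \<open>(10 * N) ^ 11\<close>.\<close>

lemma balanced_log_bound:
  fixes p q N :: real
  assumes N: "N \<ge> 2" and pq: "p > 0" "q > 0" and r: "p \<le> 2 * N * q" "q \<le> 900 * N ^ 4 * p"
    and lo: "1 / 27 \<le> p * q ^ 2" and up: "p * q ^ 2 \<le> 27 * (100 * N ^ 2) ^ 3"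
  shows "\<bar>ln p\<bar> \<le> 11 * ln (10 * N) \<and> \<bar>ln q\<bar> \<le> 11 * ln (10 * N)"
proof -
  define W where "W = (10 * N) ^ 11"
  have N0: "N > 0" using N by simp
  have pow: "N ^ i \<le> N ^ j" if "i \<le> j" for i j using that N by (intro power_increasing) auto
  have q_lo: "1 / (54 * N) \<le> q"
  proof (cases "q \<ge> 1")
    case True
    have "1 / (54 * N) \<le> 1" using N by simp
    then show ?thesis using True by linarith
  next
    case False
    have "1 / 27 \<le> (2 * N * q) * q ^ 2" using lo mult_right_mono[OF r(1), of "q ^ 2"] by simp
    also have "\<dots> = 2 * N * q ^ 3" by (simp add: power2_eq_square power3_eq_cube)
    also have "\<dots> \<le> 2 * N * q ^ 1" using False pq N by (intro mult_left_mono power_decreasing) auto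
    finally show ?thesis using N0 by (simp add: field_simps)
  qed
  have q_up: "q \<le> 900 * N ^ 4 * (27 * (100 * N ^ 2) ^ 3)"
  proof (cases "q \<le> 1")
    case True
    have "1 * (1 * 1) \<le> 900 * N ^ 4 * (27 * (100 * N ^ 2) ^ 3)"
    proof (intro mult_mono)
      show "1 \<le> 900 * N ^ 4" using pow[of 0 4] by simp
      show "1 \<le> (100 * N ^ 2) ^ 3" using pow[of 0 2] by (intro one_le_power) simp
    qed (use N in auto)
    then show ?thesis using True by simp
  next
    case False
    have "q ^ 1 \<le> q ^ 3" using False by (intro power_increasing) auto
    also have "q ^ 3 = q * q ^ 2" by (simp add: power2_eq_square power3_eq_cube)
    also have "\<dots> \<le> (900 * N ^ 4 * p) * q ^ 2" using r(2) by (intro mult_right_mono) auto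
    also have "\<dots> = 900 * N ^ 4 * (p * q ^ 2)" by simp
    also have "\<dots> \<le> 900 * N ^ 4 * (27 * (100 * N ^ 2) ^ 3)" using up N by (intro mult_left_mono) auto
    finally show ?thesis by simp
  qed
  have e: "900 * N ^ 4 * (27 * (100 * N ^ 2) ^ 3) = 24300000000 * N ^ 10"
    by (simp add: power_mult_distrib power_mult[symmetric] power_add[symmetric])
  have W: "W = 100000000000 * N ^ 11" by (simp add: W_def power_mult_distrib)
  have W1: "24300000000 * N ^ 10 \<le> W"
    unfolding W using pow[of 10 11] N by (intro mult_mono) auto
  have "p \<le> 2 * N * (24300000000 * N ^ 10)" using r(1) q_up[unfolded e] N0 by (meson mult_left_mono order_trans mult_nonneg_nonneg less_imp_le zero_le_numeral)
  also have "\<dots> = 48600000000 * N ^ 11" by (simp add: power_Suc[symmetric] del: power_Suc)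
  also have "\<dots> \<le> W" unfolding W using N by (intro mult_right_mono) auto
  finally have p_up: "p \<le> W" .
  have q_up': "q \<le> W" using q_up W1 unfolding e by linarith
  have W48: "48600 * N ^ 5 \<le> W" unfolding W using pow[of 5 11] N by (intro mult_mono) auto
  have "54 * N \<le> W" unfolding W using pow[of 1 11] N by (intro mult_mono[of 54 _ N]) auto
  then have q_lo': "1 / W \<le> q" using q_lo N0 by (meson order_trans divide_left_mono mult_pos_pos zero_less_numeral zero_le_one less_le_trans)
  have "1 / (54 * N) \<le> 900 * N ^ 4 * p" using q_lo r(2) by linarith
  then have "1 \<le> 900 * N ^ 4 * p * (54 * N)" using N0 by (simp only: pos_divide_le_eq mult_pos_pos zero_less_numeral)
  also have "\<dots> = 48600 * N ^ 5 * p" by (simp add: eval_nat_numeral)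
  finally have "1 \<le> 48600 * N ^ 5 * p" .

  also have "\<dots> \<le> W * p" using W48 pq by (intro mult_right_mono) auto
  finally have p_lo: "1 / W \<le> p" using N0 by (simp add: W_def field_simps)
  have W0: "W > 0" using N0 by (simp add: W_def)
  have lnW: "ln W = 11 * ln (10 * N)" unfolding W_def using N0 ln_realpow[of "10 * N" 11] by (simp only: mult_pos_pos zero_less_numeral of_nat_numeral)
  have "\<bar>ln u\<bar> \<le> ln W" if "1 / W \<le> u" "u \<le> W" "u > 0" for u
  proof -
    have "ln (1 / W) \<le> ln u" using that W0 by (subst ln_le_cancel_iff) auto
    moreover have "ln u \<le> ln W" using that W0 by (subst ln_le_cancel_iff) auto
    moreover have "ln (1 / W) = - ln W" using W0 by (simp add: ln_div)
    ultimately show ?thesis by linarith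
  qed
  then show ?thesis using p_lo p_up q_lo' q_up' pq lnW by simp
qed

lemma minvec_log_range:
  assumes l: "l > 0" and I: "frac_ideal I" and \<gamma>: "\<gamma> \<in> KK" "\<gamma> \<noteq> 0" "OS.ipow I l = (*) \<gamma> ` OK"
    and m: "m > 0" "of_int m \<le> real_of_int (a * b)"
    and v: "minvec (I \<diamondop> PO m c1 c2) (root l (norm \<gamma>)) (root l (norm (sg \<gamma>))) v"
  shows "\<lfloor>ln (norm v / root l (norm \<gamma>))\<rfloor> \<in> {- logbound..logbound}"
    and "\<lfloor>ln (norm (sg v) / root l (norm (sg \<gamma>)))\<rfloor> \<in> {- logbound..logbound}"
proof -
  define x y where "x = root l (norm \<gamma>)" and "y = root l (norm (sg \<gamma>))"
  have xy: "x > 0" "y > 0" using \<gamma> l by (simp_all add: x_def y_def sg_eq_0_iff)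
  have fA: "frac_ideal (I \<diamondop> PO m c1 c2)" using I m(1) by (rule frac_ideal_iprod_PO)
  have v0: "minvec (I \<diamondop> PO m c1 c2) x y v" using v by (simp add: x_def y_def)
  then have "v \<in> KK" "v \<noteq> 0" using fA by (auto simp: minvec_def frac_ideal_def)
  then have pos: "norm v / x > 0" "norm (sg v) / y > 0" using xy by (simp_all add: sg_eq_0_iff)
  have "2 \<le> a * b" using ab_gt_1 by simp
  then have N: "2 \<le> real_of_int (a * b)" by linarith
  have "\<bar>ln (norm v / x)\<bar> \<le> 11 * ln (10 * real_of_int (a * b)) \<and> \<bar>ln (norm (sg v) / y)\<bar> \<le> 11 * ln (10 * real_of_int (a * b))"
    by (rule balanced_log_bound[OF N pos minvec_balanced[OF fA v0 xy]
      minvec_norm_bounds[OF l I \<gamma> m v, folded x_def y_def]])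
  then show "\<lfloor>ln (norm v / root l (norm \<gamma>))\<rfloor> \<in> {- logbound..logbound}"
    "\<lfloor>ln (norm (sg v) / root l (norm (sg \<gamma>)))\<rfloor> \<in> {- logbound..logbound}"
    unfolding x_def y_def logbound_def atLeastAtMost_iff by linarith+
qed

text \<open>For distinct indices, \<open>\<alpha>\<close> is the quotient of the two numbers
  \<open>v ^ l / \<gamma>\<close>; it carries one \<open>l\<close>-th power to the other, and equal
  floors of logarithms bound it by \<open>exp 1 ^ l\<close> at both places. Primality and smallness
  are demanded of pairs of distinct indices, which admits the index set \<open>{1}\<close>.\<close>

theorem torsion_count:
  fixes Idx :: "nat set"
  assumes l: "l > 0"
    and idx: "\<And>m. m \<in> Idx \<Longrightarrow> m > 0 \<and> real m \<le> real_of_int (a * b) \<and> split_data l (int m) (c1 m) (c2 m)"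
    and sep: "\<And>m m'. m \<in> Idx \<Longrightarrow> m' \<in> Idx \<Longrightarrow> m \<noteq> m' \<Longrightarrow>
      Factorial_Ring.prime m \<and> Factorial_Ring.prime m' \<and> 54 * (exp 1 ^ l) ^ 3 * real m' ^ (2 * l) < of_int (a * b)"
  shows "torsion_class_number l KK * card Idx \<le> card reduced_ideals * (nat (2 * logbound + 1)) ^ 2"
proof -
  define T where "T = {t \<in> carrier (class_group KK). t [^]\<^bsub>class_group KK\<^esub> l = \<one>\<^bsub>class_group KK\<^esub>}"
  have "\<forall>t\<in>T. \<exists>p. frac_ideal (fst p) \<and> t = cls (fst p) \<and> snd p \<in> KK \<and> snd p \<noteq> 0 \<and> OS.ipow (fst p) l = (*) (snd p) ` OK"
  proof
    fix t assume "t \<in> T"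
    then have "t \<in> carrier (class_group KK)" "t [^]\<^bsub>class_group KK\<^esub> l = \<one>\<^bsub>class_group KK\<^esub>" by (auto simp: T_def)
    then obtain I \<gamma> where "frac_ideal I" "t = cls I" "\<gamma> \<in> KK" "\<gamma> \<noteq> 0" "OS.ipow I l = (*) \<gamma> ` OK" by (rule torsion_class)
    then show "\<exists>p. frac_ideal (fst p) \<and> t = cls (fst p) \<and> snd p \<in> KK \<and> snd p \<noteq> 0 \<and> OS.ipow (fst p) l = (*) (snd p) ` OK"
      by (intro exI[of _ "(I, \<gamma>)"]) simp
  qed
  from bchoice[OF this] obtain P where P: "\<forall>t\<in>T. frac_ideal (fst (P t)) \<and> t = cls (fst (P t)) \<and> snd (P t) \<in> KK
      \<and> snd (P t) \<noteq> 0 \<and> OS.ipow (fst (P t)) l = (*) (snd (P t)) ` OK" ..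
  define I \<gamma> where "I t = fst (P t)" and "\<gamma> t = snd (P t)" for t
  have T: "frac_ideal (I t)" "t = cls (I t)" "\<gamma> t \<in> KK" "\<gamma> t \<noteq> 0" "OS.ipow (I t) l = (*) (\<gamma> t) ` OK" if "t \<in> T" for t
    using bspec[OF P that] by (simp_all add: I_def \<gamma>_def)
  define x y where "x t = root l (norm (\<gamma> t))" and "y t = root l (norm (sg (\<gamma> t)))" for t
  have xy: "x t > 0" "y t > 0" "x t ^ l = norm (\<gamma> t)" "y t ^ l = norm (sg (\<gamma> t))" if "t \<in> T" for t
    using T[OF that] l by (simp_all add: x_def y_def sg_eq_0_iff)
  define M where "M m = PO (int m) (c1 m) (c2 m)" for m
  have fA: "frac_ideal (I t \<diamondop> M m)" if "t \<in> T" "m \<in> Idx" for t m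
    unfolding M_def using T(1)[OF that(1)] idx[OF that(2)] by (intro frac_ideal_iprod_PO) simp_all
  have "\<forall>p\<in>T \<times> Idx. \<exists>v. minvec (I (fst p) \<diamondop> M (snd p)) (x (fst p)) (y (fst p)) v"
  proof
    fix p assume "p \<in> T \<times> Idx"
    then have p: "fst p \<in> T" "snd p \<in> Idx" by auto
    show "\<exists>v. minvec (I (fst p) \<diamondop> M (snd p)) (x (fst p)) (y (fst p)) v"
      by (rule minvec_exists[OF fA[OF p] xy(1,2)[OF p(1)]], rule exI)
  qed
  from bchoice[OF this] obtain v' where v': "\<forall>p\<in>T \<times> Idx. minvec (I (fst p) \<diamondop> M (snd p)) (x (fst p)) (y (fst p)) (v' p)" ..
  define v where "v t m = v' (t, m)" for t m
  have v: "minvec (I t \<diamondop> M m) (x t) (y t) (v t m)" if "t \<in> T" "m \<in> Idx" for t m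
    using bspec[OF v', of "(t, m)"] that by (simp add: v_def)
  have vK: "v t m \<in> KK" "v t m \<noteq> 0" if "t \<in> T" "m \<in> Idx" for t m
    using v[OF that] fA[OF that] by (auto simp: minvec_def frac_ideal_def)
  define p1 p2 where "p1 t m = norm (v t m) / x t" and "p2 t m = norm (sg (v t m)) / y t" for t m
  have ppos: "p1 t m > 0" "p2 t m > 0" if "t \<in> T" "m \<in> Idx" for t m
    using vK[OF that] xy[OF that(1)] by (simp_all add: p1_def p2_def sg_eq_0_iff)
  define f where "f p = ((*) (1 / v (fst p) (snd p)) ` (I (fst p) \<diamondop> M (snd p)), \<lfloor>ln (p1 (fst p) (snd p))\<rfloor>, \<lfloor>ln (p2 (fst p) (snd p))\<rfloor>)" for p
  define D where "D = reduced_ideals \<times> {- logbound..logbound} \<times> {- logbound..logbound}"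
  have finD: "finite D" unfolding D_def using card_reduced_ideals by (intro finite_cartesian_product) auto
  have range: "f ` (T \<times> Idx) \<subseteq> D"
  proof (rule image_subsetI)
    fix p assume "p \<in> T \<times> Idx"
    then obtain t m where p: "p = (t, m)" "t \<in> T" "m \<in> Idx" by auto
    have "(*) (1 / v t m) ` (I t \<diamondop> M m) \<in> reduced_ideals"
      using minvec_reduced_ideal[OF fA[OF p(2,3)] v[OF p(2,3)] xy(1,2)[OF p(2)]] .
    moreover have "int m > 0" "of_int (int m) \<le> real_of_int (a * b)" using idx[OF p(3)] by simp_all
    from minvec_log_range[OF l T(1,3,4,5)[OF p(2)] this v[OF p(2,3), unfolded M_def x_def y_def]]
    have "\<lfloor>ln (p1 t m)\<rfloor> \<in> {- logbound..logbound}" "\<lfloor>ln (p2 t m)\<rfloor> \<in> {- logbound..logbound}"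
      unfolding p1_def p2_def x_def y_def .
    ultimately show "f p \<in> D" unfolding f_def D_def p(1) fst_conv snd_conv by (intro SigmaI)
  qed
  have "inj_on f (T \<times> Idx)"
  proof (rule inj_onI)
    fix p p' assume pp: "p \<in> T \<times> Idx" "p' \<in> T \<times> Idx" "f p = f p'"
    obtain t m where p: "p = (t, m)" "t \<in> T" "m \<in> Idx" using pp(1) by auto
    obtain t' m' where p': "p' = (t', m')" "t' \<in> T" "m' \<in> Idx" using pp(2) by auto
    define w w' where "w = v t m" and "w' = v t' m'"
    have w: "w \<in> KK" "w \<noteq> 0" and w': "w' \<in> KK" "w' \<noteq> 0" unfolding w_def w'_def using vK p p' by simp_all
    have e1: "(*) (1 / w) ` (I t \<diamondop> M m) = (*) (1 / w') ` (I t' \<diamondop> M m')"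
      and e2: "\<lfloor>ln (p1 t m)\<rfloor> = \<lfloor>ln (p1 t' m')\<rfloor>" and e3: "\<lfloor>ln (p2 t m)\<rfloor> = \<lfloor>ln (p2 t' m')\<rfloor>"
      using pp(3) unfolding f_def p(1) p'(1) fst_conv snd_conv w_def w'_def by simp_all
    have sI: "OS.submod (I t)" "OS.submod (I t')" using T(1)[OF p(2)] T(1)[OF p'(2)] by (simp_all add: frac_ideal_def)
    have mm: "m = m'"
    proof (rule ccontr)
      assume ne: "m \<noteq> m'"
      note s = sep[OF p(3) p'(3) ne]
      have "OS.ipow ((*) (1 / w) ` (I t \<diamondop> M m)) l = OS.ipow ((*) (1 / w') ` (I t' \<diamondop> M m')) l" unfolding e1 ..
      then have e4: "(*) ((1 / w) ^ l * \<gamma> t) ` OS.ipow (M m) l = (*) ((1 / w') ^ l * \<gamma> t') ` OS.ipow (M m') l"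
        unfolding OS.ipow_scale M_def ipow_class_PO[OF sI(1) T(5)[OF p(2)]] ipow_class_PO[OF sI(2) T(5)[OF p'(2)]] scale_scale .
      define \<beta> where "\<beta> = (1 / w) ^ l * \<gamma> t"
      define \<alpha> where "\<alpha> = (w ^ l / \<gamma> t) / (w' ^ l / \<gamma> t')"
      have \<beta>0: "\<beta> \<noteq> 0" unfolding \<beta>_def using w T(4)[OF p(2)] by simp
      have "(1 / w') ^ l * \<gamma> t' = \<beta> * \<alpha>" unfolding \<beta>_def \<alpha>_def using w w' T(4)[OF p(2)] by (simp add: power_divide)
      then have "(*) \<beta> ` OS.ipow (M m) l = (*) \<beta> ` ((*) \<alpha> ` OS.ipow (M m') l)"
        using e4 unfolding scale_scale \<beta>_def[symmetric] by (simp only:)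
      from scale_cancel[OF \<beta>0 this] have eq: "(*) \<alpha> ` OS.ipow (M m') l = OS.ipow (M m) l" by (rule sym)
      have \<alpha>K: "\<alpha> \<in> KK" "\<alpha> \<noteq> 0"
        unfolding \<alpha>_def using w w' T(3,4)[OF p(2)] T(3,4)[OF p'(2)] by (simp_all add: KK_divide KK_power del: divide_divide_eq_left divide_divide_eq_right)
      have ratio: "(u / u') ^ l \<le> exp 1 ^ l" if "\<lfloor>ln u\<rfloor> = \<lfloor>ln u'\<rfloor>" "u > 0" "u' > 0" for u u' :: real
      proof (rule power_mono)
        have "ln u - ln u' \<le> 1" using that(1) by linarith
        then have "ln (u / u') \<le> 1" using that by (simp add: ln_div)
        then have "exp (ln (u / u')) \<le> exp 1" by simp
        then show "u / u' \<le> exp 1" using that by simp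
      qed (use that in simp)
      have "norm \<alpha> = (p1 t m / p1 t' m') ^ l"
        unfolding \<alpha>_def p1_def w_def w'_def norm_divide norm_power xy(3)[OF p(2), symmetric] xy(3)[OF p'(2), symmetric]
        by (simp only: power_divide)
      also have "\<dots> \<le> exp 1 ^ l" by (rule ratio[OF e2 ppos(1)[OF p(2,3)] ppos(1)[OF p'(2,3)]])
      finally have n1: "norm \<alpha> \<le> exp 1 ^ l" .
      have "sg \<alpha> = (sg w ^ l / sg (\<gamma> t)) / (sg w' ^ l / sg (\<gamma> t'))"
        unfolding \<alpha>_def using w(1) w'(1) T(3)[OF p(2)] T(3)[OF p'(2)] by (simp only: sg_divide KK_divide KK_power sg_power)
      then have "norm (sg \<alpha>) = (p2 t m / p2 t' m') ^ l"
        unfolding p2_def w_def w'_def by (simp only: norm_divide norm_power xy(4)[OF p(2), symmetric] xy(4)[OF p'(2), symmetric] power_divide)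
      also have "\<dots> \<le> exp 1 ^ l" by (rule ratio[OF e3 ppos(2)[OF p(2,3)] ppos(2)[OF p'(2,3)]])
      finally have n2: "norm (sg \<alpha>) \<le> exp 1 ^ l" .
      have pr: "Factorial_Ring.prime (int m)" "Factorial_Ring.prime (int m')" "int m \<noteq> int m'" using s ne by simp_all
      have small: "54 * (exp 1 ^ l) ^ 3 * of_int (int m') ^ (2 * l) < real_of_int (a * b)" using s by simp
      have sd: "split_data l (int m) (c1 m) (c2 m)" "split_data l (int m') (c1 m') (c2 m')" using idx p p' by simp_all
      show False by (rule separation[OF l pr sd \<alpha>K n1 n2 eq[unfolded M_def] small])
    qed
    have m0: "m > 0" and sd: "split_data l (int m) (c1 m) (c2 m)" using idx[OF p(3)] by simp_all
    \<comment> \<open>For equal indices, multiplication by the complementary ideal turns both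
      products into \<open>m\<close> times \<open>I t\<close> and \<open>m\<close> times
      \<open>I t'\<close>, up to the scalings by \<open>w\<close> and \<open>w'\<close>.\<close>
    define Q where "Q = QO (int m) (c1 m) (c2 m)"
    have MQ: "(J \<diamondop> M m) \<diamondop> Q = (*) (of_nat m) ` J" if "OS.submod J" for J
    proof -
      have "(J \<diamondop> M m) \<diamondop> Q = (M m \<diamondop> Q) \<diamondop> J" by (simp only: iprod_assoc iprod_left_commute iprod_commute)
      also have "M m \<diamondop> Q = (*) (of_int (int m)) ` OK" unfolding M_def Q_def by (rule PO_QO[OF sd l])
      finally show ?thesis unfolding iprod_scale OS.R_iprod[OF that] by simp
    qed
    have "((*) (1 / w) ` (I t \<diamondop> M m)) \<diamondop> Q = ((*) (1 / w') ` (I t' \<diamondop> M m)) \<diamondop> Q" using e1 unfolding mm by simp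
    then have "(*) (1 / w * of_nat m) ` I t = (*) (1 / w' * of_nat m) ` I t'"
      unfolding iprod_scale MQ[OF sI(1)] MQ[OF sI(2)] scale_scale .
    moreover have "1 / w' * of_nat m = (1 / w * of_nat m) * (w / w')" using w by simp
    ultimately have "(*) (1 / w * of_nat m) ` I t = (*) (1 / w * of_nat m) ` ((*) (w / w') ` I t')"
      unfolding scale_scale by (simp only:)
    then have "I t = (*) (w / w') ` I t'" by (rule scale_cancel[rotated]) (use w m0 in simp)
    then have "cls (I t) = cls (I t')" using w w' by (simp only:) (intro cls_eqI KK_divide; simp)
    then have "t = t'" using T(2)[OF p(2)] T(2)[OF p'(2)] by simp
    then show "p = p'" using mm p p' by simp
  qed
  then have "card (T \<times> Idx) \<le> card D" using range finD by (rule card_inj_on_le)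
  moreover have "card D = card reduced_ideals * (nat (2 * logbound + 1)) ^ 2"
  proof -
    have "card {- logbound..logbound} = nat (2 * logbound + 1)" by simp
    then show ?thesis unfolding D_def card_cartesian_product by (simp only: power2_eq_square)
  qed
  ultimately show ?thesis unfolding torsion_class_number_def T_def[symmetric] by (simp only: card_cartesian_product)
qed

end

subsection \<open>The torsion bound\<close>

text \<open>Bounds the number of primes lost because they divide \<open>a * b\<close> by a binary
  logarithm.\<close>

lemma two_power_card_prime_factors_le:
  assumes "n > 0"
  shows "2 ^ card (prime_factors n) \<le> (n :: nat)"
proof -
  have "(\<Prod>p\<in>prime_factors n. 2) \<le> (\<Prod>p\<in>prime_factors n. p ^ multiplicity p n)"
  proof (rule prod_mono, safe)
    fix p assume p: "p \<in> prime_factors n"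
    then have "Factorial_Ring.prime p" "multiplicity p n > 0" by (auto simp: prime_factors_multiplicity)
    then have "2 ^ 1 \<le> p ^ 1" "p ^ 1 \<le> p ^ multiplicity p n"
      using prime_ge_2_nat[of p] by (auto intro: self_le_power)
    then show "2 \<le> p ^ multiplicity p n" by simp
  qed
  also have "\<dots> = n" by (rule prime_factorization_nat[OF assms, symmetric])
  finally show ?thesis by simp
qed

context pure_cubic
begin

definition rad :: real where "rad = real_of_int (a * b)"

lemma rad_ge_2: "rad \<ge> 2"
  using ab_gt_1 unfolding rad_def by linarith

lemma card_reduced_ideals_le:
  assumes \<delta>: "\<delta> > 0" and C: "C \<ge> 1"
    "\<And>n. n > 0 \<Longrightarrow> real (\<Prod>p\<in>prime_factors n. (3 * multiplicity p n + 1) ^ 3) \<le> C * real n powr \<delta>"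
  shows "real (card reduced_ideals) \<le> C * (100 * rad) powr (1 + \<delta>)"
proof -
  define n0 where "n0 = nat (100 * (a * b))"
  have n0: "real n0 = 100 * rad" using ab_gt_1 by (simp add: n0_def rad_def)
  have "real (card reduced_ideals) \<le> real (\<Sum>n=1..n0. card (ID.ideals_of n))"
    using card_reduced_ideals unfolding n0_def by (simp only: of_nat_le_iff)
  also have "\<dots> = (\<Sum>n=1..n0. real (card (ID.ideals_of n)))" by simp
  also have "\<dots> \<le> (\<Sum>n=1..n0. C * real n0 powr \<delta>)"
  proof (rule sum_mono)
    fix n assume n: "n \<in> {1..n0}"
    then have "real (card (ID.ideals_of n)) \<le> real (\<Prod>p\<in>prime_factors n. (3 * multiplicity p n + 1) ^ 3)"
      using ID.card_ideals_of[of n] by (simp only: of_nat_le_iff) simp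
    also have "\<dots> \<le> C * real n powr \<delta>" using n by (intro C(2)) simp
    also have "\<dots> \<le> C * real n0 powr \<delta>" using n C(1) \<delta> by (intro mult_left_mono powr_mono2) auto
    finally show "real (card (ID.ideals_of n)) \<le> C * real n0 powr \<delta>" .
  qed
  also have "\<dots> = C * (real n0 * real n0 powr \<delta>)" by simp
  also have "real n0 * real n0 powr \<delta> = (100 * rad) powr (1 + \<delta>)"
    using rad_ge_2 unfolding n0 by (subst powr_add) simp
  finally show ?thesis .
qed

lemma logbound_le:
  assumes \<delta>: "\<delta> > 0"
  shows "real ((nat (2 * logbound + 1)) ^ 2) \<le> (44 / \<delta> + 3) ^ 2 * (10 * rad) powr \<delta>"
proof -
  have ge: "10 * rad \<ge> 1" using rad_ge_2 by simp
  have l0: "ln (10 * rad) \<ge> 0" using ge by simp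
  have lb: "real_of_int logbound \<le> 11 * ln (10 * rad) + 1" unfolding logbound_def rad_def by linarith
  have "logbound \<ge> 0" using l0 unfolding logbound_def rad_def by simp
  then have "real (nat (2 * logbound + 1)) = real_of_int (2 * logbound + 1)" by (intro of_nat_nat) simp
  then have "real (nat (2 * logbound + 1)) = 2 * real_of_int logbound + 1" by (simp only: of_int_add of_int_mult of_int_numeral of_int_1)
  also have "\<dots> \<le> 22 * ln (10 * rad) + 3" using lb by linarith
  \<comment> \<open>Half of \<open>\<delta>\<close>, because the square is estimated in the
    end.\<close>
  also have "\<dots> \<le> 22 * ((10 * rad) powr (\<delta> / 2) / (\<delta> / 2)) + 3 * (10 * rad) powr (\<delta> / 2)"
    using ln_powr_bound[OF ge, of "\<delta> / 2"] \<delta> ge_one_powr_ge_zero[OF ge, of "\<delta> / 2"] by linarith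
  also have "\<dots> = (44 / \<delta> + 3) * (10 * rad) powr (\<delta> / 2)" by (simp add: distrib_right)
  finally have "real (nat (2 * logbound + 1)) ^ 2 \<le> ((44 / \<delta> + 3) * (10 * rad) powr (\<delta> / 2)) ^ 2"
    by (intro power_mono) simp_all
  also have "\<dots> = (44 / \<delta> + 3) ^ 2 * ((10 * rad) powr (\<delta> / 2)) ^ 2" by (rule power_mult_distrib)
  also have "((10 * rad) powr (\<delta> / 2)) ^ 2 = (10 * rad) powr \<delta>"
    unfolding power2_eq_square powr_add[symmetric] by simp
  finally show ?thesis by (simp only: of_nat_power)
qed

text \<open>The primes up to \<open>y\<close> satisfy the smallness condition of
  \<open>torsion_count\<close>; the constant 55 in place of 54 makes it strict. Discarding those
  that divide \<open>a * b\<close> loses at most \<open>log 2 rad\<close> of them. If none remains,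
  the index set \<open>{1}\<close> is used: its conditions hold trivially modulo 1, and the estimate
  follows all the same.\<close>

lemma split_index_set:
  fixes l :: nat and \<delta> c :: real
  assumes l: "l > 0" and \<delta>: "\<delta> > 0" "\<delta> < 1" and c: "c > 0"
    "\<And>x. x \<ge> 1 \<Longrightarrow> c * real x powr (1 - \<delta>) \<le> real (card (primes_res 2 x)) + 1"
  obtains Idx :: "nat set" and c1 c2 where
    "\<And>m. m \<in> Idx \<Longrightarrow> m > 0 \<and> real m \<le> real_of_int (a * b) \<and> split_data l (int m) (c1 m) (c2 m)"
    "\<And>m m'. m \<in> Idx \<Longrightarrow> m' \<in> Idx \<Longrightarrow> m \<noteq> m' \<Longrightarrow>
      Factorial_Ring.prime m \<and> Factorial_Ring.prime m' \<and> 54 * (exp 1 ^ l) ^ 3 * real m' ^ (2 * l) < of_int (a * b)"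
    "((rad / (55 * (exp 1 ^ l) ^ 3)) powr (1 / (2 * real l))) powr (1 - \<delta>) \<le> (2 / c + 1) * (real (card Idx) * (2 + log 2 rad))"
proof -
  define E where "E = 55 * (exp (1::real) ^ l) ^ 3"
  define y where "y = (rad / E) powr (1 / (2 * real l))"
  define x where "x = nat \<lfloor>y\<rfloor>"
  define n0 where "n0 = nat (a * b)"
  define P where "P = {p \<in> primes_res 2 x. \<not> int p dvd a * b}"
  have e1: "exp (1::real) ^ l \<ge> 1" by (intro one_le_power) simp
  then have e3: "(exp (1::real) ^ l) ^ 3 \<ge> 1" by (rule one_le_power)
  then have E: "E \<ge> 1" unfolding E_def by linarith
  have N0: "rad \<ge> 1" using rad_ge_2 by simp
  have n0: "n0 > 0" "real n0 = rad" "int n0 = a * b" using ab_gt_1 by (simp_all add: n0_def rad_def)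
  have y0: "y > 0" using N0 E by (simp add: y_def)
  have xy: "real x \<le> y" using y0 by (simp add: x_def)
  have "y powr (2 * real l) = rad / E" using l N0 E by (simp add: y_def powr_powr)
  then have y2l: "y ^ (2 * l) = rad / E" using y0 by (simp add: powr_realpow[symmetric])
  have "y \<le> rad"
  proof -
    have "y \<le> rad powr (1 / (2 * real l))" unfolding y_def using N0 E by (intro powr_mono2) (auto simp: field_simps)
    also have "\<dots> \<le> rad powr 1" using N0 l by (intro powr_mono) (auto simp: field_simps)
    finally show ?thesis using N0 by simp
  qed
  have bnd: "real m \<le> rad" "54 * (exp 1 ^ l) ^ 3 * real m ^ (2 * l) < rad" if "m \<le> x" for m
  proof -
    have my: "real m \<le> y" using that xy by linarith
    then show "real m \<le> rad" using \<open>y \<le> rad\<close> by linarith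
    have "real m ^ (2 * l) \<le> rad / E" unfolding y2l[symmetric] using my by (intro power_mono) simp_all
    then have "54 * (exp 1 ^ l) ^ 3 * real m ^ (2 * l) \<le> 54 * (exp 1 ^ l) ^ 3 * (rad / E)"
      using e3 by (intro mult_left_mono) simp_all
    also have "\<dots> = 54 / 55 * rad" using e3 by (simp add: E_def)
    also have "\<dots> < rad" using N0 by simp
    finally show "54 * (exp 1 ^ l) ^ 3 * real m ^ (2 * l) < rad" .
  qed
  have finP: "finite P" unfolding P_def using finite_primes_res by (rule finite_subset[rotated]) auto
  have "card (primes_res 2 x) \<le> card (P \<union> prime_factors n0)"
  proof (rule card_mono)
    show "finite (P \<union> prime_factors n0)" using finP by simp
    show "primes_res 2 x \<subseteq> P \<union> prime_factors n0"
      using n0 by (auto simp: P_def primes_res_def in_prime_factors_iff simp flip: int_dvd_int_iff)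
  qed
  also have "\<dots> \<le> card P + card (prime_factors n0)" by (rule card_Un_le)
  finally have cP: "card (primes_res 2 x) \<le> card P + card (prime_factors n0)" .
  have "real (2 ^ card (prime_factors n0)) \<le> rad"
    unfolding n0(2)[symmetric] of_nat_le_iff by (rule two_power_card_prime_factors_le[OF n0(1)])
  then have "log 2 (2 ^ card (prime_factors n0)) \<le> log 2 rad" by (subst log_le_cancel_iff) (use N0 in auto)
  then have \<omega>: "real (card (prime_factors n0)) \<le> log 2 rad" by (simp add: log_nat_power)
  have L0: "log 2 rad \<ge> 0" using N0 by simp
  \<comment> \<open>\<open>k\<close> stands for the size of the index set to be chosen: the number
    of primes, or 1 if there is none.\<close>
  have est: "y powr (1 - \<delta>) \<le> (2 / c + 1) * (k * (2 + log 2 rad))" if k: "k \<ge> 1" "k \<ge> real (card P)" for k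
  proof -
    have k1: "1 * 1 \<le> k * (2 + log 2 rad)" using k L0 by (intro mult_mono) auto
    show ?thesis
    proof (cases "y \<ge> 1")
      case True
      then have x: "x \<ge> 1" by (simp add: x_def le_nat_floor)
      have "y \<le> 2 * real x" using x True unfolding x_def by linarith
      then have "y powr (1 - \<delta>) \<le> (2 * real x) powr (1 - \<delta>)" using y0 \<delta> by (intro powr_mono2) auto
      also have "\<dots> = 2 powr (1 - \<delta>) * real x powr (1 - \<delta>)" by (simp add: powr_mult)
      also have "\<dots> \<le> 2 powr 1 * real x powr (1 - \<delta>)" using \<delta> by (intro mult_right_mono powr_mono) auto
      also have "\<dots> = 2 / c * (c * real x powr (1 - \<delta>))" using c by simp
      also have "\<dots> \<le> 2 / c * (real (card P) + log 2 rad + 1)"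
        using c c(2)[OF x] cP \<omega> by (intro mult_left_mono) auto
      also have "real (card P) + log 2 rad + 1 \<le> k * (2 + log 2 rad)"
      proof -
        have "1 * log 2 rad \<le> k * log 2 rad" using k L0 by (intro mult_right_mono) auto
        then show ?thesis using k by (simp add: algebra_simps)
      qed
      then have "2 / c * (real (card P) + log 2 rad + 1) \<le> 2 / c * (k * (2 + log 2 rad))" using c by (intro mult_left_mono) auto
      also have "\<dots> \<le> (2 / c + 1) * (k * (2 + log 2 rad))" using k1 by (intro mult_right_mono) auto
      finally show ?thesis .
    next
      case False
      then have "y powr (1 - \<delta>) \<le> 1" using y0 \<delta> by (intro powr_le1) auto
      moreover have "1 * 1 \<le> (2 / c + 1) * (k * (2 + log 2 rad))" using k1 c by (intro mult_mono) auto
      ultimately show ?thesis by simp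
    qed
  qed
  show thesis
  proof (cases "P = {}")
    case True
    show thesis
    proof (rule that[of "{1}" "\<lambda>_. 0" "\<lambda>_. 0"])
      show "((rad / (55 * (exp 1 ^ l) ^ 3)) powr (1 / (2 * real l))) powr (1 - \<delta>) \<le> (2 / c + 1) * (real (card {1::nat}) * (2 + log 2 rad))"
        using est[of 1] True unfolding y_def E_def by simp
      show "m > 0 \<and> real m \<le> real_of_int (a * b) \<and> split_data l (int m) 0 0" if "m \<in> {1}" for m
        using that N0 unfolding rad_def by (simp add: split_data_def)
    qed simp
  next
    case False
    have "\<forall>p\<in>P. \<exists>c. split_data l (int p) (fst c) (snd c)"
    proof
      fix p assume "p \<in> P"
      then have p: "Factorial_Ring.prime p" "p mod 3 = 2" "\<not> int p dvd a * b" by (auto simp: P_def primes_res_def)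
      obtain c1 c2 where "split_data l (int p) c1 c2" by (rule split_data_exists[OF p l])
      then show "\<exists>c. split_data l (int p) (fst c) (snd c)" by (intro exI[of _ "(c1, c2)"]) simp
    qed
    from bchoice[OF this] obtain c' where c': "\<forall>p\<in>P. split_data l (int p) (fst (c' p)) (snd (c' p))" ..
    have P: "Factorial_Ring.prime p" "p \<le> x" if "p \<in> P" for p
      using that by (auto simp: P_def primes_res_def)
    show thesis
    proof (rule that[of P "\<lambda>p. fst (c' p)" "\<lambda>p. snd (c' p)"])
      show "m > 0 \<and> real m \<le> real_of_int (a * b) \<and> split_data l (int m) (fst (c' m)) (snd (c' m))" if "m \<in> P" for m
        using bspec[OF c' that] P[OF that] bnd(1)[of m] prime_gt_0_nat[of m] by (simp add: rad_def)
      show "Factorial_Ring.prime m \<and> Factorial_Ring.prime m' \<and> 54 * (exp 1 ^ l) ^ 3 * real m' ^ (2 * l) < of_int (a * b)"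
        if "m \<in> P" "m' \<in> P" "m \<noteq> m'" for m m'
        using P[OF that(1)] P[OF that(2)] bnd(2)[of m'] by (simp add: rad_def)
      have "card P \<ge> 1" using False finP by (simp add: Suc_le_eq card_gt_0_iff)
      then show "((rad / (55 * (exp 1 ^ l) ^ 3)) powr (1 / (2 * real l))) powr (1 - \<delta>) \<le> (2 / c + 1) * (real (card P) * (2 + log 2 rad))"
        using est[of "real (card P)"] unfolding y_def E_def by simp
    qed
  qed
qed

end

text \<open>The exponent collects \<open>1 + \<delta>\<close> from the reduced ideals,
  \<open>\<delta>\<close> from the recorded logarithms and \<open>\<delta>\<close> from the binary
  logarithm in the prime count, and the primes gain at least \<open>e - \<delta>\<close>, where
  \<open>e = 1 / (2 * l)\<close>.\<close>

lemma torsion_bound: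
  fixes l :: nat and \<delta> :: real
  assumes l: "l > 0" and \<delta>: "\<delta> > 0" "\<delta> < 1"
  obtains C where "C \<ge> 0" "\<And>a b. pure_cubic a b \<Longrightarrow>
    real (torsion_class_number l (pure_cubic.KK a b)) \<le> C * real_of_int (a * b) powr (1 - 1 / (2 * real l) + 4 * \<delta>)"
proof -
  obtain C1 where C1: "C1 \<ge> 1"
    "\<And>n. n > 0 \<Longrightarrow> real (\<Prod>p\<in>prime_factors n. (3 * multiplicity p n + 1) ^ 3) \<le> C1 * real n powr \<delta>"
  proof (rule divisor_type_bound[OF \<delta>(1)])
    fix C :: real
    assume "C \<ge> 1" "\<And>n. n > 0 \<Longrightarrow> real (\<Prod>p\<in>prime_factors n. (3 * multiplicity p n + 1) ^ 3) \<le> C * real n powr \<delta>"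
    then show thesis by (rule that)
  qed
  obtain c where c: "c > 0" "\<And>x. x \<ge> 1 \<Longrightarrow> c * real x powr (1 - \<delta>) \<le> real (card (primes_res 2 x)) + 1"
  proof (rule primes_2_mod_3_lower[OF \<delta>(1)])
    fix c :: real
    assume "c > 0" "\<And>x. x \<ge> 1 \<Longrightarrow> c * real x powr (1 - \<delta>) \<le> real (card (primes_res 2 x)) + 1"
    then show thesis by (rule that)
  qed
  define E where "E = 55 * (exp (1::real) ^ l) ^ 3"
  define e where "e = 1 / (2 * real l)"
  define A where "A = C1 * 100 powr (1 + \<delta>)"
  define B where "B = (44 / \<delta> + 3) ^ 2 * 10 powr \<delta>"
  define F where "F = (2 / c + 1) * (2 + 1 / (\<delta> * ln 2)) * E powr (e * (1 - \<delta>))"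
  have E: "E \<ge> 1"
  proof -
    have "(exp (1::real) ^ l) ^ 3 \<ge> 1" by (intro one_le_power) simp
    then show ?thesis unfolding E_def by linarith
  qed
  have "2 / c + 1 > 0" "2 + 1 / (\<delta> * ln 2) > 0" "44 / \<delta> + 3 > 0"
    using c(1) \<delta>(1) by (simp_all add: add_pos_pos)
  then have pos: "A > 0" "B > 0" "F > 0" "e > 0" "e \<le> 1"
    unfolding A_def B_def F_def e_def using C1(1) E l by (simp_all only: mult_pos_pos zero_less_power powr_gt_zero) simp_all
  have main: "real (torsion_class_number l (pure_cubic.KK a b)) \<le> A * B * F * real_of_int (a * b) powr (1 - e + 4 * \<delta>)"
    if pc: "pure_cubic a b" for a b
  proof -
    interpret pure_cubic a b by (rule pc)
    define h where "h = real (torsion_class_number l KK)"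
    have N: "rad \<ge> 2" by (rule rad_ge_2)
    obtain Idx c1 c2 where Idx:
      "\<And>m. m \<in> Idx \<Longrightarrow> m > 0 \<and> real m \<le> real_of_int (a * b) \<and> split_data l (int m) (c1 m) (c2 m)"
      "\<And>m m'. m \<in> Idx \<Longrightarrow> m' \<in> Idx \<Longrightarrow> m \<noteq> m' \<Longrightarrow>
        Factorial_Ring.prime m \<and> Factorial_Ring.prime m' \<and> 54 * (exp 1 ^ l) ^ 3 * real m' ^ (2 * l) < of_int (a * b)"
      "((rad / E) powr e) powr (1 - \<delta>) \<le> (2 / c + 1) * (real (card Idx) * (2 + log 2 rad))"
    proof (rule split_index_set[OF l \<delta> c])
      fix Idx :: "nat set" and c1 c2
      assume "\<And>m. m \<in> Idx \<Longrightarrow> m > 0 \<and> real m \<le> real_of_int (a * b) \<and> split_data l (int m) (c1 m) (c2 m)"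
        "\<And>m m'. m \<in> Idx \<Longrightarrow> m' \<in> Idx \<Longrightarrow> m \<noteq> m' \<Longrightarrow>
          Factorial_Ring.prime m \<and> Factorial_Ring.prime m' \<and> 54 * (exp 1 ^ l) ^ 3 * real m' ^ (2 * l) < of_int (a * b)"
        "((rad / (55 * (exp 1 ^ l) ^ 3)) powr (1 / (2 * real l))) powr (1 - \<delta>) \<le> (2 / c + 1) * (real (card Idx) * (2 + log 2 rad))"
      then show thesis unfolding E_def[symmetric] e_def[symmetric] by (rule that)
    qed
    have "real (torsion_class_number l KK * card Idx) \<le> real (card reduced_ideals * (nat (2 * logbound + 1)) ^ 2)"
      unfolding of_nat_le_iff by (rule torsion_count[OF l Idx(1,2)])
    then have "h * real (card Idx) \<le> real (card reduced_ideals) * real ((nat (2 * logbound + 1)) ^ 2)"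
      by (simp add: h_def)
    also have "\<dots> \<le> (C1 * (100 * rad) powr (1 + \<delta>)) * ((44 / \<delta> + 3) ^ 2 * (10 * rad) powr \<delta>)"
      using C1(1) by (intro mult_mono card_reduced_ideals_le[OF \<delta>(1) C1] logbound_le[OF \<delta>(1)]) auto
    also have "\<dots> = A * B * (rad powr (1 + \<delta>) * rad powr \<delta>)"
      using N by (simp add: A_def B_def powr_mult)
    also have "rad powr (1 + \<delta>) * rad powr \<delta> = rad powr (1 + 2 * \<delta>)" by (simp add: add.commute flip: powr_add)
    finally have hI: "h * real (card Idx) \<le> A * B * rad powr (1 + 2 * \<delta>)" .
    have "2 + log 2 rad \<le> 2 * rad powr \<delta> + (rad powr \<delta> / \<delta>) / ln 2"
    proof (rule add_mono)
      show "2 \<le> 2 * rad powr \<delta>" using ge_one_powr_ge_zero[of rad \<delta>] N \<delta> by simp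
      show "log 2 rad \<le> (rad powr \<delta> / \<delta>) / ln 2"
        unfolding log_def using ln_powr_bound[of rad \<delta>] N \<delta> by (intro divide_right_mono) auto
    qed
    also have "\<dots> = (2 + 1 / (\<delta> * ln 2)) * rad powr \<delta>" using \<delta> by (simp add: field_simps)
    finally have lg: "2 + log 2 rad \<le> (2 + 1 / (\<delta> * ln 2)) * rad powr \<delta>" .
    have "rad powr (e - \<delta>) \<le> rad powr (e * (1 - \<delta>))"
    proof (rule powr_mono)
      have "e * \<delta> \<le> 1 * \<delta>" using pos \<delta> by (intro mult_right_mono) auto
      then show "e - \<delta> \<le> e * (1 - \<delta>)" by (simp add: algebra_simps)
    qed (use N in simp)
    also have "\<dots> = E powr (e * (1 - \<delta>)) * ((rad / E) powr e) powr (1 - \<delta>)"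
      using N E by (simp add: powr_powr powr_divide)
    also have "\<dots> \<le> E powr (e * (1 - \<delta>)) * ((2 / c + 1) * (real (card Idx) * (2 + log 2 rad)))"
      by (intro mult_left_mono Idx(3)) simp
    also have "\<dots> \<le> E powr (e * (1 - \<delta>)) * ((2 / c + 1) * (real (card Idx) * ((2 + 1 / (\<delta> * ln 2)) * rad powr \<delta>)))"
      using c(1) by (intro mult_left_mono lg) auto
    also have "\<dots> = F * real (card Idx) * rad powr \<delta>" by (simp add: F_def)
    finally have "rad powr (e - \<delta>) \<le> F * real (card Idx) * rad powr \<delta>" .
    then have "h * rad powr (e - \<delta>) \<le> h * (F * real (card Idx) * rad powr \<delta>)"
      by (rule mult_left_mono) (simp add: h_def)
    also have "\<dots> = (h * real (card Idx)) * (F * rad powr \<delta>)" by simp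
    also have "\<dots> \<le> (A * B * rad powr (1 + 2 * \<delta>)) * (F * rad powr \<delta>)"
      using pos by (intro mult_right_mono hI) simp
    also have "\<dots> = A * B * F * (rad powr (1 + 2 * \<delta>) * rad powr \<delta>)" by simp
    also have "rad powr (1 + 2 * \<delta>) * rad powr \<delta> = rad powr ((1 - e + 4 * \<delta>) + (e - \<delta>))" by (simp add: add.commute flip: powr_add)
    also have "\<dots> = rad powr (1 - e + 4 * \<delta>) * rad powr (e - \<delta>)" by (rule powr_add)
    finally have "h * rad powr (e - \<delta>) \<le> (A * B * F * rad powr (1 - e + 4 * \<delta>)) * rad powr (e - \<delta>)" by simp
    then have "h \<le> A * B * F * rad powr (1 - e + 4 * \<delta>)" using N by (simp only: mult_le_cancel_right_pos powr_gt_zero)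
    then show ?thesis by (simp add: h_def rad_def)
  qed
  show thesis
  proof (rule that[of "A * B * F"])
    show "A * B * F \<ge> 0" using pos by simp
  qed (rule main[unfolded e_def])
qed

theorem theorem1:
  fixes l :: nat and \<epsilon> :: real
  assumes "Factorial_Ring.prime l" and "\<epsilon> > 0"
  shows "\<exists>C :: real. \<forall>(d :: int) K. d > 1 \<longrightarrow> cube_free d \<longrightarrow>
           K = rat_adjoin (complex_of_real (root 3 (real_of_int d))) \<longrightarrow>
           real (torsion_class_number l K) \<le>
             C * \<bar>real_of_int (discriminant K)\<bar> powr (1 / 2 - 1 / (4 * real l) + \<epsilon>)"
proof -
  have l: "l > 0" using assms(1) by (rule prime_gt_0_nat)
  \<comment> \<open>With \<open>\<delta>\<close> at most \<open>\<epsilon> / 2\<close> the loss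
    \<open>4 * \<delta>\<close> fits into \<open>2 * \<epsilon>\<close>, which becomes
    \<open>\<epsilon>\<close> when \<open>N ^ 2\<close> is replaced by the discriminant.\<close>
  define \<delta> where "\<delta> = min (\<epsilon> / 2) (1 / 2)"
  have \<delta>: "\<delta> > 0" "\<delta> < 1" "\<delta> \<le> \<epsilon> / 2" using assms(2) by (auto simp: \<delta>_def)
  obtain C where C: "C \<ge> 0" "\<And>a b. pure_cubic a b \<Longrightarrow>
    real (torsion_class_number l (pure_cubic.KK a b)) \<le> C * real_of_int (a * b) powr (1 - 1 / (2 * real l) + 4 * \<delta>)"
  proof (rule torsion_bound[OF l \<delta>(1,2)])
    fix C :: real
    assume "C \<ge> 0" "\<And>a b. pure_cubic a b \<Longrightarrow>
      real (torsion_class_number l (pure_cubic.KK a b)) \<le> C * real_of_int (a * b) powr (1 - 1 / (2 * real l) + 4 * \<delta>)"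
    then show thesis by (rule that)
  qed
  define e where "e = 1 / 2 - 1 / (4 * real l) + \<epsilon>"
  have "1 / (4 * real l) \<le> 1 / 4" using l by (simp add: field_simps)
  then have e: "e > 0" using assms(2) unfolding e_def by linarith
  have main: "real (torsion_class_number l K) \<le> C * 27 powr e * \<bar>real_of_int (discriminant K)\<bar> powr e"
    if d: "d > 1" "cube_free d" and K: "K = rat_adjoin (complex_of_real (root 3 (real_of_int d)))" for d K
  proof -
    obtain a b where ab: "d = a * b ^ 2" "a > 0" "b > 0" "coprime a b" "squarefree a" "squarefree b" "a * b > 1"
      by (rule cube_free_decomposition[OF d])
    interpret pure_cubic a b using ab by unfold_locales
    have K': "K = KK" unfolding K ab(1) rat_adjoin_eq[symmetric] t1_def r1_def ..
    define N where "N = real_of_int (a * b)"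
    have "1 \<le> a * b" using ab(7) by simp
    then have N: "N \<ge> 1" unfolding N_def by linarith
    have "N powr (2 * e) = (N ^ 2) powr e" using N by (simp add: powr_powr[symmetric] powr_numeral)
    also have "\<dots> \<le> (27 * \<bar>real_of_int (discriminant KK)\<bar>) powr e"
      using e discriminant_bound by (intro powr_mono2) (auto simp: N_def)
    also have "\<dots> = 27 powr e * \<bar>real_of_int (discriminant K)\<bar> powr e" unfolding K' by (rule powr_mult)
    finally have disc: "N powr (2 * e) \<le> 27 powr e * \<bar>real_of_int (discriminant K)\<bar> powr e" .
    have "real (torsion_class_number l K) \<le> C * N powr (1 - 1 / (2 * real l) + 4 * \<delta>)"
      unfolding K' N_def by (rule C(2)) unfold_locales
    also have "\<dots> \<le> C * N powr (2 * e)"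
      using N C(1) \<delta>(3) by (intro mult_left_mono powr_mono) (auto simp: e_def)
    also have "\<dots> \<le> C * (27 powr e * \<bar>real_of_int (discriminant K)\<bar> powr e)"
      using disc C(1) by (rule mult_left_mono)
    finally show ?thesis by (simp only: mult.assoc)
  qed
  show ?thesis unfolding e_def[symmetric] by (intro exI[of _ "C * 27 powr e"] allI impI main)
qed

end
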